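(* Let $N\geq1$ be a fixed square-free integer and $p$ a fixed prime with $p\nmid N$. There exists an infinite sequence of even weights $\{k_n\}$ with $k_n\to\infty$ such that \[ D\left(\nu_{k_n,N}^*, \mu_{\infty}\right) \gg \frac{1}{k_n^{1/3}(\log k_n)^2}. \]
   Context: For a positive integer $N$ and even $k$, $S_k(N)$ is the space of holomorphic cusp forms of weight $k$ for $\Gamma_0(N)$ with Petersson inner product $\langle f,g\rangle=\int_{\Gamma_0(N)\backslash\mathbb H} f(z)\overline{g(z)}y^k\,\frac{dx\,dy}{y^2}$, and $S_k(N)^*$ is its subspace of newforms. For $n$ coprime to $N$ the normalized Hecke operator is $\mathcal T_n f(z)=n^{\frac{k-1}{2}}\sum_{ad=n}d^{-k}\sum_{b \bmod d} f\left(\frac{az+b}{d}\right)$. Let $B^*_{k,N}$ be an orthonormal basis of $S_k(N)^*$ of Hecke eigenforms; for $f\in B^*_{k,N}$ write $f(z)=\sum_{n\ge1}\rho_f(n)n^{\frac{k-1}{2}}e^{2\pi i nz}$ and $\mathcal T_pf=\lambda_f(p)f$. Define $\nu^*_{k,N}=\frac{\Gamma(k-1)}{(4\pi)^{k-1}}\sum_{f\in B^*_{k,N}}|\rho_f(1)|^2\delta_{\lambda_f(p)}$ and the semicircle law $\mu_\infty=\frac1\pi\sqrt{1-\frac{x^2}{4}}\,dx$ on $[-2,2]$. For measures on $\mathbb R$, $D(\mu_1,\mu_2)=\sup\{|\mu_1(I)-\mu_2(I)|: I=[a,b]\subset\mathbb R\}$. *)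

theory Defs
  imports
    "HOL-Analysis.Analysis"
    "HOL-Computational_Algebra.Computational_Algebra"
    "HOL-Library.Function_Algebras"
begin

interpretation cfun: vector_space "\<lambda>(c::complex) (f::complex \<Rightarrow> complex) z. c * f z"
  by unfold_locales (auto simp: fun_eq_iff algebra_simps)

definition upper_half_plane :: "complex set" where
  "upper_half_plane = {z. Im z > 0}"

definition Gamma0 :: "nat \<Rightarrow> (int^2^2) set" where
  "Gamma0 N = {A. det A = 1 \<and> int N dvd A $ 2 $ 1}"

definition mobius :: "int^2^2 \<Rightarrow> complex \<Rightarrow> complex" where
  "mobius A z = (of_int (A $ 1 $ 1) * z + of_int (A $ 1 $ 2))
              / (of_int (A $ 2 $ 1) * z + of_int (A $ 2 $ 2))"

definition slash :: "nat \<Rightarrow> (complex \<Rightarrow> complex) \<Rightarrow> int^2^2 \<Rightarrow> complex \<Rightarrow> complex" where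
  "slash k f A z = f (mobius A z) / (of_int (A $ 2 $ 1) * z + of_int (A $ 2 $ 2)) ^ k"

text \<open>A form on the upper half plane is represented by its extension by 0 to all of the
  complex numbers, so that forms agreeing on the half plane are equal functions.
  The last clause is vanishing at all cusps: every translate of \<open>f\<close> by the full modular
  group (\<open>Gamma0 1\<close>) has an expansion in \<open>exp (2 \<pi> \<i> z / N)\<close> without constant term.
  The width of every cusp of \<open>Gamma0 N\<close> divides \<open>N\<close>.\<close>

definition cusp_forms :: "nat \<Rightarrow> nat \<Rightarrow> (complex \<Rightarrow> complex) set" where
  "cusp_forms k N = {f.
     (\<forall>z. z \<notin> upper_half_plane \<longrightarrow> f z = 0) \<and>
     f holomorphic_on upper_half_plane \<and>
     (\<forall>A\<in>Gamma0 N. \<forall>z\<in>upper_half_plane. slash k f A z = f z) \<and>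
     (\<forall>A\<in>Gamma0 1. \<exists>a::nat \<Rightarrow> complex. a 0 = 0 \<and>
        (\<forall>z\<in>upper_half_plane.
           (\<lambda>n. a n * exp (2 * of_real pi * \<i> * of_nat n * z / of_nat N)) sums slash k f A z))}"

text \<open>The Ford fundamental domain of \<open>Gamma0 N\<close>: each orbit contains points of maximal
  imaginary part, which are those with \<open>\<bar>c z + d\<bar> \<ge> 1\<close> for all lower rows \<open>(c, d)\<close>, and the
  stabiliser of infinity acts by integer translations. It meets every orbit, and distinct
  points of one orbit can lie only on its boundary, a null set. Integrals of invariant
  functions over the quotient are integrals over this set.\<close>

definition fundamental_domain :: "nat \<Rightarrow> complex set" where
  "fundamental_domain N = {z \<in> upper_half_plane. \<bar>Re z\<bar> \<le> 1 / 2 \<and>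
     (\<forall>A\<in>Gamma0 N. cmod (of_int (A $ 2 $ 1) * z + of_int (A $ 2 $ 2)) \<ge> 1)}"

definition petersson :: "nat \<Rightarrow> nat \<Rightarrow> (complex \<Rightarrow> complex) \<Rightarrow> (complex \<Rightarrow> complex) \<Rightarrow> complex" where
  "petersson k N f g =
     (LINT z:fundamental_domain N|lborel. f z * cnj (g z) * of_real (Im z ^ k / (Im z)\<^sup>2))"

definition old_space :: "nat \<Rightarrow> nat \<Rightarrow> (complex \<Rightarrow> complex) set" where
  "old_space k N = cfun.span
     {(\<lambda>z. f (of_nat d * z)) | f d M. M * d dvd N \<and> M < N \<and> f \<in> cusp_forms k M}"

definition new_space :: "nat \<Rightarrow> nat \<Rightarrow> (complex \<Rightarrow> complex) set" where
  "new_space k N = {f \<in> cusp_forms k N. \<forall>g\<in>old_space k N. petersson k N f g = 0}"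

definition hecke :: "nat \<Rightarrow> nat \<Rightarrow> (complex \<Rightarrow> complex) \<Rightarrow> complex \<Rightarrow> complex" where
  "hecke k n f z = of_real (real n powr ((real k - 1) / 2)) *
     (\<Sum>d | d dvd n. (1 / of_nat d ^ k) *
        (\<Sum>b<d. f ((of_nat (n div d) * z + of_nat b) / of_nat d)))"

definition hecke_eigenform :: "nat \<Rightarrow> nat \<Rightarrow> (complex \<Rightarrow> complex) \<Rightarrow> bool" where
  "hecke_eigenform k N f \<longleftrightarrow> f \<noteq> 0 \<and>
     (\<forall>n>0. coprime n N \<longrightarrow> (\<exists>l::complex. hecke k n f = (\<lambda>z. l * f z)))"

definition hecke_eigenvalue :: "nat \<Rightarrow> nat \<Rightarrow> (complex \<Rightarrow> complex) \<Rightarrow> complex" where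
  "hecke_eigenvalue k n f = (THE l. hecke k n f = (\<lambda>z. l * f z))"

definition newform_basis :: "nat \<Rightarrow> nat \<Rightarrow> (complex \<Rightarrow> complex) set \<Rightarrow> bool" where
  "newform_basis k N B \<longleftrightarrow>
     cfun.independent B \<and> cfun.span B = new_space k N \<and>
     (\<forall>f\<in>B. \<forall>g\<in>B. petersson k N f g = (if f = g then 1 else 0)) \<and>
     (\<forall>f\<in>B. hecke_eigenform k N f)"

definition rho :: "nat \<Rightarrow> (complex \<Rightarrow> complex) \<Rightarrow> nat \<Rightarrow> complex" where
  "rho k f = (THE r. r 0 = 0 \<and> (\<forall>z\<in>upper_half_plane.
     (\<lambda>n. r n * of_real (real n powr ((real k - 1) / 2)) * exp (2 * of_real pi * \<i> * of_nat n * z))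
       sums f z))"

text \<open>The sum of weighted Dirac measures is the image of a weighted counting measure on \<open>B\<close>
  under the map sending \<open>f\<close> to its eigenvalue. Eigenvalues on cusp forms are real because
  the Hecke operators of index coprime to the level are self-adjoint, so taking real parts
  loses nothing.\<close>

definition nu :: "nat \<Rightarrow> nat \<Rightarrow> (complex \<Rightarrow> complex) set \<Rightarrow> real measure" where
  "nu k p B = distr
     (point_measure B (\<lambda>f. ennreal (Gamma (real k - 1) / (4 * pi) ^ (k - 1) * (cmod (rho k f 1))\<^sup>2)))
     borel (\<lambda>f. Re (hecke_eigenvalue k p f))"

definition semicircle :: "real measure" where
  "semicircle = density lborel
     (\<lambda>x. ennreal (indicator {-2..2} x * (1 / pi * sqrt (1 - x\<^sup>2 / 4))))"

definition discrepancy :: "real measure \<Rightarrow> real measure \<Rightarrow> real" where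
  "discrepancy M1 M2 = Sup {\<bar>measure M1 {a..b} - measure M2 {a..b}\<bar> | a b. a \<le> b}"

end

theory Submission
  imports Defs "HOL-Complex_Analysis.Complex_Analysis" "HOL-Real_Asymp.Real_Asymp"
begin

no_notation fps_nth (infixl \<open>$\<close> 75)

text \<open>Let \<open>P\<close> be the Poincare series of level one, weight \<open>k\<close> and index one, and let
  \<open>c\<^sub>k = \<Gamma>(k - 1) / (4 \<pi>)\<^sup>k\<^sup>-\<^sup>1\<close>. Two elementary estimates replace unfolding, finite-dimensionality and
  Deligne's bound. Integrating \<open>\<bar>f\<bar>\<^sup>2\<close> over the strip \<open>y \<ge> 1\<close> gives
  \<open>(c\<^sub>k - n\<^sup>k\<^sup>-\<^sup>1) \<bar>\<rho>\<^sub>f(n)\<bar>\<^sup>2 \<le> \<langle>f, f\<rangle>\<close>, and bounding \<open>P\<close> on the fundamental domain gives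
  \<open>\<langle>P, P\<rangle> \<le> c\<^sub>k (1 + o(1))\<close>. As \<open>c\<^sub>k\<close> grows superexponentially, \<open>P\<close> agrees up to tiny errors with the form
  dual to the first Fourier coefficient.

  If \<open>N > 1\<close>, then \<open>P\<close> is an oldform of norm \<open>O(c\<^sub>k)\<close> whose first coefficient is close to 1. Being orthogonal to
  the newforms it takes a fixed proportion of the mass, so \<open>\<nu>\<close> has total mass at most \<open>1 - \<delta>\<close> and the discrepancy
  does not even tend to 0.

  If \<open>N = 1\<close>, the duality gives \<open>\<integral> U\<^sub>m d\<nu> \<approx> \<rho>\<^sub>P(p\<^sup>m)\<close> for the Chebyshev polynomials \<open>U\<^sub>m\<close>. For \<open>m = 2 j\<close> and
  \<open>k \<equiv> 2 (mod 4)\<close> the right-hand side is \<open>- 2 \<pi> J\<^sub>k\<^sub>-\<^sub>1(4 \<pi> p\<^sup>j)\<close> up to an exponentially small error. The weight is chosen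
  such that \<open>4 \<pi> p\<^sup>j\<close> is in the transition range of the Bessel function, which makes this at most
  \<open>- C k\<^sup>-\<^sup>1\<^sup>/\<^sup>3\<close>. On the other hand \<open>U\<^sub>m\<close> has integral 0 against the semicircle law, is nonnegative outside
  \<open>[-2, 2]\<close>, and \<open>U\<^sub>m(2 cos \<theta>)\<close> has derivative \<open>O(m\<^sup>2)\<close> with \<open>m = O(log k)\<close>, so integration by parts bounds the
  integral below by \<open>- O((log k)\<^sup>2)\<close> times the discrepancy.\<close>

section \<open>The Lipschitz summation formula\<close>

text \<open>Two facts about the basis are not established and shape the level one argument.
  Eigenvalues at \<open>p\<close> may a priori be complex, while \<open>nu\<close> sees only real
  parts. Since |l|^2 - Re (l^2) = 2 (Im l)^2, the coefficients of index p and p^2 control the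
  imaginary parts in weighted mean square. The basis may a priori be infinite, so estimates are made
  for finite subsets, uniformly, and the finite set of forms that expand the Poincare series turns
  out to carry almost all the mass. As eigenvalues outside [-2, 2] are not excluded, the integration
  by parts is one-sided, and a coefficient of definite sign is needed: (-i)^k = -1 turns a positive
  Bessel value into a negative coefficient. Positivity in the transition range comes from a Sturm
  comparison with an explicit function, not from an asymptotic expansion. The even exponent 2 j
  makes the index a square, so that the Bessel argument contains no root. Since p^j is at most k -
  1, the crude bound (p + 2)^(2 j) is polynomial in k, and the transfer errors of size 2^(-k) absorb
  it.\<close>

definition ec :: "complex \<Rightarrow> complex" where
  "ec z = exp (2 * of_real pi * \<i> * z)"

lemma ec_add: "ec (a + b) = ec a * ec b"
  by (simp add: ec_def ring_distribs exp_add)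

lemma ec_0 [simp]: "ec 0 = 1"
  by (simp add: ec_def)

lemma norm_ec: "norm (ec z) = exp (- 2 * pi * Im z)"
  by (simp add: ec_def)

lemma ec_of_nat_mult: "ec (of_nat n * z) = ec z ^ n"
  by (simp add: ec_def exp_of_nat_mult [symmetric] algebra_simps)

lemma ec_of_int [simp]: "ec (of_int n) = 1"
  by (simp add: ec_def exp_eq_1)

lemma ec_nonzero [simp]: "ec z \<noteq> 0"
  by (simp add: ec_def)

lemma norm_ec_less_1: "Im z > 0 \<Longrightarrow> norm (ec z) < 1"
  by (simp add: norm_ec)

lemma norm_ec_le_1: "Im z \<ge> 0 \<Longrightarrow> norm (ec z) \<le> 1"
  by (simp add: norm_ec)

lemma has_field_derivative_ec: "(ec has_field_derivative 2 * of_real pi * \<i> * ec z) (at z)"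
  unfolding ec_def by (auto intro!: derivative_eq_intros)

lemma upper_half_plane_iff [simp]: "z \<in> upper_half_plane \<longleftrightarrow> Im z > 0"
  by (simp add: upper_half_plane_def)

lemma open_upper_half_plane: "open upper_half_plane"
  unfolding upper_half_plane_def by (simp add: open_halfspace_Im_gt)

text \<open>The majorant for the lattice sums below; the shift by 1 avoids an exceptional term at m
  = 0.\<close>

lemma summable_on_int_inverse_square:
  "(\<lambda>m::int. 1 / (1 + \<bar>real_of_int m\<bar>)\<^sup>2) summable_on UNIV"
proof -
  have s: "summable (\<lambda>n. 1 / (1 + real n)\<^sup>2)"
    using inverse_squares_sums by (auto simp: sums_iff add_ac)
  hence s': "(\<lambda>n. 1 / (1 + real n)\<^sup>2) summable_on UNIV"
    by (intro norm_summable_imp_summable_on) auto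
  have 1: "(\<lambda>m::int. 1 / (1 + \<bar>real_of_int m\<bar>)\<^sup>2) summable_on (int ` UNIV)"
    using s' by (subst summable_on_reindex) (auto simp: o_def)
  have 2: "(\<lambda>m::int. 1 / (1 + \<bar>real_of_int m\<bar>)\<^sup>2) summable_on ((\<lambda>n. - int n) ` UNIV)"
    using s' by (subst summable_on_reindex) (auto simp: o_def inj_on_def)
  have "(\<lambda>m::int. 1 / (1 + \<bar>real_of_int m\<bar>)\<^sup>2) summable_on (int ` UNIV \<union> (\<lambda>n. - int n) ` UNIV)"
    by (intro summable_on_union 1 2)
  moreover have "int ` UNIV \<union> (\<lambda>n. - int n) ` UNIV = UNIV"
    by (auto simp: image_iff) (metis int_cases2)
  ultimately show ?thesis by simp
qed

section \<open>Reflection formulas for polygamma functions and the cotangent\<close>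

text \<open>Both sides of \<Gamma>(z) \<Gamma>(1 - z) = \<pi> / sin (\<pi> z) are differentiated and
  the results compared; in the open upper half plane neither side has a pole.\<close>

lemma Digamma_reflection:
  fixes z :: complex
  assumes "Im z > 0"
  shows "Digamma (1 - z) - Digamma z = of_real pi * cot (of_real pi * z)"
proof -
  have nz: "w \<notin> \<int>" "1 - w \<notin> \<int>" if "Im w > 0" for w :: complex
    using that by (auto elim!: Ints_cases simp: complex_eq_iff algebra_simps)
  have nz': "w \<notin> \<int>\<^sub>\<le>\<^sub>0" "1 - w \<notin> \<int>\<^sub>\<le>\<^sub>0" if "Im w > 0" for w :: complex
    using nz[OF that] nonpos_Ints_Int by blast+
  have sn: "sin (of_real pi * w) \<noteq> 0" if "Im w > 0" for w :: complex
    using nz[OF that] by (auto simp: sin_eq_0 mult.commute)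
  have d1: "((\<lambda>w. Gamma w * Gamma (1 - w)) has_field_derivative
     Gamma z * Gamma (1 - z) * (Digamma z - Digamma (1 - z))) (at z)"
    using nz'[OF assms] by (auto intro!: derivative_eq_intros simp: algebra_simps)
  have "((\<lambda>w. of_real pi / sin (of_real pi * w)) has_field_derivative
     - of_real pi * (of_real pi * cos (of_real pi * z)) / (sin (of_real pi * z))\<^sup>2) (at z)"
    using sn[OF assms] by (auto intro!: derivative_eq_intros simp: power2_eq_square)
  hence d2: "((\<lambda>w. Gamma w * Gamma (1 - w)) has_field_derivative
     - of_real pi * (of_real pi * cos (of_real pi * z)) / (sin (of_real pi * z))\<^sup>2) (at z)"
    by (simp add: Gamma_reflection_complex)
  define s where "s = sin (of_real pi * z)"
  have s: "s \<noteq> 0" using sn[OF assms] by (simp add: s_def)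
  have "Digamma z - Digamma (1 - z) = s / of_real pi * (of_real pi / s * (Digamma z - Digamma (1 - z)))"
    using s by simp
  also have "of_real pi / s * (Digamma z - Digamma (1 - z)) = - of_real pi * (of_real pi * cos (of_real pi * z)) / s\<^sup>2"
    using DERIV_unique[OF d1 d2] unfolding Gamma_reflection_complex s_def .
  also have "s / of_real pi * \<dots> = - (of_real pi * cos (of_real pi * z) / s)"
    using s by (simp add: power2_eq_square)
  finally show ?thesis by (simp add: cot_def s_def algebra_simps)
qed

lemma pi_cot_eq_ec:
  assumes "Im z > 0"
  shows "of_real pi * cot (of_real pi * z) = - of_real pi * \<i> - 2 * of_real pi * \<i> * (ec z / (1 - ec z))"
proof -
  define u where "u = exp (\<i> * (of_real pi * z))"
  have u0: "u \<noteq> 0" by (simp add: u_def)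
  have uu: "ec z = u\<^sup>2" unfolding u_def ec_def by (simp add: power2_eq_square exp_add [symmetric] algebra_simps)
  have q1: "ec z \<noteq> 1" using norm_ec_less_1[OF assms] by auto
  hence u1: "u\<^sup>2 \<noteq> 1" using uu by simp
  have ei: "exp (- (\<i> * (of_real pi * z))) = 1 / u" by (simp add: u_def exp_minus inverse_eq_divide)
  have c: "cos (of_real pi * z) = (u + 1 / u) / 2" by (simp add: cos_exp_eq u_def[symmetric] ei)
  have s: "sin (of_real pi * z) = (u - 1 / u) / (2 * \<i>)" by (simp add: sin_exp_eq u_def[symmetric] ei)
  have C: "cot (of_real pi * z) = - \<i> - 2 * \<i> * (u\<^sup>2 / (1 - u\<^sup>2))"
  proof -
    have "u * u - 1 \<noteq> 0" "1 - u * u \<noteq> 0" using u1 by (auto simp: power2_eq_square)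
    thus ?thesis unfolding cot_def c s using u0
      by (simp add: divide_simps power2_eq_square) (simp add: algebra_simps)?
  qed
  show ?thesis unfolding uu C by (simp add: algebra_simps)
qed

text \<open>The polylogarithm of order -r at q = e(z). Differentiation in z raises r by one, which
  drives the induction for the reflection formula.\<close>

definition lip_series :: "nat \<Rightarrow> complex \<Rightarrow> complex" where
  "lip_series r z = (\<Sum>n. of_nat (Suc n) ^ r * ec z ^ Suc n)"

lemma summable_poly_power:
  fixes q :: complex
  assumes "norm q < 1"
  shows "summable (\<lambda>n. norm (of_nat (Suc n) ^ r * q ^ Suc n))"
proof -
  obtain t where t: "norm q < t" "t < 1" using assms dense by blast
  have "(\<lambda>n. (real (Suc (Suc n)) / real (Suc n)) ^ r * norm q) \<longlonglongrightarrow> 1 ^ r * norm q"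
    by (intro tendsto_mult tendsto_power tendsto_const) real_asymp
  hence "eventually (\<lambda>n. (real (Suc (Suc n)) / real (Suc n)) ^ r * norm q < t) sequentially"
    using t(1) by (intro order_tendstoD) auto
  then obtain N where N: "\<And>n. n \<ge> N \<Longrightarrow> (real (Suc (Suc n)) / real (Suc n)) ^ r * norm q < t"
    by (auto simp: eventually_sequentially)
  show ?thesis
  proof (rule summable_ratio_test[OF t(2)])
    fix n assume n: "n \<ge> N"
    have "norm (norm (of_nat (Suc (Suc n)) ^ r * q ^ Suc (Suc n))) =
       ((real (Suc (Suc n)) / real (Suc n)) ^ r * norm q) * (real (Suc n) ^ r * norm q ^ Suc n)"
      by (simp add: norm_mult norm_power power_divide del: of_nat_Suc)
    also have "\<dots> \<le> t * (real (Suc n) ^ r * norm q ^ Suc n)"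
      by (rule mult_right_mono[OF less_imp_le[OF N[OF n]]]) simp
    finally show "norm (norm (of_nat (Suc (Suc n)) ^ r * q ^ Suc (Suc n))) \<le> t * norm (norm (of_nat (Suc n) ^ r * q ^ Suc n))"
      by (simp add: norm_mult norm_power del: of_nat_Suc)
  qed
qed

lemma lip_series_sums:
  assumes "Im z > 0"
  shows "(\<lambda>n. of_nat (Suc n) ^ r * ec z ^ Suc n) sums lip_series r z"
  unfolding lip_series_def
  by (intro summable_sums summable_norm_cancel[OF summable_poly_power] norm_ec_less_1 assms)

lemma lip_series_0:
  assumes "Im z > 0"
  shows "lip_series 0 z = ec z / (1 - ec z)"
proof -
  have "(\<lambda>n. ec z * ec z ^ n) sums (ec z * (1 / (1 - ec z)))"
    by (intro sums_mult geometric_sums norm_ec_less_1 assms)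
  thus ?thesis using lip_series_sums[OF assms, of 0] by (simp add: sums_iff)
qed

lemma has_field_derivative_lip_series:
  assumes "Im z > 0"
  shows "(lip_series r has_field_derivative 2 * of_real pi * \<i> * lip_series (Suc r) z) (at z)"
proof -
  define c :: "nat \<Rightarrow> complex" where "c = (\<lambda>n. if n = 0 then 0 else of_nat n ^ r)"
  have sm: "summable (\<lambda>n. c n * q ^ n)" if "norm q < 1" for q
    by (subst summable_Suc_iff [symmetric])
       (use summable_norm_cancel[OF summable_poly_power[OF that]] in \<open>simp add: c_def\<close>)
  obtain K where K: "norm (ec z) < K" "K < 1" using norm_ec_less_1[OF assms] dense by blast
  have Kp: "K > 0" using K norm_ge_zero[of "ec z"] by linarith
  have d: "((\<lambda>q. \<Sum>n. c n * q ^ n) has_field_derivative (\<Sum>n. diffs c n * ec z ^ n)) (at (ec z))"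
    by (rule termdiffs_strong[where K="of_real K"]) (use K Kp sm in \<open>auto\<close>)
  have d2: "((\<lambda>w. \<Sum>n. c n * ec w ^ n) has_field_derivative (\<Sum>n. diffs c n * ec z ^ n) * (2 * of_real pi * \<i> * ec z)) (at z)"
    by (rule DERIV_chain2[OF d has_field_derivative_ec])
  have e1: "(\<Sum>n. c n * ec w ^ n) = lip_series r w" if "Im w > 0" for w
  proof -
    have "(\<lambda>n. c (Suc n) * ec w ^ Suc n) sums lip_series r w"
      using lip_series_sums[OF that, of r] by (simp add: c_def)
    hence "(\<lambda>n. c n * ec w ^ n) sums (lip_series r w + c 0 * ec w ^ 0)" by (rule sums_Suc)
    thus ?thesis by (simp add: c_def sums_iff)
  qed
  have e2: "(\<Sum>n. diffs c n * ec z ^ n) * (2 * of_real pi * \<i> * ec z) = 2 * of_real pi * \<i> * lip_series (Suc r) z"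
  proof -
    have "(\<lambda>n. diffs c n * ec z ^ n) sums (lip_series (Suc r) z / ec z)"
    proof -
      have "of_nat (Suc n) ^ Suc r * ec z ^ Suc n / ec z = diffs c n * ec z ^ n" for n
        by (simp add: diffs_def c_def)
      thus ?thesis using sums_divide[OF lip_series_sums[OF assms, of "Suc r"], of "ec z"] by (simp only:)
    qed
    thus ?thesis by (simp add: sums_iff)
  qed
  have "(lip_series r has_field_derivative (\<Sum>n. diffs c n * ec z ^ n) * (2 * of_real pi * \<i> * ec z)) (at z)"
    by (rule has_field_derivative_transform_within_open[OF d2 open_upper_half_plane])
       (use assms e1 in auto)
  thus ?thesis by (simp only: e2)
qed

text \<open>The case r = 0 is the q-expansion of \<pi> cot (\<pi> z); the others follow by
  differentiation, which kills the constant -\<pi> i after the first step.\<close>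

lemma Polygamma_reflection:
  fixes z :: complex
  assumes "Im z > 0"
  shows "(-1) ^ r * Polygamma r (1 - z) - Polygamma r z =
    (if r = 0 then - of_real pi * \<i> else 0) - (2 * of_real pi * \<i>) ^ Suc r * lip_series r z"
  using assms
proof (induction r arbitrary: z)
  case 0
  thus ?case by (simp add: Digamma_reflection pi_cot_eq_ec lip_series_0)
next
  case (Suc r)
  have nz': "z \<notin> \<int>\<^sub>\<le>\<^sub>0" "1 - z \<notin> \<int>\<^sub>\<le>\<^sub>0"
    using Suc.prems by (auto elim!: nonpos_Ints_cases simp: complex_eq_iff algebra_simps)
  have d1: "((\<lambda>z. (-1) ^ r * Polygamma r (1 - z) - Polygamma r z) has_field_derivative
     (-1) ^ Suc r * Polygamma (Suc r) (1 - z) - Polygamma (Suc r) z) (at z)"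
    using nz' by (auto intro!: derivative_eq_intros)
  have "((\<lambda>z. (if r = 0 then - of_real pi * \<i> else 0) - (2 * of_real pi * \<i>) ^ Suc r * lip_series r z) has_field_derivative
     0 - (2 * of_real pi * \<i>) ^ Suc r * (2 * of_real pi * \<i> * lip_series (Suc r) z)) (at z)"
    by (intro DERIV_diff DERIV_const DERIV_cmult has_field_derivative_lip_series Suc.prems)
  hence d2: "((\<lambda>z. (-1) ^ r * Polygamma r (1 - z) - Polygamma r z) has_field_derivative
     0 - (2 * of_real pi * \<i>) ^ Suc r * (2 * of_real pi * \<i> * lip_series (Suc r) z)) (at z)"
    by (rule has_field_derivative_transform_within_open[OF _ open_upper_half_plane])
       (use Suc in auto)
  show ?case using DERIV_unique[OF d1 d2] by (simp add: mult_ac)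
qed

lemma norm_add_of_int_ge:
  assumes "Im z > 0"
  obtains \<kappa> :: real where "\<kappa> > 0" "\<And>m. norm (z + of_int m) \<ge> \<kappa> * (1 + \<bar>of_int m\<bar>)"
proof
  define K where "K = 1 + (1 + norm z) / Im z"
  have K: "K > 0" using assms unfolding K_def by (intro add_pos_nonneg divide_nonneg_pos) auto
  show "1 / K > 0" using K by simp
  fix m :: int
  have "\<bar>of_int m\<bar> \<le> norm (z + of_int m) + norm z"
    using norm_triangle_ineq4[of "z + of_int m" z] by simp
  moreover have "Im z \<le> norm (z + of_int m)"
    using abs_Im_le_cmod[of "z + of_int m"] by simp
  hence "(1 + norm z) * Im z \<le> (1 + norm z) * norm (z + of_int m)"
    by (intro mult_left_mono) auto
  hence "1 + norm z \<le> (1 + norm z) / Im z * norm (z + of_int m)"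
    using assms by (simp add: field_simps)
  ultimately have "1 + \<bar>of_int m\<bar> \<le> norm (z + of_int m) * K" unfolding K_def by (simp add: algebra_simps)
  thus "norm (z + of_int m) \<ge> 1 / K * (1 + \<bar>of_int m\<bar>)" using K by (simp add: field_simps)
qed

lemma summable_on_inverse_add_of_int_power:
  assumes "Im z > 0" "s \<ge> 2"
  shows "(\<lambda>m::int. 1 / norm (z + of_int m) ^ s) summable_on UNIV"
proof -
  obtain \<kappa> :: real where k: "\<kappa> > 0" "\<And>m. norm (z + of_int m) \<ge> \<kappa> * (1 + \<bar>of_int m\<bar>)"
    using norm_add_of_int_ge[OF assms(1)] by blast
  show ?thesis
  proof (rule summable_on_comparison_test)
    show "(\<lambda>m::int. 1 / \<kappa> ^ s * (1 / (1 + \<bar>real_of_int m\<bar>)\<^sup>2)) summable_on UNIV"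
      by (intro summable_on_cmult_right summable_on_int_inverse_square)
    fix m :: int
    have "1 / norm (z + of_int m) ^ s \<le> 1 / (\<kappa> * (1 + \<bar>of_int m\<bar>)) ^ s"
    proof -
      have p: "0 < \<kappa> * (1 + \<bar>real_of_int m\<bar>)" using k(1) by (intro mult_pos_pos) auto
      hence "0 < norm (z + of_int m)" using k(2)[of m] by linarith
      thus ?thesis using p k by (intro divide_left_mono power_mono mult_pos_pos zero_less_power) auto
    qed
    also have "\<dots> \<le> 1 / \<kappa> ^ s * (1 / (1 + \<bar>real_of_int m\<bar>)\<^sup>2)"
    proof -
      have "(1 + \<bar>real_of_int m\<bar>)\<^sup>2 \<le> (1 + \<bar>real_of_int m\<bar>) ^ s"
        using assms(2) by (intro power_increasing) auto
      thus ?thesis using k(1) unfolding power_mult_distrib by (simp add: divide_simps mult_left_mono)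
    qed
    finally show "1 / norm (z + of_int m) ^ s \<le> 1 / \<kappa> ^ s * (1 / (1 + \<bar>real_of_int m\<bar>)\<^sup>2)" .
  qed auto
qed

text \<open>The integers split into m \<ge> 0 and m \<le> -1, giving polygamma series at z and at 1
  - z, which the reflection formula combines. The exponent is at least 2, so the sum is absolutely
  convergent and may be cut in this way.\<close>

theorem Lipschitz_summation:
  assumes z: "Im z > 0" and r: "r \<ge> 1"
  shows "((\<lambda>m::int. 1 / (z + of_int m) ^ Suc r) has_sum ((- 2 * of_real pi * \<i>) ^ Suc r / fact r * lip_series r z)) UNIV"
proof -
  define f where "f = (\<lambda>m::int. 1 / (z + of_int m) ^ Suc r)"
  have "(\<lambda>m. norm (f m)) summable_on UNIV"
    using summable_on_inverse_add_of_int_power[OF z, of "Suc r"] r by (simp add: f_def norm_divide norm_power norm_mult)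
  hence sf: "f summable_on UNIV" by (rule abs_summable_summable)
  have nz: "z \<noteq> 0" "1 - z \<noteq> 0" using z by auto
  have 1: "(\<lambda>n. f (int n)) sums ((-1) ^ Suc r * Polygamma r z / fact r)"
    using Polygamma_LIMSEQ[of z r] nz r by (simp add: f_def inverse_eq_divide)
  have h1: "((\<lambda>n. f (int n)) has_sum ((-1) ^ Suc r * Polygamma r z / fact r)) UNIV"
  proof -
    have "f summable_on range int" by (rule summable_on_subset[OF sf]) auto
    hence "(\<lambda>n. f (int n)) summable_on UNIV" by (subst (asm) summable_on_reindex) (auto simp: o_def)
    then obtain S where "((\<lambda>n. f (int n)) has_sum S) UNIV" by (auto simp: summable_on_def)
    with 1 show ?thesis using has_sum_imp_sums sums_unique2 by blast
  qed
  have 2: "(\<lambda>n. f (- int n - 1)) sums (Polygamma r (1 - z) / fact r)"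
  proof -
    have "(\<lambda>n. (-1) ^ Suc r * inverse ((1 - z + of_nat n) ^ Suc r)) sums ((-1) ^ Suc r * ((-1) ^ Suc r * Polygamma r (1 - z) / fact r))"
      using Polygamma_LIMSEQ[of "1 - z" r] nz r by (intro sums_mult) simp
    moreover have "(-1) ^ Suc r * inverse ((1 - z + of_nat n) ^ Suc r) = f (- int n - 1)" for n
    proof -
      have "(z + of_int (- int n - 1)) ^ Suc r = (-1) ^ Suc r * (1 - z + of_nat n) ^ Suc r"
        by (subst power_mult_distrib [symmetric]) (simp add: algebra_simps)
      thus ?thesis unfolding f_def inverse_eq_divide by (cases "even r") simp_all
    qed
    moreover have "(-1) ^ Suc r * ((-1) ^ Suc r * Polygamma r (1 - z) / fact r) = Polygamma r (1 - z) / fact r"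
      by (cases "even r") auto
    ultimately show ?thesis by simp
  qed
  have h2: "((\<lambda>n. f (- int n - 1)) has_sum (Polygamma r (1 - z) / fact r)) UNIV"
  proof -
    have "f summable_on range (\<lambda>n. - int n - 1)" by (rule summable_on_subset[OF sf]) auto
    hence "(\<lambda>n. f (- int n - 1)) summable_on UNIV"
      by (subst (asm) summable_on_reindex) (auto simp: o_def inj_on_def)
    then obtain S where "((\<lambda>n. f (- int n - 1)) has_sum S) UNIV" by (auto simp: summable_on_def)
    with 2 show ?thesis using has_sum_imp_sums sums_unique2 by blast
  qed
  have i1: "(f has_sum ((-1) ^ Suc r * Polygamma r z / fact r)) (range int)"
    using h1 by (subst has_sum_reindex) (auto simp: o_def)
  have i2: "(f has_sum (Polygamma r (1 - z) / fact r)) (range (\<lambda>n. - int n - 1))"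
    using h2 by (subst has_sum_reindex) (auto simp: o_def inj_on_def)
  have un: "range int \<union> range (\<lambda>n. - int n - 1) = UNIV"
  proof -
    have "m \<in> range int \<union> range (\<lambda>n. - int n - 1)" for m
    proof (cases "m \<ge> 0")
      case True thus ?thesis by (metis UnI1 nonneg_int_cases rangeI)
    next
      case False
      hence "m = - int (nat (- m - 1)) - 1" by simp
      thus ?thesis by blast
    qed
    thus ?thesis by blast
  qed
  have "(f has_sum ((-1) ^ Suc r * Polygamma r z / fact r + Polygamma r (1 - z) / fact r)) (range int \<union> range (\<lambda>n. - int n - 1))"
    by (intro has_sum_Un_disjoint i1 i2) auto
  moreover have "(-1) ^ Suc r * Polygamma r z / fact r + Polygamma r (1 - z) / fact r =
     (- 2 * of_real pi * \<i>) ^ Suc r / fact r * lip_series r z"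
  proof -
    have "(-1) ^ Suc r * Polygamma r z + Polygamma r (1 - z) = (-1) ^ r * ((-1) ^ r * Polygamma r (1 - z) - Polygamma r z)"
      by (cases "even r") auto
    also have "\<dots> = (-1) ^ Suc r * (2 * of_real pi * \<i>) ^ Suc r * lip_series r z"
      using r by (subst Polygamma_reflection[OF z]) simp
    also have "(-1) ^ Suc r * (2 * of_real pi * \<i>) ^ Suc r = (- 2 * of_real pi * \<i>) ^ Suc r"
      by (subst power_mult_distrib [symmetric]) simp
    finally show ?thesis unfolding add_divide_distrib [symmetric] by simp
  qed
  ultimately show ?thesis unfolding f_def un by simp
qed

section \<open>Bessel functions in the transition range\<close>

text \<open>The Bessel function \<open>J\<^sub>\<nu>(x)\<close> equals \<open>(x / 2)\<^sup>\<nu>\<close> times the following series at \<open>x\<^sup>2 / 4\<close>.\<close>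

definition bes :: "nat \<Rightarrow> real \<Rightarrow> real" where
  "bes \<nu> u = (\<Sum>j. (-1) ^ j / (fact j * fact (\<nu> + j)) * u ^ j)"

lemma summable_bes: "summable (\<lambda>j. norm ((-1) ^ j / (fact j * fact (\<nu> + j)) * (u::real) ^ j))"
proof (rule summable_comparison_test)
  show "summable (\<lambda>j. \<bar>u\<bar> ^ j / fact j)"
    using summable_exp[of "\<bar>u\<bar>"] by (simp add: field_simps)
  have "\<bar>u\<bar> ^ j / (fact j * fact (\<nu> + j)) \<le> \<bar>u\<bar> ^ j / (fact j * 1)" for j
    by (intro divide_left_mono mult_left_mono) auto
  thus "\<exists>N. \<forall>n\<ge>N. norm (norm ((-1) ^ n / (fact n * fact (\<nu> + n)) * u ^ n)) \<le> \<bar>u\<bar> ^ n / fact n"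
    by (auto simp: abs_mult power_abs)
qed

lemma bes_sums: "(\<lambda>j. (-1) ^ j / (fact j * fact (\<nu> + j)) * (u::real) ^ j) sums bes \<nu> u"
  unfolding bes_def by (intro summable_sums summable_norm_cancel[OF summable_bes])

lemma bes_0: "bes \<nu> 0 = 1 / fact \<nu>"
  unfolding bes_def by (subst powser_zero) simp

lemma has_field_derivative_bes: "(bes \<nu> has_field_derivative - bes (Suc \<nu>) u) (at u)"
proof -
  let ?c = "\<lambda>j. (-1) ^ j / (fact j * fact (\<nu> + j)) :: real"
  have "((\<lambda>u. \<Sum>j. ?c j * u ^ j) has_field_derivative (\<Sum>n. diffs ?c n * u ^ n)) (at u)"
    by (rule termdiffs_strong_converges_everywhere) (intro summable_norm_cancel[OF summable_bes])
  moreover have "diffs ?c n * u ^ n = - ((-1) ^ n / (fact n * fact (Suc \<nu> + n)) * u ^ n)" for n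
    by (simp add: diffs_def divide_simps)
  hence "(\<lambda>n. diffs ?c n * u ^ n) sums - bes (Suc \<nu>) u"
    using sums_minus[OF bes_sums] by (simp only:)
  hence "(\<Sum>n. diffs ?c n * u ^ n) = - bes (Suc \<nu>) u" by (rule sums_unique[symmetric])
  ultimately show ?thesis unfolding bes_def[abs_def] by simp
qed

text \<open>Combined with the derivative \<open>- bes (Suc \<nu>)\<close> this is Bessel's equation
  u G'' + (\<nu> + 1) G' + G = 0 for G = \<open>bes \<nu>\<close>. It is checked on coefficients;
  the constant terms on the right cancel, which accounts for the index shift.\<close>

lemma bes_recurrence: "u * bes (Suc (Suc \<nu>)) u = of_nat (Suc \<nu>) * bes (Suc \<nu>) u - bes \<nu> u"
proof -
  let ?a = "\<lambda>\<nu> j. (-1) ^ j / (fact j * fact (\<nu> + j)) * u ^ j :: real"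
  define d where "d = (\<lambda>j. of_nat (Suc \<nu>) * ?a (Suc \<nu>) j - ?a \<nu> j)"
  have d: "d sums (of_nat (Suc \<nu>) * bes (Suc \<nu>) u - bes \<nu> u)"
    unfolding d_def by (intro sums_diff sums_mult bes_sums)
  have d0: "d 0 = 0" by (simp add: d_def)
  have "d (Suc j) = u * ?a (Suc (Suc \<nu>)) j" for j
  proof -
    have f1: "fact (Suc \<nu> + Suc j) = (of_nat (Suc (Suc (\<nu> + j))) * fact (Suc (\<nu> + j)) :: real)"
      and f2: "fact (\<nu> + Suc j) = (fact (Suc (\<nu> + j)) :: real)"
      and f3: "fact (Suc (Suc \<nu>) + j) = (of_nat (Suc (Suc (\<nu> + j))) * fact (Suc (\<nu> + j)) :: real)"
      by simp_all
    have "of_nat (Suc \<nu>) / of_nat (Suc (Suc (\<nu> + j))) - 1 = - (of_nat (Suc j) / of_nat (Suc (Suc (\<nu> + j))) :: real)"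
      by (simp add: field_simps)
    hence "d (Suc j) = - (of_nat (Suc j) / of_nat (Suc (Suc (\<nu> + j)))) * ((-1) ^ Suc j * u ^ Suc j / (fact (Suc j) * fact (Suc (\<nu> + j))))"
      unfolding d_def f1 f2 by (simp add: divide_simps) (simp add: algebra_simps)
    also have "\<dots> = u * ?a (Suc (Suc \<nu>)) j"
      unfolding f3 fact_Suc[of j] by (simp add: divide_simps)
    finally show ?thesis .
  qed
  hence "(\<lambda>j. d (Suc j)) sums (u * bes (Suc (Suc \<nu>)) u)"
    using sums_mult[OF bes_sums] by (simp only:)
  hence "d sums (u * bes (Suc (Suc \<nu>)) u + d 0)" by (rule sums_Suc)
  thus ?thesis using sums_unique2[OF _ d] d0 by simp
qed

section \<open>Elementary bounds for logarithms and factorials\<close>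

lemma ln_one_plus_ge:
  assumes "(y::real) \<ge> 0"
  shows "2 * y / (2 + y) \<le> ln (1 + y)"
proof -
  have "(\<lambda>y. ln (1 + y) - 2 * y / (2 + y)) 0 \<le> (\<lambda>y. ln (1 + y) - 2 * y / (2 + y)) y"
  proof (rule DERIV_nonneg_imp_nondecreasing[OF assms])
    fix x :: real assume x: "0 \<le> x" "x \<le> y"
    have "((\<lambda>y. ln (1 + y) - 2 * y / (2 + y)) has_real_derivative (1 / (1 + x) - (2 * (2 + x) - 2 * x) / (2 + x)\<^sup>2)) (at x)"
      using x by (auto intro!: derivative_eq_intros simp: power2_eq_square)
    moreover have "1 / (1 + x) - (2 * (2 + x) - 2 * x) / (2 + x)\<^sup>2 = x\<^sup>2 / ((1 + x) * (2 + x)\<^sup>2)"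
      using x by (simp add: divide_simps) (simp add: algebra_simps power2_eq_square)
    ultimately show "\<exists>D. ((\<lambda>y. ln (1 + y) - 2 * y / (2 + y)) has_real_derivative D) (at x) \<and> 0 \<le> D"
      using x by auto
  qed
  thus ?thesis by simp
qed

text \<open>The logarithm is artanh y, so the error is cubic. In the transition range y has order
  n^(-1/3), hence n y^3 stays bounded.\<close>

lemma artanh_le:
  assumes "0 \<le> y" "y \<le> (1/2 :: real)"
  shows "ln ((1 + y) / (1 - y)) / 2 \<le> y + y ^ 3"
proof -
  have "(\<lambda>y. y + y ^ 3 - (ln (1 + y) - ln (1 - y)) / 2) 0 \<le> (\<lambda>y. y + y ^ 3 - (ln (1 + y) - ln (1 - y)) / 2) y"
  proof (rule DERIV_nonneg_imp_nondecreasing[OF assms(1)])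
    fix x :: real assume x: "0 \<le> x" "x \<le> y"
    hence x': "x \<le> 1/2" using assms by simp
    have "((\<lambda>y. y + y ^ 3 - (ln (1 + y) - ln (1 - y)) / 2) has_real_derivative (1 + 3 * x\<^sup>2 - (1 / (1 + x) + 1 / (1 - x)) / 2)) (at x)"
      using x x' by (auto intro!: derivative_eq_intros simp: power2_eq_square)
    moreover have "x\<^sup>2 \<le> 1/4" using power_mono[OF x' x(1), of 2] by (simp add: power2_eq_square)
    hence "0 \<le> x\<^sup>2 * (2 - 3 * x\<^sup>2) / (1 - x\<^sup>2)" by (intro divide_nonneg_nonneg mult_nonneg_nonneg) auto
    moreover have "1 + 3 * x\<^sup>2 - (1 / (1 + x) + 1 / (1 - x)) / 2 = x\<^sup>2 * (2 - 3 * x\<^sup>2) / (1 - x\<^sup>2)"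
    proof -
      have "1 - x\<^sup>2 = (1 + x) * (1 - x)" by (simp add: algebra_simps power2_eq_square)
      moreover have "(1 + x) * (1 - x) \<noteq> 0" using x x' by simp
      ultimately show ?thesis using x x' by (simp add: divide_simps) (simp add: algebra_simps power2_eq_square)
    qed
    ultimately show "\<exists>D. ((\<lambda>y. y + y ^ 3 - (ln (1 + y) - ln (1 - y)) / 2) has_real_derivative D) (at x) \<and> 0 \<le> D"
      by (intro exI[of _ "1 + 3 * x\<^sup>2 - (1 / (1 + x) + 1 / (1 - x)) / 2"] conjI) simp_all
  qed
  moreover have "ln ((1 + y) / (1 - y)) = ln (1 + y) - ln (1 - y)"
    using assms by (intro ln_divide_pos) auto
  ultimately show ?thesis by simp
qed

text \<open>The quotient of n! by sqrt n (n / e)^n starts at e for n = 1 and does not increase,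
  because e \<le> (1 + 1/n)^(n + 1/2). The bound 2 y / (2 + y) \<le> ln (1 + y) at y = 1/n gives
  this with equality in the rational part.\<close>

lemma fact_le_Stirling:
  assumes "n \<ge> 1"
  shows "fact n \<le> exp 1 * sqrt (real n) * (real n / exp 1) ^ n"
  using assms
proof (induction n rule: nat_induct_at_least)
  case base
  show ?case by simp
next
  case (Suc n)
  have n: "real n > 0" using Suc by simp
  have "1 \<le> (real n + 1/2) * ln (1 + 1 / real n)"
  proof -
    have "1 = (real n + 1/2) * (2 * (1 / real n) / (2 + 1 / real n))"
      using n by (simp add: field_simps)
    also have "\<dots> \<le> (real n + 1/2) * ln (1 + 1 / real n)"
      by (intro mult_left_mono ln_one_plus_ge) auto
    finally show ?thesis .
  qed
  hence "exp 1 \<le> exp ((real n + 1/2) * ln (1 + 1 / real n))" by simp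
  also have "\<dots> = exp (real n * ln (1 + 1 / real n)) * exp (ln (1 + 1 / real n) / 2)"
    by (simp add: exp_add [symmetric] algebra_simps)
  also have "exp (real n * ln (1 + 1 / real n)) = (1 + 1 / real n) ^ n"
    using n by (simp add: exp_of_nat_mult add_pos_pos)
  also have "exp (ln (1 + 1 / real n) / 2) = sqrt (1 + 1 / real n)"
    using powr_half_sqrt[of "1 + 1 / real n"] n by (simp add: powr_def add_pos_pos field_simps)
  finally have *: "exp 1 \<le> (1 + 1 / real n) ^ n * sqrt (1 + 1 / real n)" .
  have "1 + 1 / real n = real (Suc n) / real n" using n by (simp add: field_simps)
  with * have **: "exp 1 \<le> (real (Suc n) / real n) ^ n * (sqrt (real (Suc n)) / sqrt (real n))"
    by (simp add: real_sqrt_divide)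
  have "fact (Suc n) = real (Suc n) * fact n" by simp
  also have "\<dots> \<le> real (Suc n) * (exp 1 * sqrt (real n) * (real n / exp 1) ^ n)"
    using Suc by (intro mult_left_mono) auto
  also have "\<dots> = real (Suc n) * sqrt (real n) * (real n / exp 1) ^ n * exp 1" by simp
  also have "\<dots> \<le> real (Suc n) * sqrt (real n) * (real n / exp 1) ^ n * ((real (Suc n) / real n) ^ n * (sqrt (real (Suc n)) / sqrt (real n)))"
    by (intro mult_left_mono **) auto
  also have "\<dots> = exp 1 * sqrt (real (Suc n)) * (real (Suc n) / exp 1) ^ Suc n"
    using n by (simp add: power_divide power_mult_distrib)
  finally show ?case .
qed

text \<open>With \<open>s = sqrt (\<nu>\<^sup>2 - t\<^sup>2)\<close>, the function \<open>t\<^sup>\<nu> bes_cmp \<nu> t\<close> is a WKB approximation of \<open>J\<^sub>\<nu>\<close>, lowered by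
  the term in \<open>s\<^sup>-\<^sup>3\<close> so as to become a subsolution of Bessel's equation as long as \<open>4 s\<^sup>3 \<ge> 5 \<nu>\<^sup>2\<close>.\<close>

definition bes_cmp :: "nat \<Rightarrow> real \<Rightarrow> real" where
  "bes_cmp \<nu> t = (let s = sqrt ((real \<nu>)\<^sup>2 - t\<^sup>2) in
     exp (s - 5 * (real \<nu>)\<^sup>2 / (24 * s ^ 3) - real \<nu> * ln (real \<nu> + s) - ln s / 2))"

lemma bes_cmp_pos: "bes_cmp \<nu> t > 0"
  by (simp add: bes_cmp_def Let_def)

text \<open>This is t times the logarithmic derivative of \<open>bes_cmp \<nu>\<close>. The term
  -\<nu> is there because the factor t^\<nu> has been divided out of the Bessel function.\<close>

definition bes_h :: "nat \<Rightarrow> real \<Rightarrow> real" where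
  "bes_h \<nu> t = (let s = sqrt ((real \<nu>)\<^sup>2 - t\<^sup>2) in
     s - real \<nu> + t\<^sup>2 / (2 * s\<^sup>2) - 5 * t\<^sup>2 * (real \<nu>)\<^sup>2 / (8 * s ^ 5))"

lemma bes_s_pos:
  assumes "0 \<le> t" "t < real \<nu>"
  shows "sqrt ((real \<nu>)\<^sup>2 - t\<^sup>2) > 0" "(sqrt ((real \<nu>)\<^sup>2 - t\<^sup>2))\<^sup>2 = (real \<nu>)\<^sup>2 - t\<^sup>2"
proof -
  have "t\<^sup>2 < (real \<nu>)\<^sup>2" using assms by (intro power_strict_mono) auto
  thus "sqrt ((real \<nu>)\<^sup>2 - t\<^sup>2) > 0" "(sqrt ((real \<nu>)\<^sup>2 - t\<^sup>2))\<^sup>2 = (real \<nu>)\<^sup>2 - t\<^sup>2" by auto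
qed

lemma has_field_derivative_bes_s:
  assumes "0 \<le> t" "t < real \<nu>"
  shows "((\<lambda>t. sqrt ((real \<nu>)\<^sup>2 - t\<^sup>2)) has_real_derivative - t / sqrt ((real \<nu>)\<^sup>2 - t\<^sup>2)) (at t)"
  using bes_s_pos[OF assms] by (auto intro!: derivative_eq_intros simp: field_simps)

lemma has_field_derivative_inverse_bes_s_power:
  assumes "0 \<le> t" "t < real \<nu>"
  defines "i \<equiv> inverse (sqrt ((real \<nu>)\<^sup>2 - t\<^sup>2))"
  shows "((\<lambda>t. inverse (sqrt ((real \<nu>)\<^sup>2 - t\<^sup>2)) ^ k) has_real_derivative real k * (t * i ^ 3 * i ^ (k - 1))) (at t)"
proof -
  have "((\<lambda>t. inverse (sqrt ((real \<nu>)\<^sup>2 - t\<^sup>2))) has_real_derivative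
      - (i * (- t / sqrt ((real \<nu>)\<^sup>2 - t\<^sup>2)) * i)) (at t)"
    unfolding i_def using bes_s_pos[OF assms(1,2)]
    by (intro DERIV_inverse' has_field_derivative_bes_s assms) auto
  also have "- (i * (- t / sqrt ((real \<nu>)\<^sup>2 - t\<^sup>2)) * i) = t * i ^ 3"
    by (simp add: i_def divide_inverse power3_eq_cube)
  finally have "((\<lambda>t. inverse (sqrt ((real \<nu>)\<^sup>2 - t\<^sup>2))) has_real_derivative t * i ^ 3) (at t)" .
  from DERIV_power[OF this, of k] show ?thesis by (simp add: i_def)
qed

lemma divide_mult_power_eq_inverse: "a / (b * x ^ k) = a / b * inverse x ^ k" for x :: real
  by (simp only: divide_inverse inverse_mult_distrib power_inverse mult.assoc)

text \<open>The relation is multiplied by t so that it also makes sense at t = 0.\<close>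

lemma bes_cmp_deriv:
  assumes t: "0 \<le> t" "t < real \<nu>"
  shows "\<exists>D. (bes_cmp \<nu> has_real_derivative D) (at t) \<and> t * D = bes_h \<nu> t * bes_cmp \<nu> t"
proof -
  define n where "n = real \<nu>"
  define S where "S = (\<lambda>t. sqrt (n\<^sup>2 - t\<^sup>2))"
  define s i where "s = S t" and "i = inverse s"
  have s: "s > 0" "s\<^sup>2 = n\<^sup>2 - t\<^sup>2" using bes_s_pos[OF t] by (simp_all add: s_def S_def n_def)
  have n: "n > 0" using t by (simp add: n_def)
  have si: "s * i = 1" using s by (simp add: i_def)
  have dS: "(S has_real_derivative - t * i) (at t)"
    using has_field_derivative_bes_s[OF t] by (simp add: S_def s_def n_def i_def divide_inverse)
  have dI: "((\<lambda>t. inverse (S t) ^ k) has_real_derivative real k * (t * i ^ 3 * i ^ (k - 1))) (at t)" for k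
    using has_field_derivative_inverse_bes_s_power[OF t, of k] by (simp add: S_def s_def n_def i_def)
  have eq: "bes_cmp \<nu> = (\<lambda>t. exp (S t - 5 * n\<^sup>2 / 24 * inverse (S t) ^ 3 - n * ln (n + S t) - ln (S t) / 2))"
    by (rule ext) (simp only: bes_cmp_def Let_def S_def n_def divide_mult_power_eq_inverse)
  define E where "E = - t * i - 5 * n\<^sup>2 / 24 * (3 * (t * i ^ 3 * i ^ 2)) - n * (- t * i * inverse (n + s)) - (- t * i * i) / 2"
  have "((\<lambda>t. S t - 5 * n\<^sup>2 / 24 * inverse (S t) ^ 3 - n * ln (n + S t) - ln (S t) / 2) has_real_derivative E) (at t)"
  proof -
    have 1: "((\<lambda>t. inverse (S t) ^ 3) has_real_derivative 3 * (t * i ^ 3 * i\<^sup>2)) (at t)"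
      using dI[of 3] by simp
    have "((\<lambda>t. n + S t) has_real_derivative - t * i) (at t)"
      using DERIV_add[OF DERIV_const dS] by simp
    from DERIV_chain2[OF DERIV_ln this] have 2: "((\<lambda>t. ln (n + S t)) has_real_derivative - t * i * inverse (n + s)) (at t)"
      using s n by (simp add: s_def mult_ac)
    from DERIV_chain2[OF DERIV_ln dS] have 3: "((\<lambda>t. ln (S t)) has_real_derivative - t * i * i) (at t)"
      using s by (simp add: s_def i_def mult_ac)
    show ?thesis unfolding E_def
      by (rule DERIV_diff[OF DERIV_diff[OF DERIV_diff[OF dS DERIV_cmult[OF 1]] DERIV_cmult[OF 2]] DERIV_cdivide[OF 3]])
  qed
  from DERIV_chain2[OF DERIV_exp this]
  have d: "(bes_cmp \<nu> has_real_derivative bes_cmp \<nu> t * E) (at t)" by (simp add: eq)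
  have h: "bes_h \<nu> t = s - n + t\<^sup>2 / 2 * i\<^sup>2 - 5 / 8 * t\<^sup>2 * n\<^sup>2 * i ^ 5"
    by (simp add: bes_h_def Let_def s_def S_def n_def i_def divide_mult_power_eq_inverse del: inverse_eq_divide power_inverse)
  \<comment> \<open>Rationalising the denominator from ln (n + s): t^2 = (n - s)(n + s).\<close>
  have sn: "t\<^sup>2 * inverse (n + s) = n - s"
    using s n by (simp add: field_simps power2_eq_square)
  have "t * E = - t\<^sup>2 * i + n * i * (t\<^sup>2 * inverse (n + s)) + t\<^sup>2 / 2 * i\<^sup>2 - 5 / 8 * t\<^sup>2 * n\<^sup>2 * i ^ 5"
    by (simp add: E_def algebra_simps eval_nat_numeral)
  also have "- t\<^sup>2 * i + n * i * (t\<^sup>2 * inverse (n + s)) = s - n"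
  proof -
    have t2: "t\<^sup>2 = n\<^sup>2 - s\<^sup>2" using s by simp
    have "- t\<^sup>2 * i + n * i * (n - s) = (s * i) * (s - n)"
      unfolding t2 by (simp add: algebra_simps power2_eq_square)
    thus ?thesis unfolding sn si by simp
  qed
  finally have "t * E = bes_h \<nu> t" unfolding h .
  with d show ?thesis by (intro exI[of _ "bes_cmp \<nu> t * E"]) (simp add: algebra_simps)
qed

text \<open>The subsolution property, as a Riccati inequality for the logarithmic derivative \<open>\<nu> + bes_h \<nu> t\<close>.\<close>

lemma bes_h_deriv:
  assumes t: "0 \<le> t" "t < real \<nu>" and C: "5 * (real \<nu>)\<^sup>2 \<le> 4 * sqrt ((real \<nu>)\<^sup>2 - t\<^sup>2) ^ 3"
  shows "\<exists>D. (bes_h \<nu> has_real_derivative D) (at t) \<and>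
    t * D \<le> (real \<nu>)\<^sup>2 - t\<^sup>2 - (real \<nu> + bes_h \<nu> t)\<^sup>2"
proof -
  define n where "n = real \<nu>"
  define S where "S = (\<lambda>t. sqrt (n\<^sup>2 - t\<^sup>2))"
  define s i where "s = S t" and "i = inverse s"
  have s: "s > 0" "s\<^sup>2 = n\<^sup>2 - t\<^sup>2" using bes_s_pos[OF t] by (simp_all add: s_def S_def n_def)
  have n: "n > 0" using t by (simp add: n_def)
  have si: "s * i = 1" and i: "i > 0" using s by (simp_all add: i_def)
  have dS: "(S has_real_derivative - t * i) (at t)"
    using has_field_derivative_bes_s[OF t] by (simp add: S_def s_def n_def i_def divide_inverse)
  have dI: "((\<lambda>t. inverse (S t) ^ k) has_real_derivative real k * (t * i ^ 3 * i ^ (k - 1))) (at t)" for k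
    using has_field_derivative_inverse_bes_s_power[OF t, of k] by (simp add: S_def s_def n_def i_def)
  have eq: "bes_h \<nu> = (\<lambda>t. S t - n + t\<^sup>2 / 2 * inverse (S t) ^ 2 - 5 / 8 * n\<^sup>2 * (t\<^sup>2 * inverse (S t) ^ 5))"
    by (rule ext) (simp add: bes_h_def Let_def S_def n_def divide_mult_power_eq_inverse del: inverse_eq_divide power_inverse)
  define D where "D = - t * i - 0 + (2 * t / 2 * i\<^sup>2 + 2 * (t * i ^ 3 * i) * (t\<^sup>2 / 2))
     - 5 / 8 * n\<^sup>2 * (2 * t * i ^ 5 + 5 * (t * i ^ 3 * i ^ 4) * t\<^sup>2)"
  have dt: "((\<lambda>t. t\<^sup>2) has_real_derivative 2 * t) (at t)" by (auto intro!: derivative_eq_intros)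
  have d: "(bes_h \<nu> has_real_derivative D) (at t)"
  proof -
    have 1: "((\<lambda>t. t\<^sup>2 / 2 * (inverse (S t))\<^sup>2) has_real_derivative 2 * t / 2 * i\<^sup>2 + 2 * (t * i ^ 3 * i) * (t\<^sup>2 / 2)) (at t)"
      using DERIV_mult[OF DERIV_cdivide[OF dt, of 2] dI[of 2]] by (simp add: s_def i_def)
    have 2: "((\<lambda>t. t\<^sup>2 * inverse (S t) ^ 5) has_real_derivative 2 * t * i ^ 5 + 5 * (t * i ^ 3 * i ^ 4) * t\<^sup>2) (at t)"
      using DERIV_mult[OF dt dI[of 5]] by (simp add: s_def i_def)
    show ?thesis unfolding eq D_def
      by (rule DERIV_diff[OF DERIV_add[OF DERIV_diff[OF dS DERIV_const] 1] DERIV_cmult[OF 2]])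
  qed
  \<comment> \<open>The hypothesis on s says exactly x \<le> 1, and the logarithmic derivative
    becomes s + t^2 (1 - x) / (2 s^2).\<close>
  define x where "x = 5 / 4 * n\<^sup>2 * i ^ 3"
  have si3: "s ^ 3 * i ^ 3 = 1" using si by (simp add: power_mult_distrib [symmetric])
  have x: "0 \<le> x" using i by (simp add: x_def)
  have "5 * n\<^sup>2 * i ^ 3 \<le> 4 * s ^ 3 * i ^ 3"
    using C i by (intro mult_right_mono) (simp_all add: s_def S_def n_def)
  hence x1: "x \<le> 1" using si3 by (simp add: x_def)
  have v: "n + bes_h \<nu> t = s + t\<^sup>2 / 2 * i\<^sup>2 * (1 - x)"
    unfolding eq x_def s_def[symmetric] i_def[symmetric] by (simp add: algebra_simps eval_nat_numeral)
  have v2: "(n + bes_h \<nu> t)\<^sup>2 = s\<^sup>2 + t\<^sup>2 * i * (1 - x) + t ^ 4 * i ^ 4 / 4 * (1 - x)\<^sup>2"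
  proof -
    have "(n + bes_h \<nu> t)\<^sup>2 = s\<^sup>2 + (s * i) * (t\<^sup>2 * i * (1 - x)) + t ^ 4 * i ^ 4 / 4 * (1 - x)\<^sup>2"
      unfolding v by (simp add: power2_eq_square algebra_simps eval_nat_numeral)
    thus ?thesis by (simp add: si)
  qed
  have tD: "t * D = - t\<^sup>2 * i + t\<^sup>2 * n\<^sup>2 * i ^ 4 - 5 / 8 * n\<^sup>2 * (2 * t\<^sup>2 * i ^ 5 + 5 * t ^ 4 * i ^ 7)"
  proof -
    have "t\<^sup>2 * i\<^sup>2 = t\<^sup>2 * i ^ 4 * s\<^sup>2"
      using si by (simp add: eval_nat_numeral) (metis mult.assoc mult.commute mult.right_neutral)
    hence *: "t\<^sup>2 * i\<^sup>2 + t ^ 4 * i ^ 4 = t\<^sup>2 * n\<^sup>2 * i ^ 4"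
      unfolding s(2) by (simp add: algebra_simps eval_nat_numeral)
    have "t * D = - t\<^sup>2 * i + (t\<^sup>2 * i\<^sup>2 + t ^ 4 * i ^ 4) - 5 / 8 * n\<^sup>2 * (2 * t\<^sup>2 * i ^ 5 + 5 * t ^ 4 * i ^ 7)"
      unfolding D_def by (simp add: algebra_simps eval_nat_numeral)
    thus ?thesis unfolding * .
  qed
  have xx: "t\<^sup>2 * i * x = 5 / 4 * (t\<^sup>2 * n\<^sup>2 * i ^ 4)"
    unfolding x_def by (simp add: algebra_simps eval_nat_numeral)
  \<comment> \<open>The budget of the constant 5: it produces 5/4 of t^2 n^2 i^4, of which
    \<open>t * D\<close> uses 1; the remaining 1/4 has to pay for the square of the second-order
    term.\<close>
  have q: "t ^ 4 * i ^ 4 / 4 * (1 - x)\<^sup>2 \<le> t\<^sup>2 * n\<^sup>2 * i ^ 4 / 4 * 1"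
  proof (intro mult_mono)
    have "t\<^sup>2 \<le> n\<^sup>2" using s by (metis diff_ge_0_iff_ge zero_le_power2)
    hence "t ^ 4 \<le> t\<^sup>2 * n\<^sup>2" using mult_left_mono[of "t\<^sup>2" "n\<^sup>2" "t\<^sup>2"] by (simp add: eval_nat_numeral)
    thus "t ^ 4 * i ^ 4 / 4 \<le> t\<^sup>2 * n\<^sup>2 * i ^ 4 / 4" using i by (intro divide_right_mono mult_right_mono) auto
    show "(1 - x)\<^sup>2 \<le> 1" using x x1 by (simp add: power_le_one)
    show "0 \<le> t\<^sup>2 * n\<^sup>2 * i ^ 4 / 4" using i by simp
  qed auto
  have pos: "0 \<le> 5 / 8 * n\<^sup>2 * (2 * t\<^sup>2 * i ^ 5 + 5 * t ^ 4 * i ^ 7)" using i by simp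
  have "n\<^sup>2 - t\<^sup>2 - (n + bes_h \<nu> t)\<^sup>2 = - t\<^sup>2 * i + t\<^sup>2 * i * x - t ^ 4 * i ^ 4 / 4 * (1 - x)\<^sup>2"
    unfolding v2 s(2)[symmetric] by (simp add: algebra_simps)
  hence "t * D \<le> n\<^sup>2 - t\<^sup>2 - (n + bes_h \<nu> t)\<^sup>2"
    unfolding tD xx using q pos by simp
  with d show ?thesis unfolding n_def by blast
qed

text \<open>Sturm comparison. \<open>W\<close> is t times the Wronskian of t^\<nu> G and t^\<nu>
  \<open>bes_cmp \<nu> t\<close>. It vanishes at 0 and is nondecreasing where G > 0, since the
  second function is a subsolution; its sign is the sign of the derivative of the quotient.\<close>

lemma bes_cmp_quotient_mono:
  assumes b: "0 < b" "b < real \<nu>" and C: "5 * (real \<nu>)\<^sup>2 \<le> 4 * sqrt ((real \<nu>)\<^sup>2 - b\<^sup>2) ^ 3"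
    and pos: "\<And>t. 0 \<le> t \<Longrightarrow> t < b \<Longrightarrow> bes \<nu> (t\<^sup>2 / 4) > 0"
  shows "bes \<nu> 0 / bes_cmp \<nu> 0 \<le> bes \<nu> (b\<^sup>2 / 4) / bes_cmp \<nu> b"
proof -
  define G where "G = (\<lambda>t. bes \<nu> (t\<^sup>2 / 4))"
  define G1 where "G1 = (\<lambda>t. - (t / 2) * bes (Suc \<nu>) (t\<^sup>2 / 4))"
  define R where "R = (\<lambda>t. t * G1 t - bes_h \<nu> t * G t)"
  define W where "W = (\<lambda>t. t ^ (2 * \<nu>) * bes_cmp \<nu> t * R t)"
  have sq: "((\<lambda>t. t\<^sup>2 / 4) has_real_derivative t / 2) (at t)" for t :: real
    by (auto intro!: derivative_eq_intros)
  have dG: "(G has_real_derivative G1 t) (at t)" for t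
    using DERIV_chain2[OF has_field_derivative_bes sq] by (simp add: G_def G1_def mult.commute)
  have dG1: "(G1 has_real_derivative - (1 / 2) * bes (Suc \<nu>) (t\<^sup>2 / 4) + (t / 2) * (t / 2) * bes (Suc (Suc \<nu>)) (t\<^sup>2 / 4)) (at t)" for t
  proof -
    have 1: "((\<lambda>t. - (t / 2)) has_real_derivative - (1 / 2)) (at t)" by (auto intro!: derivative_eq_intros)
    show ?thesis unfolding G1_def
      using DERIV_mult[OF 1 DERIV_chain2[OF has_field_derivative_bes sq], of "Suc \<nu>"] by (simp add: algebra_simps)
  qed
  have tG1: "t * (t * (- (1 / 2) * bes (Suc \<nu>) (t\<^sup>2 / 4) + (t / 2) * (t / 2) * bes (Suc (Suc \<nu>)) (t\<^sup>2 / 4))) =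
      - (2 * real \<nu> + 1) * (t * G1 t) - t\<^sup>2 * G t" for t
  proof -
    have "t * (t * (- (1 / 2) * bes (Suc \<nu>) (t\<^sup>2 / 4) + (t / 2) * (t / 2) * bes (Suc (Suc \<nu>)) (t\<^sup>2 / 4))) =
       - (t\<^sup>2 / 2) * bes (Suc \<nu>) (t\<^sup>2 / 4) + t\<^sup>2 * (t\<^sup>2 / 4 * bes (Suc (Suc \<nu>)) (t\<^sup>2 / 4))"
      by (simp add: algebra_simps power2_eq_square)
    also have "\<dots> = - (2 * real \<nu> + 1) * (t * G1 t) - t\<^sup>2 * G t"
      unfolding bes_recurrence by (simp add: field_simps power2_eq_square G1_def G_def)
    finally show ?thesis .
  qed
  have s_mono: "5 * (real \<nu>)\<^sup>2 \<le> 4 * sqrt ((real \<nu>)\<^sup>2 - t\<^sup>2) ^ 3" if "0 \<le> t" "t \<le> b" for t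
  proof -
    have "t\<^sup>2 \<le> b\<^sup>2" using that by (intro power_mono) auto
    hence "sqrt ((real \<nu>)\<^sup>2 - b\<^sup>2) ^ 3 \<le> sqrt ((real \<nu>)\<^sup>2 - t\<^sup>2) ^ 3"
      using bes_s_pos[of b \<nu>] b by (intro power_mono) auto
    thus ?thesis using C by simp
  qed
  have dR: "\<exists>D. (R has_real_derivative D) (at t) \<and> t * D \<ge> - (2 * real \<nu> + bes_h \<nu> t) * R t"
    if t: "0 \<le> t" "t < b" for t
  proof -
    obtain H where H: "(bes_h \<nu> has_real_derivative H) (at t)"
        "t * H \<le> (real \<nu>)\<^sup>2 - t\<^sup>2 - (real \<nu> + bes_h \<nu> t)\<^sup>2"
      using bes_h_deriv[of t \<nu>] s_mono[of t] t b by auto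
    define D where "D = 1 * G1 t + (- (1 / 2) * bes (Suc \<nu>) (t\<^sup>2 / 4) + (t / 2) * (t / 2) * bes (Suc (Suc \<nu>)) (t\<^sup>2 / 4)) * t - (H * G t + G1 t * bes_h \<nu> t)"
    have d: "(R has_real_derivative D) (at t)"
      unfolding R_def D_def by (rule DERIV_diff[OF DERIV_mult[OF DERIV_ident dG1] DERIV_mult[OF H(1) dG]])
    have "t * D = t * G1 t + t * (t * (- (1 / 2) * bes (Suc \<nu>) (t\<^sup>2 / 4) + (t / 2) * (t / 2) * bes (Suc (Suc \<nu>)) (t\<^sup>2 / 4)))
         - (t * H) * G t - t * G1 t * bes_h \<nu> t"
      unfolding D_def by (simp add: algebra_simps)
    also have "\<dots> = - 2 * real \<nu> * (t * G1 t) - t\<^sup>2 * G t - (t * H) * G t - t * G1 t * bes_h \<nu> t"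
      unfolding tG1 by (simp add: algebra_simps)
    \<comment> \<open>Here positivity of G enters: the Riccati inequality is multiplied by
      it.\<close>
    also have "\<dots> \<ge> - 2 * real \<nu> * (t * G1 t) - t\<^sup>2 * G t - ((real \<nu>)\<^sup>2 - t\<^sup>2 - (real \<nu> + bes_h \<nu> t)\<^sup>2) * G t - t * G1 t * bes_h \<nu> t"
    proof -
      have "0 \<le> G t" using pos[OF t] by (simp add: G_def)
      from mult_right_mono[OF H(2) this] show ?thesis by linarith
    qed
    also have "- 2 * real \<nu> * (t * G1 t) - t\<^sup>2 * G t - ((real \<nu>)\<^sup>2 - t\<^sup>2 - (real \<nu> + bes_h \<nu> t)\<^sup>2) * G t - t * G1 t * bes_h \<nu> t
        = - (2 * real \<nu> + bes_h \<nu> t) * R t"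
      unfolding R_def by (simp add: algebra_simps power2_eq_square)
    finally show ?thesis using d by blast
  qed
  have dW: "\<exists>D. (W has_real_derivative D) (at t) \<and> (0 < t \<longrightarrow> 0 \<le> D)" if t: "0 \<le> t" "t < b" for t
  proof -
    obtain D where D: "(R has_real_derivative D) (at t)" "t * D \<ge> - (2 * real \<nu> + bes_h \<nu> t) * R t"
      using dR[OF t] by blast
    obtain E where E: "(bes_cmp \<nu> has_real_derivative E) (at t)" "t * E = bes_h \<nu> t * bes_cmp \<nu> t"
      using bes_cmp_deriv[of t \<nu>] t b by auto
    define F where "F = (real (2 * \<nu>) * (1 * t ^ (2 * \<nu> - Suc 0)) * bes_cmp \<nu> t + E * t ^ (2 * \<nu>)) * R t + D * (t ^ (2 * \<nu>) * bes_cmp \<nu> t)"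
    have d: "(W has_real_derivative F) (at t)"
      unfolding W_def F_def
      using DERIV_mult[OF DERIV_mult[OF DERIV_power[OF DERIV_ident, of "2 * \<nu>"] E(1)] D(1)] by simp
    have "0 \<le> F" if t0: "0 < t"
    proof -
      have nu: "\<nu> > 0" using b by (cases \<nu>) auto
      have tp: "t * t ^ (2 * \<nu> - Suc 0) = t ^ (2 * \<nu>)" using nu by (cases \<nu>) auto
      have "t * F = (2 * real \<nu> * (t * t ^ (2 * \<nu> - Suc 0)) * bes_cmp \<nu> t + (t * E) * t ^ (2 * \<nu>)) * R t + t * D * (t ^ (2 * \<nu>) * bes_cmp \<nu> t)"
        by (simp add: F_def algebra_simps)
      also have "\<dots> = t ^ (2 * \<nu>) * bes_cmp \<nu> t * ((2 * real \<nu> + bes_h \<nu> t) * R t + t * D)"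
        unfolding tp E(2) by (simp add: algebra_simps)
      finally have tF: "t * F = t ^ (2 * \<nu>) * bes_cmp \<nu> t * ((2 * real \<nu> + bes_h \<nu> t) * R t + t * D)" .
      have "0 \<le> (2 * real \<nu> + bes_h \<nu> t) * R t + t * D"
        using D(2) unfolding mult_minus_left by linarith
      moreover have "0 \<le> t ^ (2 * \<nu>) * bes_cmp \<nu> t" using t0 bes_cmp_pos[of \<nu> t] by simp
      ultimately have "0 \<le> t * F" unfolding tF by (rule mult_nonneg_nonneg[rotated])
      thus ?thesis using t0 by (simp add: zero_le_mult_iff)
    qed
    with d show ?thesis by (intro exI[of _ F] conjI impI)
  qed
  have R0: "0 \<le> R t" if t: "0 < t" "t < b" for t
  proof -
    have W0t: "W 0 \<le> W t"
    proof (rule DERIV_nonneg_imp_increasing_open[of 0 t W])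
      show "continuous_on {0..t} W"
      proof (intro continuous_at_imp_continuous_on ballI)
        fix x assume "x \<in> {0..t}"
        thus "isCont W x" using dW[of x] t by (auto dest: DERIV_isCont)
      qed
      show "\<exists>y. (W has_real_derivative y) (at x) \<and> 0 \<le> y" if "0 < x" "x < t" for x
        using dW[of x] that t by auto
    qed (use t in simp)
    have "W 0 = 0" using b by (simp add: W_def)
    hence "0 \<le> (t ^ (2 * \<nu>) * bes_cmp \<nu> t) * R t" using W0t by (simp only: W_def)
    moreover have "0 < t ^ (2 * \<nu>) * bes_cmp \<nu> t" using t bes_cmp_pos[of \<nu> t] by simp
    ultimately show ?thesis by (simp only: zero_le_mult_iff) linarith
  qed
  have "G 0 / bes_cmp \<nu> 0 \<le> G b / bes_cmp \<nu> b"
  proof (rule DERIV_nonneg_imp_increasing_open[of 0 b "\<lambda>t. G t / bes_cmp \<nu> t"])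
    have dq: "\<exists>D. ((\<lambda>t. G t / bes_cmp \<nu> t) has_real_derivative D) (at t) \<and> (0 < t \<longrightarrow> t < b \<longrightarrow> 0 \<le> D)"
      if t: "0 \<le> t" "t \<le> b" for t
    proof -
      obtain E where E: "(bes_cmp \<nu> has_real_derivative E) (at t)" "t * E = bes_h \<nu> t * bes_cmp \<nu> t"
        using bes_cmp_deriv[of t \<nu>] t b by auto
      define F where "F = (G1 t * bes_cmp \<nu> t - G t * E) / (bes_cmp \<nu> t * bes_cmp \<nu> t)"
      have "((\<lambda>t. G t / bes_cmp \<nu> t) has_real_derivative F) (at t)"
        unfolding F_def using bes_cmp_pos[of \<nu> t] by (intro DERIV_divide dG E) auto
      moreover have "0 \<le> F" if "0 < t" "t < b"
      proof -
        have "t * (G1 t * bes_cmp \<nu> t - G t * E) = bes_cmp \<nu> t * R t"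
          using E(2) by (simp add: R_def algebra_simps)
        also have "\<dots> \<ge> 0" using R0[OF that] bes_cmp_pos[of \<nu> t] by simp
        finally have "0 \<le> G1 t * bes_cmp \<nu> t - G t * E" using that by (simp add: zero_le_mult_iff)
        thus ?thesis unfolding F_def by (intro divide_nonneg_nonneg) auto
      qed
      ultimately show ?thesis by blast
    qed
    show "continuous_on {0..b} (\<lambda>t. G t / bes_cmp \<nu> t)"
    proof (intro continuous_at_imp_continuous_on ballI)
      fix x assume "x \<in> {0..b}"
      thus "isCont (\<lambda>t. G t / bes_cmp \<nu> t) x" using dq[of x] by (auto dest: DERIV_isCont)
    qed
    show "\<exists>y. ((\<lambda>t. G t / bes_cmp \<nu> t) has_real_derivative y) (at x) \<and> 0 \<le> y" if "0 < x" "x < b" for x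
      using dq[of x] that by auto
  qed (use b in simp)
  thus ?thesis by (simp add: G_def)
qed

lemma isCont_bes [continuous_intros]: "isCont f x \<Longrightarrow> isCont (\<lambda>x. bes \<nu> (f x)) x"
  using isCont_o2[OF _ DERIV_isCont[OF has_field_derivative_bes]] .

text \<open>Positivity comes for free: up to a first zero the quotient is nondecreasing and starts
  from a positive value, so it cannot have reached 0 there.\<close>

lemma bes_ge_bes_cmp:
  assumes x: "0 < x" "x < real \<nu>" and C: "5 * (real \<nu>)\<^sup>2 \<le> 4 * sqrt ((real \<nu>)\<^sup>2 - x\<^sup>2) ^ 3"
  shows "bes \<nu> 0 / bes_cmp \<nu> 0 \<le> bes \<nu> (x\<^sup>2 / 4) / bes_cmp \<nu> x"
proof -
  have s_mono: "5 * (real \<nu>)\<^sup>2 \<le> 4 * sqrt ((real \<nu>)\<^sup>2 - t\<^sup>2) ^ 3" if "0 \<le> t" "t \<le> x" for t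
  proof -
    have "t\<^sup>2 \<le> x\<^sup>2" using that by (intro power_mono) auto
    hence "sqrt ((real \<nu>)\<^sup>2 - x\<^sup>2) ^ 3 \<le> sqrt ((real \<nu>)\<^sup>2 - t\<^sup>2) ^ 3"
      using bes_s_pos[of x \<nu>] x by (intro power_mono) auto
    thus ?thesis using C by simp
  qed
  have b0: "bes \<nu> 0 / bes_cmp \<nu> 0 > 0" using bes_cmp_pos by (simp add: bes_0)
  have "bes \<nu> (t\<^sup>2 / 4) > 0" if t: "0 \<le> t" "t < x" for t
  proof (rule ccontr)
    assume "\<not> bes \<nu> (t\<^sup>2 / 4) > 0"
    define Z where "Z = {0..t} \<inter> {u. bes \<nu> (u\<^sup>2 / 4) \<le> 0}"
    have "closed {u. bes \<nu> (u\<^sup>2 / 4) \<le> 0}"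
      by (intro closed_Collect_le continuous_at_imp_continuous_on ballI continuous_intros) auto
    hence "compact Z" unfolding Z_def by (intro compact_Int_closed) auto
    moreover have "Z \<noteq> {}" using \<open>\<not> bes \<nu> (t\<^sup>2 / 4) > 0\<close> t by (auto simp: Z_def)
    ultimately obtain b where b: "b \<in> Z" "\<And>u. u \<in> Z \<Longrightarrow> b \<le> u"
      using compact_attains_inf[of Z] by auto
    have "bes \<nu> 0 > 0" by (simp add: bes_0)
    hence "b \<noteq> 0" using b(1) by (auto simp: Z_def simp del: bes_0)
    moreover have "0 \<le> b" "b \<le> t" using b(1) by (simp_all add: Z_def)
    ultimately have b': "0 < b" "b \<le> t" by simp_all
    have "bes \<nu> 0 / bes_cmp \<nu> 0 \<le> bes \<nu> (b\<^sup>2 / 4) / bes_cmp \<nu> b"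
    proof (rule bes_cmp_quotient_mono)
      show "bes \<nu> (u\<^sup>2 / 4) > 0" if "0 \<le> u" "u < b" for u
      proof (rule ccontr)
        assume "\<not> bes \<nu> (u\<^sup>2 / 4) > 0"
        hence "u \<in> Z" using that b' by (simp add: Z_def)
        thus False using b(2)[of u] that by simp
      qed
    qed (use b' t x s_mono[of b] in auto)
    hence "0 < bes \<nu> (b\<^sup>2 / 4) / bes_cmp \<nu> b" using b0 by linarith
    hence "0 < bes \<nu> (b\<^sup>2 / 4)" using bes_cmp_pos[of \<nu> b] by (simp add: zero_less_divide_iff)
    thus False using b(1) by (simp add: Z_def)
  qed
  with x C show ?thesis by (intro bes_cmp_quotient_mono) auto
qed

text \<open>The hypotheses place \<open>x\<close> in the transition range, where \<open>\<nu> - x\<close> has order \<open>\<nu>\<^sup>1\<^sup>/\<^sup>3\<close>.\<close>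

theorem bes_transition_lower_bound:
  assumes x: "0 < x" "x < real \<nu>" and nu: "real \<nu> \<ge> 320"
    and C: "5 * (real \<nu>)\<^sup>2 \<le> 4 * sqrt ((real \<nu>)\<^sup>2 - x\<^sup>2) ^ 3"
    and L: "sqrt ((real \<nu>)\<^sup>2 - x\<^sup>2) ^ 3 \<le> 40 * (real \<nu>)\<^sup>2"
  shows "(x / 2) ^ \<nu> * bes \<nu> (x\<^sup>2 / 4) \<ge> exp (- 42) * 40 powr (-1/6) * real \<nu> powr (-1/3)"
proof -
  define n where "n = real \<nu>"
  define s where "s = sqrt (n\<^sup>2 - x\<^sup>2)"
  have n: "n > 0" "n \<ge> 320" using nu by (auto simp: n_def)
  have s: "s > 0" "s\<^sup>2 = n\<^sup>2 - x\<^sup>2" using bes_s_pos[of x \<nu>] x by (simp_all add: s_def n_def)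
  have C': "5 * n\<^sup>2 \<le> 4 * s ^ 3" and L': "s ^ 3 \<le> 40 * n\<^sup>2" using C L by (simp_all add: s_def n_def)
  define y where "y = s / n"
  have y0: "0 < y" using s n by (simp add: y_def)
  have ny3: "n * y ^ 3 \<le> 40"
    using L' n by (simp add: y_def power_divide field_simps power2_eq_square power3_eq_cube)
  \<comment> \<open>The threshold 320 is 8 times 40: it turns n y^3 \<le> 40 into y^3 \<le>
    1/8.\<close>
  have y12: "y \<le> 1 / 2"
  proof -
    have "n * y ^ 3 \<le> n * (1 / 8)" using ny3 n by linarith
    hence "n * y ^ 3 \<le> n * (1 / 2) ^ 3" by (simp add: power3_eq_cube)
    hence "y ^ 3 \<le> (1 / 2) ^ 3" using n by simp
    thus ?thesis using power_mono_iff[of y "1/2" 3] y0 by simp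
  qed
  have ratio: "x / (n + s) = sqrt ((1 - y) / (1 + y))"
  proof -
    have "(1 - y) / (1 + y) = (n - s) / (n + s)"
    proof -
      have "1 - y = (n - s) / n" "1 + y = (n + s) / n" using n by (simp_all add: y_def diff_divide_distrib add_divide_distrib)
      thus ?thesis using n by simp
    qed
    also have "\<dots> = (x / (n + s))\<^sup>2"
    proof -
      have "x\<^sup>2 = n\<^sup>2 - s\<^sup>2" using s(2) by linarith
      hence "x\<^sup>2 = (n - s) * (n + s)" by (simp only:) (simp add: algebra_simps power2_eq_square)
      moreover have "n + s > 0" using n s(1) by simp
      ultimately show ?thesis by (simp add: power_divide power2_eq_square)
    qed
    finally have e: "(1 - y) / (1 + y) = (x / (n + s))\<^sup>2" .
    have "0 \<le> x / (n + s)" using x n s(1) by simp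
    thus ?thesis unfolding e real_sqrt_abs by (rule abs_of_nonneg[symmetric])
  qed
  \<comment> \<open>By \<open>ratio\<close> the logarithm equals -artanh (s / n), and n artanh y
    \<le> s + n y^3.\<close>
  have lnr: "n * ln (x / (n + s)) \<ge> - s - 40"
  proof -
    have "ln (x / (n + s)) = - (ln ((1 + y) / (1 - y)) / 2)"
    proof -
      have "ln (sqrt ((1 - y) / (1 + y))) = ln ((1 - y) / (1 + y)) / 2" using y0 y12 by (intro ln_sqrt) auto
      moreover have "ln ((1 - y) / (1 + y)) = - ln ((1 + y) / (1 - y))"
        using y0 y12 by (simp add: ln_divide_pos)
      ultimately show ?thesis unfolding ratio by simp
    qed
    moreover have "ln ((1 + y) / (1 - y)) / 2 \<le> y + y ^ 3" using artanh_le[of y] y0 y12 by simp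
    ultimately have "ln (x / (n + s)) \<ge> - y - y ^ 3" by simp
    hence "n * ln (x / (n + s)) \<ge> n * (- y - y ^ 3)" using n by (intro mult_left_mono) auto
    also have "n * (- y - y ^ 3) = - s - n * y ^ 3" using n by (simp add: y_def algebra_simps)
    finally show ?thesis using ny3 by linarith
  qed
  have main: "bes \<nu> (x\<^sup>2 / 4) \<ge> bes_cmp \<nu> x / bes_cmp \<nu> 0 / fact \<nu>"
    using bes_ge_bes_cmp[OF x C] bes_cmp_pos[of \<nu> x] bes_cmp_pos[of \<nu> 0]
    by (simp add: bes_0 field_simps)
  have f: "fact \<nu> \<le> exp 1 * sqrt n * (n / exp 1) ^ \<nu>"
    using fact_le_Stirling[of \<nu>] nu by (simp add: n_def)
  have lnf: "ln (fact \<nu>) \<le> 1 + ln n / 2 + n * (ln n - 1)"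
  proof -
    have "ln (fact \<nu>) \<le> ln (exp 1 * sqrt n * (n / exp 1) ^ \<nu>)"
      using f n by (subst ln_le_cancel_iff) auto
    also have "\<dots> = 1 + ln n / 2 + n * (ln n - 1)"
      using n by (simp add: ln_mult ln_sqrt ln_realpow ln_divide_pos n_def[symmetric])
    finally show ?thesis .
  qed
  have c1: "bes_cmp \<nu> x = exp (s - 5 * n\<^sup>2 / (24 * s ^ 3) - n * ln (n + s) - ln s / 2)"
    by (simp add: bes_cmp_def Let_def s_def n_def)
  have c0: "bes_cmp \<nu> 0 = exp (n - 5 * n\<^sup>2 / (24 * n ^ 3) - n * ln (n + n) - ln n / 2)"
    by (simp add: bes_cmp_def Let_def n_def)
  have ls: "ln s \<le> ln 40 / 3 + 2 / 3 * ln n"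
  proof -
    have "3 * ln s = ln (s ^ 3)" using s(1) by (simp add: ln_realpow)
    also have "\<dots> \<le> ln (40 * n\<^sup>2)" using L' s(1) n by (subst ln_le_cancel_iff) auto
    also have "\<dots> = ln 40 + 2 * ln n" using n by (simp add: ln_mult ln_realpow)
    finally show ?thesis by simp
  qed
  have q1: "5 * n\<^sup>2 / (24 * s ^ 3) \<le> 1"
  proof -
    have "5 * n\<^sup>2 \<le> 24 * s ^ 3" using C' zero_less_power[OF s(1), of 3] by linarith
    thus ?thesis using s(1) by (simp add: divide_le_eq)
  qed
  have q0: "0 \<le> 5 * n\<^sup>2 / (24 * n ^ 3)" using n by simp
  \<comment> \<open>In the exponent -42, 40 is the cubic error of artanh, 1 comes from Stirling and
    1 from the term in s^(-3). The power of n is decided by ln s / 2 alone, since the other two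
    halves of ln n, from Stirling and from \<open>bes_cmp \<nu> 0\<close>, cancel.\<close>
  have "exp (- 42) * 40 powr (-1/6) * n powr (-1/3) = exp (- 42 - ln 40 / 6 - ln n / 3)"
    using n by (simp add: powr_def exp_add [symmetric] exp_diff exp_minus field_simps)
  also have "\<dots> \<le> exp (n * ln (x / 2) + ((s - 5 * n\<^sup>2 / (24 * s ^ 3) - n * ln (n + s) - ln s / 2)
     - (n - 5 * n\<^sup>2 / (24 * n ^ 3) - n * ln (n + n) - ln n / 2) - ln (fact \<nu>)))"
  proof -
    have l1: "ln (x / 2) = ln x - ln 2" using x by (simp add: ln_divide_pos)
    have l2: "ln (n + n) = ln 2 + ln n" using n using ln_mult[of 2 n] by simp
    have l3: "ln (x / (n + s)) = ln x - ln (n + s)" using x n s(1) by (intro ln_divide_pos) auto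
    have "n * ln (x / 2) + ((s - 5 * n\<^sup>2 / (24 * s ^ 3) - n * ln (n + s) - ln s / 2)
     - (n - 5 * n\<^sup>2 / (24 * n ^ 3) - n * ln (n + n) - ln n / 2) - ln (fact \<nu>)) =
      n * ln (x / (n + s)) + s - ln s / 2 - n + n * ln n + ln n / 2 - ln (fact \<nu>) - 5 * n\<^sup>2 / (24 * s ^ 3) + 5 * n\<^sup>2 / (24 * n ^ 3)"
      unfolding l1 l2 l3 by (simp add: algebra_simps)
    moreover have "n * (ln n - 1) = n * ln n - n" by (simp add: algebra_simps)
    ultimately show ?thesis using lnr lnf ls q1 q0 by (subst exp_le_cancel_iff) linarith
  qed
  also have "\<dots> = (x / 2) ^ \<nu> * (bes_cmp \<nu> x / bes_cmp \<nu> 0 / fact \<nu>)"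
  proof -
    have "exp (n * ln (x / 2)) = (x / 2) ^ \<nu>" using x by (simp add: n_def exp_of_nat_mult)
    moreover have "exp (a + ((p - q) - l)) = exp a * (exp p / exp q / exp l)" for a p q l :: real
      by (simp add: exp_add exp_diff)
    ultimately show ?thesis unfolding c1 c0 by simp
  qed
  also have "\<dots> \<le> (x / 2) ^ \<nu> * bes \<nu> (x\<^sup>2 / 4)"
    using x by (intro mult_left_mono main) auto
  finally show ?thesis by (simp add: n_def)
qed

section \<open>The modular group\<close>

definition mob_j :: "int^2^2 \<Rightarrow> complex \<Rightarrow> complex" where
  "mob_j A z = of_int (A $ 2 $ 1) * z + of_int (A $ 2 $ 2)"

definition mat2 :: "int \<Rightarrow> int \<Rightarrow> int \<Rightarrow> int \<Rightarrow> int^2^2" where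
  "mat2 a b c d = vector [vector [a, b], vector [c, d]]"

lemma mat2_nth [simp]:
  "mat2 a b c d $ 1 $ 1 = a" "mat2 a b c d $ 1 $ 2 = b"
  "mat2 a b c d $ 2 $ 1 = c" "mat2 a b c d $ 2 $ 2 = d"
  by (simp_all add: mat2_def)

lemma mat2_eqI:
  fixes A B :: "int^2^2"
  assumes "A $ 1 $ 1 = B $ 1 $ 1" "A $ 1 $ 2 = B $ 1 $ 2" "A $ 2 $ 1 = B $ 2 $ 1" "A $ 2 $ 2 = B $ 2 $ 2"
  shows "A = B"
proof -
  have "A $ i $ j = B $ i $ j" for i j
    using exhaust_2[of i] exhaust_2[of j] assms by auto
  thus ?thesis unfolding vec_eq_iff by blast
qed

lemma matrix_mult_2_nth:
  "(A ** B) $ i $ j = A $ i $ 1 * B $ 1 $ j + A $ i $ 2 * B $ 2 $ (j :: 2)" for A B :: "int^2^2"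
  by (simp add: matrix_matrix_mult_def sum_2)

lemma Gamma0_iff:
  "A \<in> Gamma0 N \<longleftrightarrow> A $ 1 $ 1 * A $ 2 $ 2 - A $ 1 $ 2 * A $ 2 $ 1 = 1 \<and> int N dvd A $ 2 $ 1"
  by (simp add: Gamma0_def det_2)

lemma Gamma0_mult: "A \<in> Gamma0 N \<Longrightarrow> B \<in> Gamma0 N \<Longrightarrow> A ** B \<in> Gamma0 N"
  by (auto simp: Gamma0_def det_mul matrix_mult_2_nth intro: dvd_add)

definition gamma_inv :: "int^2^2 \<Rightarrow> int^2^2" where
  "gamma_inv A = mat2 (A $ 2 $ 2) (- (A $ 1 $ 2)) (- (A $ 2 $ 1)) (A $ 1 $ 1)"

lemma gamma_inv_in_Gamma0: "A \<in> Gamma0 N \<Longrightarrow> gamma_inv A \<in> Gamma0 N"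
  by (simp add: gamma_inv_def Gamma0_iff algebra_simps)

lemma gamma_inv_mult:
  assumes "A \<in> Gamma0 N"
  shows "gamma_inv A ** A = mat 1" "A ** gamma_inv A = mat 1"
  using assms by (auto intro!: mat2_eqI simp: gamma_inv_def Gamma0_iff matrix_mult_2_nth mat_def algebra_simps)

lemma mob_j_nonzero:
  assumes "A \<in> Gamma0 N" "Im z > 0"
  shows "mob_j A z \<noteq> 0"
proof
  assume *: "mob_j A z = 0"
  hence "Im (mob_j A z) = 0" by simp
  hence c: "A $ 2 $ 1 = 0" using assms by (simp add: mob_j_def)
  hence "A $ 2 $ 2 = 0" using * by (simp add: mob_j_def)
  with c assms show False by (simp add: Gamma0_iff)
qed

lemma mobius_altdef: "mobius A z = (of_int (A $ 1 $ 1) * z + of_int (A $ 1 $ 2)) / mob_j A z"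
  by (simp add: mobius_def mob_j_def)

lemma slash_altdef: "slash k f A z = f (mobius A z) / mob_j A z ^ k"
  by (simp add: slash_def mob_j_def)

lemma Im_mobius:
  assumes "A \<in> Gamma0 N"
  shows "Im (mobius A z) = Im z / (norm (mob_j A z))\<^sup>2"
proof -
  define a b c d where "a = real_of_int (A $ 1 $ 1)" "b = real_of_int (A $ 1 $ 2)"
    "c = real_of_int (A $ 2 $ 1)" "d = real_of_int (A $ 2 $ 2)"
  have "A $ 1 $ 1 * A $ 2 $ 2 - A $ 1 $ 2 * A $ 2 $ 1 = 1" using assms by (simp add: Gamma0_iff)
  hence "real_of_int (A $ 1 $ 1 * A $ 2 $ 2 - A $ 1 $ 2 * A $ 2 $ 1) = 1" by simp
  hence det: "a * d - b * c = 1" by (simp add: a_b_c_d_def)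
  have "Im (mobius A z) = ((a * Im z) * (c * Re z + d) - (a * Re z + b) * (c * Im z)) / ((c * Re z + d)\<^sup>2 + (c * Im z)\<^sup>2)"
    by (simp add: mobius_def Im_divide a_b_c_d_def)
  also have "(a * Im z) * (c * Re z + d) - (a * Re z + b) * (c * Im z) = (a * d - b * c) * Im z"
    by (simp add: algebra_simps)
  also have "(c * Re z + d)\<^sup>2 + (c * Im z)\<^sup>2 = (norm (mob_j A z))\<^sup>2"
    by (simp add: cmod_power2 mob_j_def a_b_c_d_def)
  finally show ?thesis by (simp add: det)
qed

lemma Im_mobius_pos: "A \<in> Gamma0 N \<Longrightarrow> Im z > 0 \<Longrightarrow> Im (mobius A z) > 0"
  using mob_j_nonzero by (subst Im_mobius) auto

lemma mob_j_mult:
  assumes "B \<in> Gamma0 N" "Im z > 0"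
  shows "mob_j (A ** B) z = mob_j A (mobius B z) * mob_j B z"
  using mob_j_nonzero[OF assms]
  by (simp add: mobius_altdef mob_j_def[of A] mob_j_def[of "A ** B"] matrix_mult_2_nth field_simps)
     (simp add: mob_j_def algebra_simps)

lemma mobius_mult:
  assumes "B \<in> Gamma0 N" "Im z > 0"
  shows "mobius (A ** B) z = mobius A (mobius B z)"
proof -
  have "(of_int ((A ** B) $ 1 $ 1) * z + of_int ((A ** B) $ 1 $ 2)) =
    (of_int (A $ 1 $ 1) * mobius B z + of_int (A $ 1 $ 2)) * mob_j B z"
    using mob_j_nonzero[OF assms]
    by (simp add: mobius_altdef matrix_mult_2_nth field_simps) (simp add: mob_j_def algebra_simps)
  thus ?thesis
    using mob_j_nonzero[OF assms] unfolding mobius_altdef[of "A ** B"] mob_j_mult[OF assms] mobius_altdef[of A]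
    by simp
qed

lemma mobius_gamma_inv:
  assumes "A \<in> Gamma0 N" "Im z > 0"
  shows "mobius (gamma_inv A) (mobius A z) = z" "mobius A (mobius (gamma_inv A) z) = z"
  using mobius_mult[OF assms, of "gamma_inv A"] mobius_mult[OF gamma_inv_in_Gamma0[OF assms(1)] assms(2), of A]
    gamma_inv_mult[OF assms(1)] by (simp_all add: mobius_def mat_def)

lemma mobius_translate: "mobius (mat2 1 t 0 1) z = z + of_int t" "mob_j (mat2 1 t 0 1) z = 1"
  by (simp_all add: mobius_def mob_j_def)

lemma translate_in_Gamma0: "mat2 1 t 0 1 \<in> Gamma0 N"
  by (simp add: Gamma0_iff)

section \<open>Lower rows as cosets modulo translations\<close>

lemma mobius_same_lower_row:
  fixes A B :: "int^2^2"
  assumes A: "A \<in> Gamma0 1" and B: "B \<in> Gamma0 1"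
    and eq: "A $ 2 $ 1 = B $ 2 $ 1" "A $ 2 $ 2 = B $ 2 $ 2" and z: "Im z > 0"
  obtains t where "mobius B z = mobius A z + of_int t" "mob_j B z = mob_j A z"
proof -
  \<comment> \<open>The upper right entry of B times the inverse of A; that product is a translation
    because the lower rows agree.\<close>
  define t where "t = A $ 1 $ 1 * B $ 1 $ 2 - B $ 1 $ 1 * A $ 1 $ 2"
  have dA: "A $ 1 $ 1 * A $ 2 $ 2 = 1 + A $ 1 $ 2 * A $ 2 $ 1" using A by (simp add: Gamma0_iff)
  have dB: "B $ 1 $ 1 * A $ 2 $ 2 = 1 + B $ 1 $ 2 * A $ 2 $ 1" using B eq by (simp add: Gamma0_iff)
  have "t * A $ 2 $ 1 = A $ 1 $ 1 * (B $ 1 $ 2 * A $ 2 $ 1) - B $ 1 $ 1 * (A $ 1 $ 2 * A $ 2 $ 1)"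
    by (simp add: t_def algebra_simps)
  also have "B $ 1 $ 2 * A $ 2 $ 1 = B $ 1 $ 1 * A $ 2 $ 2 - 1" using dB by simp
  also have "A $ 1 $ 2 * A $ 2 $ 1 = A $ 1 $ 1 * A $ 2 $ 2 - 1" using dA by simp
  finally have t1: "t * A $ 2 $ 1 = B $ 1 $ 1 - A $ 1 $ 1" by (simp add: algebra_simps)
  have "t * A $ 2 $ 2 = (A $ 1 $ 1 * A $ 2 $ 2) * B $ 1 $ 2 - (B $ 1 $ 1 * A $ 2 $ 2) * A $ 1 $ 2"
    by (simp add: t_def algebra_simps)
  also have "\<dots> = B $ 1 $ 2 - A $ 1 $ 2" unfolding dA dB by (simp add: algebra_simps)
  finally have t2: "t * A $ 2 $ 2 = B $ 1 $ 2 - A $ 1 $ 2" .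
  have B1: "B $ 1 $ 1 = A $ 1 $ 1 + t * A $ 2 $ 1" "B $ 1 $ 2 = A $ 1 $ 2 + t * A $ 2 $ 2" using t1 t2 by simp_all
  have j: "mob_j B z = mob_j A z" by (simp add: mob_j_def eq)
  have "mobius B z = (of_int (A $ 1 $ 1) * z + of_int (A $ 1 $ 2) + of_int t * mob_j A z) / mob_j A z"
    unfolding mobius_altdef j B1 by (simp add: mob_j_def algebra_simps)
  also have "\<dots> = mobius A z + of_int t"
    using mob_j_nonzero[OF A z] by (simp add: mobius_altdef add_divide_distrib)
  finally show ?thesis using that j by blast
qed

definition coprime_pairs :: "(int \<times> int) set" where
  "coprime_pairs = {(c, d). coprime c d}"

text \<open>The choice is harmless: two lifts of the same row differ by an integer translation on
  the left, which \<open>ec\<close> does not see.\<close>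

definition gamma_lift :: "int \<Rightarrow> int \<Rightarrow> int^2^2" where
  "gamma_lift c d = (SOME A. A \<in> Gamma0 1 \<and> A $ 2 $ 1 = c \<and> A $ 2 $ 2 = d)"

lemma gamma_lift:
  assumes "coprime c d"
  shows "gamma_lift c d \<in> Gamma0 1" "gamma_lift c d $ 2 $ 1 = c" "gamma_lift c d $ 2 $ 2 = d"
proof -
  obtain x y where "x * c + y * d = 1" using bezout_int[of c d] assms by (auto simp: coprime_iff_gcd_eq_1)
  hence "mat2 y (- x) c d \<in> Gamma0 1 \<and> mat2 y (- x) c d $ 2 $ 1 = c \<and> mat2 y (- x) c d $ 2 $ 2 = d"
    by (simp add: Gamma0_iff algebra_simps)
  hence "gamma_lift c d \<in> Gamma0 1 \<and> gamma_lift c d $ 2 $ 1 = c \<and> gamma_lift c d $ 2 $ 2 = d"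
    unfolding gamma_lift_def by (rule someI)
  thus "gamma_lift c d \<in> Gamma0 1" "gamma_lift c d $ 2 $ 1 = c" "gamma_lift c d $ 2 $ 2 = d" by auto
qed

lemma coprime_lower_row:
  fixes A :: "int^2^2"
  assumes "A \<in> Gamma0 N"
  shows "coprime ((A $ 2) $ 1) ((A $ 2) $ 2)"
proof (rule coprimeI)
  fix e assume e: "e dvd A $ 2 $ 1" "e dvd A $ 2 $ 2"
  hence "e dvd A $ 1 $ 1 * A $ 2 $ 2 - A $ 1 $ 2 * A $ 2 $ 1" by (intro dvd_diff dvd_mult)
  thus "is_unit e" using assms by (simp add: Gamma0_iff)
qed

definition poincare_term :: "nat \<Rightarrow> int \<times> int \<Rightarrow> complex \<Rightarrow> complex" where
  "poincare_term k x z = ec (mobius (gamma_lift (fst x) (snd x)) z) / mob_j (gamma_lift (fst x) (snd x)) z ^ k"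

lemma poincare_term_eq:
  fixes A :: "int^2^2"
  assumes "A \<in> Gamma0 1" "Im z > 0"
  shows "poincare_term k (A $ 2 $ 1, A $ 2 $ 2) z = ec (mobius A z) / mob_j A z ^ k"
proof -
  note L = gamma_lift[OF coprime_lower_row[OF assms(1)]]
  obtain t where "mobius (gamma_lift (A $ 2 $ 1) (A $ 2 $ 2)) z = mobius A z + of_int t"
     "mob_j (gamma_lift (A $ 2 $ 1) (A $ 2 $ 2)) z = mob_j A z"
    by (rule mobius_same_lower_row[OF assms(1) L(1) _ _ assms(2)]) (use L in auto)
  thus ?thesis by (simp add: poincare_term_def ec_add)
qed

text \<open>A row vector times a matrix, the right action of the modular group on the cosets that
  index the Poincare series.\<close>

definition row_mult :: "int^2^2 \<Rightarrow> int \<times> int \<Rightarrow> int \<times> int" where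
  "row_mult A x = (fst x * A $ 1 $ 1 + snd x * A $ 2 $ 1, fst x * A $ 1 $ 2 + snd x * A $ 2 $ 2)"

lemma poincare_term_slash:
  assumes A: "A \<in> Gamma0 1" and x: "x \<in> coprime_pairs" and z: "Im z > 0"
  shows "poincare_term k x (mobius A z) / mob_j A z ^ k = poincare_term k (row_mult A x) z"
proof -
  define L where "L = gamma_lift (fst x) (snd x)"
  have L: "L \<in> Gamma0 1" "L $ 2 $ 1 = fst x" "L $ 2 $ 2 = snd x"
    using gamma_lift[of "fst x" "snd x"] x by (auto simp: L_def coprime_pairs_def)
  have "row_mult A x = ((L ** A) $ 2 $ 1, (L ** A) $ 2 $ 2)"
    by (simp add: row_mult_def matrix_mult_2_nth L)
  hence "poincare_term k (row_mult A x) z = ec (mobius (L ** A) z) / mob_j (L ** A) z ^ k"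
    using poincare_term_eq[OF Gamma0_mult[OF L(1) A] z] by simp
  also have "\<dots> = poincare_term k x (mobius A z) / mob_j A z ^ k"
    unfolding mobius_mult[OF A z] mob_j_mult[OF A z] by (simp add: poincare_term_def L_def power_mult_distrib)
  finally show ?thesis by simp
qed

lemma row_mult_coprime:
  assumes A: "A \<in> Gamma0 1" and x: "x \<in> coprime_pairs"
  shows "row_mult A x \<in> coprime_pairs"
proof -
  define L where "L = gamma_lift (fst x) (snd x)"
  have L: "L \<in> Gamma0 1" "L $ 2 $ 1 = fst x" "L $ 2 $ 2 = snd x"
    using gamma_lift[of "fst x" "snd x"] x by (auto simp: L_def coprime_pairs_def)
  have "row_mult A x = ((L ** A) $ 2 $ 1, (L ** A) $ 2 $ 2)"
    by (simp add: row_mult_def matrix_mult_2_nth L)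
  thus ?thesis using coprime_lower_row[OF Gamma0_mult[OF L(1) A]] by (simp add: coprime_pairs_def)
qed

lemma row_mult_row_mult: "row_mult B (row_mult A x) = row_mult (A ** B) x"
  by (simp add: row_mult_def matrix_mult_2_nth algebra_simps)

lemma row_mult_mat_1: "row_mult (mat 1) x = x"
  by (simp add: row_mult_def mat_def)

lemma bij_betw_row_mult:
  assumes A: "A \<in> Gamma0 1"
  shows "bij_betw (row_mult A) coprime_pairs coprime_pairs"
  by (rule bij_betw_byWitness[where f' = "row_mult (gamma_inv A)"])
     (use row_mult_coprime A gamma_inv_in_Gamma0[OF A] gamma_inv_mult[OF A] in
       \<open>auto simp: row_mult_row_mult row_mult_mat_1\<close>)

text \<open>Rows (c, d) and (-c, -d) give equal terms when k is even, hence the factor 1/2. The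
  value 0 below the real axis follows the convention of \<open>cusp_forms\<close>.\<close>

definition poincare :: "nat \<Rightarrow> complex \<Rightarrow> complex" where
  "poincare k z = (if Im z > 0 then (\<Sum>\<^sub>\<infinity>x\<in>coprime_pairs. poincare_term k x z) / 2 else 0)"

text \<open>By the cocycle relation, slashing by A only permutes the coprime rows.\<close>

lemma poincare_slash:
  assumes A: "A \<in> Gamma0 1" and z: "Im z > 0"
  shows "slash k (poincare k) A z = poincare k z"
proof -
  have "slash k (poincare k) A z = (\<Sum>\<^sub>\<infinity>x\<in>coprime_pairs. poincare_term k x (mobius A z)) * (1 / mob_j A z ^ k) / 2"
    using Im_mobius_pos[OF A z] by (simp add: slash_altdef poincare_def)
  also have "\<dots> = (\<Sum>\<^sub>\<infinity>x\<in>coprime_pairs. poincare_term k x (mobius A z) * (1 / mob_j A z ^ k)) / 2"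
    by (subst infsum_cmult_left') simp
  also have "(\<Sum>\<^sub>\<infinity>x\<in>coprime_pairs. poincare_term k x (mobius A z) * (1 / mob_j A z ^ k)) =
      (\<Sum>\<^sub>\<infinity>x\<in>coprime_pairs. poincare_term k (row_mult A x) z)"
    using poincare_term_slash[OF A _ z] by (intro infsum_cong) simp
  also have "\<dots> = (\<Sum>\<^sub>\<infinity>x\<in>coprime_pairs. poincare_term k x z)"
    by (rule infsum_reindex_bij_betw[OF bij_betw_row_mult[OF A]])
  finally show ?thesis using z unfolding poincare_def by (simp only: if_True)
qed

text \<open>The lower bound is a product in c and d so that lattice sums factor into two sums over
  the integers. Its constant comes from max |c| |d| \<le> K |c z + d|: the imaginary part controls
  c, the triangle inequality then controls d.\<close>

lemma norm_linear_form_ge: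
  assumes "Im z > 0"
  obtains \<kappa> :: real where "\<kappa> > 0" "\<And>c d. \<kappa> * (1 + \<bar>of_int c\<bar>) * (1 + \<bar>of_int d\<bar>) \<le> (norm (of_int c * z + of_int d))\<^sup>2 \<or> c = 0 \<and> d = 0"
proof
  define K where "K = max (1 / Im z) (1 + norm z / Im z)"
  have K: "K > 0" using assms unfolding K_def by (simp add: less_max_iff_disj)
  show "1 / (4 * K\<^sup>2) > 0" using K by simp
  fix c d :: int
  define m where "m = max \<bar>real_of_int c\<bar> \<bar>real_of_int d\<bar>"
  define w where "w = norm (of_int c * z + of_int d)"
  have "\<bar>Im (of_int c * z + of_int d)\<bar> \<le> w" unfolding w_def by (rule abs_Im_le_cmod)
  hence 1: "\<bar>of_int c\<bar> * Im z \<le> w" using assms by (simp add: abs_mult)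
  hence cb: "\<bar>of_int c\<bar> \<le> w / Im z" using assms by (simp add: field_simps)
  have w0: "w \<ge> 0" by (simp add: w_def)
  have "\<bar>real_of_int c\<bar> \<le> K * w"
    using cb mult_right_mono[of "1 / Im z" K w] w0 by (simp add: K_def)
  moreover have "\<bar>real_of_int d\<bar> \<le> K * w"
  proof -
    have "\<bar>real_of_int d\<bar> = norm ((of_int c * z + of_int d) - of_int c * z)" by simp
    also have "\<dots> \<le> w + \<bar>of_int c\<bar> * norm z"
      unfolding w_def by (rule order_trans[OF norm_triangle_ineq4]) (simp add: norm_mult)
    also have "\<dots> \<le> w + (w / Im z) * norm z" by (intro add_left_mono mult_right_mono cb) auto
    also have "\<dots> = (1 + norm z / Im z) * w" by (simp add: algebra_simps)
    also have "\<dots> \<le> K * w" using w0 by (intro mult_right_mono) (auto simp: K_def)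
    finally show ?thesis .
  qed
  ultimately have m: "m \<le> K * w" by (simp add: m_def)
  show "1 / (4 * K\<^sup>2) * (1 + \<bar>of_int c\<bar>) * (1 + \<bar>of_int d\<bar>) \<le> (norm (of_int c * z + of_int d))\<^sup>2 \<or> c = 0 \<and> d = 0"
  proof (cases "c = 0 \<and> d = 0")
    case False
    hence "\<bar>c\<bar> \<ge> 1 \<or> \<bar>d\<bar> \<ge> 1" by linarith
    hence "\<bar>real_of_int c\<bar> \<ge> 1 \<or> \<bar>real_of_int d\<bar> \<ge> 1" by linarith
    hence m1: "m \<ge> 1" by (auto simp: m_def)
    have "(1 + \<bar>of_int c\<bar>) * (1 + \<bar>of_int d\<bar>) \<le> (2 * m) * (2 * m)"
      using m1 by (intro mult_mono) (auto simp: m_def)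
    also have "\<dots> \<le> (2 * (K * w)) * (2 * (K * w))"
      using m m1 by (intro mult_mono) auto
    finally have "(1 + \<bar>of_int c\<bar>) * (1 + \<bar>of_int d\<bar>) \<le> 4 * K\<^sup>2 * w\<^sup>2"
      by (simp add: power2_eq_square mult_ac)
    hence "1 / (4 * K\<^sup>2) * ((1 + \<bar>of_int c\<bar>) * (1 + \<bar>of_int d\<bar>)) \<le> 1 / (4 * K\<^sup>2) * (4 * K\<^sup>2 * w\<^sup>2)"
      by (intro mult_left_mono) auto
    also have "\<dots> = w\<^sup>2" using K by simp
    finally show ?thesis by (simp add: w_def mult_ac)
  qed auto
qed

section \<open>Poincare series\<close>

text \<open>Fubini for a family dominated by a product of two summable sequences. Both iterated sums
  are obtained with the same value.\<close>

lemma has_sum_exchange: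
  fixes f :: "'a \<Rightarrow> 'b \<Rightarrow> 'c :: banach"
  assumes ab: "\<And>x y. x \<in> A \<Longrightarrow> y \<in> B \<Longrightarrow> norm (f x y) \<le> a x * b y"
    and a: "a summable_on A" "\<And>x. x \<in> A \<Longrightarrow> a x \<ge> (0::real)" and b: "b summable_on B" "\<And>y. y \<in> B \<Longrightarrow> b y \<ge> (0::real)"
    and g: "\<And>x. x \<in> A \<Longrightarrow> (f x has_sum g x) B" and h: "\<And>y. y \<in> B \<Longrightarrow> ((\<lambda>x. f x y) has_sum h y) A"
  obtains S where "(g has_sum S) A" "(h has_sum S) B"
proof -
  obtain Sb where Sb: "(b has_sum Sb) B" using b(1) by (auto simp: summable_on_def)
  have "(\<lambda>(x, y). a x * b y) summable_on (A \<times> B)"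
  proof (rule summable_on_SigmaI)
    show "((\<lambda>y. case (x, y) of (x, y) \<Rightarrow> a x * b y) has_sum a x * Sb) B" if "x \<in> A" for x
      using has_sum_cmult_right[OF Sb] by simp
    show "(\<lambda>x. a x * Sb) summable_on A" by (intro summable_on_cmult_left a)
  qed (use a b in auto)
  hence "(\<lambda>z. norm (case z of (x, y) \<Rightarrow> f x y)) summable_on (A \<times> B)"
    by (rule Infinite_Sum.abs_summable_on_comparison_test') (use ab in auto)
  hence "(\<lambda>(x, y). f x y) summable_on (A \<times> B)" by (rule abs_summable_summable)
  then obtain S where S: "((\<lambda>(x, y). f x y) has_sum S) (A \<times> B)" by (auto simp: summable_on_def)
  have "(g has_sum S) A" by (rule has_sum_SigmaD[OF S]) (use g in auto)
  moreover have "(h has_sum S) B"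
    using S by (subst (asm) has_sum_swap) (rule has_sum_SigmaD, assumption, use h in auto)
  ultimately show ?thesis using that by blast
qed

text \<open>Writing A s as (\<delta> s)(A / \<delta>) and giving one factorial to each factor bounds
  the growth in s by an exponential of arbitrarily small rate \<delta>. Any decay of q^n is then
  enough for convergence.\<close>

lemma norm_bes_le:
  assumes "A \<ge> 0" "s \<ge> 0" "\<delta> > 0"
  shows "(A * s) ^ j / (fact j * fact (r + j)) \<le> exp (\<delta> * s) * ((A / \<delta>) ^ j / fact j)"
    and "\<bar>bes r (A * s)\<bar> \<le> exp (\<delta> * s) * exp (A / \<delta>)"
proof -
  have *: "(A * s) ^ j / (fact j * fact (r + j)) \<le> exp (\<delta> * s) * ((A / \<delta>) ^ j / fact j)" for j
  proof -
    have "(\<delta> * s) ^ j / fact (r + j) \<le> (\<delta> * s) ^ j / fact j"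
      using assms by (intro divide_left_mono fact_mono) auto
    also have "\<dots> \<le> exp (\<delta> * s)"
    proof -
      have "sum (\<lambda>i. (\<delta> * s) ^ i / fact i) {j} \<le> (\<Sum>i. (\<delta> * s) ^ i / fact i)"
        using assms summable_exp[of "\<delta> * s"] by (intro sum_le_suminf) (auto simp: field_simps)
      thus ?thesis by (simp add: exp_def field_simps)
    qed
    finally have "(\<delta> * s) ^ j / fact (r + j) * ((A / \<delta>) ^ j / fact j) \<le> exp (\<delta> * s) * ((A / \<delta>) ^ j / fact j)"
      using assms by (intro mult_right_mono) auto
    moreover have "(\<delta> * s) ^ j * (A / \<delta>) ^ j = (A * s) ^ j"
    proof -
      have "\<delta> * s * (A / \<delta>) = A * s" using assms by simp
      thus ?thesis by (simp only: power_mult_distrib [symmetric])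
    qed
    ultimately show ?thesis by (simp add: mult_ac)
  qed
  show "(A * s) ^ j / (fact j * fact (r + j)) \<le> exp (\<delta> * s) * ((A / \<delta>) ^ j / fact j)" by (rule *)
  have e: "(\<lambda>j. exp (\<delta> * s) * ((A / \<delta>) ^ j / fact j)) sums (exp (\<delta> * s) * exp (A / \<delta>))"
    using exp_converges[of "A / \<delta>"] by (intro sums_mult) (simp add: field_simps)
  have "norm (bes r (A * s)) \<le> (\<Sum>j. exp (\<delta> * s) * ((A / \<delta>) ^ j / fact j))"
    unfolding bes_def
  proof (rule norm_suminf_le)
    show "norm ((- 1) ^ j / (fact j * fact (r + j)) * (A * s) ^ j) \<le> exp (\<delta> * s) * ((A / \<delta>) ^ j / fact j)" for j
      using *[of j] assms by (simp add: abs_mult power_abs)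
  qed (use e in \<open>simp add: sums_iff\<close>)
  thus "\<bar>bes r (A * s)\<bar> \<le> exp (\<delta> * s) * exp (A / \<delta>)" using e by (simp add: sums_iff)
qed

text \<open>With m = n + 1 and C = c^2 this is 2 \<pi> (-i)^(r + 1) c^r m^(r/2) J_r(4 \<pi> sqrt m /
  c), written so that no roots occur. The index n belongs to the power q^(n + 1).\<close>

definition bes_coeff :: "real \<Rightarrow> nat \<Rightarrow> nat \<Rightarrow> complex" where
  "bes_coeff C r n = (- 2 * of_real pi * \<i>) ^ Suc r * of_nat (Suc n) ^ r * of_real (bes r (4 * pi\<^sup>2 / C * real (Suc n)))"

lemma norm_bes_coeff_le:
  assumes "\<delta> > 0" "C \<ge> 1"
  shows "norm (bes_coeff C r n) \<le> (2 * pi) ^ Suc r * exp (4 * pi\<^sup>2 / \<delta>) * real (Suc n) ^ r * exp (\<delta> * real (Suc n))"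
proof -
  have "\<bar>bes r (4 * pi\<^sup>2 / C * real (Suc n))\<bar> \<le> exp (\<delta> * real (Suc n)) * exp (4 * pi\<^sup>2 / C / \<delta>)"
    using assms by (intro norm_bes_le) auto
  also have "\<dots> \<le> exp (\<delta> * real (Suc n)) * exp (4 * pi\<^sup>2 / \<delta>)"
  proof -
    have "4 * pi\<^sup>2 / C \<le> 4 * pi\<^sup>2 / 1" using assms(2) by (intro divide_left_mono) auto
    hence "4 * pi\<^sup>2 / C / \<delta> \<le> 4 * pi\<^sup>2 / \<delta>" using assms(1) by (intro divide_right_mono) auto
    thus ?thesis by simp
  qed
  finally have "(2 * pi) ^ Suc r * real (Suc n) ^ r * \<bar>bes r (4 * pi\<^sup>2 / C * real (Suc n))\<bar> \<le>
    (2 * pi) ^ Suc r * real (Suc n) ^ r * (exp (\<delta> * real (Suc n)) * exp (4 * pi\<^sup>2 / \<delta>))"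
    by (intro mult_left_mono) auto
  thus ?thesis unfolding bes_coeff_def norm_mult norm_power norm_of_nat norm_of_real by (simp add: mult_ac)
qed

lemma ec_exp_decay_summable:
  assumes "(t::real) > 0"
  shows "(\<lambda>n. real (Suc n) ^ r * exp (- t * real (Suc n))) summable_on UNIV"
proof -
  have "norm (complex_of_real (exp (- t))) < 1" using assms by simp
  from summable_poly_power[OF this, of r]
  have "summable (\<lambda>n. real (Suc n) ^ r * exp (- t) ^ Suc n)"
    by (simp only: norm_mult norm_power norm_of_nat norm_of_real abs_exp_cancel)
  hence "summable (\<lambda>n. real (Suc n) ^ r * exp (- t * real (Suc n)))"
    by (simp only: exp_of_nat_mult[symmetric] mult.commute)
  thus ?thesis by (intro norm_summable_imp_summable_on) (simp add: abs_mult)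
qed

text \<open>Expanding the exponential and applying the Lipschitz summation formula termwise.\<close>

lemma translates_Fourier_expansion:
  assumes w: "Im w > 0" and C: "C > 0" and r: "r \<ge> 1"
  obtains S where "((\<lambda>m::int. ec (- 1 / (of_real C * (w + of_int m))) / (w + of_int m) ^ Suc r) has_sum S) UNIV"
    "((\<lambda>n. bes_coeff C r n * ec w ^ Suc n) has_sum S) UNIV"
proof -
  define y where "y = Im w"
  have y: "y > 0" using w by (simp add: y_def)
  define K where "K = - 2 * of_real pi * \<i> / (of_real C :: complex)"
  have nK: "norm K = 2 * pi / C" using C by (simp add: K_def norm_mult norm_divide)
  define f where "f = (\<lambda>(m::int) j. K ^ j / fact j / (w + of_int m) ^ (Suc r + j))"
  define h where "h = (\<lambda>j. K ^ j / fact j * ((- 2 * of_real pi * \<i>) ^ Suc (r + j) / fact (r + j) * lip_series (r + j) w))"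
  have wm: "norm (w + of_int m) \<ge> y" for m using abs_Im_le_cmod[of "w + of_int m"] y by (simp add: y_def)
  have wm0: "w + of_int m \<noteq> 0" for m using wm[of m] y by auto
  \<comment> \<open>Exchange of the sum over translates m with the Taylor expansion of the
    exponential, indexed by j. Each inner sum over m is a Lipschitz sum.\<close>
  obtain S where S: "((\<lambda>m::int. ec (- 1 / (of_real C * (w + of_int m))) / (w + of_int m) ^ Suc r) has_sum S) UNIV" "(h has_sum S) UNIV"
  proof (rule has_sum_exchange)
    fix m :: int and j :: nat
    have "norm (f m j) = (2 * pi / C) ^ j / fact j / norm (w + of_int m) ^ j * (1 / norm (w + of_int m) ^ Suc r)"
      by (simp add: f_def norm_mult norm_divide norm_power nK power_add)
    also have "\<dots> \<le> (2 * pi / C) ^ j / fact j / y ^ j * (1 / norm (w + of_int m) ^ Suc r)"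
      using y wm[of m] C by (intro mult_right_mono divide_left_mono power_mono mult_pos_pos) (auto intro: zero_less_power order.strict_trans2)
    finally show "norm (f m j) \<le> (1 / norm (w + of_int m) ^ Suc r) * ((2 * pi / (C * y)) ^ j / fact j)"
      by (simp add: power_divide power_mult_distrib mult_ac)
  next
    show "(\<lambda>m::int. 1 / norm (w + of_int m) ^ Suc r) summable_on UNIV"
      using r by (intro summable_on_inverse_add_of_int_power w) auto
    show "(\<lambda>j. (2 * pi / (C * y)) ^ j / fact j) summable_on UNIV"
      using summable_exp[of "2 * pi / (C * y)"] C y
      by (intro norm_summable_imp_summable_on) (simp add: field_simps power_divide)
    show "(f m has_sum ec (- 1 / (of_real C * (w + of_int m))) / (w + of_int m) ^ Suc r) UNIV" for m
    proof -
      have "((\<lambda>j. (K / (w + of_int m)) ^ j /\<^sub>R fact j) has_sum exp (K / (w + of_int m))) UNIV"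
        by (intro norm_summable_imp_has_sum exp_converges) (use summable_norm_exp in blast)
      from has_sum_cmult_left[OF this, of "1 / (w + of_int m) ^ Suc r"]
      have "((\<lambda>j. (K / (w + of_int m)) ^ j /\<^sub>R fact j * (1 / (w + of_int m) ^ Suc r)) has_sum exp (K / (w + of_int m)) / (w + of_int m) ^ Suc r) UNIV"
        by simp
      moreover have "(K / (w + of_int m)) ^ j /\<^sub>R fact j * (1 / (w + of_int m) ^ Suc r) = f m j" for j
        by (simp add: f_def scaleR_conv_of_real power_divide power_add divide_simps)
      moreover have "exp (K / (w + of_int m)) = ec (- 1 / (of_real C * (w + of_int m)))"
        by (simp add: ec_def K_def mult_ac)
      ultimately show ?thesis by simp
    qed
    show "((\<lambda>m. f m j) has_sum h j) UNIV" for j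
    proof -
      have "((\<lambda>m::int. K ^ j / fact j * (1 / (w + of_int m) ^ Suc (r + j))) has_sum h j) UNIV"
        unfolding h_def using r by (intro has_sum_cmult_right Lipschitz_summation w) auto
      thus ?thesis by (simp add: f_def)
    qed
  qed (use C y in auto)
  define g where "g = (\<lambda>n j. K ^ j / fact j * ((- 2 * of_real pi * \<i>) ^ Suc (r + j) / fact (r + j) * (of_nat (Suc n) ^ (r + j) * ec w ^ Suc n)))"
  have geq: "g n j = (- 2 * of_real pi * \<i>) ^ Suc r * of_nat (Suc n) ^ r * ec w ^ Suc n *
      of_real ((-1) ^ j / (fact j * fact (r + j)) * (4 * pi\<^sup>2 / C * real (Suc n)) ^ j)" for n j
  proof -
    have "K ^ j * (- 2 * of_real pi * \<i>) ^ j = (of_real (- (4 * pi\<^sup>2 / C)) :: complex) ^ j"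
    proof -
      have "K * (- 2 * of_real pi * \<i>) = (of_real (- (4 * pi\<^sup>2 / C)) :: complex)"
        using C by (simp add: K_def complex_eq_iff power2_eq_square)
      thus ?thesis by (simp only: power_mult_distrib [symmetric])
    qed
    also have "\<dots> = of_real ((-1) ^ j * (4 * pi\<^sup>2 / C) ^ j)"
      by (simp add: power_minus[of "4 * (complex_of_real pi)\<^sup>2 / complex_of_real C"])
    finally have 1: "K ^ j * (- 2 * of_real pi * \<i>) ^ j = of_real ((-1) ^ j * (4 * pi\<^sup>2 / C) ^ j)" .
    define Z :: complex where "Z = - 2 * of_real pi * \<i>"
    have 2: "(of_real ((-1) ^ j / (fact j * fact (r + j)) * (4 * pi\<^sup>2 / C * real (Suc n)) ^ j) :: complex) =
        (K ^ j * Z ^ j) * (of_nat (Suc n) ^ j / (fact j * fact (r + j)))"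
      unfolding 1[folded Z_def] power_mult_distrib by simp
    show ?thesis unfolding 2 Z_def[symmetric] g_def by (simp add: power_add mult_ac del: of_nat_Suc)
  qed
  \<comment> \<open>Half of the decay rate 2 \<pi> y of q^n. One half cancels the growth of the
    Bessel factor, the other half makes the majorant summable.\<close>
  define t where "t = pi * y"
  have t: "t > 0" using y by (simp add: t_def)
  \<comment> \<open>The second exchange, of the frequency n with j; the inner sum over j is the
    Bessel series.\<close>
  obtain S' where S': "((\<lambda>n. bes_coeff C r n * ec w ^ Suc n) has_sum S') UNIV" "(h has_sum S') UNIV"
  proof (rule has_sum_exchange)
    fix n j :: nat
    have "norm (g n j) = (2 * pi) ^ Suc r * real (Suc n) ^ r * norm (ec w) ^ Suc n * ((4 * pi\<^sup>2 / C * real (Suc n)) ^ j / (fact j * fact (r + j)))"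
      unfolding geq norm_mult norm_power norm_of_nat norm_of_real using C by (simp add: abs_mult power_abs)
    also have "\<dots> \<le> (2 * pi) ^ Suc r * real (Suc n) ^ r * norm (ec w) ^ Suc n * (exp (t * real (Suc n)) * ((4 * pi\<^sup>2 / C / t) ^ j / fact j))"
      using C t by (intro mult_left_mono norm_bes_le(1)) auto
    also have "norm (ec w) ^ Suc n = exp (- t * real (Suc n)) * exp (- t * real (Suc n))"
      unfolding exp_add [symmetric] norm_ec exp_of_nat_mult [symmetric] by (simp add: t_def y_def algebra_simps)
    also have "(2 * pi) ^ Suc r * real (Suc n) ^ r * (exp (- t * real (Suc n)) * exp (- t * real (Suc n))) * (exp (t * real (Suc n)) * ((4 * pi\<^sup>2 / C / t) ^ j / fact j)) =
      ((2 * pi) ^ Suc r * (real (Suc n) ^ r * exp (- t * real (Suc n)))) * ((4 * pi\<^sup>2 / C / t) ^ j / fact j) * (exp (- t * real (Suc n)) * exp (t * real (Suc n)))"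
      by (simp only: mult_ac)
    also have "exp (- t * real (Suc n)) * exp (t * real (Suc n)) = 1"
      by (simp add: exp_add [symmetric])
    finally show "norm (g n j) \<le> ((2 * pi) ^ Suc r * (real (Suc n) ^ r * exp (- t * real (Suc n)))) * ((4 * pi\<^sup>2 / C / t) ^ j / fact j)"
      by simp
  next
    show "(\<lambda>n. (2 * pi) ^ Suc r * (real (Suc n) ^ r * exp (- t * real (Suc n)))) summable_on UNIV"
      by (intro summable_on_cmult_right ec_exp_decay_summable t)
    show "(\<lambda>j. (4 * pi\<^sup>2 / C / t) ^ j / fact j) summable_on UNIV"
      using summable_exp[of "4 * pi\<^sup>2 / C / t"] C t
      by (intro norm_summable_imp_summable_on) (simp add: field_simps power_divide)
    show "(g n has_sum bes_coeff C r n * ec w ^ Suc n) UNIV" for n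
    proof -
      define A where "A = (- 2 * of_real pi * \<i>) ^ Suc r * of_nat (Suc n) ^ r * ec w ^ Suc n"
      have "((\<lambda>j. (-1) ^ j / (fact j * fact (r + j)) * (4 * pi\<^sup>2 / C * real (Suc n)) ^ j) has_sum bes r (4 * pi\<^sup>2 / C * real (Suc n))) UNIV"
        by (intro norm_summable_imp_has_sum bes_sums summable_bes)
      hence "((\<lambda>j. complex_of_real ((-1) ^ j / (fact j * fact (r + j)) * (4 * pi\<^sup>2 / C * real (Suc n)) ^ j)) has_sum of_real (bes r (4 * pi\<^sup>2 / C * real (Suc n)))) UNIV"
        by (rule has_sum_of_real)
      from has_sum_cmult_right[OF this, of A] show ?thesis
        unfolding geq[abs_def] A_def bes_coeff_def by (simp only: mult_ac)
    qed
    show "((\<lambda>n. g n j) has_sum h j) UNIV" for j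
      unfolding g_def h_def
      by (intro has_sum_cmult_right norm_summable_imp_has_sum lip_series_sums w summable_poly_power norm_ec_less_1)
  qed (use C t in auto)
  have "S = S'" using S(2) S'(2) has_sum_unique by blast
  with S S' that show ?thesis by blast
qed

section \<open>Fourier expansion by residue classes and Kloosterman sums\<close>

lemma poincare_term_translate:
  assumes "coprime c d" "Im z > 0"
  shows "poincare_term k (c, d + c * m) z = poincare_term k (c, d) (z + of_int m)"
proof -
  have "(c, d) \<in> coprime_pairs" using assms by (simp add: coprime_pairs_def)
  from poincare_term_slash[OF translate_in_Gamma0 this assms(2), of k m] show ?thesis
    by (simp add: mobius_translate row_mult_def algebra_simps)
qed

lemma poincare_term_uminus:
  assumes "coprime c d" "Im z > 0" "even k"
  shows "poincare_term k (- c, - d) z = poincare_term k (c, d) z"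
proof -
  have A: "mat2 (-1) 0 0 (-1) \<in> Gamma0 1" by (simp add: Gamma0_iff)
  have "(c, d) \<in> coprime_pairs" using assms by (simp add: coprime_pairs_def)
  from poincare_term_slash[OF A this assms(2), of k] show ?thesis using assms(3)
    by (simp add: mobius_def mob_j_def row_mult_def)
qed

text \<open>The upper left entry of the lift is an inverse of d modulo c, so this is the first
  factor in a term of a Kloosterman sum.\<close>

definition cusp_phase :: "int \<Rightarrow> int \<Rightarrow> complex" where
  "cusp_phase c d = ec (of_int (gamma_lift c d $ 1 $ 1) / of_int c)"

lemma norm_cusp_phase [simp]: "norm (cusp_phase c d) = 1"
  by (simp add: cusp_phase_def norm_ec Im_divide)

text \<open>The identity A z = a/c - 1 / (c (c z + d)), with c z + d = c u, isolates the phase and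
  leaves a function of u to which the expansion over translates applies.\<close>

lemma poincare_term_eq_cusp_phase:
  assumes "coprime c d" "c > 0" "Im z > 0"
  defines "u \<equiv> z + of_int d / of_int c"
  shows "poincare_term k (c, d) z = cusp_phase c d / of_int c ^ k * (ec (- 1 / (of_real ((of_int c)\<^sup>2) * u)) / u ^ k)"
proof -
  define A where "A = gamma_lift c d"
  have A: "A \<in> Gamma0 1" "A $ 2 $ 1 = c" "A $ 2 $ 2 = d" using gamma_lift[OF assms(1)] by (auto simp: A_def)
  have det: "A $ 1 $ 1 * d - A $ 1 $ 2 * c = 1" using A by (simp add: Gamma0_iff)
  have det': "of_int (A $ 1 $ 1) * of_int d - of_int (A $ 1 $ 2) * of_int c = (1 :: complex)"
    using arg_cong[OF det, of "of_int :: int \<Rightarrow> complex"] by simp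
  have c0: "of_int c \<noteq> (0 :: complex)" using assms by simp
  have j: "mob_j A z = of_int c * u" using c0 by (simp add: mob_j_def A u_def ring_distribs)
  have j0: "mob_j A z \<noteq> 0" using mob_j_nonzero[OF A(1) assms(3)] .
  hence u0: "u \<noteq> 0" using j by auto
  have "mobius A z - of_int (A $ 1 $ 1) / of_int c = - 1 / (of_int c * mob_j A z)"
  proof -
    have "(of_int (A $ 1 $ 1) * z + of_int (A $ 1 $ 2)) * of_int c - of_int (A $ 1 $ 1) * mob_j A z = - 1"
      using det' by (simp add: mob_j_def A algebra_simps)
    thus ?thesis unfolding mobius_altdef using j0 c0 by (simp add: divide_simps)
  qed
  hence "mobius A z = of_int (A $ 1 $ 1) / of_int c + - 1 / (of_real ((of_int c)\<^sup>2) * u)"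
    unfolding j by (simp add: power2_eq_square mult_ac algebra_simps)
  hence "ec (mobius A z) = cusp_phase c d * ec (- 1 / (of_real ((of_int c)\<^sup>2) * u))"
    by (simp only: ec_add cusp_phase_def A_def)
  thus ?thesis unfolding poincare_term_def fst_conv snd_conv A_def[symmetric] j by (simp add: power_mult_distrib)
qed

lemma has_sum_finite_sum:
  fixes f :: "'a \<Rightarrow> 'b \<Rightarrow> 'c :: topological_comm_monoid_add"
  assumes "finite F" "\<And>x. x \<in> F \<Longrightarrow> (f x has_sum S x) A"
  shows "((\<lambda>y. \<Sum>x\<in>F. f x y) has_sum (\<Sum>x\<in>F. S x)) A"
  using assms by (induction F rule: finite_induct) (auto intro!: has_sum_add)

definition coprime_residues :: "int \<Rightarrow> int set" where
  "coprime_residues c = {d. 0 \<le> d \<and> d < c \<and> coprime c d}"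

lemma finite_coprime_residues [simp]: "finite (coprime_residues c)"
  by (rule finite_subset[of _ "{0..<c}"]) (auto simp: coprime_residues_def)

lemma card_coprime_residues_le: "c > 0 \<Longrightarrow> real (card (coprime_residues c)) \<le> of_int c"
proof -
  assume c: "c > 0"
  have "coprime_residues c \<subseteq> {0..<c}" by (auto simp: coprime_residues_def)
  hence "card (coprime_residues c) \<le> nat c" using card_mono[of "{0..<c}" "coprime_residues c"] by simp
  thus ?thesis using c by linarith
qed

lemma coprime_residues_1: "coprime_residues 1 = {0}"
  by (auto simp: coprime_residues_def)

text \<open>The classical sum S(1, n; c). The estimates below rely on its trivial bound by
  c.\<close>

definition kloosterman :: "int \<Rightarrow> nat \<Rightarrow> complex" where
  "kloosterman c n = (\<Sum>d\<in>coprime_residues c. cusp_phase c d * ec (of_int d / of_int c) ^ n)"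

lemma norm_kloosterman_le:
  assumes "c > 0"
  shows "norm (kloosterman c n) \<le> of_int c"
proof -
  have "norm (kloosterman c n) \<le> (\<Sum>d\<in>coprime_residues c. 1)"
    unfolding kloosterman_def
    by (rule sum_norm_le) (simp add: norm_mult norm_power norm_ec Im_divide)
  thus ?thesis using card_coprime_residues_le[OF assms] by simp
qed

lemma kloosterman_1: "kloosterman 1 n = 1"
  by (simp add: kloosterman_def coprime_residues_1 cusp_phase_def)

text \<open>The factor |c z + d|^(-k) is at most a constant times ((1 + |c|)(1 + |d|))^(-k/2).
  Weight at least 4 makes this exponent at most -2, and the majorant splits into two convergent
  sums.\<close>

lemma summable_poincare_term:
  assumes "Im z > 0" "k \<ge> 4"
  shows "(\<lambda>x. norm (poincare_term k x z)) summable_on coprime_pairs"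
proof -
  obtain \<kappa> :: real where kap: "\<kappa> > 0" "\<And>c d. \<kappa> * (1 + \<bar>of_int c\<bar>) * (1 + \<bar>of_int d\<bar>) \<le> (norm (of_int c * z + of_int d))\<^sup>2 \<or> c = 0 \<and> d = 0"
    using norm_linear_form_ge[OF assms(1)] by blast
  define g where "g = (\<lambda>m::int. 1 / (1 + \<bar>real_of_int m\<bar>)\<^sup>2)"
  have g: "g summable_on UNIV" unfolding g_def by (rule summable_on_int_inverse_square)
  have "(\<lambda>(c, d). g c * g d) summable_on (UNIV \<times> UNIV)"
  proof (rule summable_on_SigmaI)
    show "((\<lambda>d. case (c, d) of (c, d) \<Rightarrow> g c * g d) has_sum g c * infsum g UNIV) UNIV" for c
      using has_sum_cmult_right[OF has_sum_infsum[OF g]] by simp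
    show "(\<lambda>c. g c * infsum g UNIV) summable_on UNIV" by (intro summable_on_cmult_left g)
  qed (auto simp: g_def)
  hence "(\<lambda>x. g (fst x) * g (snd x)) summable_on UNIV" by (simp add: case_prod_unfold)
  hence "(\<lambda>x. g (fst x) * g (snd x)) summable_on coprime_pairs" by (rule summable_on_subset) auto
  hence s1: "(\<lambda>x. (\<kappa> powr (- real k / 2)) * (g (fst x) * g (snd x))) summable_on coprime_pairs"
    by (rule summable_on_cmult_right)
  show ?thesis
  proof (rule Infinite_Sum.abs_summable_on_comparison_test'[OF s1])
    fix x assume x: "x \<in> coprime_pairs"
    obtain c d where cd: "x = (c, d)" by (cases x)
    have cop: "coprime c d" using x cd by (simp add: coprime_pairs_def)
    note L = gamma_lift[OF cop]
    define w where "w = norm (of_int c * z + of_int d)"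
    have j: "norm (mob_j (gamma_lift c d) z) = w" by (simp add: mob_j_def L w_def)
    have w0: "w > 0" using mob_j_nonzero[OF L(1) assms(1)] j by auto
    define P where "P = (1 + \<bar>real_of_int c\<bar>) * (1 + \<bar>real_of_int d\<bar>)"
    have P1: "P \<ge> 1" unfolding P_def using mult_mono[of 1 "1 + \<bar>real_of_int c\<bar>" 1 "1 + \<bar>real_of_int d\<bar>"] by simp
    have "\<not> (c = 0 \<and> d = 0)" using cop by auto
    hence "\<kappa> * (1 + \<bar>of_int c\<bar>) * (1 + \<bar>of_int d\<bar>) \<le> (norm (of_int c * z + of_int d))\<^sup>2" using kap(2)[of c d] by blast
    hence wP: "\<kappa> * P \<le> w\<^sup>2" by (simp only: P_def w_def mult.assoc)
    have "norm (poincare_term k x z) \<le> 1 / w ^ k"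
      using norm_ec_le_1[of "mobius (gamma_lift c d) z"] Im_mobius_pos[OF L(1) assms(1)] w0
      by (simp add: poincare_term_def cd norm_divide norm_power j divide_right_mono less_imp_le)
    also have "1 / w ^ k = (w\<^sup>2) powr (- real k / 2)"
    proof -
      have "w\<^sup>2 = w powr 2" using w0 by (simp add: powr_numeral)
      hence "(w\<^sup>2) powr (- real k / 2) = w powr (2 * (- real k / 2))" by (simp only: powr_powr)
      also have "2 * (- real k / 2) = - real k" by simp
      also have "w powr (- real k) = 1 / w ^ k" using w0 by (simp add: powr_minus powr_realpow divide_inverse)
      finally show ?thesis by simp
    qed
    also have "\<dots> \<le> (\<kappa> * P) powr (- real k / 2)"
      using wP kap(1) P1 by (intro powr_mono2') auto
    also have "\<dots> = \<kappa> powr (- real k / 2) * P powr (- real k / 2)" using kap(1) P1 by (simp add: powr_mult)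
    also have "P powr (- real k / 2) \<le> P powr (- 2)"
      using P1 assms(2) by (intro powr_mono) auto
    also have "P powr (-2) = g c * g d"
      using P1 by (simp add: powr_minus P_def g_def powr_numeral divide_inverse power_mult_distrib)
    finally show "norm (poincare_term k x z) \<le> \<kappa> powr (- real k / 2) * (g (fst x) * g (snd x))"
      using kap(1) by (simp add: cd mult_left_mono)
  qed
qed

definition poincare_coeff_c :: "nat \<Rightarrow> int \<Rightarrow> nat \<Rightarrow> complex" where
  "poincare_coeff_c r c n = bes_coeff ((of_int c)\<^sup>2) r n * kloosterman c (Suc n) / of_int c ^ Suc r"

text \<open>The coefficient of q^(n + 1) in weight r + 1. The term 1 at n = 0 is the contribution of
  the rows (0, 1) and (0, -1).\<close>

definition poincare_coeff :: "nat \<Rightarrow> nat \<Rightarrow> complex" where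
  "poincare_coeff r n = (if n = 0 then 1 else 0) + (\<Sum>\<^sub>\<infinity>c\<in>{0<..}. poincare_coeff_c r c n)"

lemma norm_poincare_coeff_c_le:
  assumes "c > 0"
  shows "norm (poincare_coeff_c r c n) \<le> norm (bes_coeff ((of_int c)\<^sup>2) r n) / of_int c ^ r"
proof -
  have "norm (poincare_coeff_c r c n) = norm (bes_coeff ((of_int c)\<^sup>2) r n) * norm (kloosterman c (Suc n)) / of_int c ^ Suc r"
    using assms by (simp add: poincare_coeff_c_def norm_mult norm_divide norm_power del: power_Suc)
  also have "\<dots> \<le> norm (bes_coeff ((of_int c)\<^sup>2) r n) * of_int c / of_int c ^ Suc r"
    using assms by (intro divide_right_mono mult_left_mono norm_kloosterman_le) auto
  also have "\<dots> = norm (bes_coeff ((of_int c)\<^sup>2) r n) / of_int c ^ r" using assms by simp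
  finally show ?thesis .
qed

lemma summable_on_inverse_power_int:
  assumes "r \<ge> 2"
  shows "(\<lambda>c::int. 1 / real_of_int c ^ r) summable_on {0<..}"
proof (rule summable_on_comparison_test)
  show "(\<lambda>c::int. 4 * (1 / (1 + \<bar>real_of_int c\<bar>)\<^sup>2)) summable_on {0<..}"
    by (intro summable_on_cmult_right summable_on_subset[OF summable_on_int_inverse_square]) auto
  fix c :: int assume c: "c \<in> {0<..}"
  hence c1: "real_of_int c \<ge> 1" by simp
  have "(1 + \<bar>real_of_int c\<bar>)\<^sup>2 \<le> (2 * real_of_int c)\<^sup>2" using c1 by (intro power_mono) auto
  also have "\<dots> = 4 * (real_of_int c)\<^sup>2" by (simp add: power2_eq_square)
  also have "(real_of_int c)\<^sup>2 \<le> real_of_int c ^ r" using c1 assms by (intro power_increasing) auto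
  finally have "(1 + \<bar>real_of_int c\<bar>)\<^sup>2 \<le> 4 * real_of_int c ^ r" by simp
  thus "1 / real_of_int c ^ r \<le> 4 * (1 / (1 + \<bar>real_of_int c\<bar>)\<^sup>2)"
    using c1 by (simp add: divide_simps)
qed auto

lemma bij_betw_coprime_residues:
  assumes "c > 0"
  shows "bij_betw (\<lambda>(d, m). d + c * m) (coprime_residues c \<times> UNIV) {d. coprime c d}"
proof (rule bij_betwI[where g = "\<lambda>d. (d mod c, d div c)"])
  have *: "coprime c (d + c * m) \<longleftrightarrow> coprime c d" for d m
    by (metis coprime_iff_gcd_eq_1 gcd_add_mult mult.commute add.commute)
  show "(\<lambda>(d, m). d + c * m) \<in> coprime_residues c \<times> UNIV \<rightarrow> {d. coprime c d}"
    using * by (auto simp: coprime_residues_def)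
  show "(\<lambda>d. (d mod c, d div c)) \<in> {d. coprime c d} \<rightarrow> coprime_residues c \<times> UNIV"
    using assms *[of "_ mod c" "_ div c"] by (auto simp: coprime_residues_def)
qed (use assms in \<open>auto simp: coprime_residues_def\<close>)

text \<open>For fixed c, d is split into a residue and a multiple of c. Each residue class is a sum
  over translates with a known Fourier series, and adding the phases over the residues yields the
  Kloosterman sum.\<close>

lemma poincare_inner_sum:
  assumes c: "c > 0" and z: "Im z > 0" and r: "r \<ge> 3"
  obtains S where "((\<lambda>d. poincare_term (Suc r) (c, d) z) has_sum S) {d. coprime c d}"
    "((\<lambda>n. poincare_coeff_c r c n * ec z ^ Suc n) has_sum S) UNIV"
proof -
  define C where "C = (real_of_int c)\<^sup>2"
  have C: "C > 0" using c by (simp add: C_def)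
  have "\<exists>S. ((\<lambda>m::int. ec (- 1 / (of_real C * (z + of_int d / of_int c + of_int m))) / (z + of_int d / of_int c + of_int m) ^ Suc r) has_sum S) UNIV
     \<and> ((\<lambda>n. bes_coeff C r n * ec (z + of_int d / of_int c) ^ Suc n) has_sum S) UNIV" for d :: int
  proof -
    have i: "Im (z + of_int d / of_int c) > 0" using z by (simp add: Im_divide)
    have r1: "r \<ge> 1" using r by simp
    show ?thesis by (rule translates_Fourier_expansion[OF i C r1]) blast
  qed
  hence "\<forall>d::int. \<exists>S. ((\<lambda>m::int. ec (- 1 / (of_real C * (z + of_int d / of_int c + of_int m))) / (z + of_int d / of_int c + of_int m) ^ Suc r) has_sum S) UNIV
     \<and> ((\<lambda>n. bes_coeff C r n * ec (z + of_int d / of_int c) ^ Suc n) has_sum S) UNIV" by blast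
  from choice[OF this] obtain S where S: "\<And>d::int. ((\<lambda>m::int. ec (- 1 / (of_real C * (z + of_int d / of_int c + of_int m))) / (z + of_int d / of_int c + of_int m) ^ Suc r) has_sum S d) UNIV"
    "\<And>d::int. ((\<lambda>n. bes_coeff C r n * ec (z + of_int d / of_int c) ^ Suc n) has_sum S d) UNIV"
    by blast
  define S' where "S' = (\<Sum>d\<in>coprime_residues c. cusp_phase c d / of_int c ^ Suc r * S d)"
  have t: "((\<lambda>m. poincare_term (Suc r) (c, d + c * m) z) has_sum (cusp_phase c d / of_int c ^ Suc r * S d)) UNIV"
    if d: "d \<in> coprime_residues c" for d
  proof -
    have cop: "coprime c d" using d by (simp add: coprime_residues_def)
    have "poincare_term (Suc r) (c, d + c * m) z = cusp_phase c d / of_int c ^ Suc r *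
      (ec (- 1 / (of_real C * (z + of_int d / of_int c + of_int m))) / (z + of_int d / of_int c + of_int m) ^ Suc r)" for m
    proof -
      have "Im (z + of_int m) > 0" using z by simp
      from poincare_term_eq_cusp_phase[OF cop c this, of "Suc r"] show ?thesis
        unfolding poincare_term_translate[OF cop z] C_def by (simp only: add_ac)
    qed
    thus ?thesis using has_sum_cmult_right[OF S(1)[of d], of "cusp_phase c d / of_int c ^ Suc r"] by simp
  qed
  have "(\<lambda>x. norm (poincare_term (Suc r) x z)) summable_on ((\<lambda>d. (c, d)) ` {d. coprime c d})"
    by (rule summable_on_subset[OF summable_poincare_term[OF z, of "Suc r"]]) (use r in \<open>auto simp: coprime_pairs_def\<close>)
  hence "(\<lambda>x. poincare_term (Suc r) x z) summable_on ((\<lambda>d. (c, d)) ` {d. coprime c d})"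
    by (rule abs_summable_summable)
  hence "(\<lambda>d. poincare_term (Suc r) (c, d) z) summable_on {d. coprime c d}"
    by (subst (asm) summable_on_reindex) (auto simp: inj_on_def o_def)
  then obtain T where T: "((\<lambda>d. poincare_term (Suc r) (c, d) z) has_sum T) {d. coprime c d}"
    by (auto simp: summable_on_def)
  hence "((\<lambda>x. poincare_term (Suc r) (c, (case x of (d, m) \<Rightarrow> d + c * m)) z) has_sum T) (coprime_residues c \<times> UNIV)"
    by (subst has_sum_reindex_bij_betw[OF bij_betw_coprime_residues[OF c]])
  hence "((\<lambda>d. cusp_phase c d / of_int c ^ Suc r * S d) has_sum T) (coprime_residues c)"
    by (rule has_sum_SigmaD) (use t in simp)
  hence "T = S'" unfolding S'_def by (simp add: has_sum_finite_iff)
  moreover have "((\<lambda>n. poincare_coeff_c r c n * ec z ^ Suc n) has_sum S') UNIV"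
  proof -
    have "((\<lambda>n. \<Sum>d\<in>coprime_residues c. cusp_phase c d / of_int c ^ Suc r * (bes_coeff C r n * ec (z + of_int d / of_int c) ^ Suc n)) has_sum S') UNIV"
      unfolding S'_def by (intro has_sum_finite_sum has_sum_cmult_right S(2)) auto
    moreover have "(\<Sum>d\<in>coprime_residues c. cusp_phase c d / of_int c ^ Suc r * (bes_coeff C r n * ec (z + of_int d / of_int c) ^ Suc n)) =
       poincare_coeff_c r c n * ec z ^ Suc n" for n
    proof -
      have "cusp_phase c d / of_int c ^ Suc r * (bes_coeff C r n * ec (z + of_int d / of_int c) ^ Suc n) =
        (bes_coeff C r n / of_int c ^ Suc r * ec z ^ Suc n) * (cusp_phase c d * ec (of_int d / of_int c) ^ Suc n)" for d
        unfolding ec_add power_mult_distrib by (simp only: times_divide_eq_left times_divide_eq_right mult_ac)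
      thus ?thesis by (simp only: sum_distrib_left [symmetric]) (simp add: poincare_coeff_c_def C_def kloosterman_def mult_ac)
    qed
    ultimately show ?thesis by simp
  qed
  ultimately show ?thesis using T that by blast
qed

text \<open>The bound factors into a part in c and a part in n, as the exchange of the two sums
  requires. One power of c is lost to the trivial Kloosterman bound.\<close>

lemma poincare_coeff_c_bound:
  assumes "c > 0" "\<delta> > 0"
  shows "norm (poincare_coeff_c r c n) \<le> (1 / of_int c ^ r) * ((2 * pi) ^ Suc r * exp (4 * pi\<^sup>2 / \<delta>) * real (Suc n) ^ r * exp (\<delta> * real (Suc n)))"
proof -
  have "(1::real) \<le> (of_int c)\<^sup>2" using assms by simp
  from norm_bes_coeff_le[OF assms(2) this, of r n]
  have "norm (bes_coeff ((of_int c)\<^sup>2) r n) / of_int c ^ r \<le>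
     ((2 * pi) ^ Suc r * exp (4 * pi\<^sup>2 / \<delta>) * real (Suc n) ^ r * exp (\<delta> * real (Suc n))) / of_int c ^ r"
    using assms by (intro divide_right_mono) auto
  with norm_poincare_coeff_c_le[OF assms(1), of r n] show ?thesis by simp
qed

lemma summable_poincare_coeff_c:
  assumes "r \<ge> 2"
  shows "(\<lambda>c. poincare_coeff_c r c n) summable_on {0<..}"
proof -
  have "(\<lambda>c. norm (poincare_coeff_c r c n)) summable_on {0<..}"
    by (rule Infinite_Sum.abs_summable_on_comparison_test'[OF summable_on_cmult_left[OF summable_on_inverse_power_int[OF assms]]])
       (rule poincare_coeff_c_bound[where \<delta> = 1], auto)
  thus ?thesis by (rule abs_summable_summable)
qed

theorem poincare_Fourier:
  assumes z: "Im z > 0" and r: "r \<ge> 3" "odd r"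
  shows "((\<lambda>n. poincare_coeff r n * ec z ^ Suc n) has_sum poincare (Suc r) z) UNIV"
    and "(\<lambda>c. \<Sum>\<^sub>\<infinity>d\<in>{d. coprime c d}. poincare_term (Suc r) (c, d) z) summable_on {0<..}"
    and "poincare (Suc r) z = ec z + (\<Sum>\<^sub>\<infinity>x\<in>(SIGMA c:{0<..}. {d. coprime c d}). poincare_term (Suc r) x z)"
proof -
  define f where "f = (\<lambda>x. poincare_term (Suc r) x z)"
  define Pos where "Pos = (SIGMA c:{0<..}. {d. coprime c (d::int)})"
  have sub: "Pos \<subseteq> coprime_pairs" by (auto simp: Pos_def coprime_pairs_def)
  have "f summable_on coprime_pairs"
    unfolding f_def by (rule abs_summable_summable[OF summable_poincare_term[OF z]]) (use r in simp)
  hence "f summable_on Pos" by (rule summable_on_subset[OF _ sub])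
  then obtain T where T: "(f has_sum T) Pos" by (auto simp: summable_on_def)
  \<comment> \<open>Rows with c < 0 mirror those with c > 0. The doubled sum cancels the factor 1/2
    in \<open>poincare\<close>.\<close>
  have T': "(f has_sum T) (uminus ` Pos)"
  proof (subst has_sum_reindex)
    show "inj_on uminus Pos" by simp
    have "f (- x) = f x" if "x \<in> Pos" for x
      using poincare_term_uminus[OF _ z, of "fst x" "snd x" "Suc r"] r that by (auto simp: f_def Pos_def)
    thus "(f \<circ> uminus has_sum T) Pos" using T by (subst has_sum_cong[where g = f]) auto
  qed
  have T2: "(f has_sum (T + T)) (Pos \<union> uminus ` Pos)"
    by (intro has_sum_Un_disjoint T T') (auto simp: Pos_def)
  have f1: "f (0, 1) = ec z"
    using poincare_term_eq[OF translate_in_Gamma0 z, of "Suc r" 0] by (simp add: f_def mobius_translate)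
  have f2: "f (0, -1) = ec z"
    using poincare_term_uminus[OF _ z, of 0 1 "Suc r"] r f1 by (simp add: f_def)
  have fe: "(f has_sum (ec z + ec z)) {(0, 1), (0, -1)}"
    by (rule has_sum_finiteI) (auto simp: f1 f2)
  have "{(0, 1), (0, -1)} \<inter> (Pos \<union> uminus ` Pos) = {}" by (auto simp: Pos_def)
  hence "(f has_sum (ec z + ec z + (T + T))) ({(0, 1), (0, -1)} \<union> (Pos \<union> uminus ` Pos))"
    by (rule has_sum_Un_disjoint[OF fe T2])
  also have "{(0, 1), (0, -1)} \<union> (Pos \<union> uminus ` Pos) = coprime_pairs"
  proof (rule set_eqI)
    fix x :: "int \<times> int"
    obtain c d where x: "x = (c, d)" by (cases x)
    have "x \<in> uminus ` Pos \<longleftrightarrow> - x \<in> Pos" by (metis image_iff minus_minus)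
    thus "x \<in> {(0, 1), (0, -1)} \<union> (Pos \<union> uminus ` Pos) \<longleftrightarrow> x \<in> coprime_pairs"
      by (cases "c = 0") (auto simp: x Pos_def coprime_pairs_def zdvd1_eq abs_if split: if_splits)
  qed
  finally have P: "poincare (Suc r) z = ec z + T"
    using z by (simp add: poincare_def f_def infsumI)
  thus "poincare (Suc r) z = ec z + (\<Sum>\<^sub>\<infinity>x\<in>(SIGMA c:{0<..}. {d. coprime c d}). poincare_term (Suc r) x z)"
    using T by (simp add: infsumI f_def Pos_def)
  have "\<exists>S. \<forall>c\<in>{0<..}. ((\<lambda>d. poincare_term (Suc r) (c, d) z) has_sum S c) {d. coprime c d} \<and>
    ((\<lambda>n. poincare_coeff_c r c n * ec z ^ Suc n) has_sum S c) UNIV"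

  proof (intro bchoice ballI)
    fix c :: int assume "c \<in> {0<..}"
    hence "c > 0" by simp
    thus "\<exists>S. ((\<lambda>d. poincare_term (Suc r) (c, d) z) has_sum S) {d. coprime c d} \<and>
      ((\<lambda>n. poincare_coeff_c r c n * ec z ^ Suc n) has_sum S) UNIV"
      by (rule poincare_inner_sum[OF _ z r(1)]) blast
  qed
  then obtain S where S: "\<And>c. c > 0 \<Longrightarrow> ((\<lambda>d. poincare_term (Suc r) (c, d) z) has_sum S c) {d. coprime c d}"
    "\<And>c. c > 0 \<Longrightarrow> ((\<lambda>n. poincare_coeff_c r c n * ec z ^ Suc n) has_sum S c) UNIV" by auto
  have ST: "(S has_sum T) {0<..}"
    using T unfolding Pos_def by (rule has_sum_SigmaD) (use S in \<open>simp add: f_def\<close>)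
  thus "(\<lambda>c. \<Sum>\<^sub>\<infinity>d\<in>{d. coprime c d}. poincare_term (Suc r) (c, d) z) summable_on {0<..}"
    using S(1) by (subst summable_on_cong[where g = S]) (auto simp: infsumI summable_on_def)
  define t where "t = pi * Im z"
  have t: "t > 0" using z by (simp add: t_def)
  define a where "a = (\<lambda>n. \<Sum>\<^sub>\<infinity>c\<in>{0<..}. poincare_coeff_c r c n)"
  \<comment> \<open>The exchange of c and n. As before, t is half the decay rate of q^n.\<close>
  obtain T'' where T'': "(S has_sum T'') {0<..}" "((\<lambda>n. a n * ec z ^ Suc n) has_sum T'') UNIV"
  proof (rule has_sum_exchange)
    fix c :: int and n :: nat assume c: "c \<in> {0<..}"
    have e: "norm (ec z) ^ Suc n = exp (- t * real (Suc n)) * exp (- t * real (Suc n))"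
      unfolding exp_add [symmetric] norm_ec exp_of_nat_mult [symmetric] by (simp add: t_def algebra_simps)
    have "norm (poincare_coeff_c r c n * ec z ^ Suc n) \<le>
      (1 / of_int c ^ r) * ((2 * pi) ^ Suc r * exp (4 * pi\<^sup>2 / t) * real (Suc n) ^ r * exp (t * real (Suc n))) * norm (ec z) ^ Suc n"
      unfolding norm_mult norm_power using c t by (intro mult_right_mono poincare_coeff_c_bound) auto
    also have "\<dots> = (1 / of_int c ^ r) * ((2 * pi) ^ Suc r * exp (4 * pi\<^sup>2 / t) * (real (Suc n) ^ r * exp (- t * real (Suc n)))) *
        (exp (- t * real (Suc n)) * exp (t * real (Suc n)))"
      unfolding e by (simp only: mult_ac)
    also have "exp (- t * real (Suc n)) * exp (t * real (Suc n)) = 1" by (simp add: exp_add [symmetric])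
    finally show "norm (poincare_coeff_c r c n * ec z ^ Suc n) \<le>
       (1 / of_int c ^ r) * ((2 * pi) ^ Suc r * exp (4 * pi\<^sup>2 / t) * (real (Suc n) ^ r * exp (- t * real (Suc n))))" by simp
  next
    show "(\<lambda>c::int. 1 / real_of_int c ^ r) summable_on {0<..}" using r by (intro summable_on_inverse_power_int) auto
    show "(\<lambda>n. (2 * pi) ^ Suc r * exp (4 * pi\<^sup>2 / t) * (real (Suc n) ^ r * exp (- t * real (Suc n)))) summable_on UNIV"
      by (intro summable_on_cmult_right ec_exp_decay_summable t)
    show "((\<lambda>n. poincare_coeff_c r c n * ec z ^ Suc n) has_sum S c) UNIV" if "c \<in> {0<..}" for c
      using S(2) that by simp
    show "((\<lambda>c. poincare_coeff_c r c n * ec z ^ Suc n) has_sum a n * ec z ^ Suc n) {0<..}" for n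
      unfolding a_def using r by (intro has_sum_cmult_left has_sum_infsum summable_poincare_coeff_c) auto
  qed auto
  have "T'' = T" using T''(1) ST has_sum_unique by blast
  have "((\<lambda>n. if n = 0 then ec z else 0) has_sum ec z) (UNIV :: nat set)"
    by (rule has_sum_finite_neutralI[of "{0}"]) auto
  from has_sum_add[OF this T''(2)]
  have "((\<lambda>n. (if n = 0 then ec z else 0) + a n * ec z ^ Suc n) has_sum (ec z + T)) UNIV" by (simp add: \<open>T'' = T\<close>)
  moreover have "(if n = 0 then ec z else 0) + a n * ec z ^ Suc n = poincare_coeff r n * ec z ^ Suc n" for n
    by (simp add: poincare_coeff_def a_def ring_distribs)
  ultimately show "((\<lambda>n. poincare_coeff r n * ec z ^ Suc n) has_sum poincare (Suc r) z) UNIV"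
    by (simp add: P)
qed

section \<open>Fourier expansions and Hecke operators\<close>

definition q_expansion :: "(complex \<Rightarrow> complex) \<Rightarrow> (nat \<Rightarrow> complex) \<Rightarrow> bool" where
  "q_expansion f \<alpha> \<longleftrightarrow> \<alpha> 0 = 0 \<and> (\<forall>z. Im z > 0 \<longrightarrow> (\<lambda>n. \<alpha> n * ec z ^ n) sums f z)"

lemma q_expansion_sums: "q_expansion f \<alpha> \<Longrightarrow> Im z > 0 \<Longrightarrow> (\<lambda>n. \<alpha> n * ec z ^ n) sums f z"
  by (simp add: q_expansion_def)

lemma q_expansion_add: "q_expansion f \<alpha> \<Longrightarrow> q_expansion g \<beta> \<Longrightarrow> q_expansion (\<lambda>z. f z + g z) (\<lambda>n. \<alpha> n + \<beta> n)"
  unfolding q_expansion_def by (auto intro!: sums_add simp: ring_distribs)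

lemma q_expansion_cmult: "q_expansion f \<alpha> \<Longrightarrow> q_expansion (\<lambda>z. c * f z) (\<lambda>n. c * \<alpha> n)"
  unfolding q_expansion_def by (auto intro!: sums_mult simp: mult.assoc)

lemma q_expansion_sum:
  "finite I \<Longrightarrow> (\<And>i. i \<in> I \<Longrightarrow> q_expansion (f i) (\<alpha> i)) \<Longrightarrow> q_expansion (\<lambda>z. \<Sum>i\<in>I. f i z) (\<lambda>n. \<Sum>i\<in>I. \<alpha> i n)"
  unfolding q_expansion_def by (auto intro!: sums_sum simp: sum_distrib_right)

lemma ec_surj_punctured_disc:
  assumes "q \<noteq> 0" "norm q < 1"
  obtains z where "Im z > 0" "ec z = q"
proof
  define z where "z = Ln q / (2 * of_real pi * \<i>)"
  show e: "ec z = q" using assms by (simp add: ec_def z_def)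
  have "exp (- 2 * pi * Im z) < 1" using assms norm_ec[of z] e by simp
  thus "Im z > 0" by (simp add: zero_less_mult_iff)
qed

lemma ec_of_nat_divide_eq_1_iff:
  assumes "N > 0"
  shows "ec (of_nat n / of_nat N) = 1 \<longleftrightarrow> N dvd n"
proof
  assume 1: "ec (of_nat n / of_nat N) = 1"
  define x where "x = 2 * pi * (real n / real N)"
  have "ec (of_nat n / of_nat N) = exp (of_real x * \<i>)"
    by (simp add: ec_def x_def mult_ac)
  hence "exp (of_real x * \<i>) = 1" using 1 by simp
  then obtain m :: int where "x = of_int (2 * m) * pi"
    unfolding exp_eq_1 by auto
  hence "(2 * pi) * (real n / real N) = (2 * pi) * of_int m"
    by (simp only: x_def of_int_mult of_int_numeral mult_ac)
  hence "real n / real N = of_int m" by (simp only: mult_cancel_left) simp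
  hence "real_of_int (int n) = real_of_int (m * int N)" using assms by (simp add: divide_eq_eq)
  hence "int n = m * int N" by (simp only: of_int_eq_iff)
  hence "int N dvd int n" by simp
  thus "N dvd n" by simp
next
  assume "N dvd n"
  then obtain m where "n = N * m" by auto
  thus "ec (of_nat n / of_nat N) = 1" using assms ec_of_int[of "int m"] by simp
qed

text \<open>The exponential maps the upper half plane onto the punctured unit disc, so the
  difference of the two expansions is a power series vanishing on the whole disc. A nonzero
  coefficient would make 0 an isolated zero.\<close>

lemma q_expansion_unique:
  assumes "q_expansion f \<alpha>" "q_expansion f \<beta>"
  shows "\<alpha> = \<beta>"
proof (rule ccontr)
  assume "\<alpha> \<noteq> \<beta>"
  then obtain m where m: "\<alpha> m - \<beta> m \<noteq> 0" by (auto simp: fun_eq_iff)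
  have m0: "m > 0" using m assms by (cases m) (auto simp: q_expansion_def)
  have s: "(\<lambda>n. (\<alpha> n - \<beta> n) * (q - 0) ^ n) sums 0" if "norm (q - 0) < 1" for q
  proof (cases "q = 0")
    case True
    have "(\<lambda>n. (\<alpha> n - \<beta> n) * (q - 0) ^ n) = (\<lambda>n. 0)"
      using assms by (auto simp: fun_eq_iff True q_expansion_def power_0_left)
    thus ?thesis by simp
  next
    case False
    have "norm q < 1" using that by simp
    then obtain z where z: "Im z > 0" "ec z = q" by (rule ec_surj_punctured_disc[OF False])
    from sums_diff[OF q_expansion_sums[OF assms(1) z(1)] q_expansion_sums[OF assms(2) z(1)]]
    show ?thesis by (simp add: z algebra_simps)
  qed
  show False
  proof (rule powser_0_nonzero[where r = 1 and \<xi> = 0 and a = "\<lambda>n. \<alpha> n - \<beta> n" and f = "\<lambda>_. 0 :: complex" and m = m])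
    show "(\<lambda>n. (\<alpha> n - \<beta> n) * (q - 0) ^ n) sums 0" if "norm (q - 0) < 1" for q by (rule s[OF that])
    show "\<alpha> m - \<beta> m \<noteq> 0" "0 < m" by (fact m, fact m0)
    fix e :: real assume e: "0 < e" "\<And>z::complex. z \<in> cball 0 e - {0} \<Longrightarrow> (0 :: complex) \<noteq> 0"
    have "of_real e \<in> cball 0 e - {0 :: complex}" using e(1) by (simp add: dist_norm)
    thus False using e(2) by blast
  qed (rule zero_less_one refl)+
qed

lemma q_expansion_abs_summable:
  assumes "q_expansion f \<alpha>" "0 \<le> t" "t < 1"
  shows "summable (\<lambda>n. norm (\<alpha> n) * t ^ n)"
proof -
  obtain u where u: "t < u" "u < 1" using assms(3) dense by blast
  obtain z where z: "Im z > 0" "ec z = of_real u" using ec_surj_punctured_disc[of "of_real u"] u assms by auto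
  have "summable (\<lambda>n. \<alpha> n * of_real u ^ n)"
    using q_expansion_sums[OF assms(1) z(1)] by (simp add: z sums_iff)
  from powser_insidea[OF this, of "of_real t"] show ?thesis
    using u assms by (simp add: norm_mult norm_power)
qed

lemma q_expansion_holomorphic:
  assumes "q_expansion f \<alpha>"
  shows "f holomorphic_on upper_half_plane"
proof -
  define F where "F = (\<lambda>q. \<Sum>n. \<alpha> n * q ^ n)"
  have s: "(\<lambda>n. \<alpha> n * (q - 0) ^ n) sums F q" if "q \<in> ball 0 1" for q
  proof -
    have "summable (\<lambda>n. norm (\<alpha> n * q ^ n))"
      using q_expansion_abs_summable[OF assms, of "norm q"] that by (simp add: norm_mult norm_power)
    thus ?thesis by (simp add: F_def summable_norm_cancel summable_sums)
  qed
  have "F holomorphic_on ball 0 1" by (rule power_series_holomorphic[OF s])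
  moreover have "ec holomorphic_on upper_half_plane"
    using has_field_derivative_ec by (auto simp: holomorphic_on_def field_differentiable_def intro: has_field_derivative_at_within)
  moreover have "ec ` upper_half_plane \<subseteq> ball 0 1" using norm_ec_less_1 by auto
  ultimately have "(F \<circ> ec) holomorphic_on upper_half_plane" by (intro holomorphic_on_compose_gen)
  moreover have "(F \<circ> ec) z = f z" if "z \<in> upper_half_plane" for z
    using q_expansion_sums[OF assms, of z] that by (simp add: F_def sums_iff)
  ultimately show ?thesis by (rule holomorphic_transform)
qed

text \<open>The constant term vanishes, so one factor q comes out; the remaining series is dominated
  on Im z \<ge> y0 by its absolute values at height y0.\<close>

lemma q_expansion_decay:
  assumes "q_expansion f \<alpha>" "y0 > 0"
  obtains C where "C \<ge> 0" "\<And>z. Im z \<ge> y0 \<Longrightarrow> norm (f z) \<le> C * exp (- 2 * pi * Im z)"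
proof
  define t where "t = exp (- 2 * pi * y0)"
  have t: "0 < t" "t < 1" using assms by (auto simp: t_def)
  have sm: "summable (\<lambda>n. norm (\<alpha> (Suc n)) * t ^ n)"
  proof -
    have "summable (\<lambda>n. norm (\<alpha> (Suc n)) * t ^ Suc n)"
      using q_expansion_abs_summable[OF assms(1), of t] t by (subst summable_Suc_iff) auto
    from summable_mult[OF this, of "1 / t"] show ?thesis using t by simp
  qed
  define C where "C = (\<Sum>n. norm (\<alpha> (Suc n)) * t ^ n)"
  show "C \<ge> 0" unfolding C_def using sm t by (intro suminf_nonneg) auto
  fix z assume z: "Im z \<ge> y0"
  hence z0: "Im z > 0" using assms by simp
  have nt: "norm (ec z) \<le> t" using z by (simp add: norm_ec t_def)
  have "(\<lambda>n. \<alpha> (Suc n) * ec z ^ Suc n) sums (f z - \<alpha> 0 * ec z ^ 0)"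
    using q_expansion_sums[OF assms(1) z0] by (subst sums_Suc_iff) simp
  hence s: "(\<lambda>n. \<alpha> (Suc n) * ec z ^ Suc n) sums f z" using assms(1) by (simp add: q_expansion_def)
  have "norm (\<alpha> (Suc n) * ec z ^ Suc n) \<le> (norm (\<alpha> (Suc n)) * t ^ n) * norm (ec z)" for n
  proof -
    have "norm (ec z) ^ n \<le> t ^ n" using nt by (intro power_mono) auto
    hence "norm (\<alpha> (Suc n)) * norm (ec z) ^ n * norm (ec z) \<le> norm (\<alpha> (Suc n)) * t ^ n * norm (ec z)"
      by (intro mult_right_mono mult_left_mono) auto
    thus ?thesis by (simp add: norm_mult norm_power mult_ac)
  qed
  hence "norm (\<Sum>n. \<alpha> (Suc n) * ec z ^ Suc n) \<le> (\<Sum>n. (norm (\<alpha> (Suc n)) * t ^ n) * norm (ec z))"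
    by (rule norm_suminf_le) (intro summable_mult2 sm)
  also have "\<dots> = C * norm (ec z)" unfolding C_def by (rule suminf_mult2[OF sm, symmetric])
  finally show "norm (f z) \<le> C * exp (- 2 * pi * Im z)" using s by (simp add: sums_iff norm_ec)
qed

text \<open>\<open>rho\<close> is a definite description, and uniqueness of the expansion identifies
  it. At n = 0 both sides are 0 because the coefficient is.\<close>

lemma rho_eq:
  assumes "q_expansion f \<alpha>"
  shows "rho k f n = \<alpha> n / of_real (real n powr ((real k - 1) / 2))"
proof -
  define r where "r = (\<lambda>n. \<alpha> n / of_real (real n powr ((real k - 1) / 2)))"
  have e: "exp (2 * of_real pi * \<i> * of_nat n * z) = ec z ^ n" for n z
    by (simp add: ec_of_nat_mult [symmetric]) (simp add: ec_def mult_ac)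
  have r: "r n * of_real (real n powr ((real k - 1) / 2)) = \<alpha> n" for n
    using assms by (cases "n = 0") (auto simp: r_def q_expansion_def)
  have "rho k f = r"
    unfolding rho_def
  proof (rule the_equality)
    show "r 0 = 0 \<and> (\<forall>z\<in>upper_half_plane. (\<lambda>n. r n * of_real (real n powr ((real k - 1) / 2)) *
        exp (2 * of_real pi * \<i> * of_nat n * z)) sums f z)"
      unfolding r e using assms by (auto simp: q_expansion_def r_def)
  next
    fix s assume s: "s 0 = 0 \<and> (\<forall>z\<in>upper_half_plane. (\<lambda>n. s n * of_real (real n powr ((real k - 1) / 2)) *
        exp (2 * of_real pi * \<i> * of_nat n * z)) sums f z)"
    hence "q_expansion f (\<lambda>n. s n * of_real (real n powr ((real k - 1) / 2)))"
      unfolding e by (simp add: q_expansion_def)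
    hence *: "(\<lambda>n. s n * of_real (real n powr ((real k - 1) / 2))) = \<alpha>" using q_expansion_unique assms by blast
    show "s = r"
    proof
      fix n show "s n = r n" using fun_cong[OF *, of n] s by (cases "n = 0") (simp_all add: r_def nonzero_eq_divide_eq)
    qed
  qed
  thus ?thesis by (simp add: r_def)
qed

lemma q_expansion_coeff_eq_rho:
  assumes "q_expansion f \<alpha>"
  shows "\<alpha> n = rho k f n * of_real (real n powr ((real k - 1) / 2))"
  using assms by (cases "n = 0") (auto simp: rho_eq[OF assms] q_expansion_def)

lemma sums_multiples:
  assumes "p > 0" "\<And>n. \<not> p dvd n \<Longrightarrow> a n = (0 :: complex)"
  shows "(\<lambda>n. a (p * n)) sums c \<longleftrightarrow> a sums c"
proof (rule sums_mono_reindex[of "\<lambda>n. p * n" a c])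
  show "strict_mono (\<lambda>n. p * n)" using assms(1) by (auto simp: strict_mono_def)
  show "a n = 0" if "n \<notin> range (\<lambda>n. p * n)" for n
    using that assms(2)[of n] by (auto elim!: dvdE)
qed

text \<open>The definition provides a series in e(z / N). Invariance under z + 1 multiplies its n-th
  coefficient by e(n / N), and uniqueness kills every n not divisible by N. Uniqueness is applied to
  z \<mapsto> f (N z), whose expansion is in powers of e(z).\<close>

lemma cusp_form_q_expansion:
  assumes f: "f \<in> cusp_forms k N" and N: "N \<ge> 1"
  obtains \<alpha> where "q_expansion f \<alpha>"
proof -
  have one: "mat2 1 0 0 1 \<in> Gamma0 1" by (rule translate_in_Gamma0)
  then obtain a where a: "a 0 = 0" "\<And>z. Im z > 0 \<Longrightarrow>
      (\<lambda>n. a n * exp (2 * of_real pi * \<i> * of_nat n * z / of_nat N)) sums slash k f (mat2 1 0 0 1) z"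
    using f unfolding cusp_forms_def by auto
  have a': "(\<lambda>n. a n * ec (z / of_nat N) ^ n) sums f z" if "Im z > 0" for z
    using a(2)[OF that] by (simp add: slash_altdef mobius_translate ec_of_nat_mult [symmetric]) (simp add: ec_def mult_ac)
  have Nn: "real N > 0" using N by simp
  have per: "f (z + 1) = f z" if "Im z > 0" for z
  proof -
    have "slash k f (mat2 1 1 0 1) z = f z"
      using f that translate_in_Gamma0[of 1 N] unfolding cusp_forms_def by auto
    thus ?thesis by (simp add: slash_altdef mobius_translate)
  qed
  have q1: "q_expansion (\<lambda>z. f (of_nat N * z)) a"
    using a(1) a'[of "of_nat N * _"] Nn by (auto simp: q_expansion_def)
  have q2: "q_expansion (\<lambda>z. f (of_nat N * z)) (\<lambda>n. a n * ec (1 / of_nat N) ^ n)"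
  proof -
    have "(\<lambda>n. a n * ec (1 / of_nat N) ^ n * ec z ^ n) sums f (of_nat N * z)" if z: "Im z > 0" for z
    proof -
      have Nz: "Im (of_nat N * z) > 0" using z Nn by simp
      have "(of_nat N * z + 1) / of_nat N = 1 / of_nat N + z" using Nn by (simp add: field_simps)
      with a'[of "of_nat N * z + 1"] per[OF Nz] Nz show ?thesis
        by (simp add: ec_add power_mult_distrib mult.assoc)
    qed
    thus ?thesis using a(1) by (simp add: q_expansion_def)
  qed
  have a0: "a n = 0" if "\<not> N dvd n" for n
  proof -
    have "a n = a n * ec (1 / of_nat N) ^ n" using q_expansion_unique[OF q1 q2] by (rule fun_cong)
    moreover have "ec (1 / of_nat N) ^ n \<noteq> 1"
      using ec_of_nat_divide_eq_1_iff[of N n] that N by (simp add: ec_of_nat_mult [symmetric])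
    ultimately show ?thesis by auto
  qed
  have "q_expansion f (\<lambda>n. a (N * n))"
    unfolding q_expansion_def
  proof (intro conjI allI impI)
    fix z :: complex assume z: "Im z > 0"
    have "(\<lambda>n. a (N * n) * ec (z / of_nat N) ^ (N * n)) sums f z"
      using a'[OF z] by (subst sums_multiples[of N]) (use N a0 in auto)
    moreover have "ec (z / of_nat N) ^ (N * n) = ec z ^ n" for n
      using Nn by (simp add: power_mult ec_of_nat_mult [symmetric])
    ultimately show "(\<lambda>n. a (N * n) * ec z ^ n) sums f z" by simp
  qed (use a in simp)
  thus ?thesis using that by blast
qed

lemma poincare_q_expansion:
  assumes "r \<ge> 3" "odd r"
  shows "q_expansion (poincare (Suc r)) (\<lambda>n. if n = 0 then 0 else poincare_coeff r (n - 1))"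
  unfolding q_expansion_def
proof (intro conjI allI impI)
  fix z :: complex assume z: "Im z > 0"
  have "(\<lambda>n. poincare_coeff r n * ec z ^ Suc n) sums poincare (Suc r) z"
    using poincare_Fourier(1)[OF z assms] by (rule has_sum_imp_sums)
  from sums_Suc[of "\<lambda>n. (if n = 0 then 0 else poincare_coeff r (n - 1)) * ec z ^ n"] this
  show "(\<lambda>n. (if n = 0 then 0 else poincare_coeff r (n - 1)) * ec z ^ n) sums poincare (Suc r) z" by simp
qed simp

text \<open>At level one every slash translate equals the series itself, so its expansion at
  infinity serves at all cusps.\<close>

lemma poincare_cusp_form:
  assumes "r \<ge> 3" "odd r"
  shows "poincare (Suc r) \<in> cusp_forms (Suc r) 1"
  unfolding cusp_forms_def
proof (intro CollectI conjI allI impI ballI)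
  note q = poincare_q_expansion[OF assms]
  show "poincare (Suc r) holomorphic_on upper_half_plane" by (rule q_expansion_holomorphic[OF q])
  show "\<exists>a. a 0 = 0 \<and> (\<forall>z\<in>upper_half_plane.
      (\<lambda>n. a n * exp (2 * of_real pi * \<i> * of_nat n * z / of_nat 1)) sums slash (Suc r) (poincare (Suc r)) A z)"
    if A: "A \<in> Gamma0 1" for A
  proof (intro exI[of _ "\<lambda>n. if n = 0 then 0 else poincare_coeff r (n - 1)"] conjI ballI)
    fix z assume z: "z \<in> upper_half_plane"
    have e: "exp (2 * of_real pi * \<i> * of_nat n * z / of_nat 1) = ec z ^ n" for n
      by (simp add: ec_of_nat_mult [symmetric]) (simp add: ec_def mult_ac)
    show "(\<lambda>n. (if n = 0 then 0 else poincare_coeff r (n - 1)) * exp (2 * of_real pi * \<i> * of_nat n * z / of_nat 1))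
        sums slash (Suc r) (poincare (Suc r)) A z"
      unfolding e using q_expansion_sums[OF q] poincare_slash[OF A] z by simp
  qed simp
qed (use poincare_slash in \<open>auto simp: poincare_def\<close>)

section \<open>The Hecke operator at a prime and Fourier coefficients\<close>

lemma hecke_prime:
  assumes "prime p"
  shows "hecke k p f z = of_real (real p powr ((real k - 1) / 2)) *
    (f (of_nat p * z) + 1 / of_nat p ^ k * (\<Sum>b<p. f ((z + of_nat b) / of_nat p)))"
proof -
  have "{d. d dvd p} = {1, p}" "p \<noteq> 1" "p > 0"
    using assms by (auto simp: prime_nat_iff)
  thus ?thesis by (simp add: hecke_def)
qed

lemma q_expansion_mult_arg:
  assumes "q_expansion f \<alpha>" "p > 0"
  shows "q_expansion (\<lambda>z. f (of_nat p * z)) (\<lambda>n. if p dvd n then \<alpha> (n div p) else 0)"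
  unfolding q_expansion_def
proof (intro conjI allI impI)
  fix z :: complex assume z: "Im z > 0"
  have "(\<lambda>n. \<alpha> n * ec (of_nat p * z) ^ n) sums f (of_nat p * z)"
    using assms z by (intro q_expansion_sums[OF assms(1)]) auto
  hence "(\<lambda>n. (\<lambda>m. (if p dvd m then \<alpha> (m div p) else 0) * ec z ^ m) (p * n)) sums f (of_nat p * z)"
    using assms(2) by (simp add: ec_of_nat_mult power_mult)
  thus "(\<lambda>m. (if p dvd m then \<alpha> (m div p) else 0) * ec z ^ m) sums f (of_nat p * z)"
    by (subst (asm) sums_multiples) (use assms in auto)
qed (use assms in \<open>simp add: q_expansion_def\<close>)

lemma sum_roots_of_unity:
  assumes "p > 0"
  shows "(\<Sum>b<p. ec (of_nat b / of_nat p) ^ n) = (if p dvd n then of_nat p else 0)"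
proof -
  define w where "w = ec (of_nat n / of_nat p)"
  have e: "ec (of_nat b / of_nat p) ^ n = w ^ b" for b
    unfolding w_def ec_of_nat_mult [symmetric] by (simp add: mult_ac)
  have wp: "w ^ p = 1"
    using assms ec_of_int[of "int n"] unfolding w_def ec_of_nat_mult [symmetric] by simp
  show ?thesis
  proof (cases "p dvd n")
    case True
    then obtain m where "n = p * m" by auto
    hence "w = 1" using assms ec_of_int[of "int m"] by (simp add: w_def)
    thus ?thesis using True by (simp add: e)
  next
    case False
    have "w \<noteq> 1" using ec_of_nat_divide_eq_1_iff[OF assms, of n] False by (simp add: w_def)
    thus ?thesis using False wp by (simp add: e geometric_sum[of w p])
  qed
qed

text \<open>Summation over b is a sum over p-th roots of unity, which selects the exponents
  divisible by p and multiplies them by p.\<close>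

lemma q_expansion_div_arg:
  assumes "q_expansion f \<alpha>" "p > 0"
  shows "q_expansion (\<lambda>z. \<Sum>b<p. f ((z + of_nat b) / of_nat p)) (\<lambda>n. of_nat p * \<alpha> (p * n))"
  unfolding q_expansion_def
proof (intro conjI allI impI)
  fix z :: complex assume z: "Im z > 0"
  have "(\<lambda>n. \<Sum>b<p. \<alpha> n * ec ((z + of_nat b) / of_nat p) ^ n) sums (\<Sum>b<p. f ((z + of_nat b) / of_nat p))"
    using assms z by (intro sums_sum q_expansion_sums[OF assms(1)]) (auto simp: Im_divide)
  also have "(\<lambda>n. \<Sum>b<p. \<alpha> n * ec ((z + of_nat b) / of_nat p) ^ n) =
      (\<lambda>n. \<alpha> n * ec (z / of_nat p) ^ n * (if p dvd n then of_nat p else 0))"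
    by (simp add: add_divide_distrib ec_add power_mult_distrib sum_roots_of_unity[OF assms(2), symmetric] sum_distrib_left mult_ac)
  finally have "(\<lambda>n. \<alpha> (p * n) * ec (z / of_nat p) ^ (p * n) * (if p dvd p * n then of_nat p else 0)) sums (\<Sum>b<p. f ((z + of_nat b) / of_nat p))"
    by (subst (asm) sums_multiples[OF assms(2), symmetric]) auto
  thus "(\<lambda>n. of_nat p * \<alpha> (p * n) * ec z ^ n) sums (\<Sum>b<p. f ((z + of_nat b) / of_nat p))"
    using assms(2) by (simp add: power_mult ec_of_nat_mult [symmetric] mult_ac)
qed (use assms in \<open>simp add: q_expansion_def\<close>)

lemma hecke_coeff_recursion:
  assumes f: "q_expansion f \<alpha>" and p: "prime p" and n: "n > 0"
    and hk: "hecke k p f = (\<lambda>z. l * f z)"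
  shows "l * rho k f n = (if p dvd n then rho k f (n div p) else 0) + rho k f (p * n)"
proof -
  have p0: "p > 0" using p prime_gt_0_nat by blast
  define s where "s = (real k - 1) / 2"
  have hk': "of_real (real p powr s) * (f (of_nat p * z) + 1 / of_nat p ^ k * (\<Sum>b<p. f ((z + of_nat b) / of_nat p))) = l * f z" for z
    using fun_cong[OF hk, of z] by (simp only: hecke_prime[OF p] s_def)
  have "q_expansion (\<lambda>z. of_real (real p powr s) * (f (of_nat p * z) + 1 / of_nat p ^ k * (\<Sum>b<p. f ((z + of_nat b) / of_nat p))))
     (\<lambda>n. of_real (real p powr s) * ((if p dvd n then \<alpha> (n div p) else 0) + 1 / of_nat p ^ k * (of_nat p * \<alpha> (p * n))))"
    by (intro q_expansion_cmult q_expansion_add q_expansion_mult_arg[OF f p0] q_expansion_div_arg[OF f p0])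
  hence "q_expansion (\<lambda>z. l * f z)
     (\<lambda>n. of_real (real p powr s) * ((if p dvd n then \<alpha> (n div p) else 0) + 1 / of_nat p ^ k * (of_nat p * \<alpha> (p * n))))"
    by (simp only: hk')
  from fun_cong[OF q_expansion_unique[OF q_expansion_cmult[OF f] this], of n]
  have eq: "l * \<alpha> n = of_real (real p powr s) * ((if p dvd n then \<alpha> (n div p) else 0) + 1 / of_nat p ^ k * (of_nat p * \<alpha> (p * n)))" .
  define P V :: complex where "P = of_real (real p powr s)" and "V = of_real (real n powr s)"
  have V0: "V \<noteq> 0" using n by (simp add: V_def)
  \<comment> \<open>The reason for the normalisations: with them both terms of the Hecke relation
    for \<open>rho\<close> have coefficient 1.\<close>
  have pk: "P * P * of_nat p = of_nat p ^ k"
  proof -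
    have "real p powr s * real p powr s * real p = real p powr (s + s + 1)" by (simp only: powr_add) simp
    also have "s + s + 1 = real k" by (simp add: s_def)
    also have "real p powr real k = real p ^ k" using p0 by (simp add: powr_realpow)
    finally have "complex_of_real (real p powr s * real p powr s * real p) = of_real (real p ^ k)" by (rule arg_cong)
    thus ?thesis by (simp add: P_def)
  qed
  have a1: "\<alpha> n = rho k f n * V" using q_expansion_coeff_eq_rho[OF f, of n k] by (simp add: V_def s_def)
  have "\<alpha> (p * n) = rho k f (p * n) * (P * V)"
    using q_expansion_coeff_eq_rho[OF f, of "p * n" k] by (simp add: V_def P_def s_def powr_mult)
  hence "P * (1 / of_nat p ^ k * (of_nat p * \<alpha> (p * n))) = (P * P * of_nat p) / of_nat p ^ k * (rho k f (p * n) * V)"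
    by (simp add: mult_ac)
  hence a2: "P * (1 / of_nat p ^ k * (of_nat p * \<alpha> (p * n))) = rho k f (p * n) * V" using p0 by (simp add: pk)
  have a3: "P * (if p dvd n then \<alpha> (n div p) else 0) = (if p dvd n then rho k f (n div p) else 0) * V"
  proof (cases "p dvd n")
    case True
    then obtain m where m: "n = p * m" by auto
    have "\<alpha> m = rho k f m * of_real (real m powr s)" using q_expansion_coeff_eq_rho[OF f, of m k] by (simp add: s_def)
    thus ?thesis using p0 unfolding m V_def P_def by (simp add: powr_mult)
  qed simp
  have "(l * rho k f n) * V = ((if p dvd n then rho k f (n div p) else 0) + rho k f (p * n)) * V"
    using eq unfolding P_def[symmetric] distrib_left a2 a3 unfolding a1 distrib_right by (simp only: mult.assoc)
  thus ?thesis using mult_right_cancel[OF V0] by blast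
qed

text \<open>The Chebyshev polynomial of the second kind rescaled to [-2, 2], that is U_n(x / 2). It
  is polymorphic because it is applied to complex eigenvalues as well as to their real
  parts.\<close>

fun cheb :: "nat \<Rightarrow> 'a :: comm_ring_1 \<Rightarrow> 'a" where
  "cheb 0 x = 1"
| "cheb (Suc 0) x = x"
| "cheb (Suc (Suc n)) x = x * cheb (Suc n) x - cheb n x"

lemma rho_prime_power:
  assumes f: "q_expansion f \<alpha>" and p: "prime p" and hk: "hecke k p f = (\<lambda>z. l * f z)"
  shows "rho k f (p ^ j) = cheb j l * rho k f 1"
proof (induction j rule: induct_nat_012)
  case 1
  have "\<not> p dvd 1" using p by auto
  thus ?case using hecke_coeff_recursion[OF f p _ hk, of 1] by simp
next
  case (ge2 j)
  have p0: "p > 0" using p prime_gt_0_nat by blast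
  have "l * rho k f (p ^ Suc j) = rho k f (p ^ j) + rho k f (p ^ Suc (Suc j))"
    using hecke_coeff_recursion[OF f p _ hk, of "p ^ Suc j"] p0 by simp
  hence "rho k f (p ^ Suc (Suc j)) = l * rho k f (p ^ Suc j) - rho k f (p ^ j)" by (simp add: algebra_simps)
  thus ?case using ge2 by (simp only: cheb.simps) (simp add: algebra_simps)
qed simp

lemma hecke_eigenvalue_eq:
  assumes "f \<noteq> 0" "hecke k n f = (\<lambda>z. l * f z)"
  shows "hecke_eigenvalue k n f = l"
  unfolding hecke_eigenvalue_def
proof (rule the_equality, rule assms(2))
  fix m assume "hecke k n f = (\<lambda>z. m * f z)"
  moreover obtain z where "f z \<noteq> 0" using assms(1) by (auto simp: fun_eq_iff)
  ultimately show "m = l" using fun_cong[OF assms(2), of z] by simp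
qed

section \<open>The Petersson norm\<close>

lemma measurable_Complex [measurable]:
  assumes f: "f \<in> borel_measurable M" and g: "g \<in> borel_measurable M"
  shows "(\<lambda>x. Complex (f x) (g x)) \<in> borel_measurable M"
proof -
  have "(\<lambda>p::real \<times> real. Complex (fst p) (snd p)) \<in> borel_measurable borel"
    unfolding Complex_eq by (intro borel_measurable_continuous_onI continuous_intros)
  from measurable_compose[OF borel_measurable_Pair[OF f g] this] show ?thesis by simp
qed

lemma lborel_complex_eq: "lborel = distr (lborel \<Otimes>\<^sub>M lborel) borel (\<lambda>(x, y). Complex x y)"
proof (rule lborel_eqI)
  have m: "(\<lambda>(x, y). Complex x y) \<in> borel_measurable (lborel \<Otimes>\<^sub>M lborel)"
    unfolding case_prod_unfold by measurable
  fix l u :: complex assume lu: "\<And>b. b \<in> Basis \<Longrightarrow> l \<bullet> b \<le> u \<bullet> b"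
  have lu': "Re l \<le> Re u" "Im l \<le> Im u" using lu[of 1] lu[of \<i>] by (auto simp: Basis_complex_def)
  have "emeasure (distr (lborel \<Otimes>\<^sub>M lborel) borel (\<lambda>(x, y). Complex x y)) (box l u) =
      emeasure (lborel \<Otimes>\<^sub>M lborel) ((\<lambda>(x, y). Complex x y) -` box l u \<inter> space (lborel \<Otimes>\<^sub>M lborel))"
    by (rule emeasure_distr[OF m]) simp
  also have "(\<lambda>(x, y). Complex x y) -` box l u \<inter> space (lborel \<Otimes>\<^sub>M lborel) = {Re l<..<Re u} \<times> {Im l<..<Im u}"
    by (auto simp: box_def Basis_complex_def space_pair_measure)
  also have "emeasure (lborel \<Otimes>\<^sub>M lborel) ({Re l<..<Re u} \<times> {Im l<..<Im u}) = ennreal (Re u - Re l) * ennreal (Im u - Im l)"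
    using lu' by (subst lborel.emeasure_pair_measure_Times) auto
  also have "\<dots> = ennreal (\<Prod>b\<in>Basis. (u - l) \<bullet> b)"
    using lu' by (simp add: Basis_complex_def ennreal_mult')
  finally show "emeasure (distr (lborel \<Otimes>\<^sub>M lborel) borel (\<lambda>(x, y). Complex x y)) (box l u) = ennreal (\<Prod>b\<in>Basis. (u - l) \<bullet> b)" .
qed simp

lemma nn_integral_complex:
  fixes f :: "complex \<Rightarrow> ennreal"
  assumes [measurable]: "f \<in> borel_measurable borel"
  shows "(\<integral>\<^sup>+z. f z \<partial>lborel) = (\<integral>\<^sup>+y. (\<integral>\<^sup>+x. f (Complex x y) \<partial>lborel) \<partial>lborel)"
proof -
  have "(\<integral>\<^sup>+z. f z \<partial>lborel) = (\<integral>\<^sup>+p. f (case p of (x, y) \<Rightarrow> Complex x y) \<partial>(lborel \<Otimes>\<^sub>M lborel))"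
    by (subst lborel_complex_eq, subst nn_integral_distr) (auto simp: case_prod_unfold)
  also have "\<dots> = (\<integral>\<^sup>+y. (\<integral>\<^sup>+x. f (Complex x y) \<partial>lborel) \<partial>lborel)"
    by (subst lborel_pair.nn_integral_snd [symmetric]) (auto simp: case_prod_unfold)
  finally show ?thesis .
qed

definition pet_const :: "nat \<Rightarrow> real" where
  "pet_const k = Gamma (real k - 1) / (4 * pi) ^ (k - 1)"

definition pet_weight :: "nat \<Rightarrow> complex \<Rightarrow> real" where
  "pet_weight k z = Im z ^ k / (Im z)\<^sup>2"

lemma pet_const_pos: "k \<ge> 2 \<Longrightarrow> pet_const k > 0"
  by (simp add: pet_const_def Gamma_real_pos)

lemma pet_weight_nonneg: "Im z \<ge> 0 \<Longrightarrow> pet_weight k z \<ge> 0"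
  by (simp add: pet_weight_def)

lemma measurable_pet_weight [measurable]: "pet_weight k \<in> borel_measurable borel"
  unfolding pet_weight_def[abs_def] by measurable

text \<open>Euler's integral for \<Gamma>(k - 1) after the substitution t = c y. The power y^(k - 2)
  is written as a quotient to match \<open>pet_weight\<close>.\<close>

lemma nn_integral_power_exp:
  assumes c: "c > 0" and k: "k \<ge> 2"
  shows "(\<integral>\<^sup>+y. ennreal (indicator {0<..} y * (y ^ k / y\<^sup>2 * exp (- c * y))) \<partial>lborel) = ennreal (Gamma (real k - 1) / c ^ (k - 1))"
proof -
  define s where "s = real k - 1"
  have s: "s > 0" using k by (simp add: s_def)
  define I where "I = (\<integral>\<^sup>+y. ennreal (indicator {0<..} y * (y ^ k / y\<^sup>2 * exp (- c * y))) \<partial>lborel)"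
  have "ennreal (Gamma s) = (\<integral>\<^sup>+t. ennreal (indicator {0..} t * t powr (s - 1) / exp t) \<partial>lborel)"
    by (rule Gamma_conv_nn_integral_real[OF s])
  also have "\<dots> = ennreal \<bar>c\<bar> * (\<integral>\<^sup>+y. ennreal (indicator {0..} (0 + c * y) * (0 + c * y) powr (s - 1) / exp (0 + c * y)) \<partial>lborel)"
    using c by (intro nn_integral_real_affine) auto
  also have "(\<integral>\<^sup>+y. ennreal (indicator {0..} (0 + c * y) * (0 + c * y) powr (s - 1) / exp (0 + c * y)) \<partial>lborel) =
     (\<integral>\<^sup>+y. ennreal (c ^ (k - 2)) * ennreal (indicator {0<..} y * (y ^ k / y\<^sup>2 * exp (- c * y))) \<partial>lborel)"
  proof (rule nn_integral_cong_AE)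
    have "AE y in lborel. y \<noteq> (0::real)" by (rule AE_lborel_singleton)
    thus "AE y in lborel. ennreal (indicator {0..} (0 + c * y) * (0 + c * y) powr (s - 1) / exp (0 + c * y)) =
        ennreal (c ^ (k - 2)) * ennreal (indicator {0<..} y * (y ^ k / y\<^sup>2 * exp (- c * y)))"
    proof eventually_elim
      case (elim y)
      show ?case
      proof (cases "y > 0")
        case True
        have "s - 1 = real (k - 2)" using k by (simp add: s_def of_nat_diff)
        hence "(c * y) powr (s - 1) = (c * y) ^ (k - 2)" using c True by (simp add: powr_realpow)
        moreover have "y ^ k / y\<^sup>2 = y ^ (k - 2)" using True k by (simp add: power_diff)
        ultimately show ?thesis using True c
          by (simp add: power_mult_distrib exp_minus divide_inverse mult_ac flip: ennreal_mult')
      next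
        case False
        hence "\<not> (c * y \<ge> 0)" using c elim by (simp add: zero_le_mult_iff)
        thus ?thesis using False by simp
      qed
    qed
  qed
  also have "\<dots> = ennreal (c ^ (k - 2)) * I"
    unfolding I_def by (rule nn_integral_cmult) simp
  also have "ennreal \<bar>c\<bar> * (ennreal (c ^ (k - 2)) * I) = ennreal (c ^ (k - 1)) * I"
  proof -
    have "k - 1 = Suc (k - 2)" using k by simp
    hence "c ^ (k - 1) = c * c ^ (k - 2)" by simp
    hence "ennreal (c ^ (k - 1)) = ennreal c * ennreal (c ^ (k - 2))" using c by (simp add: ennreal_mult)
    thus ?thesis using c by (simp add: mult.assoc)
  qed
  finally have e: "ennreal (Gamma s) = ennreal (c ^ (k - 1)) * I" .
  define q where "q = c ^ (k - 1)"
  have q: "q > 0" using c by (simp add: q_def)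
  have "ennreal (Gamma s / q) = ennreal (inverse q * Gamma s)"
    by (simp only: divide_inverse mult.commute)
  also have "\<dots> = ennreal (inverse q) * ennreal (Gamma s)"
    by (rule ennreal_mult) (use q s in \<open>auto intro: less_imp_le Gamma_real_pos\<close>)
  also have "\<dots> = ennreal (inverse q) * ennreal q * I" unfolding e q_def by (simp only: mult.assoc)
  also have "ennreal (inverse q) * ennreal q = ennreal (inverse q * q)"
    by (rule ennreal_mult[symmetric]) (use q in auto)
  also have "inverse q * q = 1" using q by simp
  also have "ennreal 1 * I = I" by simp
  finally show ?thesis by (simp only: I_def s_def q_def)
qed

section \<open>Bessel's inequality on horizontal segments\<close>

lemma has_integral_ec_orthogonal:
  "((\<lambda>x. ec (Complex x y) ^ m * cnj (ec (Complex x y) ^ n)) has_integral (if m = n then of_real (exp (- 4 * pi * real n * y)) else 0)) {-1/2..1/2}"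
proof (cases "m = n")
  case True
  have "ec (Complex x y) ^ m * cnj (ec (Complex x y) ^ n) = of_real (exp (- 4 * pi * real n * y))" for x
  proof -
    have "(norm (ec (Complex x y) ^ n))\<^sup>2 = exp (- 4 * pi * real n * y)"
      by (simp add: norm_power norm_ec power_mult[symmetric] exp_of_nat_mult[symmetric] mult_ac)
    thus ?thesis using True by (simp add: complex_norm_square[symmetric] del: of_real_power complex_cnj_power)
  qed
  thus ?thesis using True has_integral_const_real[of "complex_of_real (exp (- 4 * pi * real n * y))" "-1/2" "1/2"] by simp
next
  case False
  define d where "d = of_int (int m - int n) * (2 * of_real pi * \<i>)"
  have d0: "d \<noteq> 0" using False by (simp add: d_def)
  define A where "A = of_real (exp (- 2 * pi * (real m + real n) * y)) / d"
  have e: "ec (Complex x y) ^ m * cnj (ec (Complex x y) ^ n) = A * d * exp (d * of_real x)" for x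
  proof -
    have 1: "ec (Complex x y) ^ m = exp (of_nat m * (2 * of_real pi * \<i> * Complex x y))"
      by (simp add: ec_def exp_of_nat_mult)
    have 2: "cnj (ec (Complex x y) ^ n) = exp (of_nat n * (- 2 * of_real pi * \<i> * Complex x (- y)))"
    proof -
      have "cnj (ec (Complex x y)) = exp (- 2 * of_real pi * \<i> * Complex x (- y))"
        by (simp add: ec_def exp_cnj complex_cnj)
      thus ?thesis by (simp only: complex_cnj_power exp_of_nat_mult)
    qed
    have "of_nat m * (2 * of_real pi * \<i> * Complex x y) + of_nat n * (- 2 * of_real pi * \<i> * Complex x (- y)) =
        of_real (- 2 * pi * (real m + real n) * y) + d * of_real x"
      by (simp add: d_def complex_eq_iff algebra_simps)
    hence "ec (Complex x y) ^ m * cnj (ec (Complex x y) ^ n) = exp (of_real (- 2 * pi * (real m + real n) * y) + d * of_real x)"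
      by (simp only: 1 2 exp_add[symmetric])
    also have "\<dots> = of_real (exp (- 2 * pi * (real m + real n) * y)) * exp (d * of_real x)"
      by (simp only: exp_add exp_of_real)
    finally show ?thesis using d0 by (simp add: A_def)
  qed
  have "((\<lambda>x. A * d * exp (d * of_real x)) has_integral (A * exp (d * of_real (1/2)) - A * exp (d * of_real (-1/2)))) {-1/2..1/2}"
  proof (rule fundamental_theorem_of_calculus)
    fix x :: real
    have "((\<lambda>z. A * exp (d * z)) has_field_derivative (A * d * exp (d * of_real x))) (at (of_real x))"
      by (auto intro!: derivative_eq_intros)
    from has_vector_derivative_real_field[OF this]
    show "((\<lambda>x. A * exp (d * of_real x)) has_vector_derivative A * d * exp (d * of_real x)) (at x within {-1/2..1/2})" .
  qed simp
  also have "A * exp (d * of_real (1/2)) - A * exp (d * of_real (-1/2)) = 0"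
  proof -
    have "exp (d * of_real (1/2)) = exp (d * of_real (-1/2)) * exp d"
      by (simp add: exp_add[symmetric])
    moreover have "exp d = 1" using ec_of_int[of "int m - int n"] by (simp add: ec_def d_def mult_ac)
    ultimately show ?thesis by simp
  qed
  finally show ?thesis using False by (simp only: e if_False)
qed

text \<open>Bessel's inequality for a single coefficient: the square of |f - \<alpha>_n q^n| has
  nonnegative integral over the segment. Uniform convergence there allows the cross term to be
  integrated termwise.\<close>

lemma q_expansion_segment_bound:
  assumes f: "q_expansion f \<alpha>" and y: "y > 0"
  shows "ennreal ((norm (\<alpha> n))\<^sup>2 * exp (- 4 * pi * real n * y)) \<le> (\<integral>\<^sup>+x. ennreal (indicator {-1/2..1/2} x * (norm (f (Complex x y)))\<^sup>2) \<partial>lborel)"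
proof -
  define E where "E = (\<lambda>x. ec (Complex x y) ^ n)"
  define \<phi> where "\<phi> = (\<lambda>x. f (Complex x y))"
  define M where "M = exp (- 4 * pi * real n * y)"
  define t where "t = exp (- 2 * pi * y)"
  have nec: "norm (ec (Complex x y)) = t" for x by (simp add: norm_ec t_def)
  have t: "0 < t" "t < 1" using y by (auto simp: t_def)
  have cE: "continuous_on S (\<lambda>x. ec (Complex x y) ^ m)" for S m
    unfolding ec_def Complex_eq by (intro continuous_intros)
  have c\<phi>: "continuous_on S \<phi>" for S
  proof -
    have "continuous_on upper_half_plane f"
      using q_expansion_holomorphic[OF f] by (rule holomorphic_on_imp_continuous_on)
    moreover have "continuous_on S (\<lambda>x. Complex x y)" unfolding Complex_eq by (intro continuous_intros)
    ultimately show ?thesis unfolding \<phi>_def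
      by (rule continuous_on_compose2) (use y in auto)
  qed
  have "uniform_limit {-1/2..1/2} (\<lambda>N x. \<Sum>m<N. \<alpha> m * ec (Complex x y) ^ m * cnj (E x)) (\<lambda>x. suminf (\<lambda>m. \<alpha> m * ec (Complex x y) ^ m * cnj (E x))) sequentially"
  proof (rule Weierstrass_m_test)
    show "norm (\<alpha> m * ec (Complex x y) ^ m * cnj (E x)) \<le> norm (\<alpha> m) * t ^ m" for m x
    proof -
      have "norm (\<alpha> m * ec (Complex x y) ^ m * cnj (E x)) = norm (\<alpha> m) * t ^ m * t ^ n"
        by (simp add: norm_mult norm_power nec E_def)
      also have "\<dots> \<le> norm (\<alpha> m) * t ^ m * 1" using t by (intro mult_left_mono power_le_one) auto
      finally show ?thesis by simp
    qed
    show "summable (\<lambda>m. norm (\<alpha> m) * t ^ m)" using q_expansion_abs_summable[OF f, of t] t by simp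
  qed
  moreover have "suminf (\<lambda>m. \<alpha> m * ec (Complex x y) ^ m * cnj (E x)) = \<phi> x * cnj (E x)" for x
  proof -
    have "(\<lambda>m. \<alpha> m * ec (Complex x y) ^ m * cnj (E x)) sums (\<phi> x * cnj (E x))"
      unfolding \<phi>_def using y by (intro sums_mult2 q_expansion_sums[OF f]) simp
    thus ?thesis by (simp add: sums_iff)
  qed
  ultimately have ul: "uniform_limit {-1/2..1/2} (\<lambda>N x. \<Sum>m<N. \<alpha> m * ec (Complex x y) ^ m * cnj (E x)) (\<lambda>x. \<phi> x * cnj (E x)) sequentially"
    by simp
  obtain I J where IJ: "\<And>N. ((\<lambda>x. \<Sum>m<N. \<alpha> m * ec (Complex x y) ^ m * cnj (E x)) has_integral I N) {-1/2..1/2}"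
      "((\<lambda>x. \<phi> x * cnj (E x)) has_integral J) {-1/2..1/2}" "I \<longlonglongrightarrow> J"
  proof (rule uniform_limit_integral[OF ul])
    show "continuous_on {-1/2..1/2} (\<lambda>x. \<Sum>m<N. \<alpha> m * ec (Complex x y) ^ m * cnj (E x))" for N
      unfolding E_def by (intro continuous_intros cE)
  qed auto
  have I: "I N = (\<Sum>m<N. \<alpha> m * (if m = n then of_real M else 0))" for N
  proof -
    have "((\<lambda>x. \<Sum>m<N. \<alpha> m * (ec (Complex x y) ^ m * cnj (E x))) has_integral (\<Sum>m<N. \<alpha> m * (if m = n then of_real M else 0))) {-1/2..1/2}"
      unfolding E_def M_def by (intro has_integral_sum has_integral_mult_right has_integral_ec_orthogonal) auto
    with IJ(1)[of N] show ?thesis by (simp add: mult.assoc has_integral_unique)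
  qed
  have "I N = \<alpha> n * of_real M" if "N > n" for N
    unfolding I using that by (simp add: if_distrib[of "\<lambda>x. _ * x"] sum.delta cong: if_cong)
  hence "eventually (\<lambda>N. I N = \<alpha> n * of_real M) sequentially"
    by (intro eventually_sequentiallyI[of "Suc n"]) auto
  hence "I \<longlonglongrightarrow> \<alpha> n * of_real M" by (rule tendsto_eventually)
  hence J: "J = \<alpha> n * of_real M" using IJ(3) LIMSEQ_unique by blast
  have i1: "((\<lambda>x. Re (cnj (\<alpha> n) * (\<phi> x * cnj (E x)))) has_integral (norm (\<alpha> n))\<^sup>2 * M) {-1/2..1/2}"
  proof -
    have "((\<lambda>x. cnj (\<alpha> n) * (\<phi> x * cnj (E x))) has_integral cnj (\<alpha> n) * J) {-1/2..1/2}"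
      by (intro has_integral_mult_right IJ)
    hence "((\<lambda>x. Re (cnj (\<alpha> n) * (\<phi> x * cnj (E x)))) has_integral Re (cnj (\<alpha> n) * J)) {-1/2..1/2}"
      by (rule has_integral_Re)
    also have "cnj (\<alpha> n) * J = of_real ((norm (\<alpha> n))\<^sup>2 * M)"
      unfolding of_real_mult complex_norm_square by (simp add: J mult_ac)
    finally show ?thesis by simp
  qed
  have nE: "(norm (E x))\<^sup>2 = M" for x
    by (simp add: E_def norm_power nec t_def M_def power_mult[symmetric] exp_of_nat_mult[symmetric] mult_ac)
  have "((\<lambda>x. (norm (\<phi> x))\<^sup>2) has_integral integral {-1/2..1/2} (\<lambda>x. (norm (\<phi> x))\<^sup>2)) {-1/2..1/2}"
    by (intro integrable_integral integrable_continuous_interval continuous_intros c\<phi>)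
  note i2 = this
  have i3: "((\<lambda>x::real. (norm (\<alpha> n))\<^sup>2 * M) has_integral (norm (\<alpha> n))\<^sup>2 * M) {-1/2..1/2}"
    using has_integral_const_real[of "(norm (\<alpha> n))\<^sup>2 * M" "-1/2" "1/2"] by simp
  have "((\<lambda>x. (norm (\<phi> x))\<^sup>2 - 2 * Re (cnj (\<alpha> n) * (\<phi> x * cnj (E x))) + (norm (\<alpha> n))\<^sup>2 * M) has_integral
      integral {-1/2..1/2} (\<lambda>x. (norm (\<phi> x))\<^sup>2) - 2 * ((norm (\<alpha> n))\<^sup>2 * M) + (norm (\<alpha> n))\<^sup>2 * M) {-1/2..1/2}"
    by (rule has_integral_add[OF has_integral_diff[OF i2 has_integral_mult_right[OF i1]] i3])
  moreover have "(norm (\<phi> x))\<^sup>2 - 2 * Re (cnj (\<alpha> n) * (\<phi> x * cnj (E x))) + (norm (\<alpha> n))\<^sup>2 * M \<ge> 0" for x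
  proof -
    have "(norm (\<phi> x - \<alpha> n * E x))\<^sup>2 = (norm (\<phi> x))\<^sup>2 - 2 * Re (cnj (\<alpha> n) * (\<phi> x * cnj (E x))) + (norm (\<alpha> n))\<^sup>2 * M"
      unfolding nE[of x, symmetric] by (simp only: cmod_power2) (simp add: power2_eq_square algebra_simps)
    thus ?thesis by (metis zero_le_power2)
  qed
  ultimately have "0 \<le> integral {-1/2..1/2} (\<lambda>x. (norm (\<phi> x))\<^sup>2) - 2 * ((norm (\<alpha> n))\<^sup>2 * M) + (norm (\<alpha> n))\<^sup>2 * M"
    by (rule has_integral_nonneg)
  hence le: "(norm (\<alpha> n))\<^sup>2 * M \<le> integral {-1/2..1/2} (\<lambda>x. (norm (\<phi> x))\<^sup>2)" by linarith
  have "(\<integral>\<^sup>+x. ennreal (indicator {-1/2..1/2} x * (norm (\<phi> x))\<^sup>2) \<partial>lborel) = ennreal (integral {-1/2..1/2} (\<lambda>x. (norm (\<phi> x))\<^sup>2))"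
    by (rule nn_integral_has_integral_lebesgue[OF _ i2]) auto
  with le show ?thesis unfolding \<phi>_def M_def by (simp add: ennreal_leI)
qed

definition cusp_strip :: "complex set" where
  "cusp_strip = {z. \<bar>Re z\<bar> \<le> 1/2 \<and> Im z \<ge> 1}"

text \<open>A row with c = 0 has d = 1 or d = -1, and for c nonzero |c z + d| \<ge> |c| Im z \<ge>
  1. As this works at every level, the coefficient bound derived from the strip is uniform in
  N.\<close>

lemma cusp_strip_subset: "N \<ge> 1 \<Longrightarrow> cusp_strip \<subseteq> fundamental_domain N"
proof
  fix z assume N: "N \<ge> 1" and z: "z \<in> cusp_strip"
  have "norm (of_int (A $ 2 $ 1) * z + of_int (A $ 2 $ 2)) \<ge> 1" if A: "A \<in> Gamma0 N" for A
  proof (cases "A $ 2 $ 1 = 0")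
    case True
    hence "A $ 1 $ 1 * A $ 2 $ 2 = 1" using A by (simp add: Gamma0_iff)
    hence "\<bar>A $ 2 $ 2\<bar> = 1" by (metis abs_mult abs_zmult_eq_1 mult.commute abs_1)
    hence "\<bar>real_of_int (A $ 2 $ 2)\<bar> = 1" by linarith
    thus ?thesis using True by simp
  next
    case False
    hence "\<bar>A $ 2 $ 1\<bar> \<ge> 1" by simp
    hence "\<bar>real_of_int (A $ 2 $ 1)\<bar> \<ge> 1" by linarith
    hence "1 * 1 \<le> \<bar>real_of_int (A $ 2 $ 1)\<bar> * Im z" using z by (intro mult_mono) (auto simp: cusp_strip_def)
    also have "\<dots> = \<bar>Im (of_int (A $ 2 $ 1) * z + of_int (A $ 2 $ 2))\<bar>" using z by (simp add: cusp_strip_def abs_mult)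
    also have "\<dots> \<le> norm (of_int (A $ 2 $ 1) * z + of_int (A $ 2 $ 2))" by (rule abs_Im_le_cmod)
    finally show ?thesis by simp
  qed
  thus "z \<in> fundamental_domain N" using z by (simp add: fundamental_domain_def cusp_strip_def)
qed

lemma cusp_strip_borel [measurable]: "cusp_strip \<in> sets borel"
  unfolding cusp_strip_def by measurable

lemma measurable_upper_half_plane_holomorphic:
  assumes "f holomorphic_on upper_half_plane" "\<And>z. z \<notin> upper_half_plane \<Longrightarrow> f z = 0"
  shows "f \<in> borel_measurable borel"
proof -
  have "(\<lambda>z. indicator upper_half_plane z *\<^sub>R f z) \<in> borel_measurable borel"
    by (intro borel_measurable_continuous_on_indicator holomorphic_on_imp_continuous_on assms borel_open open_upper_half_plane)
  also have "(\<lambda>z. indicator upper_half_plane z *\<^sub>R f z) = f"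
    using assms(2) by (auto simp: fun_eq_iff indicator_def)
  finally show ?thesis .
qed

text \<open>The Gamma integral over all \<open>y > 0\<close> gives the constant of Petersson's formula; the first term on the
  right bounds the part \<open>0 < y < 1\<close>, which lies outside the strip.\<close>

lemma cusp_strip_coeff_bound:
  assumes f: "q_expansion f \<alpha>" and fm [measurable]: "f \<in> borel_measurable borel" and k: "k \<ge> 2" and n: "n > 0"
  shows "ennreal (pet_const k * (norm (rho k f n))\<^sup>2) \<le> ennreal (real n ^ (k - 1) * (norm (rho k f n))\<^sup>2) +
    (\<integral>\<^sup>+z\<in>cusp_strip. ennreal ((norm (f z))\<^sup>2 * pet_weight k z) \<partial>lborel)"
proof -
  define c where "c = 4 * pi * real n"
  have c: "c > 0" using n by (simp add: c_def)
  define A where "A = (norm (\<alpha> n))\<^sup>2"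
  have A: "A = real n ^ (k - 1) * (norm (rho k f n))\<^sup>2"
  proof -
    have "norm (\<alpha> n) = norm (rho k f n) * real n powr ((real k - 1) / 2)"
      using q_expansion_coeff_eq_rho[OF f, of n k] by (simp add: norm_mult)
    moreover have "(real n powr ((real k - 1) / 2))\<^sup>2 = real n ^ (k - 1)"
      using n k by (simp add: powr_powr powr_realpow[symmetric] power2_eq_square powr_add[symmetric] of_nat_diff)
    ultimately show ?thesis by (simp add: A_def power_mult_distrib)
  qed
  define g where "g = (\<lambda>y. y ^ k / y\<^sup>2 * exp (- c * y))"
  have g0: "g y \<ge> 0" if "y \<ge> 0" for y using that by (simp add: g_def)
  have "ennreal (pet_const k * (norm (rho k f n))\<^sup>2) = ennreal (A * (Gamma (real k - 1) / c ^ (k - 1)))"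
    unfolding A using n by (simp add: c_def pet_const_def power_mult_distrib mult_ac)
  also have "\<dots> = ennreal A * (\<integral>\<^sup>+y. ennreal (indicator {0<..} y * g y) \<partial>lborel)"
    unfolding g_def nn_integral_power_exp[OF c k] by (rule ennreal_mult') (simp add: A_def)
  also have "\<dots> \<le> ennreal A * ((\<integral>\<^sup>+y. indicator {0..1::real} y \<partial>lborel) + (\<integral>\<^sup>+y. ennreal (indicator {1..} y * g y) \<partial>lborel))"
  proof (intro mult_left_mono)
    have "(\<integral>\<^sup>+y. ennreal (indicator {0<..} y * g y) \<partial>lborel) \<le> (\<integral>\<^sup>+y. indicator {0..1::real} y + ennreal (indicator {1..} y * g y) \<partial>lborel)"
    proof (rule nn_integral_mono)
      fix y :: real
      have "g y \<le> 1" if "0 < y" "y < 1"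
      proof -
        have "y ^ k / y\<^sup>2 = y ^ (k - 2)" using that k by (simp add: power_diff)
        also have "\<dots> \<le> 1" using that by (intro power_le_one) auto
        finally have "g y \<le> 1 * 1" unfolding g_def using that c by (intro mult_mono) auto
        thus ?thesis by simp
      qed
      thus "ennreal (indicator {0<..} y * g y) \<le> indicator {0..1::real} y + ennreal (indicator {1..} y * g y)"
        by (cases "0 < y"; cases "y < 1") (auto simp: indicator_def ennreal_leI)
    qed
    also have "\<dots> = (\<integral>\<^sup>+y. indicator {0..1::real} y \<partial>lborel) + (\<integral>\<^sup>+y. ennreal (indicator {1..} y * g y) \<partial>lborel)"
      by (subst nn_integral_add) (auto simp: g_def nn_integral_indicator[of "{0..1::real}" lborel])
    finally show "(\<integral>\<^sup>+y. ennreal (indicator {0<..} y * g y) \<partial>lborel) \<le> (\<integral>\<^sup>+y. indicator {0..1::real} y \<partial>lborel) + (\<integral>\<^sup>+y. ennreal (indicator {1..} y * g y) \<partial>lborel)" .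
  qed simp
  also have "(\<integral>\<^sup>+y. indicator {0..1::real} y \<partial>lborel) = ennreal (1::real)" by simp
  also have "ennreal A * (ennreal 1 + (\<integral>\<^sup>+y. ennreal (indicator {1..} y * g y) \<partial>lborel)) =
     ennreal A + (\<integral>\<^sup>+y. ennreal A * ennreal (indicator {1..} y * g y) \<partial>lborel)"
    by (subst nn_integral_cmult) (auto simp: g_def distrib_left)
  also have "\<dots> \<le> ennreal A + (\<integral>\<^sup>+y. (\<integral>\<^sup>+x. ennreal ((norm (f (Complex x y)))\<^sup>2 * pet_weight k (Complex x y)) * indicator cusp_strip (Complex x y) \<partial>lborel) \<partial>lborel)"
  proof (intro add_left_mono nn_integral_mono)
    fix y :: real
    show "ennreal A * ennreal (indicator {1..} y * g y) \<le> (\<integral>\<^sup>+x. ennreal ((norm (f (Complex x y)))\<^sup>2 * pet_weight k (Complex x y)) * indicator cusp_strip (Complex x y) \<partial>lborel)"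
    proof (cases "y \<ge> 1")
      case True
      hence y: "y > 0" by simp
      have w: "y ^ k / y\<^sup>2 \<ge> 0" using y by simp
      have "ennreal A * ennreal (indicator {1..} y * g y) = ennreal (y ^ k / y\<^sup>2) * ennreal (A * exp (- c * y))"
        using True w by (simp add: g_def A_def ennreal_mult'[symmetric] mult_ac)
      also have "A * exp (- c * y) = (norm (\<alpha> n))\<^sup>2 * exp (- 4 * pi * real n * y)" by (simp add: A_def c_def)
      also have "ennreal (y ^ k / y\<^sup>2) * ennreal ((norm (\<alpha> n))\<^sup>2 * exp (- 4 * pi * real n * y)) \<le>
          ennreal (y ^ k / y\<^sup>2) * (\<integral>\<^sup>+x. ennreal (indicator {-1/2..1/2} x * (norm (f (Complex x y)))\<^sup>2) \<partial>lborel)"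
        by (intro mult_left_mono q_expansion_segment_bound[OF f y]) simp
      also have "\<dots> = (\<integral>\<^sup>+x. ennreal (y ^ k / y\<^sup>2) * ennreal (indicator {-1/2..1/2} x * (norm (f (Complex x y)))\<^sup>2) \<partial>lborel)"
        by (rule nn_integral_cmult [symmetric]) simp
      also have "\<dots> = (\<integral>\<^sup>+x. ennreal ((norm (f (Complex x y)))\<^sup>2 * pet_weight k (Complex x y)) * indicator cusp_strip (Complex x y) \<partial>lborel)"
        using True w by (intro nn_integral_cong) (auto simp: indicator_def cusp_strip_def pet_weight_def ennreal_mult'[symmetric] mult_ac abs_le_iff)
      finally show ?thesis .
    qed simp
  qed
  also have "(\<integral>\<^sup>+y. (\<integral>\<^sup>+x. ennreal ((norm (f (Complex x y)))\<^sup>2 * pet_weight k (Complex x y)) * indicator cusp_strip (Complex x y) \<partial>lborel) \<partial>lborel) =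
      (\<integral>\<^sup>+z\<in>cusp_strip. ennreal ((norm (f z))\<^sup>2 * pet_weight k z) \<partial>lborel)"
    by (rule nn_integral_complex [symmetric]) measurable
  finally show ?thesis unfolding A .
qed

section \<open>Square-integrable functions and the Petersson product\<close>

lemma measurable_cnj [measurable]:
  assumes "f \<in> borel_measurable M"
  shows "(\<lambda>x. cnj (f x)) \<in> borel_measurable M"
  by (rule measurable_compose[OF assms borel_measurable_continuous_onI]) (intro continuous_intros)

lemma fundamental_domain_borel [measurable]: "fundamental_domain N \<in> sets borel"
proof -
  have "fundamental_domain N = {z. Im z > 0} \<inter> {z. \<bar>Re z\<bar> \<le> 1/2} \<inter> (\<Inter>A\<in>Gamma0 N. {z. norm (mob_j A z) \<ge> 1})"
    by (auto simp: fundamental_domain_def mob_j_def)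
  moreover have "closed (\<Inter>A\<in>Gamma0 N. {z. norm (mob_j A z) \<ge> 1})"
    unfolding mob_j_def by (intro closed_INT ballI closed_Collect_le continuous_intros)
  moreover have "{z. Im z > 0} \<in> sets borel" using open_halfspace_Im_gt[of 0] by (rule borel_open)
  moreover have "{z. \<bar>Re z\<bar> \<le> 1/2} \<in> sets borel" by (intro borel_closed closed_Collect_le continuous_intros)
  ultimately show ?thesis by (simp add: sets.Int borel_closed)
qed

lemma fundamental_domain_Im_pos: "z \<in> fundamental_domain N \<Longrightarrow> Im z > 0"
  by (simp add: fundamental_domain_def)

definition pet_measure :: "nat \<Rightarrow> nat \<Rightarrow> complex measure" where
  "pet_measure k N = density lborel (\<lambda>z. ennreal (indicator (fundamental_domain N) z * pet_weight k z))"

lemma sets_pet_measure [measurable_cong, simp]: "sets (pet_measure k N) = sets borel"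
  by (simp add: pet_measure_def)

lemma pet_weight_indicator_nonneg: "indicator (fundamental_domain N) z * pet_weight k z \<ge> 0"
  using fundamental_domain_Im_pos[of z N] by (auto simp: indicator_def intro: pet_weight_nonneg less_imp_le)

lemma petersson_eq:
  assumes [measurable]: "f \<in> borel_measurable borel" "g \<in> borel_measurable borel"
  shows "petersson k N f g = (\<integral>z. f z * cnj (g z) \<partial>pet_measure k N)"
proof -
  have "(\<integral>z. f z * cnj (g z) \<partial>pet_measure k N) =
      (\<integral>z. (indicator (fundamental_domain N) z * pet_weight k z) *\<^sub>R (f z * cnj (g z)) \<partial>lborel)"
    unfolding pet_measure_def by (rule integral_density) (auto intro: pet_weight_indicator_nonneg)
  also have "\<dots> = petersson k N f g"
    unfolding petersson_def set_lebesgue_integral_def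
    by (intro Bochner_Integration.integral_cong) (auto simp: pet_weight_def indicator_def scaleR_conv_of_real mult_ac)
  finally show ?thesis by simp
qed

lemma nn_integral_pet_measure:
  fixes f :: "complex \<Rightarrow> complex"
  assumes [measurable]: "f \<in> borel_measurable borel"
  shows "(\<integral>\<^sup>+z. ennreal ((norm (f z))\<^sup>2) \<partial>pet_measure k N) =
    (\<integral>\<^sup>+z\<in>fundamental_domain N. ennreal ((norm (f z))\<^sup>2 * pet_weight k z) \<partial>lborel)"
  unfolding pet_measure_def
proof (subst nn_integral_density)
  show "(\<integral>\<^sup>+z. ennreal (indicator (fundamental_domain N) z * pet_weight k z) * ennreal ((norm (f z))\<^sup>2) \<partial>lborel) =
     (\<integral>\<^sup>+z\<in>fundamental_domain N. ennreal ((norm (f z))\<^sup>2 * pet_weight k z) \<partial>lborel)"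
    by (intro nn_integral_cong) (auto simp: indicator_def ennreal_mult'' mult.commute)
qed measurable

text \<open>Carried as an explicit condition, because inner products and norms are Bochner
  integrals, which default to 0 for nonintegrable functions.\<close>

definition sq_int :: "complex measure \<Rightarrow> (complex \<Rightarrow> complex) \<Rightarrow> bool" where
  "sq_int M f \<longleftrightarrow> f \<in> borel_measurable M \<and> integrable M (\<lambda>z. (norm (f z))\<^sup>2)"

lemma borel_measurable_pet_measure: "borel_measurable (pet_measure k N) = borel_measurable borel"
  by (rule measurable_cong_sets) simp_all

definition inner_int :: "complex measure \<Rightarrow> (complex \<Rightarrow> complex) \<Rightarrow> (complex \<Rightarrow> complex) \<Rightarrow> complex" where
  "inner_int M f g = (\<integral>z. f z * cnj (g z) \<partial>M)"

definition norm_sq :: "complex measure \<Rightarrow> (complex \<Rightarrow> complex) \<Rightarrow> real" where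
  "norm_sq M f = (\<integral>z. (norm (f z))\<^sup>2 \<partial>M)"

lemma norm_sq_nonneg: "norm_sq M f \<ge> 0"
  by (simp add: norm_sq_def)

lemma inner_int_self: "inner_int M f f = of_real (norm_sq M f)"
  unfolding inner_int_def norm_sq_def by (simp add: complex_norm_square[symmetric] del: of_real_power)

lemma sq_int_inner_integrable:
  assumes "sq_int M f" "sq_int M g"
  shows "integrable M (\<lambda>z. f z * cnj (g z))"
proof (rule Bochner_Integration.integrable_bound)
  show "integrable M (\<lambda>z. (norm (f z))\<^sup>2 + (norm (g z))\<^sup>2)"
    using assms by (auto simp: sq_int_def)
  show "(\<lambda>z. f z * cnj (g z)) \<in> borel_measurable M" using assms by (auto simp: sq_int_def)
  have "norm (f z * cnj (g z)) \<le> norm ((norm (f z))\<^sup>2 + (norm (g z))\<^sup>2)" for z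
  proof -
    have "2 * (norm (f z) * norm (g z)) \<le> (norm (f z))\<^sup>2 + (norm (g z))\<^sup>2"
      using sum_squares_bound[of "norm (f z)" "norm (g z)"] by simp
    moreover have "0 \<le> norm (f z) * norm (g z)" by simp
    ultimately have "norm (f z) * norm (g z) \<le> (norm (f z))\<^sup>2 + (norm (g z))\<^sup>2" by linarith
    thus ?thesis by (simp add: norm_mult)
  qed
  thus "AE z in M. norm (f z * cnj (g z)) \<le> norm ((norm (f z))\<^sup>2 + (norm (g z))\<^sup>2)" by simp
qed

lemma norm_add_sq: "(norm (a + b))\<^sup>2 = (norm a)\<^sup>2 + (norm b)\<^sup>2 + 2 * Re (a * cnj b)" for a b :: complex
  by (simp only: cmod_power2) (simp add: power2_eq_square algebra_simps)

lemma sq_int_add: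
  assumes "sq_int M f" "sq_int M g"
  shows "sq_int M (\<lambda>z. f z + g z)" "norm_sq M (\<lambda>z. f z + g z) = norm_sq M f + norm_sq M g + 2 * Re (inner_int M f g)"
proof -
  note i = sq_int_inner_integrable[OF assms]
  have "integrable M (\<lambda>z. (norm (f z))\<^sup>2)" "integrable M (\<lambda>z. (norm (g z))\<^sup>2)" using assms by (auto simp: sq_int_def)
  note j = this
  have R: "integrable M (\<lambda>z. 2 * Re (f z * cnj (g z)))" by (intro integrable_mult_right integrable_Re i)
  show "sq_int M (\<lambda>z. f z + g z)" unfolding sq_int_def norm_add_sq
    by (intro conjI Bochner_Integration.integrable_add j R) (use assms in \<open>auto simp: sq_int_def\<close>)
  show "norm_sq M (\<lambda>z. f z + g z) = norm_sq M f + norm_sq M g + 2 * Re (inner_int M f g)"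
    by (simp only: norm_sq_def norm_add_sq inner_int_def Bochner_Integration.integral_add[OF Bochner_Integration.integrable_add[OF j] R]
        Bochner_Integration.integral_add[OF j] integral_mult_right_zero integral_Re[OF i])
qed

lemma sq_int_cmult:
  assumes "sq_int M f"
  shows "sq_int M (\<lambda>z. c * f z)" "norm_sq M (\<lambda>z. c * f z) = (norm c)\<^sup>2 * norm_sq M f"
  using assms by (auto simp: sq_int_def norm_sq_def norm_mult power_mult_distrib)

lemma sq_int_sum:
  assumes "finite I" "\<And>i. i \<in> I \<Longrightarrow> sq_int M (f i)"
  shows "sq_int M (\<lambda>z. \<Sum>i\<in>I. f i z)"
  using assms by (induction I rule: finite_induct) (auto intro!: sq_int_add, simp add: sq_int_def)

lemma inner_int_cmult_left: "inner_int M (\<lambda>z. c * f z) g = c * inner_int M f g"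
  by (simp add: inner_int_def mult.assoc)

lemma inner_int_commute: "inner_int M g f = cnj (inner_int M f g)"
proof -
  have "inner_int M g f = (\<integral>z. cnj (f z * cnj (g z)) \<partial>M)"
    by (simp add: inner_int_def mult.commute del: integral_cnj)
  also have "\<dots> = cnj (inner_int M f g)" unfolding inner_int_def by (rule Bochner_Integration.integral_cnj)
  finally show ?thesis .
qed

lemma inner_int_cmult_right: "inner_int M f (\<lambda>z. c * g z) = cnj c * inner_int M f g"
  by (simp add: inner_int_commute[of M f] inner_int_cmult_left)

lemma inner_int_sum_left:
  assumes "finite I" "\<And>i. i \<in> I \<Longrightarrow> sq_int M (f i)" "sq_int M g"
  shows "inner_int M (\<lambda>z. \<Sum>i\<in>I. f i z) g = (\<Sum>i\<in>I. inner_int M (f i) g)"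
  using assms unfolding inner_int_def sum_distrib_right
  by (intro Bochner_Integration.integral_sum sq_int_inner_integrable) auto

lemma inner_int_sum_right:
  assumes "finite I" "\<And>i. i \<in> I \<Longrightarrow> sq_int M (f i)" "sq_int M g"
  shows "inner_int M g (\<lambda>z. \<Sum>i\<in>I. f i z) = (\<Sum>i\<in>I. inner_int M g (f i))"
  by (simp add: inner_int_commute[of M g] inner_int_sum_left[OF assms])

lemma inner_int_orthonormal_sum:
  assumes B: "finite B" "\<And>f. f \<in> B \<Longrightarrow> sq_int M f"
    and o: "\<And>f g. f \<in> B \<Longrightarrow> g \<in> B \<Longrightarrow> inner_int M f g = (if f = g then 1 else 0)"
  shows "inner_int M (\<lambda>z. \<Sum>f\<in>B. a f * f z) (\<lambda>z. \<Sum>f\<in>B. b f * f z) = (\<Sum>f\<in>B. a f * cnj (b f))"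
    and "norm_sq M (\<lambda>z. \<Sum>f\<in>B. a f * f z) = (\<Sum>f\<in>B. (norm (a f))\<^sup>2)"
proof -
  have *: "inner_int M (\<lambda>z. \<Sum>f\<in>B. a f * f z) (\<lambda>z. \<Sum>f\<in>B. b f * f z) = (\<Sum>f\<in>B. a f * cnj (b f))" for a b
  proof -
    have "inner_int M (\<lambda>z. \<Sum>f\<in>B. a f * f z) (\<lambda>z. \<Sum>f\<in>B. b f * f z) = (\<Sum>f\<in>B. \<Sum>g\<in>B. a f * (cnj (b g) * inner_int M f g))"
      using B by (simp add: inner_int_sum_left inner_int_sum_right sq_int_cmult sq_int_sum inner_int_cmult_left inner_int_cmult_right sum_distrib_left)
    also have "\<dots> = (\<Sum>f\<in>B. \<Sum>g\<in>B. if f = g then a f * cnj (b f) else 0)"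
      using o by (intro sum.cong) auto
    also have "\<dots> = (\<Sum>f\<in>B. a f * cnj (b f))" using B by (simp add: sum.delta)
    finally show ?thesis .
  qed
  show "inner_int M (\<lambda>z. \<Sum>f\<in>B. a f * f z) (\<lambda>z. \<Sum>f\<in>B. b f * f z) = (\<Sum>f\<in>B. a f * cnj (b f))" by (rule *)
  have "of_real (norm_sq M (\<lambda>z. \<Sum>f\<in>B. a f * f z)) = (of_real (\<Sum>f\<in>B. (norm (a f))\<^sup>2) :: complex)"
    unfolding inner_int_self[symmetric] * by (simp add: complex_norm_square del: of_real_power)
  thus "norm_sq M (\<lambda>z. \<Sum>f\<in>B. a f * f z) = (\<Sum>f\<in>B. (norm (a f))\<^sup>2)" by (simp only: of_real_eq_iff)
qed

text \<open>The default value 0 of a divergent integral is turned to advantage: an element of norm 1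
  must be square integrable. Basis elements thus need no growth estimate at the cusps.\<close>

lemma sq_int_if_inner_nonzero:
  assumes "f \<in> borel_measurable M" "inner_int M f f \<noteq> 0"
  shows "sq_int M f"
proof -
  have "norm_sq M f \<noteq> 0" using assms(2) by (simp add: inner_int_self)
  hence "integrable M (\<lambda>z. (norm (f z))\<^sup>2)" unfolding norm_sq_def by (metis not_integrable_integral_eq)
  with assms show ?thesis by (simp add: sq_int_def)
qed

lemma coeff_bound_norm_sq:
  assumes f: "q_expansion f \<alpha>" and L: "sq_int (pet_measure k N) f" and k: "k \<ge> 2" and n: "n > 0" and N: "N \<ge> 1"
  shows "(pet_const k - real n ^ (k - 1)) * (norm (rho k f n))\<^sup>2 \<le> norm_sq (pet_measure k N) f"
proof -
  have fm: "f \<in> borel_measurable borel" using L by (simp add: sq_int_def borel_measurable_pet_measure)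
  have "ennreal (pet_const k * (norm (rho k f n))\<^sup>2) \<le> ennreal (real n ^ (k - 1) * (norm (rho k f n))\<^sup>2) +
    (\<integral>\<^sup>+z\<in>cusp_strip. ennreal ((norm (f z))\<^sup>2 * pet_weight k z) \<partial>lborel)"
    by (rule cusp_strip_coeff_bound[OF f fm k n])
  also have "\<dots> \<le> ennreal (real n ^ (k - 1) * (norm (rho k f n))\<^sup>2) +
     (\<integral>\<^sup>+z\<in>fundamental_domain N. ennreal ((norm (f z))\<^sup>2 * pet_weight k z) \<partial>lborel)"
    using cusp_strip_subset[OF N] by (intro add_left_mono nn_integral_mono mult_left_mono) (auto simp: indicator_def)
  also have "(\<integral>\<^sup>+z\<in>fundamental_domain N. ennreal ((norm (f z))\<^sup>2 * pet_weight k z) \<partial>lborel) = (\<integral>\<^sup>+z. ennreal ((norm (f z))\<^sup>2) \<partial>pet_measure k N)"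
    by (rule nn_integral_pet_measure[OF fm, symmetric])
  also have "\<dots> = ennreal (norm_sq (pet_measure k N) f)"
    unfolding norm_sq_def using L by (intro nn_integral_eq_integral) (auto simp: sq_int_def)
  also have "ennreal (real n ^ (k - 1) * (norm (rho k f n))\<^sup>2) + ennreal (norm_sq (pet_measure k N) f) =
     ennreal (real n ^ (k - 1) * (norm (rho k f n))\<^sup>2 + norm_sq (pet_measure k N) f)"
    using norm_sq_nonneg by simp
  finally have "pet_const k * (norm (rho k f n))\<^sup>2 \<le> real n ^ (k - 1) * (norm (rho k f n))\<^sup>2 + norm_sq (pet_measure k N) f"
    using norm_sq_nonneg[of "pet_measure k N" f] by (subst (asm) ennreal_le_iff) auto
  thus ?thesis by (simp add: algebra_simps)
qed

section \<open>Reduction theory\<close>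

lemma fundamental_domain_1_bounds:
  assumes "z \<in> fundamental_domain 1"
  shows "Im z \<ge> 1/2" "\<bar>Re z\<bar> \<le> 1/2" "norm z \<ge> 1" "Im z > 0"
proof -
  have "mat2 0 (-1) 1 0 \<in> Gamma0 1" by (simp add: Gamma0_iff)
  moreover have "\<forall>A\<in>Gamma0 1. norm (mob_j A z) \<ge> 1" using assms by (simp add: fundamental_domain_def mob_j_def)
  ultimately have "norm (mob_j (mat2 0 (-1) 1 0) z) \<ge> 1" by blast
  thus n: "norm z \<ge> 1" by (simp add: mob_j_def)
  show r: "\<bar>Re z\<bar> \<le> 1/2" and i: "Im z > 0" using assms by (simp_all add: fundamental_domain_def)
  have "1 \<le> (norm z)\<^sup>2" using n by simp
  also have "\<dots> = (Re z)\<^sup>2 + (Im z)\<^sup>2" by (rule cmod_power2)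
  also have "(Re z)\<^sup>2 \<le> (1/2)\<^sup>2" using power_mono[OF r, of 2] by simp
  finally have "(1/2)\<^sup>2 \<le> (Im z)\<^sup>2" by (simp add: power2_eq_square)
  thus "Im z \<ge> 1/2" using i by (simp add: power2_le_iff_abs_le[of "1/2"] abs_le_square_iff[symmetric])
qed

lemma finite_int_box: "finite {x :: int \<times> int. \<bar>fst x\<bar> \<le> M \<and> \<bar>snd x\<bar> \<le> M}"
  by (rule finite_subset[of _ "{-M..M} \<times> {-M..M}"]) (auto simp: abs_le_iff)

lemma finite_small_linear_forms:
  assumes "Im z > 0"
  shows "finite {x \<in> coprime_pairs. norm (of_int (fst x) * z + of_int (snd x)) \<le> 1}"
proof -
  obtain \<kappa> :: real where kap: "\<kappa> > 0" "\<And>c d. \<kappa> * (1 + \<bar>of_int c\<bar>) * (1 + \<bar>of_int d\<bar>) \<le> (norm (of_int c * z + of_int d))\<^sup>2 \<or> c = 0 \<and> d = 0"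
    using norm_linear_form_ge[OF assms] by blast
  define M where "M = \<lceil>1 / \<kappa>\<rceil>"
  have "x \<in> {x. \<bar>fst x\<bar> \<le> M \<and> \<bar>snd x\<bar> \<le> M}"
    if x: "x \<in> coprime_pairs" and le: "norm (of_int (fst x) * z + of_int (snd x)) \<le> 1" for x
  proof -
    obtain c d where cd: "x = (c, d)" by (cases x)
    have "\<not> (c = 0 \<and> d = 0)" using x by (auto simp: cd coprime_pairs_def)
    hence "\<kappa> * (1 + \<bar>of_int c\<bar>) * (1 + \<bar>of_int d\<bar>) \<le> (norm (of_int c * z + of_int d))\<^sup>2" using kap(2)[of c d] by blast
    also have "\<dots> \<le> 1" using le by (simp add: cd power_le_one)
    finally have *: "\<kappa> * ((1 + \<bar>of_int c\<bar>) * (1 + \<bar>of_int d\<bar>)) \<le> 1" by (simp only: mult.assoc)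
    hence "(1 + \<bar>of_int c\<bar>) * (1 + \<bar>of_int d\<bar>) \<le> 1 / \<kappa>" using kap(1) by (simp add: pos_le_divide_eq mult.commute)
    moreover have "\<bar>real_of_int c\<bar> \<le> (1 + \<bar>of_int c\<bar>) * (1 + \<bar>of_int d\<bar>)" "\<bar>real_of_int d\<bar> \<le> (1 + \<bar>of_int c\<bar>) * (1 + \<bar>of_int d\<bar>)"
      by (auto simp: algebra_simps)
    ultimately have "\<bar>real_of_int c\<bar> \<le> of_int M" "\<bar>real_of_int d\<bar> \<le> of_int M"
      unfolding M_def using le_of_int_ceiling[of "1 / \<kappa>"] by linarith+
    thus ?thesis by (simp add: cd) linarith
  qed
  thus ?thesis by (intro finite_subset[OF _ finite_int_box[of M]]) auto
qed

text \<open>A row minimising |c z + d| maximises the imaginary part in the orbit; only finitely many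
  rows compete, since (0, 1) already has value 1. Rounding the real part then moves the point into
  the strip.\<close>

lemma reduction_to_fundamental_domain:
  assumes z: "Im z > 0"
  obtains A where "A \<in> Gamma0 1" "mobius A z \<in> fundamental_domain 1"
proof -
  define h where "h = (\<lambda>x :: int \<times> int. norm (of_int (fst x) * z + of_int (snd x)))"
  define X where "X = {x \<in> coprime_pairs. h x \<le> 1}"
  have "finite X" unfolding X_def h_def by (rule finite_small_linear_forms[OF z])
  moreover have "(0, 1) \<in> X" by (simp add: X_def h_def coprime_pairs_def)
  ultimately obtain x where x: "x \<in> X" "\<And>y. y \<in> X \<Longrightarrow> h x \<le> h y"
    using arg_min_if_finite[of X h] by (metis arg_min_least empty_iff)
  have min: "h x \<le> h y" if "y \<in> coprime_pairs" for y
    using x that by (cases "h y \<le> 1") (auto simp: X_def)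
  define A where "A = gamma_lift (fst x) (snd x)"
  have cop: "coprime (fst x) (snd x)" using x(1) by (auto simp: X_def coprime_pairs_def)
  note L = gamma_lift[OF cop, folded A_def]
  have jA: "norm (mob_j A z) = h x" by (simp add: mob_j_def L h_def)
  define t where "t = - round (Re (mobius A z))"
  define A' where "A' = mat2 1 t 0 1 ** A"
  have A': "A' \<in> Gamma0 1" unfolding A'_def by (rule Gamma0_mult[OF translate_in_Gamma0 L(1)])
  have mA': "mobius A' z = mobius A z + of_int t" "mob_j A' z = mob_j A z"
    unfolding A'_def mobius_mult[OF L(1) z] mob_j_mult[OF L(1) z] by (simp_all add: mobius_translate)
  have "mobius A' z \<in> fundamental_domain 1"
    unfolding fundamental_domain_def
  proof (intro CollectI conjI ballI)
    show "mobius A' z \<in> upper_half_plane" using Im_mobius_pos[OF A' z] by simp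
    show "\<bar>Re (mobius A' z)\<bar> \<le> 1/2"
      using of_int_round_abs_le[of "Re (mobius A z)"] by (simp add: mA' t_def abs_minus_commute)
    fix B assume B: "B \<in> Gamma0 1"
    have BA: "B ** A' \<in> Gamma0 1" by (rule Gamma0_mult[OF B A'])
    have "h x \<le> h ((B ** A') $ 2 $ 1, (B ** A') $ 2 $ 2)"
      by (rule min) (use coprime_lower_row[OF BA] in \<open>simp add: coprime_pairs_def\<close>)
    also have "\<dots> = norm (mob_j (B ** A') z)" by (simp add: h_def mob_j_def)
    also have "\<dots> = norm (mob_j B (mobius A' z)) * h x" by (simp add: mob_j_mult[OF A' z] norm_mult mA' jA)
    finally have "1 * h x \<le> norm (mob_j B (mobius A' z)) * h x" by simp
    moreover have "h x > 0" using mob_j_nonzero[OF L(1) z] jA by (metis zero_less_norm_iff)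
    ultimately have "1 \<le> norm (mob_j B (mobius A' z))" by (simp only: mult_le_cancel_right_pos)
    thus "cmod (of_int (B $ 2 $ 1) * mobius A' z + of_int (B $ 2 $ 2)) \<ge> 1" by (simp add: mob_j_def)
  qed
  with A' that show ?thesis by blast
qed

section \<open>Sup norms and a bound for Hecke eigenvalues\<close>

lemma weight_invariance:
  assumes "slash k f A z = f z" "A \<in> Gamma0 N" "Im z > 0"
  shows "norm (f (mobius A z)) * sqrt (Im (mobius A z)) ^ k = norm (f z) * sqrt (Im z) ^ k"
proof -
  have j: "norm (mob_j A z) > 0" using mob_j_nonzero[OF assms(2,3)] by simp
  have "f (mobius A z) = f z * mob_j A z ^ k"
    using assms(1) j by (simp add: slash_altdef field_simps)
  hence "norm (f (mobius A z)) = norm (f z) * norm (mob_j A z) ^ k" by (simp add: norm_mult norm_power)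
  moreover have "sqrt (Im (mobius A z)) = sqrt (Im z) / norm (mob_j A z)"
    using j by (simp add: Im_mobius[OF assms(2)] real_sqrt_divide)
  ultimately show ?thesis using j by (simp add: power_divide)
qed

text \<open>On the fundamental domain, where Im z \<ge> 1/2, exponential decay beats the power of Im
  z; invariance of |f| (Im z)^(k/2) carries the bound to the half plane.\<close>

lemma cusp_form_level_1_bounded:
  assumes f: "f \<in> cusp_forms k 1"
  obtains M where "\<And>z. Im z > 0 \<Longrightarrow> norm (f z) * sqrt (Im z) ^ k \<le> M"
proof -
  obtain \<alpha> where q: "q_expansion f \<alpha>" using cusp_form_q_expansion[OF f] by auto
  obtain C where C: "C \<ge> 0" "\<And>z. Im z \<ge> 1/2 \<Longrightarrow> norm (f z) \<le> C * exp (- 2 * pi * Im z)"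
    using q_expansion_decay[OF q, of "1/2"] by auto
  have F: "norm (f z) * sqrt (Im z) ^ k \<le> C * fact k" if z: "z \<in> fundamental_domain 1" for z
  proof -
    note b = fundamental_domain_1_bounds[OF z]
    define y where "y = Im z"
    have y: "y > 0" using b by (simp add: y_def)
    have "sqrt y ^ k \<le> (1 + y) ^ k"
    proof (intro power_mono)
      have "sqrt y \<le> sqrt ((1 + y)\<^sup>2)" using y by (intro real_sqrt_le_mono) (simp add: power2_eq_square algebra_simps)
      thus "sqrt y \<le> 1 + y" using y by simp
    qed (use y in simp)
    also have "(1 + y) ^ k / fact k \<le> exp (1 + y)"
    proof -
      have "sum (\<lambda>i. (1 + y) ^ i / fact i) {k} \<le> (\<Sum>i. (1 + y) ^ i / fact i)"
        using y summable_exp[of "1 + y"] by (intro sum_le_suminf) (auto simp: field_simps)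
      thus ?thesis by (simp add: exp_def field_simps)
    qed
    hence "(1 + y) ^ k \<le> fact k * exp (1 + y)" by (simp add: divide_le_eq mult.commute)
    finally have 1: "sqrt y ^ k \<le> fact k * exp (1 + y)" .
    have "exp (1 + y) * exp (- 2 * pi * y) \<le> 1"
    proof -
      have "2 * y \<ge> 1" using b by (simp add: y_def)
      moreover have "6 * y \<le> 2 * pi * y" using y pi_gt3 by simp
      ultimately have "1 + y - 2 * pi * y \<le> 0" using y by linarith
      thus ?thesis by (simp add: exp_add[symmetric])
    qed
    hence 2: "fact k * (exp (1 + y) * exp (- 2 * pi * y)) \<le> fact k * 1" by (intro mult_left_mono) auto
    have "norm (f z) * sqrt (Im z) ^ k \<le> (C * exp (- 2 * pi * y)) * (fact k * exp (1 + y))"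
      using C(2)[OF b(1)] 1 y C(1) unfolding y_def[symmetric] by (intro mult_mono) auto
    also have "\<dots> = C * (fact k * (exp (1 + y) * exp (- 2 * pi * y)))" by (simp only: mult_ac)
    also have "\<dots> \<le> C * (fact k * 1)" using 2 C(1) by (intro mult_left_mono) auto
    finally show ?thesis by simp
  qed
  have "norm (f z) * sqrt (Im z) ^ k \<le> C * fact k" if z: "Im z > 0" for z
  proof -
    obtain A where A: "A \<in> Gamma0 1" "mobius A z \<in> fundamental_domain 1"
      by (rule reduction_to_fundamental_domain[OF z])
    have "slash k f A z = f z" using f A(1) z by (simp add: cusp_forms_def)
    from weight_invariance[OF this A(1) z] F[OF A(2)] show ?thesis by simp
  qed
  with that show ?thesis by blast
qed

text \<open>The operator evaluates f at p + 1 points, and in terms of |f| (Im z)^(k/2) each of them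
  contributes at most its supremum S. The factor p^((k - 1)/2) is enlarged to p^(k/2), which costs
  sqrt p and yields p + 1. Boundedness makes S finite and f nonzero makes it positive.\<close>

lemma hecke_eigenvalue_bound:
  assumes f: "f \<in> cusp_forms k 1" "f \<noteq> 0" and p: "prime p" and hk: "hecke k p f = (\<lambda>z. l * f z)"
  shows "norm l \<le> real p + 1"
proof -
  define s where "s = (\<lambda>z. norm (f z) * sqrt (Im z) ^ k)"
  have p0: "real p > 0" using p prime_gt_0_nat by simp
  have p1: "real p \<ge> 1" using p prime_ge_1_nat[of p] by simp
  obtain M where M: "\<And>z. Im z > 0 \<Longrightarrow> s z \<le> M"
    using cusp_form_level_1_bounded[OF f(1)] unfolding s_def by blast
  have s0: "s z \<ge> 0" for z by (cases "Im z \<ge> 0") (use f in \<open>auto simp: s_def cusp_forms_def\<close>)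
  define S where "S = (SUP z\<in>{z. Im z > 0}. s z)"
  have bdd: "bdd_above (s ` {z. Im z > 0})" using M by (auto intro!: bdd_aboveI2)
  have sS: "s z \<le> S" if "Im z > 0" for z unfolding S_def by (rule cSUP_upper[OF _ bdd]) (use that in simp)
  obtain z0 where z0: "f z0 \<noteq> 0" using f(2) by (auto simp: fun_eq_iff)
  hence i0: "Im z0 > 0" using f(1) by (auto simp: cusp_forms_def)
  have "0 < s z0" using z0 i0 by (simp add: s_def)
  hence Spos: "S > 0" using sS[OF i0] by linarith
  have main: "norm l * s z \<le> (real p + 1) * S" if z: "Im z > 0" for z
  proof -
    define q where "q = sqrt (real p) ^ k"
    have q0: "q > 0" using p0 by (simp add: q_def)
    have qq: "q * q = real p ^ k" unfolding q_def power_mult_distrib[symmetric] using p0 by simp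
    have "real p powr ((real k - 1) / 2) \<le> real p powr (real k / 2)"
      using p1 by (intro powr_mono) auto
    also have "\<dots> = q"
    proof -
      have "q = sqrt (real p) powr real k" using p0 by (simp add: q_def powr_realpow)
      also have "sqrt (real p) = real p powr (1/2)" using p0 by (simp add: powr_half_sqrt)
      also have "(real p powr (1/2)) powr real k = real p powr (real k / 2)" by (simp add: powr_powr)
      finally show ?thesis by simp
    qed
    finally have pq: "real p powr ((real k - 1) / 2) \<le> q" .
    define w where "w = (\<lambda>b. (z + of_nat b) / of_nat p)"
    have Iw: "Im (w b) = Im z / real p" for b using p0 by (simp add: w_def Im_divide power2_eq_square)
    have "norm l * norm (f z) = norm (hecke k p f z)" by (simp add: hk norm_mult)
    also have "\<dots> = real p powr ((real k - 1) / 2) * norm (f (of_nat p * z) + 1 / of_nat p ^ k * (\<Sum>b<p. f (w b)))"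
      unfolding hecke_prime[OF p] w_def by (simp add: norm_mult)
    also have "\<dots> \<le> q * norm (f (of_nat p * z) + 1 / of_nat p ^ k * (\<Sum>b<p. f (w b)))"
      by (intro mult_right_mono pq) auto
    also have "\<dots> \<le> q * (norm (f (of_nat p * z)) + 1 / real p ^ k * (\<Sum>b<p. norm (f (w b))))"
    proof (intro mult_left_mono)
      have "norm (1 / of_nat p ^ k * (\<Sum>b<p. f (w b))) \<le> 1 / real p ^ k * (\<Sum>b<p. norm (f (w b)))"
        using norm_sum[of "\<lambda>b. f (w b)" "{..<p}"] by (simp add: norm_mult norm_divide norm_power divide_right_mono)
      thus "norm (f (of_nat p * z) + 1 / of_nat p ^ k * (\<Sum>b<p. f (w b))) \<le> norm (f (of_nat p * z)) + 1 / real p ^ k * (\<Sum>b<p. norm (f (w b)))"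
        by (rule norm_triangle_le[OF add_left_mono])
    qed (use q0 in simp)
    finally have "norm l * norm (f z) * sqrt (Im z) ^ k \<le> q * (norm (f (of_nat p * z)) + 1 / real p ^ k * (\<Sum>b<p. norm (f (w b)))) * sqrt (Im z) ^ k"
      using z by (intro mult_right_mono) auto
    also have "\<dots> = norm (f (of_nat p * z)) * (q * sqrt (Im z) ^ k) + (\<Sum>b<p. norm (f (w b)) * (q / real p ^ k * sqrt (Im z) ^ k))"
      by (simp add: algebra_simps sum_distrib_left sum_distrib_right)
    also have "q * sqrt (Im z) ^ k = sqrt (Im (of_nat p * z)) ^ k"
      by (simp add: q_def real_sqrt_mult power_mult_distrib)
    also have "q / real p ^ k * sqrt (Im z) ^ k = sqrt (Im z / real p) ^ k"
    proof -
      have "q / real p ^ k = 1 / q" unfolding qq[symmetric] using q0 by simp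
      thus ?thesis by (simp add: q_def real_sqrt_divide power_divide)
    qed
    also have "norm (f (of_nat p * z)) * sqrt (Im (of_nat p * z)) ^ k + (\<Sum>b<p. norm (f (w b)) * sqrt (Im z / real p) ^ k) = s (of_nat p * z) + (\<Sum>b<p. s (w b))"
      by (simp add: s_def Iw)
    also have "\<dots> \<le> S + (\<Sum>b<p. S)"
      using z p0 by (intro add_mono sum_mono sS) (auto simp: Iw)
    also have "\<dots> = (real p + 1) * S" by (simp add: algebra_simps)
    finally show ?thesis by (simp add: s_def mult.assoc)
  qed
  show ?thesis
  proof (cases "l = 0")
    case False
    hence l: "norm l > 0" by simp
    have "S \<le> (real p + 1) * S / norm l"
      unfolding S_def[symmetric]
    proof -
      have "(SUP z\<in>{z. Im z > 0}. s z) \<le> (real p + 1) * S / norm l"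
      proof (rule cSUP_least)
        show "{z. Im z > 0} \<noteq> {}" using i0 by auto
        fix z assume "z \<in> {z. Im z > 0}"
        hence "norm l * s z \<le> (real p + 1) * S" using main by simp
        thus "s z \<le> (real p + 1) * S / norm l" using l by (simp add: pos_le_divide_eq mult.commute)
      qed
      thus ?thesis by (simp add: S_def)
    qed
    hence "norm l * S \<le> (real p + 1) * S" using l by (simp add: pos_le_divide_eq mult.commute)
    thus ?thesis using Spos by (simp only: mult_le_cancel_right_pos)
  qed (use p0 in simp)
qed

text \<open>Every lower row is compared with the representative of its class modulo \<open>N\<close> whose first entry has
  minimal absolute value.\<close>

lemma fundamental_domain_finite_cover:
  assumes N: "N \<ge> 1"
  obtains G where "finite G" "G \<subseteq> Gamma0 1"
    "\<And>z. z \<in> fundamental_domain N \<Longrightarrow> \<exists>A\<in>G. mobius A z \<in> fundamental_domain 1"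
proof -
  define cls :: "int \<times> int \<Rightarrow> int \<times> int" where "cls = (\<lambda>x. (fst x mod int N, snd x mod int N))"
  define P where "P = (\<lambda>i x. coprime (fst x) (snd x) \<and> fst x \<noteq> 0 \<and> cls x = i)"
  have "\<forall>i. \<exists>x. (\<exists>y. P i y) \<longrightarrow> P i x \<and> (\<forall>y. P i y \<longrightarrow> nat \<bar>fst x\<bar> \<le> nat \<bar>fst y\<bar>)"
    using ex_has_least_nat[of "P _" _ "\<lambda>x. nat \<bar>fst x\<bar>"] by blast
  then obtain rep where rep: "\<And>i y. P i y \<Longrightarrow> P i (rep i) \<and> (\<forall>y. P i y \<longrightarrow> nat \<bar>fst (rep i)\<bar> \<le> nat \<bar>fst y\<bar>)"
    by metis
  define I where "I = {0..<int N} \<times> {0..<int N}"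
  define M where "M = (\<Sum>i\<in>I. \<bar>fst (rep i)\<bar> + \<bar>snd (rep i)\<bar>)"
  have M: "\<bar>fst (rep i)\<bar> \<le> M" "\<bar>snd (rep i)\<bar> \<le> M" if "i \<in> I" for i
  proof -
    have "\<bar>fst (rep i)\<bar> + \<bar>snd (rep i)\<bar> \<le> M" unfolding M_def
      by (rule member_le_sum[OF that]) (auto simp: I_def)
    thus "\<bar>fst (rep i)\<bar> \<le> M" "\<bar>snd (rep i)\<bar> \<le> M" by linarith+
  qed
  have M0: "M \<ge> 0" unfolding M_def by (intro sum_nonneg) auto
  define K where "K = 12 * M * (4 * M) + 12 * M + 1"
  have MM: "0 \<le> 12 * M * (4 * M)" using M0 by simp
  have K: "1 \<le> K" "12 * M \<le> K" "4 * M \<le> K" "12 * M * (4 * M) + 1 \<le> K"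
    unfolding K_def using M0 MM by linarith+
  define H where "H = {C \<in> Gamma0 1. \<bar>C $ 1 $ 1\<bar> \<le> K \<and> \<bar>C $ 1 $ 2\<bar> \<le> K \<and> \<bar>C $ 2 $ 1\<bar> \<le> K \<and> \<bar>C $ 2 $ 2\<bar> \<le> K}"
  have "finite H"
  proof (rule finite_subset)
    show "H \<subseteq> (\<lambda>(x, y). mat2 (fst x) (snd x) (fst y) (snd y)) ` ({x. \<bar>fst x\<bar> \<le> K \<and> \<bar>snd x\<bar> \<le> K} \<times> {x. \<bar>fst x\<bar> \<le> K \<and> \<bar>snd x\<bar> \<le> K})"
    proof
      fix C assume "C \<in> H"
      thus "C \<in> (\<lambda>(x, y). mat2 (fst x) (snd x) (fst y) (snd y)) ` ({x. \<bar>fst x\<bar> \<le> K \<and> \<bar>snd x\<bar> \<le> K} \<times> {x. \<bar>fst x\<bar> \<le> K \<and> \<bar>snd x\<bar> \<le> K})"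
        by (intro image_eqI[of _ _ "((C $ 1 $ 1, C $ 1 $ 2), (C $ 2 $ 1, C $ 2 $ 2))"]) (auto simp: H_def intro: mat2_eqI)
    qed
  qed (intro finite_imageI finite_cartesian_product finite_int_box)
  \<comment> \<open>The covering reduces to this: matrices that carry some point of the level one
    domain into the level N domain have bounded entries. Their inverses form the finite
    cover.\<close>
  have key: "C \<in> H" if C: "C \<in> Gamma0 1" and w: "w \<in> fundamental_domain 1" and z: "mobius C w \<in> fundamental_domain N" for C w
  proof -
    note wb = fundamental_domain_1_bounds[OF w]
    define a b c d where "a = C $ 1 $ 1" and "b = C $ 1 $ 2" and "c = C $ 2 $ 1" and "d = C $ 2 $ 2"
    have det: "a * d - b * c = 1" using C by (simp add: Gamma0_iff a_def b_def c_def d_def)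
    define u v where "u = Re w" and "v = Im w"
    have u: "\<bar>u\<bar> \<le> 1/2" and v: "v \<ge> 1/2" using wb by (simp_all add: u_def v_def)
    have zr: "\<bar>Re (mobius C w)\<bar> \<le> 1/2" using z by (simp add: fundamental_domain_def)
    have j0: "mob_j C w \<noteq> 0" by (rule mob_j_nonzero[OF C wb(4)])
    show ?thesis
    proof (cases "c = 0")
      case True
      hence ad: "a * d = 1" using det by simp
      hence a1: "\<bar>a\<bar> = 1" and d1: "\<bar>d\<bar> = 1" by (auto simp: zmult_eq_1_iff)
      have "of_int b = of_int d * mobius C w - of_int a * w"
        using j0 True by (simp add: mobius_altdef mob_j_def a_def b_def c_def d_def)
      hence "real_of_int b = of_int d * Re (mobius C w) - of_int a * u"
        by (simp add: complex_eq_iff u_def)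
      also have "\<bar>\<dots>\<bar> \<le> \<bar>of_int d\<bar> * \<bar>Re (mobius C w)\<bar> + \<bar>of_int a\<bar> * \<bar>u\<bar>"
        by (rule order_trans[OF abs_triangle_ineq4]) (simp add: abs_mult)
      also have "\<dots> \<le> 1 * (1/2) + 1 * (1/2)"
        using a1 d1 zr u by (intro add_mono mult_mono) (auto simp flip: of_int_abs)
      finally have "\<bar>b\<bar> \<le> 1" by simp
      hence "C \<in> H" using C a1 d1 True K by (auto simp: H_def a_def b_def c_def d_def)
      thus ?thesis .
    next
      case False
      define i where "i = cls (c, d)"
      have "P i (c, d)" using False coprime_lower_row[OF C] by (simp add: P_def i_def c_def d_def)
      note r = rep[OF this]
      define c' d' where "c' = fst (rep i)" and "d' = snd (rep i)"
      have cop': "coprime c' d'" and cl': "cls (c', d') = cls (c, d)"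
        using r by (simp_all add: P_def c'_def d'_def i_def)
      have cc: "\<bar>c'\<bar> \<le> \<bar>c\<bar>" using r \<open>P i (c, d)\<close> by (auto simp: c'_def nat_le_eq_zle)
      have iI: "i \<in> I" using N by (simp add: i_def cls_def I_def)
      have cM: "\<bar>c'\<bar> \<le> M" and dM: "\<bar>d'\<bar> \<le> M" using M[OF iI] by (simp_all add: c'_def d'_def)
      define C' where "C' = gamma_lift c' d'"
      note L = gamma_lift[OF cop', folded C'_def]
      define A0 where "A0 = C' ** gamma_inv C"
      have A0: "A0 \<in> Gamma0 N"
      proof -
        have "A0 \<in> Gamma0 1" unfolding A0_def by (intro Gamma0_mult L gamma_inv_in_Gamma0 C)
        moreover have "A0 $ 2 $ 1 = c' * d - d' * c"
          by (simp add: A0_def matrix_mult_2_nth gamma_inv_def L c_def d_def)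
        moreover have "int N dvd c' * d - d' * c"
        proof -
          have "c' mod int N = c mod int N" "d' mod int N = d mod int N" using cl' by (simp_all add: cls_def)
          hence "(c' * d) mod int N = (d' * c) mod int N" by (metis mod_mult_eq mult.commute)
          thus ?thesis by (simp add: mod_eq_dvd_iff)
        qed
        ultimately show ?thesis by (simp add: Gamma0_iff)
      qed
      \<comment> \<open>\<open>A0\<close> lies in \<open>Gamma0 N\<close> because the rows agree
        modulo N, and C w is in the level N domain, so the cocycle factor of \<open>A0\<close> at C
        w has norm at least 1. Hence |j(C, w)| \<le> |j(C', w)|.\<close>
      have "A0 ** C = C'" unfolding A0_def using gamma_inv_mult(1)[OF C] by (simp add: matrix_mul_assoc[symmetric])
      hence "mob_j C' w = mob_j A0 (mobius C w) * mob_j C w" using mob_j_mult[OF C wb(4), of A0] by simp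
      moreover have "norm (mob_j A0 (mobius C w)) \<ge> 1" using z A0 by (simp add: fundamental_domain_def mob_j_def)
      ultimately have jj: "norm (mob_j C w) \<le> norm (mob_j C' w)"
        by (simp add: norm_mult mult_le_cancel_right1)
      hence "(norm (mob_j C w))\<^sup>2 \<le> (norm (mob_j C' w))\<^sup>2" by (intro power_mono) auto
      hence sq: "(of_int c * u + of_int d)\<^sup>2 + (of_int c * v)\<^sup>2 \<le> (of_int c' * u + of_int d')\<^sup>2 + (of_int c' * v)\<^sup>2"
        by (simp add: cmod_power2 mob_j_def L c_def d_def u_def v_def)
      have ccr: "\<bar>real_of_int c'\<bar> \<le> \<bar>real_of_int c\<bar>" using cc by linarith
      have cMr: "\<bar>real_of_int c'\<bar> \<le> of_int M" and dMr: "\<bar>real_of_int d'\<bar> \<le> of_int M" using cM dM by linarith+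
      have "(of_int c' * v)\<^sup>2 \<le> (of_int c * v)\<^sup>2"
        using ccr v by (simp add: power_mult_distrib abs_le_square_iff mult_right_mono)
      with sq have "(of_int c * u + of_int d)\<^sup>2 \<le> (of_int c' * u + of_int d')\<^sup>2" by linarith
      hence s1: "\<bar>of_int c * u + of_int d\<bar> \<le> \<bar>of_int c' * u + of_int d'\<bar>" by (simp add: abs_le_square_iff)
      have s2: "\<bar>of_int c' * u + of_int d'\<bar> \<le> 3/2 * of_int M"
      proof -
        have "\<bar>of_int c' * u + of_int d'\<bar> \<le> \<bar>of_int c'\<bar> * \<bar>u\<bar> + \<bar>of_int d'\<bar>"
          by (rule order_trans[OF abs_triangle_ineq]) (simp add: abs_mult)
        also have "\<dots> \<le> of_int M * (1/2) + of_int M" using cMr dMr u by (intro add_mono mult_mono) auto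
        finally show ?thesis by simp
      qed
      have cb: "\<bar>real_of_int c\<bar> \<le> 4 * of_int M"
      proof -
        have "(of_int c * v)\<^sup>2 \<le> (of_int c' * u + of_int d')\<^sup>2 + (of_int c' * v)\<^sup>2"
          using sq zero_le_power2[of "of_int c * u + of_int d"] by linarith
        also have "\<dots> \<le> (3/2 * of_int M)\<^sup>2 + (of_int M * v)\<^sup>2"
          using s2 cMr v by (intro add_mono) (auto simp: power_mult_distrib abs_le_square_iff[symmetric] intro!: mult_right_mono power_mono[of "\<bar>_\<bar>", simplified])
        also have "\<dots> \<le> (3/2 * of_int M + of_int M * v)\<^sup>2" using M0 v by (simp add: power2_sum)
        finally have "\<bar>of_int c * v\<bar> \<le> \<bar>3/2 * of_int M + of_int M * v\<bar>" by (simp only: abs_le_square_iff)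
        hence "\<bar>of_int c\<bar> * v \<le> 3/2 * of_int M + of_int M * v" using M0 v by (simp add: abs_mult)
        also have "3/2 * of_int M \<le> 3 * of_int M * v" using M0 v by (simp add: mult_left_mono[of "1/2" v "3 * of_int M", simplified])
        finally have "\<bar>of_int c\<bar> * v \<le> (4 * of_int M) * v" by (simp add: mult_ac)
        thus ?thesis using v by simp
      qed
      have cb': "\<bar>c\<bar> \<le> 4 * M" using cb by linarith
      have "\<bar>real_of_int d\<bar> \<le> \<bar>of_int c * u + of_int d\<bar> + \<bar>of_int c\<bar> * \<bar>u\<bar>"
        using abs_triangle_ineq4[of "of_int c * u + of_int d" "of_int c * u"] by (simp add: abs_mult)
      also have "\<dots> \<le> 3/2 * of_int M + (4 * of_int M) * (1/2)" using s1 s2 cb u M0 by (intro add_mono mult_mono) auto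
      finally have db: "\<bar>d\<bar> \<le> 4 * M" using M0 by linarith
      have c1: "\<bar>real_of_int c\<bar> \<ge> 1" using False by linarith
      have nj: "norm (mob_j C w) \<ge> 1/2"
      proof -
        have "1 * (1/2) \<le> \<bar>of_int c\<bar> * v" using c1 v by (intro mult_mono) auto
        also have "\<dots> = \<bar>Im (mob_j C w)\<bar>" using v by (simp add: mob_j_def c_def v_def abs_mult)
        also have "\<dots> \<le> norm (mob_j C w)" by (rule abs_Im_le_cmod)
        finally show ?thesis by simp
      qed
      \<comment> \<open>The upper left entry is read off from C w = a/c - 1 / (c j); both C w and
        1/j are under control.\<close>
      have "of_int a = of_int c * mobius C w + 1 / mob_j C w"
      proof -
        have "of_int a * of_int d - of_int b * of_int c = (1 :: complex)"
          using arg_cong[OF det, of "of_int :: int \<Rightarrow> complex"] by simp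
        hence "of_int a * mob_j C w = of_int c * (of_int a * w + of_int b) + 1"
          by (simp add: mob_j_def c_def[symmetric] d_def[symmetric] algebra_simps)
        thus ?thesis using j0 by (simp add: mobius_altdef a_def[symmetric] b_def[symmetric] field_simps)
      qed
      hence "real_of_int a = of_int c * Re (mobius C w) + Re (1 / mob_j C w)" by (simp add: complex_eq_iff)
      also have "\<bar>\<dots>\<bar> \<le> \<bar>of_int c\<bar> * \<bar>Re (mobius C w)\<bar> + norm (1 / mob_j C w)"
        by (rule order_trans[OF abs_triangle_ineq]) (simp add: abs_mult abs_Re_le_cmod)
      also have "\<dots> \<le> \<bar>of_int c\<bar> * (1/2) + 2 * \<bar>of_int c\<bar>"
      proof (intro add_mono mult_left_mono zr)
        have "norm (1 / mob_j C w) \<le> 1 / (1/2)" using nj unfolding norm_divide norm_one by (intro divide_left_mono) auto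
        thus "norm (1 / mob_j C w) \<le> 2 * \<bar>of_int c\<bar>" using c1 by simp
      qed auto
      finally have "\<bar>real_of_int a\<bar> \<le> 3 * \<bar>of_int c\<bar>" using c1 by simp
      hence ab: "\<bar>a\<bar> \<le> 12 * M" using cb by linarith
      have bb: "\<bar>b\<bar> \<le> 12 * M * (4 * M) + 1"
      proof -
        have "\<bar>b\<bar> * 1 \<le> \<bar>b\<bar> * \<bar>c\<bar>" using False by (intro mult_left_mono) auto
        also have "\<dots> = \<bar>a * d - 1\<bar>" using det by (simp add: abs_mult[symmetric])
        also have "\<dots> \<le> \<bar>a\<bar> * \<bar>d\<bar> + 1" by (rule order_trans[OF abs_triangle_ineq4]) (simp add: abs_mult)
        also have "\<dots> \<le> 12 * M * (4 * M) + 1" using ab db M0 by (intro add_mono mult_mono) auto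
        finally show ?thesis by simp
      qed
      show ?thesis using C ab bb cb' db K
        by (auto simp: H_def a_def[symmetric] b_def[symmetric] c_def[symmetric] d_def[symmetric])
    qed
  qed
  show ?thesis
  proof (rule that[of "gamma_inv ` H"])
    show "finite (gamma_inv ` H)" using \<open>finite H\<close> by simp
    show "gamma_inv ` H \<subseteq> Gamma0 1" using gamma_inv_in_Gamma0 by (auto simp: H_def)
    fix z assume z: "z \<in> fundamental_domain N"
    have iz: "Im z > 0" using z by (simp add: fundamental_domain_def)
    obtain B where B: "B \<in> Gamma0 1" "mobius B z \<in> fundamental_domain 1"
      by (rule reduction_to_fundamental_domain[OF iz])
    have "gamma_inv B \<in> H"
      by (rule key[OF gamma_inv_in_Gamma0[OF B(1)] B(2)]) (simp add: mobius_gamma_inv[OF B(1) iz] z)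
    moreover have "gamma_inv (gamma_inv B) = B" by (auto simp: gamma_inv_def intro: mat2_eqI)
    ultimately have "B \<in> gamma_inv ` H" by (metis image_eqI)
    with B(2) show "\<exists>A\<in>gamma_inv ` H. mobius A z \<in> fundamental_domain 1" by blast
  qed
qed

lemma cusp_form_measurable: "f \<in> cusp_forms k N \<Longrightarrow> f \<in> borel_measurable borel"
  by (rule measurable_upper_half_plane_holomorphic) (auto simp: cusp_forms_def)

section \<open>The norm of the Poincare series\<close>

text \<open>The 36 is the square of the 6 in (1 + |c|)(1 + |d|) \<le> 6 |c z + d|^2, valid on the
  level one domain for c > 0.\<close>

definition lattice_const :: real where
  "lattice_const = 36 * (\<Sum>\<^sub>\<infinity>m::int. 1 / (1 + \<bar>real_of_int m\<bar>)\<^sup>2)\<^sup>2"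

text \<open>Of the r + 1 powers of |c z + d|, four pay for the lattice sum; the other r - 3 give
  decay, since |c z + d| \<ge> max 1 (Im z) for c > 0.\<close>

lemma poincare_tail_bound:
  assumes z: "z \<in> fundamental_domain 1" and r: "r \<ge> 3" "odd r"
  shows "norm (poincare (Suc r) z - ec z) \<le> lattice_const * (1 / max 1 (Im z)) ^ (r - 3)"
proof -
  note zb = fundamental_domain_1_bounds[OF z]
  define g where "g = (\<lambda>m::int. 1 / (1 + \<bar>real_of_int m\<bar>)\<^sup>2)"
  have g0: "g m \<ge> 0" for m by (simp add: g_def)
  have g: "g summable_on UNIV" unfolding g_def by (rule summable_on_int_inverse_square)
  define G where "G = infsum g UNIV"
  have gG: "(g has_sum G) UNIV" unfolding G_def by (rule has_sum_infsum[OF g])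
  have ss: "(\<lambda>x. g (fst x) * g (snd x)) summable_on (UNIV \<times> UNIV)"
    by (rule summable_on_SigmaI[where g = "\<lambda>c. g c * G"]) (auto intro!: has_sum_cmult_right gG summable_on_cmult_left g g0 mult_nonneg_nonneg)
  have gg: "((\<lambda>x. g (fst x) * g (snd x)) has_sum (G * G)) (UNIV \<times> UNIV)"
    by (rule has_sum_SigmaI[where g = "\<lambda>c. g c * G"]) (auto intro!: has_sum_cmult_right has_sum_cmult_left gG ss[simplified])
  define Pos where "Pos = (SIGMA c:{0<..}. {d. coprime c (d::int)})"
  define f where "f = (\<lambda>x. poincare_term (Suc r) x z)"
  define m where "m = (1 / max 1 (Im z)) ^ (r - 3)"
  have m0: "m \<ge> 0" by (simp add: m_def)
  have P: "poincare (Suc r) z - ec z = infsum f Pos"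
    using poincare_Fourier(3)[OF zb(4) r] by (simp add: f_def Pos_def)
  have le: "norm (f x) \<le> (36 * m) * (g (fst x) * g (snd x))" if x: "x \<in> Pos" for x
  proof -
    obtain c d where cd: "x = (c, d)" by (cases x)
    have cop: "coprime c d" and c0: "c > 0" using x cd by (auto simp: Pos_def)
    note L = gamma_lift[OF cop]
    define w where "w = norm (of_int c * z + of_int d)"
    have j: "norm (mob_j (gamma_lift c d) z) = w" by (simp add: mob_j_def L w_def)
    have "\<forall>A\<in>Gamma0 1. norm (mob_j A z) \<ge> 1" using z by (simp add: fundamental_domain_def mob_j_def)
    hence w1: "w \<ge> 1" using L(1) j by force
    have "1 * Im z \<le> of_int c * Im z" using c0 zb(4) by (intro mult_right_mono) linarith+
    also have "\<dots> = Im (of_int c * z + of_int d)" by simp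
    also have "\<dots> \<le> w" unfolding w_def using abs_Im_le_cmod[of "of_int c * z + of_int d"] by linarith
    finally have wm: "w \<ge> max 1 (Im z)" using w1 by simp
    define C D where "C = real_of_int c" and "D = real_of_int d"
    have C1: "C \<ge> 1" using c0 by (simp add: C_def)
    have zz: "1 \<le> (Re z)\<^sup>2 + (Im z)\<^sup>2" using zb(3) cmod_power2[of z] power_mono[OF zb(3), of 2] by simp
    have "w\<^sup>2 = C\<^sup>2 * ((Re z)\<^sup>2 + (Im z)\<^sup>2) + 2 * (C * D * Re z) + D\<^sup>2"
      unfolding w_def cmod_power2 by (simp add: C_def D_def power2_eq_square algebra_simps)
    \<comment> \<open>The reduced quadratic form: |z| \<ge> 1 and |Re z| \<le> 1/2 give c^2 - |c d|
      + d^2, which is at least half of c^2 + d^2.\<close>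
    also have "\<dots> \<ge> C\<^sup>2 * 1 - \<bar>C * D\<bar> + D\<^sup>2"
    proof -
      have "C\<^sup>2 * 1 \<le> C\<^sup>2 * ((Re z)\<^sup>2 + (Im z)\<^sup>2)" using zz by (intro mult_left_mono) auto
      moreover have "\<bar>C * D * Re z\<bar> \<le> \<bar>C * D\<bar> * (1/2)" unfolding abs_mult[of _ "Re z"] using zb(2) by (intro mult_left_mono) auto
      ultimately show ?thesis by linarith
    qed
    finally have "w\<^sup>2 \<ge> C\<^sup>2 - \<bar>C * D\<bar> + D\<^sup>2" by simp
    moreover have "2 * \<bar>C * D\<bar> \<le> C\<^sup>2 + D\<^sup>2"
      using sum_squares_bound[of "\<bar>C\<bar>" "\<bar>D\<bar>"] by (simp add: abs_mult)
    ultimately have w2: "C\<^sup>2 + D\<^sup>2 \<le> 2 * w\<^sup>2" by linarith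
    have "2 * ((1 + \<bar>C\<bar>) * (1 + \<bar>D\<bar>)) \<le> (1 + \<bar>C\<bar>)\<^sup>2 + (1 + \<bar>D\<bar>)\<^sup>2"
      using sum_squares_bound[of "1 + \<bar>C\<bar>" "1 + \<bar>D\<bar>"] by (simp only: mult.assoc)
    also have "\<dots> \<le> 2 * (1 + C\<^sup>2) + 2 * (1 + D\<^sup>2)"
    proof -
      have "(1 + \<bar>a\<bar>)\<^sup>2 \<le> 2 * (1 + a\<^sup>2)" for a :: real
        using sum_squares_bound[of 1 "\<bar>a\<bar>"] by (simp add: power2_eq_square algebra_simps)
      thus ?thesis by (intro add_mono)
    qed
    finally have "(1 + \<bar>C\<bar>) * (1 + \<bar>D\<bar>) \<le> 2 + (C\<^sup>2 + D\<^sup>2)" by simp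
    moreover have "1 \<le> C\<^sup>2 + D\<^sup>2" using one_le_power[OF C1, of 2] zero_le_power2[of D] by linarith
    ultimately have b: "(1 + \<bar>C\<bar>) * (1 + \<bar>D\<bar>) \<le> 6 * w\<^sup>2" using w2 by linarith
    define Q where "Q = (1 + \<bar>C\<bar>) * (1 + \<bar>D\<bar>)"
    have Q0: "Q > 0" by (simp add: Q_def add_pos_nonneg)
    have "Q\<^sup>2 \<le> (6 * w\<^sup>2)\<^sup>2" using b Q0 by (intro power_mono) (auto simp: Q_def)
    hence "Q\<^sup>2 \<le> 36 * w ^ 4" by (simp add: power_mult_distrib power_mult[symmetric])
    hence w4: "1 / w ^ 4 \<le> 36 * (1 / Q\<^sup>2)" using w1 Q0 by (simp add: field_simps)
    have "norm (f x) \<le> 1 / w ^ Suc r"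
      using norm_ec_le_1[of "mobius (gamma_lift c d) z"] Im_mobius_pos[OF L(1) zb(4)] w1
      by (simp add: f_def poincare_term_def cd norm_divide norm_power j divide_right_mono less_imp_le del: power_Suc)
    also have "Suc r = (r - 3) + 4" using r by simp
    also have "1 / w ^ (r - 3 + 4) = (1 / w) ^ (r - 3) * (1 / w ^ 4)" by (simp add: power_add power_divide)
    also have "\<dots> \<le> m * (36 * (1 / Q\<^sup>2))"
      unfolding m_def using wm w1 w4 by (intro mult_mono power_mono divide_left_mono) auto
    also have "1 / Q\<^sup>2 = g c * g d" by (simp add: g_def Q_def C_def D_def power_mult_distrib)
    finally show ?thesis by (simp add: cd)
  qed
  have sP: "(\<lambda>x. g (fst x) * g (snd x)) summable_on Pos" by (rule summable_on_subset[OF ss]) simp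
  have fP: "f summable_on Pos"
    by (rule abs_summable_summable, rule Infinite_Sum.abs_summable_on_comparison_test'[OF summable_on_cmult_right[OF sP] le])
  have "norm (infsum f Pos) \<le> (36 * m) * infsum (\<lambda>x. g (fst x) * g (snd x)) Pos"
    by (rule norm_infsum_le[OF has_sum_infsum[OF fP] has_sum_cmult_right[OF has_sum_infsum[OF sP]] le])
  also have "\<dots> \<le> (36 * m) * (G * G)"
  proof (intro mult_left_mono)
    have "infsum (\<lambda>x. g (fst x) * g (snd x)) Pos \<le> infsum (\<lambda>x. g (fst x) * g (snd x)) (UNIV \<times> UNIV)"
      using g0 by (intro infsum_mono_neutral sP ss) auto
    also have "\<dots> = G * G" using gg by (rule infsumI)
    finally show "infsum (\<lambda>x. g (fst x) * g (snd x)) Pos \<le> G * G" .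
  qed (use m0 in simp)
  also have "\<dots> = lattice_const * m" by (simp add: lattice_const_def G_def g_def power2_eq_square)
  finally show ?thesis by (simp add: P m_def)
qed

lemma nn_integral_half_strip:
  assumes \<psi> [measurable]: "\<psi> \<in> borel_measurable borel"
  shows "(\<integral>\<^sup>+z. ennreal (indicator {z. \<bar>Re z\<bar> \<le> 1/2} z * \<psi> (Im z)) \<partial>lborel) = (\<integral>\<^sup>+y. ennreal (\<psi> y) \<partial>lborel)"
proof -
  have [measurable]: "{z :: complex. \<bar>Re z\<bar> \<le> 1/2} \<in> sets borel"
    by (intro borel_closed closed_Collect_le continuous_intros)
  have "(\<integral>\<^sup>+z. ennreal (indicator {z. \<bar>Re z\<bar> \<le> 1/2} z * \<psi> (Im z)) \<partial>lborel) =
      (\<integral>\<^sup>+y. (\<integral>\<^sup>+x. ennreal (indicator {z. \<bar>Re z\<bar> \<le> 1/2} (Complex x y) * \<psi> y) \<partial>lborel) \<partial>lborel)"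
    by (subst nn_integral_complex) auto
  also have "\<dots> = (\<integral>\<^sup>+y. (\<integral>\<^sup>+x. ennreal (\<psi> y) * indicator {-1/2..1/2::real} x \<partial>lborel) \<partial>lborel)"
    by (intro nn_integral_cong) (auto simp: indicator_def abs_le_iff)
  also have "\<dots> = (\<integral>\<^sup>+y. ennreal (\<psi> y) \<partial>lborel)"
    by (intro nn_integral_cong) (subst nn_integral_cmult_indicator, auto)
  finally show ?thesis .
qed

lemma nn_integral_inverse_square_half:
  "(\<integral>\<^sup>+y. ennreal (indicator {1/2..} y * (1 / y\<^sup>2)) \<partial>lborel) = ennreal 2"
proof -
  have "(\<integral>\<^sup>+y. ennreal (1 / y\<^sup>2) * indicator {1/2..} y \<partial>lborel) = ennreal (0 - (\<lambda>y. - 1 / y) (1/2::real))"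
  proof (rule nn_integral_FTC_atLeast)
    show "((\<lambda>y. - 1 / y) has_real_derivative 1 / y\<^sup>2) (at y)" if "1/2 \<le> y" for y :: real
      using that by (auto intro!: derivative_eq_intros simp: power2_eq_square)
    show "((\<lambda>y::real. - 1 / y) \<longlongrightarrow> 0) at_top" by real_asymp
  qed auto
  also have "(\<integral>\<^sup>+y. ennreal (1 / y\<^sup>2) * indicator {1/2..} y \<partial>lborel) = (\<integral>\<^sup>+y. ennreal (indicator {1/2..} y * (1 / y\<^sup>2)) \<partial>lborel)"
    by (intro nn_integral_cong) (simp add: indicator_def)
  finally show ?thesis by simp
qed

text \<open>The square of q plus the tail is split by Young's inequality with a free parameter
  \<eta>. The term q integrates over the whole half strip to \<open>pet_const\<close> exactly, the
  tail to a quantity independent of the weight. A fixed \<eta> serves higher level; an exponentially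
  small one is needed at level one.\<close>

lemma poincare_norm_bound:
  assumes r: "r \<ge> 7" "odd r" and \<eta>: "\<eta> > 0"
  shows "sq_int (pet_measure (Suc r) 1) (poincare (Suc r))"
    and "norm_sq (pet_measure (Suc r) 1) (poincare (Suc r)) \<le> (1 + \<eta>) * pet_const (Suc r) + (1 + 1 / \<eta>) * (lattice_const\<^sup>2 * 2)"
proof -
  define k where "k = Suc r"
  have k: "k \<ge> 8" using r by (simp add: k_def)
  define f where "f = poincare k"
  have fm [measurable]: "f \<in> borel_measurable borel"
    unfolding f_def k_def using r by (intro cusp_form_measurable[OF poincare_cusp_form]) auto
  define \<psi> where "\<psi> = (\<lambda>y::real. (1 + \<eta>) * (indicator {0<..} y * (y ^ k / y\<^sup>2 * exp (- (4 * pi) * y))) + (1 + 1 / \<eta>) * lattice_const\<^sup>2 * (indicator {1/2..} y * (1 / y\<^sup>2)))"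
  have [measurable]: "\<psi> \<in> borel_measurable borel" unfolding \<psi>_def by measurable
  have pw: "(norm (f z))\<^sup>2 * pet_weight k z \<le> \<psi> (Im z)" if z: "z \<in> fundamental_domain 1" for z
  proof -
    note zb = fundamental_domain_1_bounds[OF z]
    define y where "y = Im z"
    have y: "y > 0" "y \<ge> 1/2" using zb by (simp_all add: y_def)
    define a b where "a = norm (ec z)" and "b = norm (f z - ec z)"
    have bb: "b \<le> lattice_const * (1 / max 1 y) ^ (k - 4)"
      using poincare_tail_bound[OF z, of r] r by (simp add: b_def f_def k_def y_def)
    have "norm (f z) \<le> a + b" unfolding a_def b_def using norm_triangle_ineq[of "ec z" "f z - ec z"] by simp
    hence "(norm (f z))\<^sup>2 \<le> (a + b)\<^sup>2" by (intro power_mono) auto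
    also have "\<dots> \<le> (1 + \<eta>) * a\<^sup>2 + (1 + 1 / \<eta>) * b\<^sup>2"
    proof -
      have "0 \<le> (sqrt \<eta> * a - b / sqrt \<eta>)\<^sup>2" by simp
      also have "\<dots> = \<eta> * a\<^sup>2 + b\<^sup>2 / \<eta> - 2 * (a * b)" using \<eta> by (simp add: power2_diff power_mult_distrib power_divide)
      finally show ?thesis by (simp add: power2_sum algebra_simps)
    qed
    finally have "(norm (f z))\<^sup>2 * (y ^ k / y\<^sup>2) \<le> ((1 + \<eta>) * a\<^sup>2 + (1 + 1 / \<eta>) * b\<^sup>2) * (y ^ k / y\<^sup>2)"
      using y by (intro mult_right_mono) auto
    also have "\<dots> = (1 + \<eta>) * (y ^ k / y\<^sup>2 * a\<^sup>2) + (1 + 1 / \<eta>) * (b\<^sup>2 * (y ^ k / y\<^sup>2))"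
      by (simp only: distrib_right mult.assoc) (simp only: mult.commute[of "a\<^sup>2"])
    also have "a\<^sup>2 = exp (- (4 * pi) * y)"
      by (simp add: a_def norm_ec y_def exp_double[symmetric])
    also have "b\<^sup>2 * (y ^ k / y\<^sup>2) \<le> lattice_const\<^sup>2 * (1 / y\<^sup>2)"
    proof -
      have "b\<^sup>2 \<le> (lattice_const * (1 / max 1 y) ^ (k - 4))\<^sup>2" using bb by (intro power_mono) (auto simp: b_def)
      also have "\<dots> = lattice_const\<^sup>2 * (1 / max 1 y) ^ (2 * (k - 4))" by (simp add: power_mult_distrib power_mult[symmetric] mult.commute)
      finally have "b\<^sup>2 * (y ^ k / y\<^sup>2) \<le> lattice_const\<^sup>2 * (1 / max 1 y) ^ (2 * (k - 4)) * (y ^ k / y\<^sup>2)"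
        using y by (intro mult_right_mono) auto
      also have "\<dots> = lattice_const\<^sup>2 * (((1 / max 1 y) ^ (2 * (k - 4)) * y ^ k) * (1 / y\<^sup>2))" by simp
      also have "\<dots> \<le> lattice_const\<^sup>2 * (1 * (1 / y\<^sup>2))"
      proof (intro mult_left_mono mult_right_mono)
        \<comment> \<open>Weight at least 8 makes 2 (k - 4) \<ge> k, so the squared tail absorbs
          y^k.\<close>
        have "(1 / max 1 y) ^ (2 * (k - 4)) \<le> (1 / max 1 y) ^ k" using k by (intro power_decreasing) auto
        hence "(1 / max 1 y) ^ (2 * (k - 4)) * y ^ k \<le> (1 / max 1 y) ^ k * y ^ k" using y by (intro mult_right_mono) auto
        also have "\<dots> = (y / max 1 y) ^ k" by (simp add: power_divide)
        also have "\<dots> \<le> 1" using y by (intro power_le_one) auto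
        finally show "(1 / max 1 y) ^ (2 * (k - 4)) * y ^ k \<le> 1" .
      qed auto
      finally show ?thesis by simp
    qed
    finally have "(norm (f z))\<^sup>2 * (y ^ k / y\<^sup>2) \<le> (1 + \<eta>) * (y ^ k / y\<^sup>2 * exp (- (4 * pi) * y)) + (1 + 1 / \<eta>) * (lattice_const\<^sup>2 * (1 / y\<^sup>2))"
      using \<eta> by (simp add: mult_left_mono)
    thus ?thesis using y by (simp add: \<psi>_def pet_weight_def y_def[symmetric] mult.assoc)
  qed
  have "(\<integral>\<^sup>+z. ennreal ((norm (f z))\<^sup>2) \<partial>pet_measure k 1) = (\<integral>\<^sup>+z\<in>fundamental_domain 1. ennreal ((norm (f z))\<^sup>2 * pet_weight k z) \<partial>lborel)"
    by (rule nn_integral_pet_measure[OF fm])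
  also have "\<dots> \<le> (\<integral>\<^sup>+z. ennreal (indicator {z. \<bar>Re z\<bar> \<le> 1/2} z * \<psi> (Im z)) \<partial>lborel)"
  proof (rule nn_integral_mono)
    fix z :: complex
    show "ennreal ((norm (f z))\<^sup>2 * pet_weight k z) * indicator (fundamental_domain 1) z \<le> ennreal (indicator {z. \<bar>Re z\<bar> \<le> 1/2} z * \<psi> (Im z))"
      using pw[of z] fundamental_domain_1_bounds(2)[of z] by (cases "z \<in> fundamental_domain 1") (auto simp: ennreal_leI)
  qed
  also have "\<dots> = (\<integral>\<^sup>+y. ennreal (\<psi> y) \<partial>lborel)" by (rule nn_integral_half_strip) measurable
  also have "\<dots> = (\<integral>\<^sup>+y. ennreal (1 + \<eta>) * ennreal (indicator {0<..} y * (y ^ k / y\<^sup>2 * exp (- (4 * pi) * y))) +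
      ennreal ((1 + 1 / \<eta>) * lattice_const\<^sup>2) * ennreal (indicator {1/2..} y * (1 / y\<^sup>2)) \<partial>lborel)"
  proof (rule nn_integral_cong)
    fix y :: real
    have "0 \<le> indicator {0<..} y * (y ^ k / y\<^sup>2 * exp (- (4 * pi) * y))" by (auto simp: indicator_def)
    moreover have "0 \<le> indicator {1/2..} y * (1 / y\<^sup>2)" by (auto simp: indicator_def)
    ultimately show "ennreal (\<psi> y) = ennreal (1 + \<eta>) * ennreal (indicator {0<..} y * (y ^ k / y\<^sup>2 * exp (- (4 * pi) * y))) +
      ennreal ((1 + 1 / \<eta>) * lattice_const\<^sup>2) * ennreal (indicator {1/2..} y * (1 / y\<^sup>2))"
      unfolding \<psi>_def using \<eta> by (simp only: ennreal_plus ennreal_mult mult_nonneg_nonneg add_nonneg_nonneg zero_le_power2 divide_nonneg_pos zero_le_one less_imp_le)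
  qed
  also have "\<dots> = ennreal (1 + \<eta>) * (\<integral>\<^sup>+y. ennreal (indicator {0<..} y * (y ^ k / y\<^sup>2 * exp (- (4 * pi) * y))) \<partial>lborel) +
      ennreal ((1 + 1 / \<eta>) * lattice_const\<^sup>2) * (\<integral>\<^sup>+y. ennreal (indicator {1/2..} y * (1 / y\<^sup>2)) \<partial>lborel)"
    by (subst nn_integral_add; (subst nn_integral_cmult)?; (subst nn_integral_cmult)?) auto
  also have "\<dots> = ennreal ((1 + \<eta>) * pet_const k) + ennreal ((1 + 1 / \<eta>) * lattice_const\<^sup>2 * 2)"
    using k \<eta> unfolding nn_integral_inverse_square_half
    by (subst nn_integral_power_exp) (simp_all only: pet_const_def[symmetric] ennreal_mult'' pet_const_pos less_imp_le zero_le_numeral mult_pos_pos pi_gt_zero zero_less_numeral)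
  also have "\<dots> = ennreal ((1 + \<eta>) * pet_const k + (1 + 1 / \<eta>) * (lattice_const\<^sup>2 * 2))"
    using \<eta> pet_const_pos[of k] k by (subst ennreal_plus[symmetric]) (auto simp: mult.assoc)
  finally have le: "(\<integral>\<^sup>+z. ennreal ((norm (f z))\<^sup>2) \<partial>pet_measure k 1) \<le> ennreal ((1 + \<eta>) * pet_const k + (1 + 1 / \<eta>) * (lattice_const\<^sup>2 * 2))" .
  have fm': "(\<lambda>z. (norm (f z))\<^sup>2) \<in> borel_measurable (pet_measure k 1)" unfolding borel_measurable_pet_measure by measurable
  have int: "integrable (pet_measure k 1) (\<lambda>z. (norm (f z))\<^sup>2)"
    using le by (intro integrableI_nonneg fm') (auto simp: le_less_trans[OF _ ennreal_less_top])
  thus "sq_int (pet_measure (Suc r) 1) (poincare (Suc r))"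
    using fm by (simp add: sq_int_def borel_measurable_pet_measure f_def k_def)
  have "ennreal (norm_sq (pet_measure k 1) f) = (\<integral>\<^sup>+z. ennreal ((norm (f z))\<^sup>2) \<partial>pet_measure k 1)"
    unfolding norm_sq_def by (rule nn_integral_eq_integral[symmetric, OF int]) simp
  with le have "ennreal (norm_sq (pet_measure k 1) f) \<le> ennreal ((1 + \<eta>) * pet_const k + (1 + 1 / \<eta>) * (lattice_const\<^sup>2 * 2))" by simp
  moreover have "0 \<le> (1 + \<eta>) * pet_const k + (1 + 1 / \<eta>) * (lattice_const\<^sup>2 * 2)"
    using \<eta> pet_const_pos[of k] k by (intro add_nonneg_nonneg mult_nonneg_nonneg) auto
  ultimately show "norm_sq (pet_measure (Suc r) 1) (poincare (Suc r)) \<le> (1 + \<eta>) * pet_const (Suc r) + (1 + 1 / \<eta>) * (lattice_const\<^sup>2 * 2)"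
    by (simp add: ennreal_le_iff f_def k_def)
qed

section \<open>Change of variables and comparison of levels\<close>

text \<open>The change of variables theorem with Jacobian determinants is formulated on
  \<open>real^2\<close>, hence this identification.\<close>

lemma lborel_complex_eq_vec: "lborel = distr lborel borel (\<lambda>v::real^2. Complex (v $ 1) (v $ 2))"
proof (rule lborel_eqI)
  have m: "(\<lambda>v::real^2. Complex (v $ 1) (v $ 2)) \<in> borel_measurable lborel"
    by measurable
  fix l u :: complex assume lu: "\<And>b. b \<in> Basis \<Longrightarrow> l \<bullet> b \<le> u \<bullet> b"
  have lu': "Re l \<le> Re u" "Im l \<le> Im u" using lu[of 1] lu[of \<i>] by (auto simp: Basis_complex_def)
  have B: "Basis = {axis 1 1, axis 2 1 :: real^2}" by (auto simp: Basis_vec_def UNIV_2)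
  have ne: "axis 1 1 \<noteq> (axis 2 1 :: real^2)" by (simp add: axis_eq_axis)
  define L U :: "real^2" where "L = vector [Re l, Im l]" and "U = vector [Re u, Im u]"
  have "emeasure (distr lborel borel (\<lambda>v::real^2. Complex (v $ 1) (v $ 2))) (box l u) =
      emeasure lborel ((\<lambda>v::real^2. Complex (v $ 1) (v $ 2)) -` box l u \<inter> space lborel)"
    by (rule emeasure_distr[OF m]) simp
  also have "(\<lambda>v::real^2. Complex (v $ 1) (v $ 2)) -` box l u \<inter> space lborel = box L U"
    by (auto simp: box_def Basis_complex_def B inner_axis L_def U_def)
  also have "emeasure lborel (box L U) = ennreal (\<Prod>b\<in>Basis. (U - L) \<bullet> b)"
    by (rule emeasure_lborel_box) (auto simp: B inner_axis L_def U_def lu')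
  also have "(\<Prod>b\<in>Basis. (U - L) \<bullet> b) = (\<Prod>b\<in>Basis. (u - l) \<bullet> b)"
    using ne by (simp add: B inner_axis L_def U_def Basis_complex_def)
  finally show "emeasure (distr lborel borel (\<lambda>v::real^2. Complex (v $ 1) (v $ 2))) (box l u) = ennreal (\<Prod>b\<in>Basis. (u - l) \<bullet> b)" .
qed simp

lemma nn_integral_complex_vec:
  fixes f :: "complex \<Rightarrow> ennreal"
  assumes [measurable]: "f \<in> borel_measurable borel"
  shows "(\<integral>\<^sup>+z. f z \<partial>lborel) = (\<integral>\<^sup>+v. f (Complex (v $ 1) (v $ 2)) \<partial>(lborel :: (real^2) measure))"
  by (subst lborel_complex_eq_vec, subst nn_integral_distr) auto

lemma set_nn_integral_eq_integral_vec:
  fixes f :: "real^2 \<Rightarrow> real"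
  assumes i: "f absolutely_integrable_on S" and f: "\<And>v. v \<in> S \<Longrightarrow> f v \<ge> 0"
  shows "(\<integral>\<^sup>+v\<in>S. ennreal (f v) \<partial>lborel) = ennreal (integral S f)"
proof -
  have "(\<integral>\<^sup>+v\<in>S. ennreal (f v) \<partial>lborel) = (\<integral>\<^sup>+v. ennreal (indicator S v *\<^sub>R f v) \<partial>lebesgue)"
    unfolding nn_integral_completion by (intro nn_integral_cong) (auto simp: indicator_def)
  also have "\<dots> = ennreal (LINT v:S|lebesgue. f v)"
    unfolding set_lebesgue_integral_def using i f
    by (intro nn_integral_eq_integral) (auto simp: set_integrable_def indicator_def)
  also have "(LINT v:S|lebesgue. f v) = integral S f"
    by (rule set_lebesgue_integral_eq_integral(2)[OF i])
  finally show ?thesis .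
qed

lemma nn_integral_holomorphic_substitution:
  fixes F :: "complex \<Rightarrow> real" and g g' :: "complex \<Rightarrow> complex"
  assumes F [measurable]: "F \<in> borel_measurable borel" and F0: "\<And>z. F z \<ge> 0"
    and S [measurable]: "S \<in> sets borel" and gS [measurable]: "g ` S \<in> sets borel"
    and der: "\<And>z. z \<in> S \<Longrightarrow> (g has_field_derivative g' z) (at z)" and inj: "inj_on g S"
    and m: "(\<lambda>z. indicator S z * ((norm (g' z))\<^sup>2 * F (g z))) \<in> borel_measurable borel"
    and fin: "(\<integral>\<^sup>+z\<in>g ` S. ennreal (F z) \<partial>lborel) < \<infinity>"
  shows "(\<integral>\<^sup>+z\<in>S. ennreal ((norm (g' z))\<^sup>2 * F (g z)) \<partial>lborel) = (\<integral>\<^sup>+z\<in>g ` S. ennreal (F z) \<partial>lborel)"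
proof -
  define T where "T = (\<lambda>v::real^2. Complex (v $ 1) (v $ 2))"
  define R where "R = (\<lambda>z. vector [Re z, Im z] :: real^2)"
  have TR: "T (R z) = z" "R (T v) = v" for z v
    by (simp_all add: T_def R_def vec_eq_iff forall_2)
  have lT: "bounded_linear T" unfolding T_def
    by (intro linear_conv_bounded_linear[THEN iffD1] linearI) (simp_all add: complex_eq_iff)
  have lR: "bounded_linear R" unfolding R_def
    by (intro linear_conv_bounded_linear[THEN iffD1] linearI) (simp_all add: vec_eq_iff forall_2)
  have [measurable]: "T \<in> borel_measurable borel" unfolding T_def by measurable
  define S' where "S' = {v. T v \<in> S}"
  have S' [measurable]: "S' \<in> sets borel" unfolding S'_def using measurable_sets[of T borel borel S] by (simp add: vimage_def)
  define G where "G = (\<lambda>v. R (g (T v)))"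
  define G' where "G' = (\<lambda>v h. R (g' (T v) * T h))"
  have derG: "(G has_derivative G' v) (at v within S')" if "v \<in> S'" for v
  proof -
    have "(g has_derivative (\<lambda>h. g' (T v) * h)) (at (T v))" using der[of "T v"] that by (simp add: S'_def has_field_derivative_def)
    from has_derivative_compose[OF bounded_linear.has_derivative[OF lT has_derivative_ident] this]
    have "((\<lambda>v. g (T v)) has_derivative (\<lambda>h. g' (T v) * T h)) (at v)" .
    from bounded_linear.has_derivative[OF lR this] show ?thesis
      unfolding G_def G'_def by (rule has_derivative_at_withinI)
  qed
  \<comment> \<open>The real Jacobian of multiplication by g' is |g'|^2, as in the Cauchy-Riemann
    equations.\<close>
  have detG: "\<bar>det (matrix (G' v))\<bar> = (norm (g' (T v)))\<^sup>2" for v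
    unfolding cmod_power2 by (simp add: det_2 matrix_def G'_def R_def T_def axis_def power2_eq_square)
  have injG: "inj_on G S'"
  proof (rule inj_onI)
    fix v w assume "v \<in> S'" "w \<in> S'" "G v = G w"
    hence "g (T v) = g (T w)" by (metis G_def TR(1))
    hence "T v = T w" using inj \<open>v \<in> S'\<close> \<open>w \<in> S'\<close> by (auto simp: S'_def inj_on_def)
    thus "v = w" by (metis TR(2))
  qed
  have GS: "v \<in> G ` S' \<longleftrightarrow> T v \<in> g ` S" for v
  proof
    assume "v \<in> G ` S'" thus "T v \<in> g ` S" by (auto simp: G_def S'_def TR)
  next
    assume "T v \<in> g ` S"
    then obtain z where z: "z \<in> S" "T v = g z" by auto
    have "v = G (R z)" using z TR by (metis G_def)
    moreover have "R z \<in> S'" using z by (simp add: S'_def TR)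
    ultimately show "v \<in> G ` S'" by blast
  qed
  have [measurable]: "G ` S' \<in> sets borel"
  proof -
    have "G ` S' = T -` (g ` S)" by (rule set_eqI) (simp only: GS vimage_eq)
    thus ?thesis using measurable_sets[of T borel borel "g ` S"] by simp
  qed
  define f where "f = (\<lambda>v. F (T v))"
  have [measurable]: "f \<in> borel_measurable borel" unfolding f_def by measurable
  have I1: "(\<integral>\<^sup>+z\<in>g ` S. ennreal (F z) \<partial>lborel) = (\<integral>\<^sup>+v\<in>G ` S'. ennreal (f v) \<partial>lborel)"
  proof -
    have "(\<integral>\<^sup>+z\<in>g ` S. ennreal (F z) \<partial>lborel) = (\<integral>\<^sup>+v. ennreal (F (T v)) * indicator (g ` S) (T v) \<partial>lborel)"
      unfolding T_def by (rule nn_integral_complex_vec) measurable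
    also have "\<dots> = (\<integral>\<^sup>+v\<in>G ` S'. ennreal (f v) \<partial>lborel)"
      by (intro nn_integral_cong) (simp only: indicator_def GS f_def)
    finally show ?thesis .
  qed
  have m2: "(\<lambda>z. ennreal (indicator S z * ((norm (g' z))\<^sup>2 * F (g z)))) \<in> borel_measurable borel"
    using m by measurable
  have "(\<integral>\<^sup>+z\<in>S. ennreal ((norm (g' z))\<^sup>2 * F (g z)) \<partial>lborel) = (\<integral>\<^sup>+z. ennreal (indicator S z * ((norm (g' z))\<^sup>2 * F (g z))) \<partial>lborel)"
    by (intro nn_integral_cong) (auto simp: indicator_def)
  also have "\<dots> = (\<integral>\<^sup>+v. ennreal (indicator S (T v) * ((norm (g' (T v)))\<^sup>2 * F (g (T v)))) \<partial>lborel)"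
    unfolding T_def by (rule nn_integral_complex_vec[OF m2])
  also have "\<dots> = (\<integral>\<^sup>+v\<in>S'. ennreal (\<bar>det (matrix (G' v))\<bar> * f (G v)) \<partial>lborel)"
    by (intro nn_integral_cong) (auto simp: indicator_def S'_def detG f_def G_def TR)
  finally have I2: "(\<integral>\<^sup>+z\<in>S. ennreal ((norm (g' z))\<^sup>2 * F (g z)) \<partial>lborel) = (\<integral>\<^sup>+v\<in>S'. ennreal (\<bar>det (matrix (G' v))\<bar> * f (G v)) \<partial>lborel)" .
  have fi: "f absolutely_integrable_on G ` S'"
  proof -
    have mf: "(\<lambda>v. indicator (G ` S') v *\<^sub>R f v) \<in> borel_measurable lborel" by measurable
    have "integrable lborel (\<lambda>v. indicator (G ` S') v *\<^sub>R f v)"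
    proof (rule integrableI_nonneg[OF mf])
      show "(\<integral>\<^sup>+v. ennreal (indicator (G ` S') v *\<^sub>R f v) \<partial>lborel) < \<infinity>"
      proof -
        have "(\<integral>\<^sup>+v. ennreal (indicator (G ` S') v *\<^sub>R f v) \<partial>lborel) = (\<integral>\<^sup>+v\<in>G ` S'. ennreal (f v) \<partial>lborel)"
          by (intro nn_integral_cong) (simp add: indicator_def)
        thus ?thesis using fin unfolding I1 by simp
      qed
    qed (simp add: f_def F0)
    thus ?thesis unfolding set_integrable_def using integrable_completion[OF mf] by simp
  qed
  have sl: "S' \<in> sets lebesgue" using S' by simp
  define b where "b = integral (G ` S') f"
  have "(\<lambda>v. \<bar>det (matrix (G' v))\<bar> *\<^sub>R (vec (f (G v)) :: real^1)) absolutely_integrable_on S' \<and>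
      integral S' (\<lambda>v. \<bar>det (matrix (G' v))\<bar> *\<^sub>R (vec (f (G v)) :: real^1)) = vec b"
    by (subst has_absolute_integral_change_of_variables[OF sl derG injG])
       (use fi in \<open>auto simp: absolutely_integrable_on_1_iff integral_on_1_eq b_def\<close>)
  hence A: "(\<lambda>v. \<bar>det (matrix (G' v))\<bar> * f (G v)) absolutely_integrable_on S'"
      "integral S' (\<lambda>v. \<bar>det (matrix (G' v))\<bar> * f (G v)) = b"
    by (auto simp: absolutely_integrable_on_1_iff integral_on_1_eq vec_eq_iff)
  have f0: "f v \<ge> 0" for v by (simp add: f_def F0)
  show ?thesis unfolding I1 I2 set_nn_integral_eq_integral_vec[OF A(1) mult_nonneg_nonneg[OF abs_ge_zero f0]]
      set_nn_integral_eq_integral_vec[OF fi f0] A(2) b_def ..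
qed

text \<open>The Jacobian of a Moebius map is (Im (A z) / Im z)^2, which compensates the denominator
  of \<open>pet_weight\<close>, and |f|^2 (Im z)^k is invariant. Only an inequality remains because
  the image need not fill D.\<close>

lemma nn_integral_mobius_invariance:
  assumes A: "A \<in> Gamma0 1" and f [measurable]: "f \<in> borel_measurable borel"
    and inv: "\<And>z. Im z > 0 \<Longrightarrow> slash k f A z = f z"
    and S [measurable]: "S \<in> sets borel" and D [measurable]: "D \<in> sets borel"
    and SH: "\<And>z. z \<in> S \<Longrightarrow> Im z > 0" and DH: "\<And>z. z \<in> D \<Longrightarrow> Im z > 0"
    and fin: "(\<integral>\<^sup>+z\<in>D. ennreal ((norm (f z))\<^sup>2 * pet_weight k z) \<partial>lborel) < \<infinity>"
  shows "(\<integral>\<^sup>+z\<in>{z\<in>S. mobius A z \<in> D}. ennreal ((norm (f z))\<^sup>2 * pet_weight k z) \<partial>lborel) \<le> (\<integral>\<^sup>+z\<in>D. ennreal ((norm (f z))\<^sup>2 * pet_weight k z) \<partial>lborel)"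
proof -
  define F where "F = (\<lambda>z. indicator {z. Im z > 0} z * ((norm (f z))\<^sup>2 * pet_weight k z))"
  define E where "E = {z\<in>S. mobius A z \<in> D}"
  have H [measurable]: "{z. Im z > 0} \<in> sets borel" using open_halfspace_Im_gt[of 0] by (rule borel_open)
  have F [measurable]: "F \<in> borel_measurable borel" unfolding F_def by measurable
  have F0: "F z \<ge> 0" for z by (auto simp: F_def indicator_def intro!: mult_nonneg_nonneg pet_weight_nonneg)
  have mm: "mobius B \<in> borel_measurable borel" for B unfolding mobius_def by measurable
  note [measurable] = mm[of A] mm[of "gamma_inv A"]
  have E [measurable]: "E \<in> sets borel" unfolding E_def by measurable
  have img: "mobius A ` E = {w\<in>D. mobius (gamma_inv A) w \<in> S}"
  proof safe
    fix z assume "z \<in> E" thus "mobius A z \<in> D" "mobius (gamma_inv A) (mobius A z) \<in> S"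
      using mobius_gamma_inv(1)[OF A] SH by (auto simp: E_def)
  next
    fix w assume w: "w \<in> D" "mobius (gamma_inv A) w \<in> S"
    have "mobius A (mobius (gamma_inv A) w) = w" using mobius_gamma_inv(2)[OF A] DH w by auto
    thus "w \<in> mobius A ` E" using w by (intro image_eqI[of _ _ "mobius (gamma_inv A) w"]) (auto simp: E_def)
  qed
  have gS: "mobius A ` E \<in> sets borel" unfolding img by measurable
  define g' where "g' = (\<lambda>z. 1 / (mob_j A z)\<^sup>2)"
  have det: "of_int (A $ 1 $ 1) * of_int (A $ 2 $ 2) - of_int (A $ 1 $ 2) * of_int (A $ 2 $ 1) = (1 :: complex)"
  proof -
    have "A $ 1 $ 1 * A $ 2 $ 2 - A $ 1 $ 2 * A $ 2 $ 1 = 1" using A by (simp add: Gamma0_def det_2)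
    from this[THEN arg_cong[of _ _ "of_int :: int \<Rightarrow> complex"]] show ?thesis by simp
  qed
  have EH: "Im z > 0" if "z \<in> E" for z using that SH by (auto simp: E_def)
  have der: "(mobius A has_field_derivative g' z) (at z)" if z: "z \<in> E" for z
  proof -
    have j: "of_int (A $ 2 $ 1) * z + of_int (A $ 2 $ 2) \<noteq> 0" using mob_j_nonzero[OF A EH[OF z]] by (simp add: mob_j_def)
    have "(mobius A has_field_derivative (of_int (A $ 1 $ 1) * mob_j A z - (of_int (A $ 1 $ 1) * z + of_int (A $ 1 $ 2)) * of_int (A $ 2 $ 1)) / (mob_j A z)\<^sup>2) (at z)"
      unfolding mobius_def[abs_def] mob_j_def using j by (auto intro!: derivative_eq_intros simp: power2_eq_square)
    also have "of_int (A $ 1 $ 1) * mob_j A z - (of_int (A $ 1 $ 1) * z + of_int (A $ 1 $ 2)) * of_int (A $ 2 $ 1) = 1"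
      unfolding det[symmetric] by (simp add: mob_j_def algebra_simps)
    finally show ?thesis by (simp add: g'_def)
  qed
  have inj: "inj_on (mobius A) E"
    by (rule inj_on_inverseI[where g = "mobius (gamma_inv A)"]) (use mobius_gamma_inv(1)[OF A] EH in auto)
  have key: "(norm (g' z))\<^sup>2 * F (mobius A z) = (norm (f z))\<^sup>2 * pet_weight k z" if z: "z \<in> E" for z
  proof -
    define y y' j where "y = Im z" and "y' = Im (mobius A z)" and "j = norm (mob_j A z)"
    have j: "j > 0" using mob_j_nonzero[OF A EH[OF z]] by (simp add: j_def)
    have y: "y > 0" using EH[OF z] by (simp add: y_def)
    have y': "y' > 0" using Im_mobius_pos[OF A EH[OF z]] by (simp add: y'_def)
    have yy: "y' = y / j\<^sup>2" unfolding y'_def y_def j_def by (rule Im_mobius[OF A])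
    have "(norm (f (mobius A z)) * sqrt y' ^ k)\<^sup>2 = (norm (f z) * sqrt y ^ k)\<^sup>2"
      unfolding y_def y'_def using weight_invariance[OF inv[OF EH[OF z]] A EH[OF z]] by simp
    moreover have "(sqrt t ^ k)\<^sup>2 = t ^ k" if "t > 0" for t :: real
      using that by (simp add: power_mult[symmetric] mult.commute[of k]) (simp add: power_mult)
    ultimately have e: "(norm (f (mobius A z)))\<^sup>2 * y' ^ k = (norm (f z))\<^sup>2 * y ^ k"
      using y y' by (simp add: power_mult_distrib)
    have "(norm (g' z))\<^sup>2 = (1 / j\<^sup>2)\<^sup>2" by (simp add: g'_def j_def norm_divide norm_power)
    also have "\<dots> = y'\<^sup>2 / y\<^sup>2" unfolding yy using y j by (simp add: power_divide)
    finally have gn: "(norm (g' z))\<^sup>2 = y'\<^sup>2 / y\<^sup>2" .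
    have "F (mobius A z) = (norm (f (mobius A z)))\<^sup>2 * y' ^ k / y'\<^sup>2"
      using y' by (simp add: F_def pet_weight_def y'_def)
    thus ?thesis unfolding gn e using y y' by (simp add: pet_weight_def y_def[symmetric])
  qed
  have m: "(\<lambda>z. indicator E z * ((norm (g' z))\<^sup>2 * F (mobius A z))) \<in> borel_measurable borel"
  proof -
    have "(\<lambda>z. indicator E z * ((norm (f z))\<^sup>2 * pet_weight k z)) \<in> borel_measurable borel" by measurable
    also have "(\<lambda>z. indicator E z * ((norm (f z))\<^sup>2 * pet_weight k z)) = (\<lambda>z. indicator E z * ((norm (g' z))\<^sup>2 * F (mobius A z)))"
      by (auto simp: fun_eq_iff indicator_def key)
    finally show ?thesis .
  qed
  have le: "(\<integral>\<^sup>+z\<in>mobius A ` E. ennreal (F z) \<partial>lborel) \<le> (\<integral>\<^sup>+z\<in>D. ennreal ((norm (f z))\<^sup>2 * pet_weight k z) \<partial>lborel)"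
    unfolding img by (intro nn_integral_mono) (auto simp: indicator_def F_def)
  have "(\<integral>\<^sup>+z\<in>E. ennreal ((norm (f z))\<^sup>2 * pet_weight k z) \<partial>lborel) = (\<integral>\<^sup>+z\<in>E. ennreal ((norm (g' z))\<^sup>2 * F (mobius A z)) \<partial>lborel)"
    by (intro nn_integral_cong) (auto simp: indicator_def key)
  also have "\<dots> = (\<integral>\<^sup>+z\<in>mobius A ` E. ennreal (F z) \<partial>lborel)"
    by (rule nn_integral_holomorphic_substitution[OF F F0 E gS der inj m]) (use le fin in auto)
  finally show ?thesis using le unfolding E_def by simp
qed

text \<open>Each of the finitely many covering matrices contributes at most the level one norm. The
  order of the quantifiers matters: C depends on N only, not on the weight or the form.\<close>

lemma norm_bound_from_level_1:
  assumes N: "N \<ge> 1"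
  shows "\<exists>C\<ge>1. \<forall>k f. f \<in> cusp_forms k 1 \<longrightarrow> sq_int (pet_measure k 1) f \<longrightarrow>
    sq_int (pet_measure k N) f \<and> norm_sq (pet_measure k N) f \<le> C * norm_sq (pet_measure k 1) f"
proof -
  obtain G where G: "finite G" "G \<subseteq> Gamma0 1"
    "\<And>z. z \<in> fundamental_domain N \<Longrightarrow> \<exists>A\<in>G. mobius A z \<in> fundamental_domain 1"
    using fundamental_domain_finite_cover[OF N] by blast
  define C where "C = real (card G) + 1"
  have main: "sq_int (pet_measure k N) f \<and> norm_sq (pet_measure k N) f \<le> C * norm_sq (pet_measure k 1) f"
    if f: "f \<in> cusp_forms k 1" and sq: "sq_int (pet_measure k 1) f" for k f
  proof -
    have fm [measurable]: "f \<in> borel_measurable borel"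
      using f by (intro measurable_upper_half_plane_holomorphic) (auto simp: cusp_forms_def)
    have inv: "slash k f A z = f z" if "A \<in> Gamma0 1" "Im z > 0" for A z
      using f that by (simp add: cusp_forms_def)
    define h where "h = (\<lambda>z. ennreal ((norm (f z))\<^sup>2 * pet_weight k z))"
    have [measurable]: "h \<in> borel_measurable borel" unfolding h_def by measurable
    have n1: "(\<integral>\<^sup>+z. ennreal ((norm (f z))\<^sup>2) \<partial>pet_measure k 1) = ennreal (norm_sq (pet_measure k 1) f)"
      using sq unfolding sq_int_def norm_sq_def by (intro nn_integral_eq_integral) auto
    have h1: "(\<integral>\<^sup>+z\<in>fundamental_domain 1. h z \<partial>lborel) = ennreal (norm_sq (pet_measure k 1) f)"
      unfolding n1[symmetric] h_def by (rule nn_integral_pet_measure[OF fm, symmetric])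
    have fin: "(\<integral>\<^sup>+z\<in>fundamental_domain 1. ennreal ((norm (f z))\<^sup>2 * pet_weight k z) \<partial>lborel) < \<infinity>"
      using h1 unfolding h_def by simp
    have mm [measurable]: "mobius B \<in> borel_measurable borel" for B unfolding mobius_def by measurable
    have "(\<integral>\<^sup>+z. ennreal ((norm (f z))\<^sup>2) \<partial>pet_measure k N) = (\<integral>\<^sup>+z\<in>fundamental_domain N. h z \<partial>lborel)"
      unfolding h_def by (rule nn_integral_pet_measure[OF fm])
    also have "\<dots> \<le> (\<integral>\<^sup>+z. (\<Sum>A\<in>G. h z * indicator {z\<in>fundamental_domain N. mobius A z \<in> fundamental_domain 1} z) \<partial>lborel)"
    proof (rule nn_integral_mono)
      fix z
      show "h z * indicator (fundamental_domain N) z \<le> (\<Sum>A\<in>G. h z * indicator {z\<in>fundamental_domain N. mobius A z \<in> fundamental_domain 1} z)"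
      proof (cases "z \<in> fundamental_domain N")
        case True
        then obtain A where A: "A \<in> G" "mobius A z \<in> fundamental_domain 1" using G(3) by blast
        have "h z * indicator (fundamental_domain N) z = h z * indicator {z\<in>fundamental_domain N. mobius A z \<in> fundamental_domain 1} z"
          using True A by simp
        also have "\<dots> \<le> (\<Sum>A\<in>G. h z * indicator {z\<in>fundamental_domain N. mobius A z \<in> fundamental_domain 1} z)"
          by (rule member_le_sum[OF A(1)]) (auto simp: G(1))
        finally show ?thesis .
      qed simp
    qed
    also have "\<dots> = (\<Sum>A\<in>G. \<integral>\<^sup>+z\<in>{z\<in>fundamental_domain N. mobius A z \<in> fundamental_domain 1}. h z \<partial>lborel)"
      by (rule nn_integral_sum) measurable
    also have "\<dots> \<le> (\<Sum>A\<in>G. ennreal (norm_sq (pet_measure k 1) f))"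
    proof (rule sum_mono)
      fix A assume "A \<in> G"
      hence A: "A \<in> Gamma0 1" using G by blast
      show "(\<integral>\<^sup>+z\<in>{z\<in>fundamental_domain N. mobius A z \<in> fundamental_domain 1}. h z \<partial>lborel) \<le> ennreal (norm_sq (pet_measure k 1) f)"
        unfolding h1[symmetric] unfolding h_def
        by (rule nn_integral_mobius_invariance[OF A fm inv[OF A] _ _ _ _ fin]) (auto simp: fundamental_domain_Im_pos)
    qed
    also have "\<dots> = ennreal (real (card G) * norm_sq (pet_measure k 1) f)"
      by (simp add: ennreal_of_nat_eq_real_of_nat ennreal_mult norm_sq_nonneg)
    also have "\<dots> \<le> ennreal (C * norm_sq (pet_measure k 1) f)"
      by (intro ennreal_leI mult_right_mono) (auto simp: C_def norm_sq_nonneg)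
    finally have le: "(\<integral>\<^sup>+z. ennreal ((norm (f z))\<^sup>2) \<partial>pet_measure k N) \<le> ennreal (C * norm_sq (pet_measure k 1) f)" .
    have fm': "(\<lambda>z. (norm (f z))\<^sup>2) \<in> borel_measurable (pet_measure k N)" unfolding borel_measurable_pet_measure by measurable
    have int: "integrable (pet_measure k N) (\<lambda>z. (norm (f z))\<^sup>2)"
      using le by (intro integrableI_nonneg fm') (auto simp: le_less_trans[OF _ ennreal_less_top])
    have "ennreal (norm_sq (pet_measure k N) f) = (\<integral>\<^sup>+z. ennreal ((norm (f z))\<^sup>2) \<partial>pet_measure k N)"
      unfolding norm_sq_def by (rule nn_integral_eq_integral[symmetric, OF int]) simp
    with le have "ennreal (norm_sq (pet_measure k N) f) \<le> ennreal (C * norm_sq (pet_measure k 1) f)" by simp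
    moreover have "0 \<le> C * norm_sq (pet_measure k 1) f" by (simp add: C_def norm_sq_nonneg)
    ultimately have "norm_sq (pet_measure k N) f \<le> C * norm_sq (pet_measure k 1) f" by (simp add: ennreal_le_iff)
    thus ?thesis using int fm by (simp add: sq_int_def borel_measurable_pet_measure)
  qed
  have "C \<ge> 1" by (simp add: C_def)
  with main show ?thesis by blast
qed

section \<open>The Fourier coefficients of the Poincare series\<close>

lemma power_div_fact_le_exp: "(x::real) \<ge> 0 \<Longrightarrow> x ^ n / fact n \<le> exp x"
  using sum_le_suminf[OF summable_exp[of x], of "{n}"]
  by (simp add: exp_def divide_inverse mult.commute)

lemma fact_mult_power_le: "fact r * real (Suc r) ^ j \<le> fact (r + j)"
proof (induction j)
  case (Suc j)
  have "fact r * real (Suc r) ^ Suc j = fact r * real (Suc r) ^ j * real (Suc r)" by simp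
  also have "\<dots> \<le> fact (r + j) * real (Suc (r + j))" using Suc by (intro mult_mono) auto
  finally show ?case by (simp add: mult.commute)
qed simp

text \<open>From (r + j)! \<ge> r! (r + 1)^j. In contrast to \<open>norm_bes_le\<close> the factor 1
  / r! survives, which makes the coefficients small in large weight.\<close>

lemma abs_bes_le: "\<bar>bes r u\<bar> \<le> exp (\<bar>u\<bar> / real (Suc r)) / fact r"
proof -
  define x where "x = \<bar>u\<bar> / real (Suc r)"
  have s: "summable (\<lambda>j. x ^ j / fact j * (1 / fact r))"
    using summable_exp[of x] by (intro summable_mult2) (simp add: divide_inverse mult.commute)
  have le: "norm ((-1) ^ j / (fact j * fact (r + j)) * u ^ j) \<le> x ^ j / fact j * (1 / fact r)" for j
  proof -
    have "norm ((-1) ^ j / (fact j * fact (r + j)) * u ^ j) = \<bar>u\<bar> ^ j / fact j * (1 / fact (r + j))"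
      by (simp add: abs_mult power_abs)
    also have "\<dots> \<le> \<bar>u\<bar> ^ j / fact j * (1 / (fact r * real (Suc r) ^ j))"
      using fact_mult_power_le[of r j] by (intro mult_left_mono divide_left_mono) auto
    also have "\<dots> = x ^ j / fact j * (1 / fact r)" by (simp add: x_def power_divide)
    finally show ?thesis .
  qed
  have "\<bar>bes r u\<bar> \<le> (\<Sum>j. norm ((-1) ^ j / (fact j * fact (r + j)) * u ^ j))"
    unfolding bes_def using summable_norm[OF summable_bes] by simp
  also have "\<dots> \<le> (\<Sum>j. x ^ j / fact j * (1 / fact r))" by (rule suminf_le[OF le summable_bes s])
  also have "\<dots> = (\<Sum>j. x ^ j / fact j) * (1 / fact r)"
    using summable_exp[of x] by (intro suminf_mult2[symmetric]) (simp add: divide_inverse mult.commute)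
  also have "(\<Sum>j. x ^ j / fact j) = exp x" by (simp add: exp_def divide_inverse mult.commute)
  finally show ?thesis by (simp add: x_def)
qed

definition kloosterman_tail_const :: real where
  "kloosterman_tail_const = 4 * (\<Sum>\<^sub>\<infinity>c::int\<in>{0<..}. 1 / (real_of_int c)\<^sup>2)"

lemma kloosterman_tail_const_nonneg: "kloosterman_tail_const \<ge> 0"
  by (auto simp: kloosterman_tail_const_def intro!: infsum_nonneg)

lemma norm_bes_coeff_bound:
  assumes "C \<ge> D" "D > 0"
  shows "norm (bes_coeff C r n) \<le> (2 * pi) ^ Suc r * real (Suc n) ^ r * (exp (4 * pi\<^sup>2 / D * real (Suc n) / real (Suc r)) / fact r)"
proof -
  have "\<bar>bes r (4 * pi\<^sup>2 / C * real (Suc n))\<bar> \<le> exp (4 * pi\<^sup>2 / C * real (Suc n) / real (Suc r)) / fact r"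
    using abs_bes_le[of r "4 * pi\<^sup>2 / C * real (Suc n)"] assms by (simp add: abs_mult)
  also have "\<dots> \<le> exp (4 * pi\<^sup>2 / D * real (Suc n) / real (Suc r)) / fact r"
    using assms by (intro divide_right_mono exp_le_cancel_iff[THEN iffD2] mult_right_mono divide_left_mono) auto
  finally have b: "\<bar>bes r (4 * pi\<^sup>2 / C * real (Suc n))\<bar> \<le> exp (4 * pi\<^sup>2 / D * real (Suc n) / real (Suc r)) / fact r" .
  have "norm (bes_coeff C r n) = (2 * pi) ^ Suc r * real (Suc n) ^ r * \<bar>bes r (4 * pi\<^sup>2 / C * real (Suc n))\<bar>"
    unfolding bes_coeff_def norm_mult norm_power norm_of_nat norm_of_real by (simp add: norm_mult)
  also have "\<dots> \<le> (2 * pi) ^ Suc r * real (Suc n) ^ r * (exp (4 * pi\<^sup>2 / D * real (Suc n) / real (Suc r)) / fact r)"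
    by (intro mult_left_mono b) auto
  finally show ?thesis .
qed

text \<open>The modulus c = 1 is the main term. All others have c \<ge> 2, hence C \<ge> 4 in the
  Bessel factor and a further 2^(-r) from c^(-r), after two powers of c are kept for
  convergence.\<close>

lemma poincare_coeff_split:
  assumes r: "r \<ge> 2"
  shows "norm (poincare_coeff r n - (if n = 0 then 1 else 0) - bes_coeff 1 r n) \<le>
    (2 * pi) ^ Suc r * real (Suc n) ^ r * (exp (pi\<^sup>2 * real (Suc n) / real (Suc r)) / fact r) * (kloosterman_tail_const / 2 ^ r)"
proof -
  define f where "f = (\<lambda>c. poincare_coeff_c r c n)"
  define X where "X = (2 * pi) ^ Suc r * real (Suc n) ^ r * (exp (pi\<^sup>2 * real (Suc n) / real (Suc r)) / fact r)"
  have X0: "X \<ge> 0" by (simp add: X_def)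
  have s: "f summable_on {0<..}" unfolding f_def by (rule summable_poincare_coeff_c[OF r])
  have s1: "f summable_on {1<..}" by (rule summable_on_subset[OF s]) auto
  have "infsum f (insert 1 {1<..}) = f 1 + infsum f {1<..}" by (rule infsum_insert[OF s1]) simp
  moreover have "{0<..} = insert (1::int) {1<..}" by auto
  moreover have "f 1 = bes_coeff 1 r n" by (simp add: f_def poincare_coeff_c_def kloosterman_1)
  ultimately have e: "poincare_coeff r n - (if n = 0 then 1 else 0) - bes_coeff 1 r n = infsum f {1<..}"
    by (simp add: poincare_coeff_def f_def)
  have sq: "(\<lambda>c::int. 1 / (real_of_int c)\<^sup>2) summable_on {1<..}"
    by (rule summable_on_subset[OF summable_on_inverse_power_int[of 2]]) auto
  have le: "norm (f c) \<le> X * (4 / 2 ^ r) * (1 / (real_of_int c)\<^sup>2)" if c: "c \<in> {1<..}" for c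
  proof -
    have c2: "real_of_int c \<ge> 2" using c by simp
    have cc: "(real_of_int c)\<^sup>2 \<ge> 4" using power_mono[OF c2, of 2] by simp
    have "norm (f c) \<le> norm (bes_coeff ((of_int c)\<^sup>2) r n) / of_int c ^ r"
      unfolding f_def using c by (intro norm_poincare_coeff_c_le) auto
    also have "\<dots> \<le> X / of_int c ^ r"
      using norm_bes_coeff_bound[OF cc, of r n] c2 unfolding X_def by (intro divide_right_mono) auto
    also have "\<dots> \<le> X * (4 / 2 ^ r * (1 / (real_of_int c)\<^sup>2))"
    proof -
      have "(2::real) ^ (r - 2) \<le> of_int c ^ (r - 2)" using c2 by (intro power_mono) auto
      hence "2 ^ (r - 2) * (real_of_int c)\<^sup>2 \<le> of_int c ^ (r - 2) * (real_of_int c)\<^sup>2" by (intro mult_right_mono) auto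
      also have "\<dots> = of_int c ^ r" by (simp only: power_add[symmetric] le_add_diff_inverse2[OF r])
      finally have "1 / of_int c ^ r \<le> 1 / (2 ^ (r - 2) * (real_of_int c)\<^sup>2)" using c2 by (intro divide_left_mono) auto
      also have "(2::real) ^ (r - 2) = 2 ^ r / 4" using r by (simp add: power_diff)
      finally have "1 / of_int c ^ r \<le> 4 / 2 ^ r * (1 / (real_of_int c)\<^sup>2)" by simp
      from mult_left_mono[OF this X0] show ?thesis by simp
    qed
    finally show ?thesis by simp
  qed
  have "norm (infsum f {1<..}) \<le> X * (4 / 2 ^ r) * infsum (\<lambda>c::int. 1 / (real_of_int c)\<^sup>2) {1<..}"
    by (rule norm_infsum_le[OF has_sum_infsum[OF s1] has_sum_cmult_right[OF has_sum_infsum[OF sq]] le])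
  also have "\<dots> \<le> X * (4 / 2 ^ r) * infsum (\<lambda>c::int. 1 / (real_of_int c)\<^sup>2) {0<..}"
    using X0 by (intro mult_left_mono infsum_mono_neutral sq summable_on_inverse_power_int) auto
  also have "\<dots> = X * (kloosterman_tail_const / 2 ^ r)" by (simp add: kloosterman_tail_const_def)
  finally show ?thesis unfolding e X_def .
qed

lemma rho_poincare:
  assumes "r \<ge> 3" "odd r"
  shows "rho (Suc r) (poincare (Suc r)) (Suc n) = poincare_coeff r n / of_real (real (Suc n) powr (real r / 2))"
  by (subst rho_eq[OF poincare_q_expansion[OF assms]]) simp

lemma rho_poincare_near_delta:
  assumes "r \<ge> 3" "odd r"
  shows "norm (rho (Suc r) (poincare (Suc r)) (Suc n) - (if n = 0 then 1 else 0)) \<le>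
    2 * pi * exp (4 * pi\<^sup>2 * real (Suc n)) * (1 + kloosterman_tail_const) * ((2 * pi * real (Suc n)) ^ r / fact r)"
proof -
  define m where "m = real (Suc n)"
  have m: "m \<ge> 1" by (simp add: m_def)
  define \<delta> :: complex where "\<delta> = (if n = 0 then 1 else 0)"
  define E where "E = exp (4 * pi\<^sup>2 * m)"
  define K where "K = kloosterman_tail_const"
  have K: "K \<ge> 0" by (simp add: K_def kloosterman_tail_const_nonneg)
  have mp: "m powr (real r / 2) \<ge> 1" using m by (intro ge_one_powr_ge_zero) auto
  have d: "\<delta> / of_real (m powr (real r / 2)) = \<delta>" by (simp add: \<delta>_def m_def)
  have e1: "exp (t * m / real (Suc r)) \<le> E" if "0 \<le> t" "t \<le> 4 * pi\<^sup>2" for t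
  proof -
    have "t * m / real (Suc r) \<le> t * m / 1" using that m by (intro divide_left_mono) auto
    also have "\<dots> \<le> 4 * pi\<^sup>2 * m" using that m by (simp add: mult_right_mono)
    finally show ?thesis by (simp add: E_def)
  qed
  define Y where "Y = (2 * pi) ^ Suc r * m ^ r * (E / fact r)"
  have Y0: "Y \<ge> 0" using m by (simp add: Y_def E_def)
  have Yle: "(2 * pi) ^ Suc r * m ^ r * (exp (t * m / real (Suc r)) / fact r) \<le> Y" if "0 \<le> t" "t \<le> 4 * pi\<^sup>2" for t
    unfolding Y_def using e1[OF that] m by (intro mult_left_mono divide_right_mono) auto
  have "norm (bes_coeff 1 r n) \<le> (2 * pi) ^ Suc r * m ^ r * (exp (4 * pi\<^sup>2 * m / real (Suc r)) / fact r)"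
    using norm_bes_coeff_bound[OF order_refl zero_less_one, of r n] by (simp only: m_def div_by_1)
  also have "\<dots> \<le> Y" by (rule Yle) auto
  finally have "norm (bes_coeff 1 r n) \<le> Y" .
  moreover have "norm (poincare_coeff r n - \<delta> - bes_coeff 1 r n) \<le> Y * K"
  proof -
    have "norm (poincare_coeff r n - \<delta> - bes_coeff 1 r n) \<le> (2 * pi) ^ Suc r * m ^ r * (exp (pi\<^sup>2 * m / real (Suc r)) / fact r) * (K / 2 ^ r)"
      unfolding m_def \<delta>_def K_def using assms by (intro poincare_coeff_split) auto
    also have "\<dots> \<le> Y * (K / 1)"
      using Yle[of "pi\<^sup>2"] Y0 K by (intro mult_mono divide_left_mono) auto
    finally show ?thesis by simp
  qed
  ultimately have "norm (poincare_coeff r n - \<delta>) \<le> Y * (1 + K)"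
    using norm_triangle_ineq[of "bes_coeff 1 r n" "poincare_coeff r n - \<delta> - bes_coeff 1 r n"] by (simp add: algebra_simps)
  moreover have "rho (Suc r) (poincare (Suc r)) (Suc n) - \<delta> = (poincare_coeff r n - \<delta>) / of_real (m powr (real r / 2))"
    unfolding rho_poincare[OF assms] diff_divide_distrib d by (simp add: m_def)
  ultimately have "norm (rho (Suc r) (poincare (Suc r)) (Suc n) - \<delta>) \<le> Y * (1 + K) / (m powr (real r / 2))"
    by (simp add: norm_divide divide_right_mono)
  also have "\<dots> \<le> Y * (1 + K) / 1" using mp Y0 K by (intro divide_left_mono) auto
  also have "\<dots> = 2 * pi * E * (1 + K) * ((2 * pi * m) ^ r / fact r)"
    by (simp add: Y_def power_mult_distrib)
  finally show ?thesis by (simp only: m_def E_def K_def \<delta>_def)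
qed

text \<open>At a fixed index r! beats any exponential. This supplies the small errors at the indices
  1 and p^2, not at the growing index p^(2 j).\<close>

lemma eventually_rho_poincare_near_delta:
  assumes "b > 0"
  shows "eventually (\<lambda>r. odd r \<longrightarrow> norm (rho (Suc r) (poincare (Suc r)) (Suc n) - (if n = 0 then 1 else 0)) \<le> b ^ r) sequentially"
proof -
  define A where "A = 2 * pi * exp (4 * pi\<^sup>2 * real (Suc n)) * (1 + kloosterman_tail_const)"
  define X where "X = 2 * pi * real (Suc n) / b"
  have "(\<lambda>r. X ^ r / fact r) \<longlonglongrightarrow> 0"
    using summable_LIMSEQ_zero[OF summable_exp[of X]] by (simp add: divide_inverse mult.commute)
  hence "(\<lambda>r. A * (X ^ r / fact r)) \<longlonglongrightarrow> A * 0" by (intro tendsto_mult tendsto_const)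
  hence "eventually (\<lambda>r. A * (X ^ r / fact r) < 1) sequentially" by (intro order_tendstoD) auto
  thus ?thesis using eventually_ge_at_top[of 3]
  proof eventually_elim
    case (elim r)
    show ?case
    proof
      assume "odd r"
      hence "norm (rho (Suc r) (poincare (Suc r)) (Suc n) - (if n = 0 then 1 else 0)) \<le> A * ((2 * pi * real (Suc n)) ^ r / fact r)"
        unfolding A_def using elim by (intro rho_poincare_near_delta) auto
      also have "(2 * pi * real (Suc n)) ^ r = X ^ r * b ^ r" using assms by (simp add: X_def power_divide)
      also have "A * (X ^ r * b ^ r / fact r) = (A * (X ^ r / fact r)) * b ^ r" by simp
      also have "\<dots> \<le> 1 * b ^ r" using elim assms by (intro mult_right_mono) auto
      finally show "norm (rho (Suc r) (poincare (Suc r)) (Suc n) - (if n = 0 then 1 else 0)) \<le> b ^ r" by simp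
    qed
  qed
qed

section \<open>Square indices and the choice of weight\<close>

text \<open>The exponent is 1 + 1/16: 1 from r^r / r! \<le> e^r and 1/16 from the Bessel bound for
  moduli c \<ge> 2. Division by 4 gives the rate 3/4 of that tail.\<close>

lemma exp_17_16: "exp (17 / 16) \<le> (3::real)"
proof (rule power_le_imp_le_base)
  have "exp (17 / 16) ^ Suc 15 = exp (1::real) ^ 17" by (simp add: exp_of_nat_mult[symmetric])
  also have "\<dots> \<le> (272 / 100) ^ 17" using e_less_272 by (intro power_mono) auto
  also have "\<dots> \<le> (3::real) ^ Suc 15" by (simp add: power_divide)
  finally show "exp (17 / 16) ^ Suc 15 \<le> (3::real) ^ Suc 15" .
qed simp

lemma Re_rho_poincare_transition:
  assumes r: "r mod 4 = 1" "r \<ge> 320" and q: "q \<ge> 2" and x: "x = 4 * pi * real q" "x < real r"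
    and s: "5 * (real r)\<^sup>2 \<le> 4 * sqrt ((real r)\<^sup>2 - x\<^sup>2) ^ 3" "sqrt ((real r)\<^sup>2 - x\<^sup>2) ^ 3 \<le> 40 * (real r)\<^sup>2"
  shows "Re (rho (Suc r) (poincare (Suc r)) (q\<^sup>2)) \<le>
    - (2 * pi * exp (-42) * 40 powr (-1/6)) * real r powr (-1/3) + 2 * pi * kloosterman_tail_const * (3 / 4) ^ r"
proof -
  have odd: "odd r" using r(1) by presburger
  have q2: "q\<^sup>2 > 1" using q power_mono[OF q, of 2] by simp
  define n where "n = q\<^sup>2 - 1"
  have n: "Suc n = q\<^sup>2" "n \<noteq> 0" using q2 by (auto simp: n_def)
  have qp: "real q > 0" using q by simp
  have pw: "real (Suc n) powr (real r / 2) = real q ^ r"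
  proof -
    have "real (Suc n) powr (real r / 2) = (real q powr 2) powr (real r / 2)" using qp by (simp add: n(1) del: of_nat_Suc)
    also have "\<dots> = real q powr real r" by (simp only: powr_powr) simp
    finally show ?thesis using qp by (simp add: powr_realpow)
  qed
  define K where "K = kloosterman_tail_const"
  have K: "K \<ge> 0" by (simp add: K_def kloosterman_tail_const_nonneg)
  \<comment> \<open>The residue of r modulo 4 is used here: i^(r + 1) = -1 fixes the sign of the
    main term.\<close>
  have cpx: "(- 2 * of_real pi * \<i>) ^ Suc r = - (of_real ((2 * pi) ^ Suc r) :: complex)"
  proof -
    define j where "j = r div 4"
    have j: "r = 4 * j + 1" using r(1) unfolding j_def by presburger
    have "\<i> ^ Suc r = (\<i>\<^sup>2) ^ (2 * j + 1)" unfolding power_mult[symmetric] j by simp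
    also have "\<dots> = -1" by simp
    finally have i: "\<i> ^ Suc r = -1" .
    have ev: "even (Suc r)" using odd by simp
    have e: "- 2 * of_real pi * \<i> = - of_real (2 * pi) * \<i>" by simp
    have e2: "(- of_real (2 * pi) :: complex) ^ Suc r = of_real ((2 * pi) ^ Suc r)"
      unfolding of_real_power by (rule power_minus_even[OF ev])
    show ?thesis unfolding e power_mult_distrib e2 i by (rule mult_minus1_right)
  qed
  have arg: "4 * pi\<^sup>2 / 1 * real (Suc n) = x\<^sup>2 / 4" unfolding n(1) x(1) by (simp add: power_mult_distrib)
  have "bes_coeff 1 r n = - of_real ((2 * pi) ^ Suc r) * of_nat (Suc n) ^ r * of_real (bes r (x\<^sup>2 / 4))"
    unfolding bes_coeff_def cpx arg ..
  also have "\<dots> = - of_real ((2 * pi) ^ Suc r * (real q)\<^sup>2 ^ r * bes r (x\<^sup>2 / 4))"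
    unfolding n(1) by (simp only: of_nat_power of_real_mult of_real_power of_real_of_nat_eq mult_minus_left)
  also have "(2 * pi) ^ Suc r * (real q)\<^sup>2 ^ r = 2 * pi * (x / 2) ^ r * real q ^ r"
    by (simp add: x power_mult_distrib power2_eq_square)
  finally have m: "bes_coeff 1 r n / of_real (real q ^ r) = - of_real (2 * pi * ((x / 2) ^ r * bes r (x\<^sup>2 / 4)))"
    using qp by simp
  have "0 < x" using qp by (simp add: x)
  hence "exp (-42) * 40 powr (-1/6) * real r powr (-1/3) \<le> (x / 2) ^ r * bes r (x\<^sup>2 / 4)"
    using r(2) by (intro bes_transition_lower_bound x s) simp_all
  hence main: "Re (bes_coeff 1 r n / of_real (real q ^ r)) \<le> - (2 * pi * (exp (-42) * 40 powr (-1/6) * real r powr (-1/3)))"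
    unfolding m by (simp del: Re_divide_of_real)
  define t where "t = poincare_coeff r n - (if n = 0 then 1 else 0) - bes_coeff 1 r n"
  have "norm t \<le> (2 * pi) ^ Suc r * real (Suc n) ^ r * (exp (pi\<^sup>2 * real (Suc n) / real (Suc r)) / fact r) * (K / 2 ^ r)"
    unfolding t_def K_def using r by (intro poincare_coeff_split) auto
  also have "\<dots> = 2 * pi * K * (real q ^ r * ((pi * real q) ^ r * exp (pi\<^sup>2 * (real q)\<^sup>2 / real (Suc r)) / fact r))"
    by (simp add: n(1) power_mult_distrib power2_eq_square del: of_nat_Suc)
  finally have t: "norm t \<le> 2 * pi * K * (real q ^ r * ((pi * real q) ^ r * exp (pi\<^sup>2 * (real q)\<^sup>2 / real (Suc r)) / fact r))" .
  have "norm (t / of_real (real q ^ r)) = norm t / real q ^ r" by (simp add: norm_divide norm_power)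
  also have "\<dots> \<le> 2 * pi * K * (real q ^ r * ((pi * real q) ^ r * exp (pi\<^sup>2 * (real q)\<^sup>2 / real (Suc r)) / fact r)) / real q ^ r"
    using t by (rule divide_right_mono) simp
  also have "\<dots> = 2 * pi * K * ((pi * real q) ^ r * exp (pi\<^sup>2 * (real q)\<^sup>2 / real (Suc r)) / fact r)" using qp by simp
  also have "\<dots> \<le> 2 * pi * K * (3 / 4) ^ r"
  proof (intro mult_left_mono)
    \<comment> \<open>From 4 \<pi> q < r. The 4 is what makes the tail exponentially smaller than
      the main term.\<close>
    have a: "pi * real q \<le> real r / 4" using x by simp
    have "pi\<^sup>2 * (real q)\<^sup>2 / real (Suc r) \<le> (real r / 4)\<^sup>2 / real r"
      using power_mono[OF a, of 2] qp r unfolding power_mult_distrib[symmetric] by (intro frac_le) auto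
    also have "\<dots> = real r * (1 / 16)" using r by (simp add: power2_eq_square)
    finally have "exp (pi\<^sup>2 * (real q)\<^sup>2 / real (Suc r)) \<le> exp (1 / 16) ^ r" by (simp add: exp_of_nat_mult[symmetric])
    moreover have "(pi * real q) ^ r \<le> (real r / 4) ^ r" using a by (intro power_mono) auto
    ultimately have "(pi * real q) ^ r * exp (pi\<^sup>2 * (real q)\<^sup>2 / real (Suc r)) / fact r \<le> (real r / 4) ^ r * exp (1 / 16) ^ r / fact r"
      by (intro divide_right_mono mult_mono) auto
    also have "\<dots> = real r ^ r / fact r * (exp (1/16) / 4) ^ r" by (simp add: power_divide)
    also have "\<dots> \<le> exp (real r) * (exp (1/16) / 4) ^ r" by (intro mult_right_mono power_div_fact_le_exp) auto
    also have "exp (real r) = exp 1 ^ r" by (simp add: exp_of_nat_mult[symmetric])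
    also have "exp 1 ^ r * (exp (1/16) / 4) ^ r = (exp (17/16) / 4 :: real) ^ r"
      unfolding power_mult_distrib[symmetric] by (simp add: exp_add[symmetric])
    also have "\<dots> \<le> (3 / 4) ^ r" using exp_17_16 by (intro power_mono) auto
    finally show "(pi * real q) ^ r * exp (pi\<^sup>2 * (real q)\<^sup>2 / real (Suc r)) / fact r \<le> (3 / 4) ^ r" .
  qed (use K in auto)
  finally have tail: "norm (t / of_real (real q ^ r)) \<le> 2 * pi * K * (3 / 4) ^ r" .
  have "rho (Suc r) (poincare (Suc r)) (q\<^sup>2) = poincare_coeff r n / of_real (real q ^ r)"
    using rho_poincare[OF _ odd, of n] r unfolding n(1) pw[unfolded n(1)] by simp
  also have "poincare_coeff r n = bes_coeff 1 r n + t" using n by (simp add: t_def)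
  finally have "Re (rho (Suc r) (poincare (Suc r)) (q\<^sup>2)) = Re (bes_coeff 1 r n / of_real (real q ^ r)) + Re (t / of_real (real q ^ r))"
    by (simp only: add_divide_distrib plus_complex.sel)
  also have "\<dots> \<le> - (2 * pi * (exp (-42) * 40 powr (-1/6) * real r powr (-1/3))) + 2 * pi * K * (3 / 4) ^ r"
    using main tail complex_Re_le_cmod[of "t / of_real (real q ^ r)"] by (intro add_mono) auto
  finally show ?thesis by (simp add: K_def mult.assoc)
qed

text \<open>The least r congruent to 1 modulo 4 that satisfies the lower inequality also satisfies
  the upper one: the inequality fails at r - 4, and s^2 grows between r - 4 and r by less than 8
  r.\<close>

lemma transition_weight_exists:
  assumes q: "q \<ge> 100"
  obtains r x where "r mod 4 = 1" "r \<ge> 320" "x = 4 * pi * real q" "x < real r"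
    "5 * (real r)\<^sup>2 \<le> 4 * sqrt ((real r)\<^sup>2 - x\<^sup>2) ^ 3" "sqrt ((real r)\<^sup>2 - x\<^sup>2) ^ 3 \<le> 40 * (real r)\<^sup>2"
proof -
  define x where "x = 4 * pi * real q"
  have x: "x \<ge> 1200" using q pi_gt3 mult_mono[of 12 "4 * pi" 100 "real q"] by (simp add: x_def)
  \<comment> \<open>The square of 5 v^2 \<le> 4 s^3, which avoids the root.\<close>
  define good where "good = (\<lambda>v::nat. x < real v \<and> (25/16) * real v ^ 4 \<le> ((real v)\<^sup>2 - x\<^sup>2) ^ 3)"
  have "eventually (\<lambda>v::nat. x < real v) sequentially" by real_asymp
  moreover have "eventually (\<lambda>v::nat. (25/16) * real v ^ 4 \<le> ((real v)\<^sup>2 - x\<^sup>2) ^ 3) sequentially" by real_asymp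
  ultimately have "eventually good sequentially" unfolding good_def by (rule eventually_conj)
  then obtain V where V: "\<And>v. v \<ge> V \<Longrightarrow> good v" by (auto simp: eventually_sequentially)
  hence ex: "\<exists>j. good (4 * j + 1)" by (intro exI[of _ V]) auto
  define j where "j = (LEAST j. good (4 * j + 1))"
  have g: "good (4 * j + 1)" unfolding j_def by (rule LeastI_ex[OF ex])
  have ng: "\<not> good (4 * i + 1)" if "i < j" for i using that not_less_Least unfolding j_def by blast
  define r where "r = 4 * j + 1"
  have rx: "x < real r" using g by (simp add: good_def r_def)
  have r320: "r \<ge> 320" using rx x by simp
  have jp: "j > 0" using r320 by (simp add: r_def)
  define i where "i = j - 1"
  have ji: "j = Suc i" using jp by (simp add: i_def)
  define v where "v = real r powr (4/3)"
  have r1: "real r \<ge> 1" using r320 by simp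
  have v0': "v > 0" using r1 by (simp add: v_def)
  have v3: "v ^ 3 = real r ^ 4"
  proof -
    have "v ^ 3 = (real r powr (4/3)) powr (real 3)" using v0' by (subst powr_realpow) (auto simp: v_def)
    also have "\<dots> = real r powr real 4" by (simp only: powr_powr) simp
    also have "\<dots> = real r ^ 4" using r1 by (intro powr_realpow) simp
    finally show ?thesis .
  qed
  have rv: "real r \<le> v" using r1 powr_mono[of 1 "4/3" "real r"] by (simp add: v_def)
  have v0: "v > 0" using rv r1 by simp
  define s where "s = sqrt ((real r)\<^sup>2 - x\<^sup>2)"
  have xr: "x\<^sup>2 < (real r)\<^sup>2" by (rule power_strict_mono[OF rx]) (use x in linarith, rule pos2)
  have s0: "s > 0" using xr by (simp add: s_def)
  have s2: "s\<^sup>2 = (real r)\<^sup>2 - x\<^sup>2" using xr by (simp add: s_def)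
  have s6: "(s ^ 3)\<^sup>2 = ((real r)\<^sup>2 - x\<^sup>2) ^ 3" unfolding s2[symmetric] by (simp add: power_mult[symmetric])
  have low: "5 * (real r)\<^sup>2 \<le> 4 * s ^ 3"
  proof -
    have "(5/4 * (real r)\<^sup>2)\<^sup>2 = (25/16) * real r ^ 4" by (simp add: power_mult_distrib power_divide power_mult[symmetric])
    also have "\<dots> \<le> (s ^ 3)\<^sup>2" using g unfolding s6 by (simp add: good_def r_def)
    finally have "5/4 * (real r)\<^sup>2 \<le> s ^ 3" by (rule power2_le_imp_le) (use s0 in simp)
    thus ?thesis by simp
  qed
  define a where "a = (real r - 4)\<^sup>2 - x\<^sup>2"
  \<comment> \<open>Since (6/5)^3 > 25/16, failure at r - 4 bounds a by 6/5 r^(4/3). Adding 8 r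
    gives s^2 \<le> 11 r^(4/3), and 11^3 = 1331 is below 40^2.\<close>
  have av: "a \<le> 6/5 * v"
  proof -
    have r4: "real (4 * i + 1) = real r - 4" by (simp add: r_def ji)
    have "\<not> good (4 * i + 1)" by (rule ng) (simp add: ji)
    hence "real r - 4 \<le> x \<or> a ^ 3 < (25/16) * (real r - 4) ^ 4" unfolding good_def r4 a_def by auto
    thus ?thesis
    proof
      assume "real r - 4 \<le> x"
      hence "(real r - 4)\<^sup>2 \<le> x\<^sup>2" using r320 by (intro power_mono) auto
      thus ?thesis using v0 by (simp add: a_def)
    next
      assume "a ^ 3 < (25/16) * (real r - 4) ^ 4"
      also have "\<dots> \<le> (25/16) * real r ^ 4" using r320 by (intro mult_left_mono power_mono) auto
      also have "\<dots> \<le> (6/5 * v) ^ 3" using v0 unfolding v3[symmetric] power_mult_distrib by (intro mult_right_mono) (auto simp: power3_eq_cube)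
      finally show ?thesis using v0 by (intro less_imp_le, intro power_less_imp_less_base[of a 3]) auto
    qed
  qed
  have "s\<^sup>2 = a + 8 * real r - 16" unfolding s2 a_def by (simp add: power2_eq_square algebra_simps)
  also have "\<dots> \<le> 11 * v" using av rv v0 by simp
  finally have s11: "s\<^sup>2 \<le> 11 * v" .
  have "(s ^ 3)\<^sup>2 = (s\<^sup>2) ^ 3" by (simp add: power_mult[symmetric])
  also have "\<dots> \<le> (11 * v) ^ 3" using s11 by (intro power_mono) auto
  also have "\<dots> = 1331 * real r ^ 4" unfolding power_mult_distrib v3 by simp
  also have "\<dots> \<le> (40 * (real r)\<^sup>2)\<^sup>2" by (simp add: power_mult_distrib power_mult[symmetric])
  finally have up: "s ^ 3 \<le> 40 * (real r)\<^sup>2" by (rule power2_le_imp_le) simp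
  show ?thesis
    by (rule that[of r x]) (use low up r320 rx in \<open>auto simp: s_def x_def r_def\<close>)
qed

section \<open>Chebyshev polynomials and the semicircle law\<close>

lemma cheb_2_cos_sin: "cheb m (2 * cos \<theta>) * sin \<theta> = sin (real (Suc m) * \<theta>)" for \<theta> :: real
proof (induction m "2 * cos \<theta>" rule: cheb.induct)
  case 1 thus ?case by simp
next
  case 2 thus ?case by (simp add: sin_double)
next
  case (3 n)
  have "sin (real (Suc (Suc (Suc n))) * \<theta>) + sin (real (Suc n) * \<theta>) = 2 * cos \<theta> * sin (real (Suc (Suc n)) * \<theta>)"
  proof -
    have a: "real (Suc (Suc (Suc n))) * \<theta> = real (Suc (Suc n)) * \<theta> + \<theta>" "real (Suc n) * \<theta> = real (Suc (Suc n)) * \<theta> - \<theta>"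
      by (simp_all add: algebra_simps)
    show ?thesis unfolding a by (simp only: sin_add sin_diff) algebra
  qed
  with 3 show ?case by (simp add: algebra_simps)
qed

text \<open>Iterating this turns the even polynomials into cosine sums, 1 + 2 cos 2\<theta> + ... +
  2 cos 2j\<theta>, whose derivative in \<theta> is visibly bounded by 2 j (j + 1), without a
  division by sin \<theta>.\<close>

lemma cheb_2_cos_step: "cheb (m + 2) (2 * cos \<theta>) = cheb m (2 * cos \<theta>) + 2 * cos (real (m + 2) * \<theta>)" for \<theta> :: real
proof (induction m rule: nat_less_induct)
  case (1 m)
  consider "m = 0" | "m = 1" | n where "m = n + 2" by (metis One_nat_def add_2_eq_Suc' not0_implies_Suc)
  thus ?case
  proof cases
    case 1 thus ?thesis by (simp add: numeral_2_eq_2 cos_double_cos power2_eq_square)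
  next
    case 2
    have "cos (3 * \<theta>) = 4 * cos \<theta> ^ 3 - 3 * cos \<theta>" by (rule cos_treble_cos)
    thus ?thesis unfolding 2 by (simp add: numeral_2_eq_2 numeral_3_eq_3 power3_eq_cube algebra_simps)
  next
    case (3 n)
    have a: "cheb (n + 2) (2 * cos \<theta>) = cheb n (2 * cos \<theta>) + 2 * cos (real (n + 2) * \<theta>)"
      "cheb (Suc n + 2) (2 * cos \<theta>) = cheb (Suc n) (2 * cos \<theta>) + 2 * cos (real (Suc n + 2) * \<theta>)"
      by (rule 1[rule_format], simp add: 3)+
    have t: "cos (real (n + 4) * \<theta>) + cos (real (n + 2) * \<theta>) = 2 * cos \<theta> * cos (real (Suc n + 2) * \<theta>)"
    proof -
      have e: "real (n + 4) * \<theta> = real (Suc n + 2) * \<theta> + \<theta>" "real (n + 2) * \<theta> = real (Suc n + 2) * \<theta> - \<theta>"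
        by (simp_all add: algebra_simps)
      show ?thesis unfolding e by (simp only: cos_add cos_diff) algebra
    qed
    have c: "cheb (n + 4) x = x * cheb (Suc n + 2) x - cheb (n + 2) x" "cheb (n + 2) x = x * cheb (Suc n) x - cheb n x" for x :: real
      by (simp_all add: numeral_eq_Suc)
    have "cheb (n + 4) (2 * cos \<theta>) - cheb (n + 2) (2 * cos \<theta>) =
        2 * cos \<theta> * (cheb (Suc n + 2) (2 * cos \<theta>) - cheb (Suc n) (2 * cos \<theta>)) - (cheb (n + 2) (2 * cos \<theta>) - cheb n (2 * cos \<theta>))"
      using c(1)[of "2 * cos \<theta>"] c(2)[of "2 * cos \<theta>"] by (simp add: algebra_simps)
    also have "\<dots> = 2 * (2 * cos \<theta> * cos (real (Suc n + 2) * \<theta>)) - 2 * cos (real (n + 2) * \<theta>)" using a by simp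
    also have "\<dots> = 2 * cos (real (n + 4) * \<theta>)" using t by linarith
    finally have "cheb (n + 4) (2 * cos \<theta>) = cheb (n + 2) (2 * cos \<theta>) + 2 * cos (real (n + 4) * \<theta>)" by linarith
    note fin = this
    have e: "m + 2 = n + 4" using 3 by simp
    show ?thesis unfolding e unfolding 3 by (rule fin)
  qed
qed

lemma cheb_at_2: "cheb m (2 :: real) = real (Suc m)"
  by (induction m "2 :: real" rule: cheb.induct) auto

lemma cheb_even_derivative:
  fixes \<theta> :: real
  shows "\<exists>D. (\<forall>\<theta>. ((\<lambda>\<theta>. cheb (2 * j) (2 * cos \<theta>)) has_real_derivative D \<theta>) (at \<theta>)) \<and> continuous_on UNIV D \<and> (\<forall>\<theta>. \<bar>D \<theta>\<bar> \<le> 2 * real j * real (Suc j))"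
proof (induction j)
  case 0 show ?case by (rule exI[of _ "\<lambda>_. 0"]) auto
next
  case (Suc j)
  then obtain D where D: "\<And>\<theta>. ((\<lambda>\<theta>. cheb (2 * j) (2 * cos \<theta>)) has_real_derivative D \<theta>) (at \<theta>)" "continuous_on UNIV D" "\<And>\<theta>. \<bar>D \<theta>\<bar> \<le> 2 * real j * real (Suc j)"
    by blast
  define M where "M = real (2 * j + 2)"
  have e: "cheb (2 * Suc j) (2 * cos \<theta>) = cheb (2 * j) (2 * cos \<theta>) + 2 * cos (M * \<theta>)" for \<theta>
    using cheb_2_cos_step[of "2 * j" \<theta>] by (simp add: M_def)
  have "((\<lambda>\<theta>. cheb (2 * Suc j) (2 * cos \<theta>)) has_real_derivative D \<theta> - 2 * M * sin (M * \<theta>)) (at \<theta>)" for \<theta>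
    unfolding e by (auto intro!: derivative_eq_intros D(1))
  moreover have "continuous_on UNIV (\<lambda>\<theta>. D \<theta> - 2 * M * sin (M * \<theta>))" by (intro continuous_intros D(2))
  moreover have "\<bar>D \<theta> - 2 * M * sin (M * \<theta>)\<bar> \<le> 2 * real (Suc j) * real (Suc (Suc j))" for \<theta>
  proof -
    have "\<bar>2 * M * sin (M * \<theta>)\<bar> \<le> 2 * M * 1" unfolding abs_mult by (intro mult_mono) (auto simp: M_def)
    hence "\<bar>D \<theta> - 2 * M * sin (M * \<theta>)\<bar> \<le> 2 * real j * real (Suc j) + 2 * M" using D(3)[of \<theta>] by linarith
    also have "\<dots> = 2 * real (Suc j) * real (Suc (Suc j))" by (simp add: M_def algebra_simps)
    finally show ?thesis .
  qed
  ultimately show ?case by (intro exI[of _ "\<lambda>\<theta>. D \<theta> - 2 * M * sin (M * \<theta>)"]) blast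
qed

text \<open>For |x| \<ge> 2 the absolute values do not decrease along the recursion, so its first
  term decides the sign at every step.\<close>

lemma cheb_nonneg_outside:
  assumes "even m" "\<bar>x\<bar> \<ge> (2::real)"
  shows "cheb m x \<ge> 0"
proof -
  have step: "\<bar>cheb n x\<bar> \<le> \<bar>cheb (Suc n) x\<bar>" for n
  proof (induction n)
    case 0 thus ?case using assms by simp
  next
    case (Suc n)
    have "2 * \<bar>cheb (Suc n) x\<bar> \<le> \<bar>x * cheb (Suc n) x\<bar>" unfolding abs_mult using assms by (intro mult_right_mono) auto
    moreover have "cheb (Suc (Suc n)) x = x * cheb (Suc n) x - cheb n x" by simp
    ultimately show ?case using Suc by linarith
  qed
  have "cheb (2 * j) x \<ge> 0 \<and> x * cheb (2 * j + 1) x \<ge> 0" for j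
  proof (induction j)
    case (Suc j)
    have a: "cheb (2 * Suc j) x = x * cheb (2 * j + 1) x - cheb (2 * j) x" by simp
    have "cheb (2 * j) x \<le> x * cheb (2 * j + 1) x"
    proof -
      have "\<bar>cheb (2 * j) x\<bar> \<le> \<bar>cheb (2 * j + 1) x\<bar>" using step[of "2 * j"] by simp
      also have "\<dots> = 1 * \<bar>cheb (2 * j + 1) x\<bar>" by simp
      also have "\<dots> \<le> \<bar>x\<bar> * \<bar>cheb (2 * j + 1) x\<bar>" using assms by (intro mult_right_mono) auto
      also have "\<dots> = x * cheb (2 * j + 1) x" using Suc by (simp add: abs_mult[symmetric])
      finally show ?thesis using Suc by simp
    qed
    hence b: "cheb (2 * Suc j) x \<ge> 0" using a by simp
    have "x * cheb (2 * Suc j + 1) x = x\<^sup>2 * cheb (2 * Suc j) x - x * cheb (2 * j + 1) x"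
      by (simp add: algebra_simps power2_eq_square)
    moreover have "x * cheb (2 * j + 1) x \<le> x\<^sup>2 * cheb (2 * Suc j) x"
    proof -
      have "\<bar>x * cheb (2 * j + 1) x\<bar> \<le> \<bar>x * cheb (2 * Suc j) x\<bar>"
        unfolding abs_mult using step[of "2 * j + 1"] by (intro mult_left_mono) auto
      also have "\<dots> = \<bar>x\<bar> * cheb (2 * Suc j) x" using b by (simp add: abs_mult)
      also have "\<dots> \<le> (\<bar>x\<bar> * \<bar>x\<bar>) * cheb (2 * Suc j) x"
        using assms b mult_left_mono[of 1 "\<bar>x\<bar>" "\<bar>x\<bar>"] by (intro mult_right_mono) auto
      finally show ?thesis by (simp add: power2_eq_square)
    qed
    ultimately show ?case using b by simp
  qed (use assms in auto)
  thus ?thesis using assms(1) by (auto elim!: evenE)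
qed

section \<open>Integration by parts against the semicircle law\<close>

text \<open>The semicircle mass of [-2, 2 cos \<theta>], falling from 1 at \<theta> = 0 to 0 at
  \<theta> = \<pi>.\<close>

definition semicircle_cdf :: "real \<Rightarrow> real" where
  "semicircle_cdf \<theta> = 1 - (\<theta> - sin \<theta> * cos \<theta>) / pi"

text \<open>The orthogonality of U_{2j} to constants, in angular form: 2 sin^2 \<theta> U_m = cos
  m\<theta> - cos (m + 2)\<theta> integrates to 0, so only the boundary term at \<theta> = 0
  remains. \<open>P\<close> is the resulting antiderivative.\<close>

lemma cheb_semicircle_by_parts:
  fixes D :: "real \<Rightarrow> real"
  assumes D: "\<And>\<theta>. ((\<lambda>\<theta>. cheb (2 * j) (2 * cos \<theta>)) has_real_derivative D \<theta>) (at \<theta>)" and j: "j \<ge> 1"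
  shows "((\<lambda>\<theta>. D \<theta> * semicircle_cdf \<theta>) has_integral - real (2 * j + 1)) {0..pi}"
proof -
  define m where "m = real (2 * j)"
  have m: "m > 0" using j by (simp add: m_def)
  define G where "G = (\<lambda>\<theta>::real. cheb (2 * j) (2 * cos \<theta>))"
  define P where "P = (\<lambda>\<theta>. G \<theta> * semicircle_cdf \<theta> + (sin (m * \<theta>) / m - sin ((m + 2) * \<theta>) / (m + 2)) / pi)"
  have "(P has_real_derivative D \<theta> * semicircle_cdf \<theta>) (at \<theta>)" for \<theta>
  proof -
    have dG: "(G has_real_derivative D \<theta>) (at \<theta>)" using D by (simp add: G_def)
    have dS: "(semicircle_cdf has_real_derivative - (1 - (cos \<theta> * cos \<theta> - sin \<theta> * sin \<theta>)) / pi) (at \<theta>)"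
      unfolding semicircle_cdf_def[abs_def] by (auto intro!: derivative_eq_intros simp: field_simps)
    have d: "(P has_real_derivative (D \<theta> * semicircle_cdf \<theta> + - (1 - (cos \<theta> * cos \<theta> - sin \<theta> * sin \<theta>)) / pi * G \<theta> + (cos (m * \<theta>) - cos ((m + 2) * \<theta>)) / pi)) (at \<theta>)"
      unfolding P_def using m by (auto intro!: derivative_eq_intros dG dS)
    have "G \<theta> * sin \<theta> = sin ((m + 1) * \<theta>)" using cheb_2_cos_sin[of "2 * j" \<theta>] by (simp add: G_def m_def add.commute)
    hence "2 * sin \<theta> * sin \<theta> * G \<theta> = 2 * sin \<theta> * sin ((m + 1) * \<theta>)" by (simp add: mult_ac)
    also have "\<dots> = cos (m * \<theta>) - cos ((m + 2) * \<theta>)"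
    proof -
      have e: "m * \<theta> = (m + 1) * \<theta> - \<theta>" "(m + 2) * \<theta> = (m + 1) * \<theta> + \<theta>" by (simp_all add: algebra_simps)
      show ?thesis unfolding e by (simp only: cos_add cos_diff) algebra
    qed
    also have "2 * sin \<theta> * sin \<theta> = 1 - (cos \<theta> * cos \<theta> - sin \<theta> * sin \<theta>)"
      using sin_cos_squared_add3[of \<theta>] by linarith
    finally have "(1 - (cos \<theta> * cos \<theta> - sin \<theta> * sin \<theta>)) * G \<theta> = cos (m * \<theta>) - cos ((m + 2) * \<theta>)" .
    hence "- (1 - (cos \<theta> * cos \<theta> - sin \<theta> * sin \<theta>)) / pi * G \<theta> + (cos (m * \<theta>) - cos ((m + 2) * \<theta>)) / pi = 0"
    proof -
      have "U * g = V \<Longrightarrow> - U / pi * g + V / pi = 0" for U V g :: real by auto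
      thus ?thesis if "(1 - (cos \<theta> * cos \<theta> - sin \<theta> * sin \<theta>)) * G \<theta> = cos (m * \<theta>) - cos ((m + 2) * \<theta>)" using that by blast
    qed
    with d show ?thesis by (simp only: add.assoc add_0_right)
  qed
  hence "((\<lambda>\<theta>. D \<theta> * semicircle_cdf \<theta>) has_integral (P pi - P 0)) {0..pi}"
    by (intro fundamental_theorem_of_calculus) (auto simp: has_real_derivative_iff_has_vector_derivative[symmetric] intro: has_field_derivative_at_within)
  moreover have "sin (m * pi) = 0" using sin_npi[of "2 * j"] by (simp add: m_def)
  moreover have "sin ((m + 2) * pi) = 0" using sin_npi[of "2 * j + 2"] by (simp add: m_def add.commute)
  ultimately show ?thesis using cheb_at_2[of "2 * j"] by (simp add: P_def semicircle_cdf_def G_def)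
qed

text \<open>With t_i = arccos (x_i / 2) and n(\<theta>) the mass of the angles t_i \<ge> \<theta>,
  the sum over [-2, 2] is the integral of D n plus n(0) G(0). Replacing n by the semicircle
  distribution costs \<pi> sup |D| times d in the integral and (2 j + 1) d at \<theta> = 0; points
  outside [-2, 2] only help.\<close>

lemma cheb_sum_lower_bound:
  fixes w x :: "'a \<Rightarrow> real"
  assumes I: "finite I" and w: "\<And>i. i \<in> I \<Longrightarrow> w i \<ge> 0" and j: "j \<ge> 1"
    and near: "\<And>\<theta>. 0 \<le> \<theta> \<Longrightarrow> \<theta> \<le> pi \<Longrightarrow> \<bar>(\<Sum>i | i \<in> I \<and> -2 \<le> x i \<and> x i \<le> 2 * cos \<theta>. w i) - semicircle_cdf \<theta>\<bar> \<le> d"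
  shows "(\<Sum>i\<in>I. w i * cheb (2 * j) (x i)) \<ge> - (real (2 * j + 1) + pi * (2 * real j * real (Suc j))) * d"
proof -
  obtain D where D: "\<And>\<theta>. ((\<lambda>\<theta>. cheb (2 * j) (2 * cos \<theta>)) has_real_derivative D \<theta>) (at \<theta>)" "continuous_on UNIV D"
    "\<And>\<theta>. \<bar>D \<theta>\<bar> \<le> 2 * real j * real (Suc j)"
    using cheb_even_derivative[of j] by blast
  define G where "G = (\<lambda>\<theta>::real. cheb (2 * j) (2 * cos \<theta>))"
  define J where "J = {i\<in>I. -2 \<le> x i \<and> x i \<le> 2}"
  have J: "finite J" "J \<subseteq> I" using I by (auto simp: J_def)
  define t where "t = (\<lambda>i. arccos (x i / 2))"
  have t: "0 \<le> t i" "t i \<le> pi" "2 * cos (t i) = x i" if "i \<in> J" for i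
    using that by (auto simp: t_def J_def intro!: arccos_lbound arccos_ubound)
  define n where "n = (\<lambda>\<theta>. \<Sum>i\<in>J. w i * indicator {0..t i} \<theta>)"
  have n_eq: "n \<theta> = (\<Sum>i | i \<in> I \<and> -2 \<le> x i \<and> x i \<le> 2 * cos \<theta>. w i)" if th: "0 \<le> \<theta>" "\<theta> \<le> pi" for \<theta>
  proof -
    have "n \<theta> = (\<Sum>i\<in>J. if \<theta> \<le> t i then w i else 0)" unfolding n_def by (intro sum.cong) (use th in auto)
    also have "\<dots> = (\<Sum>i\<in>{i\<in>J. \<theta> \<le> t i}. w i)" by (rule sum.inter_filter[symmetric, OF J(1)])
    also have "{i\<in>J. \<theta> \<le> t i} = {i. i \<in> I \<and> -2 \<le> x i \<and> x i \<le> 2 * cos \<theta>}"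
    proof -
      have "\<theta> \<le> t i \<longleftrightarrow> x i \<le> 2 * cos \<theta>" if "i \<in> J" for i
        using cos_mono_le_eq[of "t i" \<theta>] t[OF that] th by auto
      moreover have "i \<in> J" if "i \<in> I" "-2 \<le> x i" "x i \<le> 2 * cos \<theta>" for i
      proof -
        have "2 * cos \<theta> \<le> 2" using cos_le_one[of \<theta>] by linarith
        hence "x i \<le> 2" using that by linarith
        thus ?thesis using that by (simp add: J_def)
      qed
      ultimately show ?thesis using J(2) by (auto simp: J_def)
    qed
    finally show ?thesis .
  qed
  have i1: "((\<lambda>\<theta>. indicator {0..t i} \<theta> * D \<theta>) has_integral (G (t i) - G 0)) {0..pi}" if i: "i \<in> J" for i
  proof -
    have "(D has_integral (G (t i) - G 0)) {0..t i}"
      using t[OF i] D(1) unfolding G_def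
      by (intro fundamental_theorem_of_calculus) (auto simp: has_real_derivative_iff_has_vector_derivative[symmetric] intro: has_field_derivative_at_within)
    hence "((\<lambda>\<theta>. if \<theta> \<in> {0..t i} then D \<theta> else 0) has_integral (G (t i) - G 0)) {0..pi}"
      by (subst has_integral_restrict) (use t[OF i] in auto)
    moreover have "(\<lambda>\<theta>. if \<theta> \<in> {0..t i} then D \<theta> else 0) = (\<lambda>\<theta>. indicator {0..t i} \<theta> * D \<theta>)" by (auto simp: fun_eq_iff)
    ultimately show ?thesis by simp
  qed
  have "((\<lambda>\<theta>. \<Sum>i\<in>J. w i * (indicator {0..t i} \<theta> * D \<theta>)) has_integral (\<Sum>i\<in>J. w i * (G (t i) - G 0))) {0..pi}"
    by (intro has_integral_sum J has_integral_mult_right i1)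
  moreover have "(\<lambda>\<theta>. \<Sum>i\<in>J. w i * (indicator {0..t i} \<theta> * D \<theta>)) = (\<lambda>\<theta>. D \<theta> * n \<theta>)"
    by (simp add: n_def fun_eq_iff sum_distrib_left mult_ac)
  ultimately have In: "((\<lambda>\<theta>. D \<theta> * n \<theta>) has_integral (\<Sum>i\<in>J. w i * (G (t i) - G 0))) {0..pi}" by simp
  have Is: "((\<lambda>\<theta>. D \<theta> * semicircle_cdf \<theta>) has_integral - real (2 * j + 1)) {0..pi}"
    by (rule cheb_semicircle_by_parts[OF D(1) j])
  define V where "V = (\<Sum>i\<in>J. w i * (G (t i) - G 0)) + real (2 * j + 1)"
  have "((\<lambda>\<theta>. D \<theta> * n \<theta> - D \<theta> * semicircle_cdf \<theta>) has_integral V) {0..pi}"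
    using has_integral_diff[OF In Is] unfolding V_def diff_minus_eq_add .
  moreover have "norm (D \<theta> * n \<theta> - D \<theta> * semicircle_cdf \<theta>) \<le> 2 * real j * real (Suc j) * d" if "\<theta> \<in> {0..pi}" for \<theta>
  proof -
    have "norm (D \<theta> * n \<theta> - D \<theta> * semicircle_cdf \<theta>) = \<bar>D \<theta>\<bar> * \<bar>n \<theta> - semicircle_cdf \<theta>\<bar>"
      by (simp add: abs_mult[symmetric] right_diff_distrib)
    also have "\<dots> \<le> 2 * real j * real (Suc j) * d"
      using that near[of \<theta>] D(3)[of \<theta>] by (intro mult_mono) (auto simp: n_eq)
    finally show ?thesis .
  qed
  ultimately have "norm V \<le> 2 * real j * real (Suc j) * d * measure lborel (cbox 0 pi)"
    by (intro has_integral_bound[of "2 * real j * real (Suc j) * d"]) (use near[of 0] in auto)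
  hence V: "V \<ge> - (pi * (2 * real j * real (Suc j)) * d)" by (simp add: mult_ac)
  have n0: "n 0 \<ge> 1 - d"
    using near[of 0] n_eq[of 0] by (simp add: semicircle_cdf_def)
  have nJ: "n 0 = (\<Sum>i\<in>J. w i)" unfolding n_def using t by (intro sum.cong) auto
  have G0: "G 0 = real (2 * j + 1)" using cheb_at_2[of "2 * j"] by (simp add: G_def)
  have "(\<Sum>i\<in>J. w i * cheb (2 * j) (x i)) = (\<Sum>i\<in>J. w i * G (t i))" using t by (intro sum.cong) (auto simp: G_def)
  also have "\<dots> = V - G 0 + n 0 * G 0"
    by (simp add: V_def G0 nJ sum_distrib_right right_diff_distrib sum_subtractf)
  also have "\<dots> \<ge> - (pi * (2 * real j * real (Suc j)) * d) - G 0 + (1 - d) * G 0"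
    using V n0 G0 by (intro add_mono diff_mono mult_right_mono) auto
  also have "- (pi * (2 * real j * real (Suc j)) * d) - G 0 + (1 - d) * G 0 = - (real (2 * j + 1) + pi * (2 * real j * real (Suc j))) * d"
    by (simp add: G0 algebra_simps)
  finally have "(\<Sum>i\<in>J. w i * cheb (2 * j) (x i)) \<ge> - (real (2 * j + 1) + pi * (2 * real j * real (Suc j))) * d" .
  also have "(\<Sum>i\<in>J. w i * cheb (2 * j) (x i)) \<le> (\<Sum>i\<in>I. w i * cheb (2 * j) (x i))"
  proof (rule sum_mono2[OF I J(2)])
    fix i assume "i \<in> I - J"
    hence "i \<in> I" "\<bar>x i\<bar> \<ge> 2" by (auto simp: J_def)
    thus "w i * cheb (2 * j) (x i) \<ge> 0" using w by (intro mult_nonneg_nonneg cheb_nonneg_outside) auto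
  qed
  finally show ?thesis .
qed

lemma semicircle_half_open:
  assumes "0 \<le> \<theta>" "\<theta> \<le> pi"
  shows "emeasure semicircle {-2..2 * cos \<theta>} = ennreal (semicircle_cdf \<theta>)" "semicircle_cdf \<theta> \<ge> 0"
proof -
  define F where "F = (\<lambda>x. (x / 2 * sqrt (1 - x\<^sup>2 / 4) + arcsin (x / 2)) / pi)"
  define g where "g = (\<lambda>x::real. 1 / pi * sqrt (1 - x\<^sup>2 / 4))"
  have g0: "g x \<ge> 0" if "-2 \<le> x" "x \<le> 2" for x
    using that abs_le_square_iff[of x 2] by (simp add: g_def abs_le_iff)
  have ub: "-2 \<le> 2 * cos \<theta>" "2 * cos \<theta> \<le> 2" using cos_le_one[of \<theta>] cos_ge_minus_one[of \<theta>] by auto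
  have xb: "x \<le> 2" if "x \<le> 2 * cos \<theta>" for x using that ub(2) by linarith
  have "(g has_integral (F (2 * cos \<theta>) - F (-2))) {-2..2 * cos \<theta>}"
  \<comment> \<open>The antiderivative contains arcsin and a root that are not differentiable at the
    end points, so only continuity is used there.\<close>
  proof (rule fundamental_theorem_of_calculus_interior[OF ub(1)])
    show "continuous_on {-2..2 * cos \<theta>} F"
      unfolding F_def using ub(1) by (intro continuous_intros) (auto dest: xb)
    fix x assume "x \<in> {-2<..<2 * cos \<theta>}"
    hence x: "-2 < x" "x < 2 * cos \<theta>" by auto
    with ub(2) have x: "-2 < x" "x < 2" by linarith+
    define s where "s = sqrt (1 - x\<^sup>2 / 4)"
    have "x\<^sup>2 < 4" using x abs_square_less_1[of "x / 2"] by (simp add: power_divide abs_less_iff)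
    hence s: "s > 0" "s\<^sup>2 = 1 - x\<^sup>2 / 4" by (simp_all add: s_def)
    have s': "sqrt (1 - (x / 2)\<^sup>2) = s" by (simp add: s_def power_divide)
    have ds: "((\<lambda>x. sqrt (1 - x\<^sup>2 / 4)) has_real_derivative - x / (4 * s)) (at x)"
      using s unfolding s_def by (auto intro!: derivative_eq_intros simp: field_simps)
    have da: "((\<lambda>x. arcsin (x / 2)) has_real_derivative 1 / (2 * s)) (at x)"
      using x s' s by (auto intro!: derivative_eq_intros simp: field_simps)
    have d0: "((\<lambda>x. x / 2) has_real_derivative 1 / 2) (at x)" by (auto intro!: derivative_eq_intros)
    have "(F has_real_derivative (1 / 2 * s + x / 2 * (- x / (4 * s)) + 1 / (2 * s)) / pi) (at x)"
      using DERIV_cdivide[OF DERIV_add[OF DERIV_mult[OF d0 ds] da], of pi] unfolding F_def s_def by (simp only: mult.commute[of "x / 2"])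
    also have "1 / 2 * s + x / 2 * (- x / (4 * s)) + 1 / (2 * s) = 1 / (2 * s) * (s\<^sup>2 + (1 - x\<^sup>2 / 4))"
      using s(1) by (simp add: field_simps power2_eq_square)
    also have "\<dots> = s" unfolding s(2)[symmetric] using s(1) by (simp add: power2_eq_square)
    finally show "(F has_vector_derivative g x) (at x)"
      by (simp add: has_real_derivative_iff_has_vector_derivative g_def s_def)
  qed
  also have "F (2 * cos \<theta>) - F (-2) = semicircle_cdf \<theta>"
  proof -
    have "sqrt (1 - (2 * cos \<theta>)\<^sup>2 / 4) = \<bar>sin \<theta>\<bar>" by (simp add: power_mult_distrib sin_squared_eq[symmetric])
    also have "\<dots> = sin \<theta>" using sin_ge_zero[OF assms] by simp
    finally have sq: "sqrt (1 - (2 * cos \<theta>)\<^sup>2 / 4) = sin \<theta>" .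
    have ac: "arcsin (cos \<theta>) = pi / 2 - \<theta>"
    proof -
      have "cos \<theta> = sin (pi / 2 - \<theta>)" by (simp add: sin_diff)
      thus ?thesis using arcsin_sin[of "pi / 2 - \<theta>"] assms by simp
    qed
    have f1: "F (2 * cos \<theta>) = (cos \<theta> * sin \<theta> + (pi / 2 - \<theta>)) / pi" unfolding F_def sq by (simp add: ac)
    have f2: "F (-2) = - 1 / 2" by (simp add: F_def)
    show ?thesis unfolding f1 f2 semicircle_cdf_def by (simp add: field_simps)
  qed
  finally have i: "(g has_integral semicircle_cdf \<theta>) {-2..2 * cos \<theta>}" .
  show nn: "semicircle_cdf \<theta> \<ge> 0" by (rule has_integral_nonneg[OF i]) (auto intro: g0 xb)
  have "((\<lambda>x. if x \<in> {-2..2 * cos \<theta>} then g x else 0) has_integral semicircle_cdf \<theta>) UNIV"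
    using i by (simp only: has_integral_restrict_UNIV)
  moreover have "(\<lambda>x. if x \<in> {-2..2 * cos \<theta>} then g x else 0) = (\<lambda>x. indicator {-2..2 * cos \<theta>} x * g x)" by (auto simp: fun_eq_iff)
  ultimately have i2: "((\<lambda>x. indicator {-2..2 * cos \<theta>} x * g x) has_integral semicircle_cdf \<theta>) UNIV" by simp
  have "(\<integral>\<^sup>+x. ennreal (indicator {-2..2 * cos \<theta>} x * g x) \<partial>lborel) = ennreal (semicircle_cdf \<theta>)"

  proof (rule nn_integral_has_integral_lborel[OF _ _ i2])
    show "(\<lambda>x. indicator {-2..2 * cos \<theta>} x * g x) \<in> borel_measurable borel" unfolding g_def by measurable
    show "0 \<le> indicator {-2..2 * cos \<theta>} x * g x" for x by (auto simp: indicator_def intro: g0 xb)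
  qed
  moreover have "emeasure semicircle {-2..2 * cos \<theta>} = (\<integral>\<^sup>+x. ennreal (indicator {-2..2} x * g x) * indicator {-2..2 * cos \<theta>} x \<partial>lborel)"
    unfolding semicircle_def g_def by (rule emeasure_density) auto
  moreover have "\<dots> = (\<integral>\<^sup>+x. ennreal (indicator {-2..2 * cos \<theta>} x * g x) \<partial>lborel)"
    by (intro nn_integral_cong) (auto simp: indicator_def dest: xb)
  ultimately show "emeasure semicircle {-2..2 * cos \<theta>} = ennreal (semicircle_cdf \<theta>)" by simp
qed

section \<open>From complex eigenvalues to their real parts\<close>

lemma norm_cheb_le:
  assumes "norm (x::complex) \<le> L"
  shows "norm (cheb m x) \<le> (L + 1) ^ m"
proof -
  have L: "L \<ge> 0" using assms norm_ge_zero order_trans by blast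
  have "norm (cheb m x) \<le> (L + 1) ^ m \<and> norm (cheb (Suc m) x) \<le> (L + 1) ^ Suc m"
  proof (induction m)
    case 0 thus ?case using assms by simp
  next
    case (Suc m)
    have "norm (cheb (Suc (Suc m)) x) \<le> norm x * norm (cheb (Suc m) x) + norm (cheb m x)"
      using norm_triangle_ineq4[of "x * cheb (Suc m) x" "cheb m x"] by (simp add: norm_mult)
    also have "\<dots> \<le> L * (L + 1) ^ Suc m + (L + 1) ^ m" using Suc assms L by (intro add_mono mult_mono) auto
    also have "\<dots> \<le> L * (L + 1) ^ Suc m + (L + 1) ^ Suc m" using L by (intro add_left_mono power_increasing) auto
    also have "\<dots> = (L + 1) ^ Suc (Suc m)" by (simp add: algebra_simps)
    finally show ?case using Suc by blast
  qed
  thus ?thesis ..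
qed

text \<open>A Lipschitz bound obtained along the recursion. It is used to replace an eigenvalue by
  its real part at a cost proportional to its imaginary part.\<close>

lemma norm_cheb_diff_le:
  assumes x: "norm (x::complex) \<le> L" and y: "norm y \<le> L"
  shows "norm (cheb m x - cheb m y) \<le> real m * (L + 1) ^ m * norm (x - y)"
proof -
  have L: "L \<ge> 0" using x norm_ge_zero order_trans by blast
  define d where "d = norm (x - y)"
  have d: "d \<ge> 0" by (simp add: d_def)
  define u where "u = (\<lambda>m. (L + 1) ^ m)"
  have u: "u m \<ge> 0" "u m \<le> u (Suc m)" "u (Suc m) = (L + 1) * u m" for m using L by (auto simp: u_def mult_right_mono[of 1 "L + 1"])
  have "norm (cheb m x - cheb m y) \<le> real m * u m * d \<and> norm (cheb (Suc m) x - cheb (Suc m) y) \<le> real (Suc m) * u (Suc m) * d"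
  proof (induction m)
    case 0 thus ?case using d L mult_right_mono[of 1 "L + 1" d] by (simp add: d_def u_def)
  next
    case (Suc m)
    have "cheb (Suc (Suc m)) x - cheb (Suc (Suc m)) y = x * (cheb (Suc m) x - cheb (Suc m) y) + (x - y) * cheb (Suc m) y - (cheb m x - cheb m y)"
      by (simp add: algebra_simps)
    hence "norm (cheb (Suc (Suc m)) x - cheb (Suc (Suc m)) y) \<le> norm x * norm (cheb (Suc m) x - cheb (Suc m) y) + d * norm (cheb (Suc m) y) + norm (cheb m x - cheb m y)"
      unfolding d_def by (simp only: norm_mult[symmetric]) (intro order_trans[OF norm_triangle_ineq4] add_right_mono norm_triangle_ineq)
    also have "\<dots> \<le> L * (real (Suc m) * u (Suc m) * d) + d * u (Suc m) + real m * u m * d"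
      using Suc x L d norm_cheb_le[OF y, of "Suc m"] by (intro add_mono mult_mono mult_left_mono) (auto simp: u_def)
    also have "\<dots> \<le> L * (real (Suc m) * u (Suc m) * d) + d * u (Suc m) + real m * u (Suc m) * d"
      using u(2)[of m] d by (intro add_left_mono mult_right_mono mult_left_mono) auto
    also have "\<dots> = real (Suc m) * ((L + 1) * u (Suc m)) * d" by (simp add: algebra_simps)
    also have "(L + 1) * u (Suc m) = u (Suc (Suc m))" by (rule u(3)[symmetric])
    also have "real (Suc m) * u (Suc (Suc m)) * d \<le> real (Suc (Suc m)) * u (Suc (Suc m)) * d"
      using u(1) d by (intro mult_right_mono) auto
    finally show ?case using Suc by blast
  qed
  thus ?thesis by (simp add: u_def d_def)
qed

lemma cheb_of_real: "cheb m (of_real x :: complex) = of_real (cheb m x)"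
  by (induction m x rule: cheb.induct) auto

lemma sum_mult_le_sqrt:
  fixes f g :: "'a \<Rightarrow> real"
  assumes "(\<Sum>i\<in>I. (f i)\<^sup>2) \<le> A" "(\<Sum>i\<in>I. (g i)\<^sup>2) \<le> B"
  shows "(\<Sum>i\<in>I. \<bar>f i\<bar> * \<bar>g i\<bar>) \<le> sqrt (A * B)"
proof -
  have "(\<Sum>i\<in>I. \<bar>f i\<bar> * \<bar>g i\<bar>) \<le> L2_set f I * L2_set g I" by (rule L2_set_mult_ineq)
  also have "\<dots> = sqrt ((\<Sum>i\<in>I. (f i)\<^sup>2) * (\<Sum>i\<in>I. (g i)\<^sup>2))" by (simp add: L2_set_def real_sqrt_mult)
  also have "\<dots> \<le> sqrt (A * B)"
  proof (intro real_sqrt_le_mono mult_mono assms)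
    show "0 \<le> A" by (rule order_trans[OF _ assms(1)]) (simp add: sum_nonneg)
  qed (simp add: sum_nonneg)
  finally show ?thesis .
qed

text \<open>An l2-closeness of b_i to c times the conjugate of \<rho>_i lets sums with b_i \<rho>_i
  stand for sums with the weights w_i, by Cauchy-Schwarz. This is used twice: for l^2, which bounds
  the imaginary parts, and for the Chebyshev polynomial itself.\<close>

lemma weighted_chebyshev_estimate:
  fixes b \<rho> l :: "'a \<Rightarrow> complex" and c :: real
  defines "w \<equiv> \<lambda>i. c * (norm (\<rho> i))\<^sup>2"
  assumes c: "c > 0" and L: "L \<ge> 0" and l: "\<And>i. i \<in> I \<Longrightarrow> norm (l i) \<le> L"
    and W: "(\<Sum>i\<in>I. w i) \<le> 2" and e: "e \<ge> 0" "(\<Sum>i\<in>I. (norm (b i - of_real c * cnj (\<rho> i)))\<^sup>2) \<le> c * e"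
    and V: "(\<Sum>i\<in>I. w i * (norm (l i))\<^sup>2) \<le> V"
    and e': "V - Re (\<Sum>i\<in>I. b i * \<rho> i * (l i)\<^sup>2) + L\<^sup>2 * sqrt (2 * e) \<le> 2 * e'"
  shows "(\<Sum>i\<in>I. w i * cheb m (Re (l i))) \<le> Re (\<Sum>i\<in>I. b i * \<rho> i * cheb m (l i)) + (L + 1) ^ m * sqrt (2 * e) + real m * (L + 1) ^ m * sqrt (2 * e')"
proof -
  have w0: "w i \<ge> 0" for i using c by (simp add: w_def)
  have R: "(\<Sum>i\<in>I. (norm (\<rho> i))\<^sup>2) \<le> 2 / c"
    using W c by (simp add: w_def sum_distrib_left[symmetric] field_simps)
  have main: "norm ((\<Sum>i\<in>I. b i * \<rho> i * g i) - (\<Sum>i\<in>I. of_real (w i) * g i)) \<le> T * sqrt (2 * e)"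
    if g: "\<And>i. i \<in> I \<Longrightarrow> norm (g i) \<le> T" and T: "T \<ge> 0" for g T
  proof -
    have "(\<Sum>i\<in>I. b i * \<rho> i * g i) - (\<Sum>i\<in>I. of_real (w i) * g i) = (\<Sum>i\<in>I. (b i - of_real c * cnj (\<rho> i)) * \<rho> i * g i)"
      unfolding sum_subtractf[symmetric]
      by (intro sum.cong) (auto simp: w_def complex_norm_square algebra_simps simp del: of_real_power)
    hence "norm ((\<Sum>i\<in>I. b i * \<rho> i * g i) - (\<Sum>i\<in>I. of_real (w i) * g i)) \<le> (\<Sum>i\<in>I. norm ((b i - of_real c * cnj (\<rho> i)) * \<rho> i * g i))"
      by (simp only: norm_sum)
    also have "\<dots> \<le> (\<Sum>i\<in>I. T * (\<bar>norm (b i - of_real c * cnj (\<rho> i))\<bar> * \<bar>norm (\<rho> i)\<bar>))"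
    proof (rule sum_mono)
      fix i assume "i \<in> I"
      hence "norm (b i - of_real c * cnj (\<rho> i)) * norm (\<rho> i) * norm (g i) \<le> norm (b i - of_real c * cnj (\<rho> i)) * norm (\<rho> i) * T"
        using g by (intro mult_left_mono) auto
      thus "norm ((b i - of_real c * cnj (\<rho> i)) * \<rho> i * g i) \<le> T * (\<bar>norm (b i - of_real c * cnj (\<rho> i))\<bar> * \<bar>norm (\<rho> i)\<bar>)"
        by (simp add: norm_mult mult_ac)
    qed
    also have "\<dots> = T * (\<Sum>i\<in>I. \<bar>norm (b i - of_real c * cnj (\<rho> i))\<bar> * \<bar>norm (\<rho> i)\<bar>)" by (simp only: sum_distrib_left)
    also have "\<dots> \<le> T * sqrt (c * e * (2 / c))" by (intro mult_left_mono sum_mult_le_sqrt e R T)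
    also have "c * e * (2 / c) = 2 * e" using c by simp
    finally show ?thesis .
  qed
  define X where "X = (\<Sum>i\<in>I. of_real (w i) * (l i)\<^sup>2)"
  have "norm ((\<Sum>i\<in>I. b i * \<rho> i * (l i)\<^sup>2) - X) \<le> L\<^sup>2 * sqrt (2 * e)"
    unfolding X_def by (rule main) (use l L in \<open>auto simp: norm_power intro!: power_mono\<close>)
  hence X: "Re (\<Sum>i\<in>I. b i * \<rho> i * (l i)\<^sup>2) - L\<^sup>2 * sqrt (2 * e) \<le> Re X"
    using complex_Re_le_cmod[of "(\<Sum>i\<in>I. b i * \<rho> i * (l i)\<^sup>2) - X"] by simp
  \<comment> \<open>The second moment of |l| minus the real part of the second moment of l is twice
    the mean square of Im l.\<close>
  have "Re X = (\<Sum>i\<in>I. w i * ((Re (l i))\<^sup>2 - (Im (l i))\<^sup>2))" by (simp add: X_def power2_eq_square)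
  also have "\<dots> = (\<Sum>i\<in>I. w i * (norm (l i))\<^sup>2) - 2 * (\<Sum>i\<in>I. w i * (Im (l i))\<^sup>2)"
    unfolding cmod_power2 sum_distrib_left sum_subtractf[symmetric] by (intro sum.cong) (auto simp: algebra_simps)
  finally have im: "(\<Sum>i\<in>I. w i * (Im (l i))\<^sup>2) \<le> e'" using X V e' by linarith
  have "(\<Sum>i\<in>I. w i * \<bar>Im (l i)\<bar>) = (\<Sum>i\<in>I. \<bar>sqrt (w i)\<bar> * \<bar>sqrt (w i) * Im (l i)\<bar>)"
    by (intro sum.cong) (auto simp: abs_mult w0)
  also have "\<dots> \<le> sqrt (2 * e')"
    by (rule sum_mult_le_sqrt) (use W im in \<open>simp_all add: w0 power_mult_distrib\<close>)
  finally have im1: "(\<Sum>i\<in>I. w i * \<bar>Im (l i)\<bar>) \<le> sqrt (2 * e')" .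
  have ch: "w i * cheb m (Re (l i)) \<le> Re (of_real (w i) * cheb m (l i)) + real m * (L + 1) ^ m * (w i * \<bar>Im (l i)\<bar>)" if i: "i \<in> I" for i
  proof -
    have d: "l i - of_real (Re (l i)) = \<i> * of_real (Im (l i))" by (simp add: complex_eq_iff)
    have "norm (cheb m (l i) - cheb m (of_real (Re (l i)))) \<le> real m * (L + 1) ^ m * norm (l i - of_real (Re (l i)))"
      using l[OF i] abs_Re_le_cmod[of "l i"] by (intro norm_cheb_diff_le) auto
    also have "norm (l i - of_real (Re (l i))) = \<bar>Im (l i)\<bar>" unfolding d by (simp add: norm_mult)
    finally have "cheb m (Re (l i)) - Re (cheb m (l i)) \<le> real m * (L + 1) ^ m * \<bar>Im (l i)\<bar>"
      using abs_Re_le_cmod[of "cheb m (l i) - cheb m (of_real (Re (l i)))"] by (simp add: cheb_of_real)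
    hence "w i * (cheb m (Re (l i)) - Re (cheb m (l i))) \<le> w i * (real m * (L + 1) ^ m * \<bar>Im (l i)\<bar>)"
      using w0 by (intro mult_left_mono)
    thus ?thesis by (simp add: algebra_simps)
  qed
  have "(\<Sum>i\<in>I. w i * cheb m (Re (l i))) \<le> (\<Sum>i\<in>I. Re (of_real (w i) * cheb m (l i)) + real m * (L + 1) ^ m * (w i * \<bar>Im (l i)\<bar>))"
    by (rule sum_mono[OF ch])
  also have "\<dots> = Re (\<Sum>i\<in>I. of_real (w i) * cheb m (l i)) + real m * (L + 1) ^ m * (\<Sum>i\<in>I. w i * \<bar>Im (l i)\<bar>)"
    by (simp only: sum.distrib sum_distrib_left Re_sum)
  also have "\<dots> \<le> (Re (\<Sum>i\<in>I. b i * \<rho> i * cheb m (l i)) + (L + 1) ^ m * sqrt (2 * e)) + real m * (L + 1) ^ m * sqrt (2 * e')"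
  proof (intro add_mono mult_left_mono im1)
    have "norm ((\<Sum>i\<in>I. b i * \<rho> i * cheb m (l i)) - (\<Sum>i\<in>I. of_real (w i) * cheb m (l i))) \<le> (L + 1) ^ m * sqrt (2 * e)"
      using L by (intro main norm_cheb_le l) auto
    thus "Re (\<Sum>i\<in>I. of_real (w i) * cheb m (l i)) \<le> Re (\<Sum>i\<in>I. b i * \<rho> i * cheb m (l i)) + (L + 1) ^ m * sqrt (2 * e)"
      using abs_Re_le_cmod[of "(\<Sum>i\<in>I. b i * \<rho> i * cheb m (l i)) - (\<Sum>i\<in>I. of_real (w i) * cheb m (l i))"] by simp
  qed (use L in auto)
  finally show ?thesis by simp
qed

text \<open>If W exceeded 1 - t/4, division by W would leave W + 3t/2 \<le> (1 + t/4)(1 + t/2): the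
  cross term gains 3t/2 while the right side grows by about 3t/4. The choice t = 1/(4 A) makes the
  quadratic cost t^2 A equal to t/4.\<close>

lemma mass_deficit:
  fixes W :: real
  assumes W: "W \<ge> 0" and A: "A \<ge> 1" and t: "t = 1 / (4 * A)" and \<kappa>: "\<kappa> \<ge> 0" "\<kappa> \<le> 1 + t / 4" and x: "x \<ge> 3 / 4"
    and le: "(W + t * x)\<^sup>2 \<le> \<kappa> * (W + t\<^sup>2 * A)"
  shows "W \<le> 1 - t / 4"
proof (rule ccontr)
  assume "\<not> W \<le> 1 - t / 4"
  moreover have t0: "t > 0" "t \<le> 1 / 4" using A by (auto simp: t divide_simps)
  ultimately have W1: "W > 1 - t / 4" "W > 1 / 2" by auto
  have tA: "t\<^sup>2 * A = t / 4" using A by (simp add: t power2_eq_square)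
  have "W * (W + 3 / 2 * t) = W\<^sup>2 + 2 * W * (t * (3 / 4))" by (simp add: power2_eq_square algebra_simps)
  also have "\<dots> \<le> W\<^sup>2 + 2 * W * (t * x)" using W1 t0 x by (intro add_left_mono mult_left_mono) auto
  also have "\<dots> \<le> (W + t * x)\<^sup>2" by (simp add: power2_sum)
  also have "\<dots> \<le> \<kappa> * (W + t / 4)" using le by (simp add: tA)
  also have "\<dots> \<le> (1 + t / 4) * (W + W * t / 2)"
  proof (intro mult_mono \<kappa> add_left_mono)
    have "1 / 2 * t \<le> W * t" using W1 t0 by (intro mult_right_mono) auto
    thus "t / 4 \<le> W * t / 2" by simp
  qed (use W1 t0 in auto)
  also have "\<dots> = W * ((1 + t / 4) * (1 + t / 2))" by (simp add: algebra_simps)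
  finally have "W + 3 / 2 * t \<le> (1 + t / 4) * (1 + t / 2)" using W1 by (subst (asm) mult_le_cancel_left_pos) auto
  also have "\<dots> = 1 + 3 / 4 * t + t * t / 8" by (simp add: algebra_simps)
  also have "\<dots> \<le> 1 + 3 / 4 * t + t * 1 / 8" using t0 by (intro add_left_mono divide_right_mono mult_left_mono) auto
  finally show False using W1 t0 by simp
qed

section \<open>Bases of newforms\<close>

lemma newform_basis_cusp_form:
  assumes "newform_basis k N B" "f \<in> B"
  shows "f \<in> cusp_forms k N" "f \<in> new_space k N"
proof -
  have "f \<in> cfun.span B" using assms(2) by (rule cfun.span_base)
  thus "f \<in> new_space k N" using assms(1) by (simp add: newform_basis_def)
  thus "f \<in> cusp_forms k N" by (simp add: new_space_def)
qed

lemma newform_basis_inner: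
  assumes "newform_basis k N B" "f \<in> B" "g \<in> B"
  shows "inner_int (pet_measure k N) f g = (if f = g then 1 else 0)"
proof -
  have "petersson k N f g = inner_int (pet_measure k N) f g"
    unfolding inner_int_def
    by (intro petersson_eq cusp_form_measurable[OF newform_basis_cusp_form(1)[OF assms(1)]] assms)
  thus ?thesis using assms unfolding newform_basis_def by metis
qed

lemma newform_basis_sq_int:
  assumes "newform_basis k N B" "f \<in> B"
  shows "sq_int (pet_measure k N) f"
  using newform_basis_inner[OF assms assms(2)] cusp_form_measurable[OF newform_basis_cusp_form(1)[OF assms]]
  by (intro sq_int_if_inner_nonzero) (auto simp: borel_measurable_pet_measure)

lemma newform_basis_hecke:
  assumes B: "newform_basis k N B" "f \<in> B" and p: "prime p" "\<not> p dvd N"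
  shows "f \<noteq> 0" "hecke k p f = (\<lambda>z. hecke_eigenvalue k p f * f z)"
proof -
  have e: "hecke_eigenform k N f" using B by (auto simp: newform_basis_def)
  thus f: "f \<noteq> 0" by (simp add: hecke_eigenform_def)
  have "coprime p N" using p by (simp add: prime_imp_coprime)
  moreover have "p > 0" using p(1) prime_gt_0_nat by blast
  ultimately obtain l where l: "hecke k p f = (\<lambda>z. l * f z)" using e unfolding hecke_eigenform_def by blast
  thus "hecke k p f = (\<lambda>z. hecke_eigenvalue k p f * f z)" using hecke_eigenvalue_eq[OF f l] by simp
qed

lemma newform_basis_rho:
  assumes B: "newform_basis k N B" "f \<in> B" and p: "prime p" "\<not> p dvd N" and N: "N \<ge> 1"
  shows "rho k f (p ^ j) = cheb j (hecke_eigenvalue k p f) * rho k f 1"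
proof -
  obtain \<alpha> where "q_expansion f \<alpha>" using cusp_form_q_expansion[OF newform_basis_cusp_form(1)[OF B] N] .
  thus ?thesis by (rule rho_prime_power[OF _ p(1) newform_basis_hecke(2)[OF B p]])
qed

lemma rho_sum:
  assumes I: "finite I" and f: "\<And>f. f \<in> I \<Longrightarrow> f \<in> cusp_forms k N" and N: "N \<ge> 1"
  shows "\<exists>\<alpha>. q_expansion (\<lambda>z. \<Sum>f\<in>I. a f * f z) \<alpha>"
    and "rho k (\<lambda>z. \<Sum>f\<in>I. a f * f z) n = (\<Sum>f\<in>I. a f * rho k f n)"
proof -
  have "\<exists>\<alpha>. q_expansion f \<alpha>" if "f \<in> I" for f
    by (rule cusp_form_q_expansion[OF f[OF that] N]) blast
  then obtain A where A: "\<And>f. f \<in> I \<Longrightarrow> q_expansion f (A f)" by metis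
  have q: "q_expansion (\<lambda>z. \<Sum>f\<in>I. a f * f z) (\<lambda>n. \<Sum>f\<in>I. a f * A f n)"
    by (intro q_expansion_sum I q_expansion_cmult A)
  thus "\<exists>\<alpha>. q_expansion (\<lambda>z. \<Sum>f\<in>I. a f * f z) \<alpha>" by blast
  show "rho k (\<lambda>z. \<Sum>f\<in>I. a f * f z) n = (\<Sum>f\<in>I. a f * rho k f n)"
    unfolding rho_eq[OF q] sum_divide_distrib
    by (intro sum.cong) (simp_all add: rho_eq[OF A])
qed

lemma rho_add_cmult:
  assumes "q_expansion f \<alpha>" "q_expansion g \<beta>"
  shows "rho k (\<lambda>z. f z + t * g z) n = rho k f n + t * rho k g n"
  unfolding rho_eq[OF q_expansion_add[OF assms(1) q_expansion_cmult[OF assms(2)]]] rho_eq[OF assms(1)] rho_eq[OF assms(2)]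
  by (simp add: add_divide_distrib)

section \<open>Duality estimates for finite sets of newforms\<close>

definition harmonic_weight :: "nat \<Rightarrow> (complex \<Rightarrow> complex) \<Rightarrow> real" where
  "harmonic_weight k f = pet_const k * (norm (rho k f 1))\<^sup>2"

lemma harmonic_weight_nonneg: "k \<ge> 2 \<Longrightarrow> harmonic_weight k f \<ge> 0"
  using pet_const_pos[of k] by (simp add: harmonic_weight_def)

lemma newform_basis_combination:
  assumes B: "newform_basis k N B" "finite I" "I \<subseteq> B"
  shows "sq_int (pet_measure k N) (\<lambda>z. \<Sum>f\<in>I. a f * f z)"
    and "norm_sq (pet_measure k N) (\<lambda>z. \<Sum>f\<in>I. a f * f z) = (\<Sum>f\<in>I. (norm (a f))\<^sup>2)"
proof -
  note s = newform_basis_sq_int[OF B(1)]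
  show "sq_int (pet_measure k N) (\<lambda>z. \<Sum>f\<in>I. a f * f z)"
    using B s by (intro sq_int_sum sq_int_cmult) auto
  show "norm_sq (pet_measure k N) (\<lambda>z. \<Sum>f\<in>I. a f * f z) = (\<Sum>f\<in>I. (norm (a f))\<^sup>2)"
    by (rule inner_int_orthonormal_sum(2)[OF B(2) s newform_basis_inner[OF B(1)]]) (auto dest: subsetD[OF B(3)])
qed

text \<open>The coefficient bound is applied to the combination with coefficients c times the
  conjugate of \<rho>_f(n). Its n-th coefficient is the sum V in question and its squared norm is c
  V, so a factor V cancels. The bound is uniform over finite subsets of the basis.\<close>

lemma large_sieve_bound:
  assumes B: "newform_basis k N B" "finite I" "I \<subseteq> B" and N: "N \<ge> 1" and k: "k \<ge> 2" and n: "n > 0"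
    and c: "pet_const k > real n ^ (k - 1)"
  shows "(\<Sum>f\<in>I. pet_const k * (norm (rho k f n))\<^sup>2) \<le> pet_const k / (pet_const k - real n ^ (k - 1))"
proof -
  define c where "c = pet_const k"
  have c0: "c > 0" using pet_const_pos[OF k] by (simp add: c_def)
  define V where "V = (\<Sum>f\<in>I. c * (norm (rho k f n))\<^sup>2)"
  define a where "a = (\<lambda>f. of_real c * cnj (rho k f n))"
  have cf: "f \<in> I \<Longrightarrow> f \<in> cusp_forms k N" for f
    by (rule newform_basis_cusp_form(1)[OF B(1) subsetD[OF B(3)]])
  have rs: "\<exists>\<alpha>. q_expansion (\<lambda>z. \<Sum>f\<in>I. a f * f z) \<alpha>"
    by (rule rho_sum(1)[OF B(2) cf N])
  have rs2: "rho k (\<lambda>z. \<Sum>f\<in>I. a f * f z) m = (\<Sum>f\<in>I. a f * rho k f m)" for m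
    by (rule rho_sum(2)[OF B(2) cf N])
  obtain \<alpha> where q1: "q_expansion (\<lambda>z. \<Sum>f\<in>I. a f * f z) \<alpha>" using rs by blast
  note q = q1 rs2
  have "rho k (\<lambda>z. \<Sum>f\<in>I. a f * f z) n = of_real V"
    unfolding q(2) V_def of_real_sum
    by (intro sum.cong) (auto simp: a_def complex_norm_square mult_ac simp del: of_real_power)
  moreover have "norm_sq (pet_measure k N) (\<lambda>z. \<Sum>f\<in>I. a f * f z) = c * V"
    unfolding newform_basis_combination(2)[OF B] V_def sum_distrib_left
    by (intro sum.cong) (auto simp: a_def norm_mult power_mult_distrib power2_eq_square)
  ultimately have le: "(c - real n ^ (k - 1)) * V\<^sup>2 \<le> c * V"
    using coeff_bound_norm_sq[OF q(1) newform_basis_combination(1)[OF B] k n N] by (simp add: c_def)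
  have V0: "V \<ge> 0" using c0 by (auto simp: V_def intro!: sum_nonneg)
  have d: "c - real n ^ (k - 1) > 0" using c by (simp add: c_def)
  have "V \<le> c / (c - real n ^ (k - 1))"
  proof (cases "V = 0")
    case True thus ?thesis using c0 d by simp
  next
    case False
    hence "V > 0" using V0 by simp
    moreover have "((c - real n ^ (k - 1)) * V) * V \<le> c * V" using le by (simp add: power2_eq_square mult.assoc)
    ultimately have "(c - real n ^ (k - 1)) * V \<le> c" by simp
    thus ?thesis using d by (simp add: pos_le_divide_eq mult.commute)
  qed
  thus ?thesis by (simp add: V_def c_def)
qed

lemma new_space_old_space_orthogonal:
  assumes "N > 1" "f \<in> new_space k N" "P \<in> cusp_forms k 1"
  shows "petersson k N f P = 0"
proof -
  have "P \<in> {(\<lambda>z. f (of_nat d * z)) | f d M. M * d dvd N \<and> M < N \<and> f \<in> cusp_forms k M}"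
  proof (intro CollectI exI conjI)
    show "P = (\<lambda>z. P (of_nat 1 * z))" by simp
    show "1 * 1 dvd N" by simp
  qed (use assms in auto)
  hence "P \<in> old_space k N" unfolding old_space_def by (rule cfun.span_base)
  thus ?thesis using assms(2) by (simp add: new_space_def)
qed

text \<open>The form \<open>P\<close> is old, hence orthogonal to the newforms. The coefficient bound is applied to the form
  dual to the first coefficient plus a multiple of \<open>P\<close>.\<close>

lemma level_N_mass_bound:
  assumes N: "N > 1" and B: "newform_basis k N B" "finite I" "I \<subseteq> B" and k: "k \<ge> 2"
    and P: "P \<in> cusp_forms k 1" "sq_int (pet_measure k N) P" "norm_sq (pet_measure k N) P \<le> A * pet_const k"
    and A: "A \<ge> 1" and \<rho>: "norm (rho k P 1 - 1) \<le> 1 / 4" and c: "pet_const k \<ge> 1 + 16 * A"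
  shows "(\<Sum>f\<in>I. harmonic_weight k f) \<le> 1 - 1 / (16 * A)"
proof -
  define c where "c = pet_const k"
  have c0: "c \<ge> 1 + 16 * A" "c > 1" using assms by (auto simp: c_def)
  define M where "M = pet_measure k N"
  define t where "t = 1 / (4 * A)"
  define W where "W = (\<Sum>f\<in>I. harmonic_weight k f)"
  define a where "a = (\<lambda>f. of_real c * cnj (rho k f 1))"
  define h where "h = (\<lambda>z. \<Sum>f\<in>I. a f * f z)"
  have N1: "N \<ge> 1" using N by simp
  have cf: "f \<in> I \<Longrightarrow> f \<in> cusp_forms k N" for f
    by (rule newform_basis_cusp_form(1)[OF B(1) subsetD[OF B(3)]])
  have rs: "\<exists>\<alpha>. q_expansion h \<alpha>" unfolding h_def by (rule rho_sum(1)[OF B(2) cf N1])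
  have rs2: "rho k h m = (\<Sum>f\<in>I. a f * rho k f m)" for m
    unfolding h_def by (rule rho_sum(2)[OF B(2) cf N1])
  obtain \<alpha> where q1: "q_expansion h \<alpha>" using rs by blast
  note q = q1 rs2
  obtain \<beta> where qP: "q_expansion P \<beta>" using cusp_form_q_expansion[OF P(1)] by auto
  have rh: "rho k h 1 = of_real W"
    unfolding q(2) W_def of_real_sum
    by (intro sum.cong) (auto simp: a_def complex_norm_square mult_ac harmonic_weight_def c_def simp del: of_real_power)
  have nh: "norm_sq M h = c * W"
    unfolding M_def h_def newform_basis_combination(2)[OF B] W_def sum_distrib_left
    by (intro sum.cong) (auto simp: a_def norm_mult power_mult_distrib power2_eq_square harmonic_weight_def c_def)
  have sh: "sq_int M h" unfolding M_def h_def by (rule newform_basis_combination(1)[OF B])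
  have sP: "sq_int M P" using P by (simp add: M_def)
  have "inner_int M f P = 0" if "f \<in> I" for f
  proof -
    have "f \<in> B" using that B by blast
    have "petersson k N f P = inner_int M f P"
      unfolding inner_int_def M_def
      by (intro petersson_eq cusp_form_measurable[OF newform_basis_cusp_form(1)[OF B(1) \<open>f \<in> B\<close>]] cusp_form_measurable[OF P(1)])
    thus ?thesis using new_space_old_space_orthogonal[OF N newform_basis_cusp_form(2)[OF B(1) \<open>f \<in> B\<close>] P(1)] by simp
  qed
  hence hP: "inner_int M h P = 0"
    unfolding h_def using B newform_basis_sq_int[OF B(1)] sP
    by (subst inner_int_sum_left) (auto simp: M_def inner_int_cmult_left intro!: sq_int_cmult)
  \<comment> \<open>By orthogonality the squared norms add, so P costs order t^2, whereas in the
    first coefficient it gains order t.\<close>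
  define g where "g = (\<lambda>z. h z + of_real t * P z)"
  have qg: "q_expansion g (\<lambda>n. \<alpha> n + of_real t * \<beta> n)" unfolding g_def by (intro q_expansion_add q_expansion_cmult q qP)
  have rg: "rho k g 1 = of_real W + of_real t * rho k P 1" unfolding g_def rho_add_cmult[OF q(1) qP] rh ..
  have sg: "sq_int M g" unfolding g_def by (intro sq_int_add sh sq_int_cmult sP)
  have ng: "norm_sq M g = c * W + t\<^sup>2 * norm_sq M P"
    unfolding g_def sq_int_add(2)[OF sh sq_int_cmult(1)[OF sP]] nh sq_int_cmult(2)[OF sP] inner_int_cmult_right hP by simp
  have "(c - 1) * (norm (rho k g 1))\<^sup>2 \<le> norm_sq M g"
    using coeff_bound_norm_sq[OF qg sg[unfolded M_def] k, of 1] N1 by (simp add: c_def M_def)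
  also have "\<dots> \<le> c * W + t\<^sup>2 * (A * c)" unfolding ng using P(3) by (intro add_left_mono mult_left_mono) (auto simp: M_def c_def)
  finally have le: "(c - 1) * (norm (rho k g 1))\<^sup>2 \<le> c * (W + t\<^sup>2 * A)" by (simp add: algebra_simps)
  have x: "Re (rho k P 1) \<ge> 3 / 4" using \<rho> abs_Re_le_cmod[of "rho k P 1 - 1"] by simp
  have W0: "W \<ge> 0" using harmonic_weight_nonneg[OF k] by (auto simp: W_def intro: sum_nonneg)
  have t0: "t > 0" using A by (simp add: t_def)
  have "W + t * Re (rho k P 1) = Re (rho k g 1)" unfolding rg by simp
  also have "\<dots> \<le> norm (rho k g 1)" by (rule complex_Re_le_cmod)
  finally have "(W + t * Re (rho k P 1))\<^sup>2 \<le> (norm (rho k g 1))\<^sup>2"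
    using W0 t0 x by (intro power_mono) auto
  also have "\<dots> \<le> c / (c - 1) * (W + t\<^sup>2 * A)"
    using le c0 by (simp add: pos_le_divide_eq mult.commute)
  finally have "W \<le> 1 - t / 4"
  proof (rule mass_deficit[OF W0 A t_def _ _ x, rotated 2])
    show "0 \<le> c / (c - 1)" using c0 by simp
    have "4 * (4 * A) \<le> c - 1" using c0 by simp
    hence "1 / (c - 1) \<le> 1 / (4 * (4 * A))" using A by (intro divide_left_mono) auto
    moreover have "c / (c - 1) = 1 + 1 / (c - 1)" using c0 by (simp add: field_simps)
    ultimately show "c / (c - 1) \<le> 1 + t / 4" by (simp add: t_def)
  qed
  thus ?thesis by (simp add: W_def t_def)
qed

text \<open>The condition M < 1 leaves only M = 0, which does not divide 1, so there are no
  oldforms.\<close>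

lemma new_space_level_1: "new_space k 1 = cusp_forms k 1"
proof -
  have e: "{(\<lambda>z. f (of_nat d * z)) | f d M. M * d dvd 1 \<and> M < 1 \<and> f \<in> cusp_forms k M} = {}" by auto
  have "old_space k 1 = {0}" unfolding old_space_def e by simp
  thus ?thesis by (auto simp: new_space_def petersson_def)
qed

lemma sum_fun_apply: "(\<Sum>i\<in>I. g i) z = (\<Sum>i\<in>I. g i z)" for g :: "'a \<Rightarrow> complex \<Rightarrow> complex"
  by (induction I rule: infinite_finite_induct) auto

text \<open>The span is algebraic, so the Poincare series involves finitely many basis elements even
  if the basis is infinite.\<close>

lemma level_1_expansion:
  assumes B: "newform_basis k 1 B" and P: "P \<in> cusp_forms k 1"
  obtains I b where "finite I" "I \<subseteq> B" "P = (\<lambda>z. \<Sum>f\<in>I. b f * f z)"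
proof -
  have "P \<in> cfun.span B" using assms new_space_level_1 by (simp add: newform_basis_def)
  then obtain I b where "finite I" "I \<subseteq> B" "P = (\<Sum>f\<in>I. (\<lambda>z. b f * f z))"
    unfolding cfun.span_explicit by blast
  thus ?thesis by (intro that[of I b]) (auto simp: sum_fun_apply)
qed

text \<open>The hypotheses are stated with t^4 because two square roots are taken: closeness to the
  dual form holds up to order t^2, and the mean size of the imaginary parts up to order t. The third
  conclusion says that the forms occurring in P carry all but a small part of the mass.\<close>

lemma level_1_estimate:
  assumes B: "newform_basis k 1 B" and k: "k \<ge> 2" and p: "prime p"
    and P: "P \<in> cusp_forms k 1" "sq_int (pet_measure k 1) P" "norm_sq (pet_measure k 1) P \<le> (1 + \<epsilon>) * pet_const k"
    and t: "0 < t" "t \<le> 1 / 4" and \<epsilon>: "0 \<le> \<epsilon>" "\<epsilon> \<le> D * t ^ 4"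
    and \<rho>: "norm (rho k P 1 - 1) \<le> t ^ 4" "norm (rho k P (p\<^sup>2)) \<le> t ^ 4"
    and c: "real p ^ (k - 1) \<le> t ^ 4 * pet_const k"
  obtains I where "finite I" "I \<subseteq> B"
    "\<And>J. finite J \<Longrightarrow> J \<subseteq> B \<Longrightarrow> I \<subseteq> J \<Longrightarrow> (\<Sum>f\<in>J. harmonic_weight k f) \<le> (\<Sum>f\<in>I. harmonic_weight k f) + (D + 4) * t"
    "(\<Sum>f\<in>I. harmonic_weight k f) \<le> 2"
    "\<And>m. (\<Sum>f\<in>I. harmonic_weight k f * cheb m (Re (hecke_eigenvalue k p f))) \<le>
        Re (rho k P (p ^ m)) + (real p + 2) ^ m * (1 + real m) * (D + 4 + (real p + 1)\<^sup>2) * t"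
proof -
  define u where "u = t ^ 4"
  have u: "0 < u" "u \<le> 1 / 256" "u \<le> t" "u \<le> t\<^sup>2"
  proof -
    show "0 < u" using t by (simp add: u_def)
    show "u \<le> 1 / 256" using power_mono[OF t(2), of 4] t by (simp add: u_def power_divide)
    show "u \<le> t" using power_decreasing[of 1 4 t] t by (simp add: u_def)
    show "u \<le> t\<^sup>2" unfolding u_def using t by (intro power_decreasing) auto
  qed
  define c where "c = pet_const k"
  have c0: "c > 0" using pet_const_pos[OF k] by (simp add: c_def)
  have p1: "real p \<ge> 1" using p prime_ge_1_nat[of p] by simp
  have D: "D \<ge> 0"
  proof (rule ccontr)
    assume "\<not> D \<ge> 0"
    hence "D * u < 0" using u by (simp add: mult_neg_pos)
    thus False using \<epsilon> by (simp add: u_def)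
  qed
  \<comment> \<open>The quotient from the large sieve is 1 + O(u). It is needed at the indices 1 and
    p.\<close>
  have frac: "c / (c - x) \<le> 1 + 2 * u" "x < c" if "x \<le> real p ^ (k - 1)" for x
  proof -
    have x: "x \<le> u * c" using that assms(13) by (simp add: u_def c_def)
    have uc: "u * c \<le> 1 / 256 * c" using u c0 by (intro mult_right_mono) auto
    show xc: "x < c" using x uc c0 by linarith
    have "2 * u * (u * c) \<le> 2 * (1 / 256) * (u * c)" using u c0 by (intro mult_right_mono) auto
    hence "c \<le> (1 + 2 * u) * (c - u * c)" using c0 u by (simp add: algebra_simps)
    also have "\<dots> \<le> (1 + 2 * u) * (c - x)" using x u by (intro mult_left_mono) auto
    finally show "c / (c - x) \<le> 1 + 2 * u" using xc by (simp add: pos_divide_le_eq)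
  qed
  have one: "(1::real) ^ (k - 1) \<le> real p ^ (k - 1)" using p1 by (intro power_mono) auto
  obtain I b where I: "finite I" "I \<subseteq> B" and Pe: "P = (\<lambda>z. \<Sum>f\<in>I. b f * f z)"
    by (rule level_1_expansion[OF B P(1)])
  have mass: "(\<Sum>f\<in>J. harmonic_weight k f) \<le> 1 + 2 * u" if "finite J" "J \<subseteq> B" for J
    using large_sieve_bound[OF B that order_refl k zero_less_one] frac[of 1] one unfolding harmonic_weight_def by (simp add: c_def)
  define W where "W = (\<Sum>f\<in>I. harmonic_weight k f)"
  have W: "W \<le> 1 + 2 * u" using mass[OF I] by (simp add: W_def)
  have rP: "rho k P n = (\<Sum>f\<in>I. b f * rho k f n)" for n
    unfolding Pe by (rule rho_sum(2)[OF I(1) newform_basis_cusp_form(1)[OF B subsetD[OF I(2)]] order_refl])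
  have nP: "(\<Sum>f\<in>I. (norm (b f))\<^sup>2) \<le> (1 + \<epsilon>) * c"
    using P(3) unfolding Pe newform_basis_combination(2)[OF B I] c_def .
  have R: "(\<Sum>f\<in>I. (norm (rho k f 1))\<^sup>2) = W / c"
    using c0 by (simp add: W_def harmonic_weight_def c_def sum_distrib_left[symmetric])
  have r1: "Re (rho k P 1) \<ge> 1 - u" using \<rho>(1) abs_Re_le_cmod[of "rho k P 1 - 1"] by (simp add: u_def)
  \<comment> \<open>Cauchy-Schwarz for \<rho>_P(1), which is close to 1: the squared coefficients b
    sum to at most (1 + \<epsilon>) c and the squared \<rho>_f(1) to W / c.\<close>
  have lowW: "1 - 2 * u - \<epsilon> \<le> W"
  proof -
    have "1 - u \<le> norm (rho k P 1)" using r1 complex_Re_le_cmod[of "rho k P 1"] by linarith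
    also have "\<dots> \<le> (\<Sum>f\<in>I. \<bar>norm (b f)\<bar> * \<bar>norm (rho k f 1)\<bar>)"
      unfolding rP by (rule order_trans[OF norm_sum]) (simp add: norm_mult)
    also have "\<dots> \<le> sqrt ((1 + \<epsilon>) * c * (W / c))" by (rule sum_mult_le_sqrt[OF nP]) (simp only: R order_refl)
    also have "(1 + \<epsilon>) * c * (W / c) = (1 + \<epsilon>) * W" using c0 by simp
    finally have "(1 - u)\<^sup>2 \<le> (sqrt ((1 + \<epsilon>) * W))\<^sup>2" using u by (intro power_mono) auto
    moreover have "0 \<le> (1 + \<epsilon>) * W" using \<epsilon> harmonic_weight_nonneg[OF k] by (auto simp: W_def intro!: mult_nonneg_nonneg sum_nonneg)
    ultimately have "(1 - u)\<^sup>2 \<le> (1 + \<epsilon>) * W" by simp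
    moreover have "(1 + \<epsilon>) * (1 - 2 * u - \<epsilon>) \<le> (1 - u)\<^sup>2"
    proof -
      have "(1 + \<epsilon>) * (1 - 2 * u - \<epsilon>) = (1 - u)\<^sup>2 - (u\<^sup>2 + 2 * (\<epsilon> * u) + \<epsilon>\<^sup>2)" by (simp add: power2_eq_square algebra_simps)
      moreover have "0 \<le> \<epsilon> * u" using \<epsilon> u by simp
      ultimately show ?thesis using zero_le_power2[of u] zero_le_power2[of \<epsilon>] by linarith
    qed
    ultimately have "(1 + \<epsilon>) * (1 - 2 * u - \<epsilon>) \<le> (1 + \<epsilon>) * W" by linarith
    thus ?thesis using \<epsilon> by simp
  qed
  define e where "e = \<epsilon> + 4 * u"
  have e0: "e \<ge> 0" "e \<le> (D + 4) * u" using \<epsilon> u by (auto simp: e_def u_def algebra_simps)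
  \<comment> \<open>The expanded square has three terms close to c, c and -2 c, so it nearly
    cancels.\<close>
  have eb: "(\<Sum>f\<in>I. (norm (b f - of_real c * cnj (rho k f 1)))\<^sup>2) \<le> c * e"
  proof -
    have "(norm (b f - of_real c * cnj (rho k f 1)))\<^sup>2 = (norm (b f))\<^sup>2 + c\<^sup>2 * (norm (rho k f 1))\<^sup>2 - 2 * c * Re (b f * rho k f 1)" for f
      by (simp only: cmod_power2) (simp add: power2_eq_square algebra_simps)
    hence "(\<Sum>f\<in>I. (norm (b f - of_real c * cnj (rho k f 1)))\<^sup>2) =
        (\<Sum>f\<in>I. (norm (b f))\<^sup>2) + c\<^sup>2 * (\<Sum>f\<in>I. (norm (rho k f 1))\<^sup>2) - 2 * c * Re (rho k P 1)"
      by (simp only: rP[of 1] Re_sum sum.distrib sum_subtractf sum_distrib_left)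
    also have "c\<^sup>2 * (\<Sum>f\<in>I. (norm (rho k f 1))\<^sup>2) = c * W" unfolding R using c0 by (simp add: power2_eq_square)
    also have "(\<Sum>f\<in>I. (norm (b f))\<^sup>2) + c * W - 2 * c * Re (rho k P 1) \<le> (1 + \<epsilon>) * c + c * (1 + 2 * u) - 2 * c * (1 - u)"
      using nP W r1 c0 by (intro diff_mono add_mono mult_left_mono) auto
    also have "\<dots> = c * e" by (simp add: e_def algebra_simps)
    finally show ?thesis .
  qed
  define L where "L = real p + 1"
  define K where "K = D + 4 + L\<^sup>2"
  have L1: "L \<ge> 1" by (simp add: L_def)
  define l where "l = hecke_eigenvalue k p"
  have npd: "\<not> p dvd 1" using p by auto
  have lf: "norm (l f) \<le> L" if "f \<in> I" for f
  proof -
    have f: "f \<in> B" using that I by blast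
    show ?thesis unfolding l_def L_def
      by (rule hecke_eigenvalue_bound[OF newform_basis_cusp_form(1)[OF B f] newform_basis_hecke(1)[OF B f p npd] p newform_basis_hecke(2)[OF B f p npd]])
  qed
  have rl: "rho k f (p ^ m) = cheb m (l f) * rho k f 1" if "f \<in> I" for f m
    using newform_basis_rho[OF B _ p npd order_refl] that I unfolding l_def by blast
  have rPm: "rho k P (p ^ m) = (\<Sum>f\<in>I. b f * rho k f 1 * cheb m (l f))" for m
    unfolding rP by (intro sum.cong) (auto simp: rl)
  \<comment> \<open>At index p the coefficient is l \<rho>_f(1), so the large sieve bounds the
    weighted second moment of |l| by nearly 1.\<close>
  have V: "(\<Sum>f\<in>I. c * (norm (rho k f 1))\<^sup>2 * (norm (l f))\<^sup>2) \<le> 1 + 2 * u"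
  proof -
    have "rho k f p = l f * rho k f 1" if "f \<in> I" for f using rl[OF that, of 1] by simp
    hence "(\<Sum>f\<in>I. c * (norm (rho k f 1))\<^sup>2 * (norm (l f))\<^sup>2) = (\<Sum>f\<in>I. c * (norm (rho k f p))\<^sup>2)"
      by (intro sum.cong) (auto simp: norm_mult power_mult_distrib)
    also have "\<dots> \<le> c / (c - real p ^ (k - 1))"
      unfolding c_def using prime_gt_0_nat[OF p] frac(2)[OF order_refl] by (intro large_sieve_bound[OF B I order_refl k]) (auto simp: c_def)
    also have "\<dots> \<le> 1 + 2 * u" by (rule frac(1)) simp
    finally show ?thesis .
  qed
  have se: "sqrt (2 * e) \<le> (D + 4) * t\<^sup>2"
  proof (rule real_le_lsqrt)
    have "2 * e \<le> 2 * ((D + 4) * u)" using e0 by simp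
    also have "\<dots> = 2 * (D + 4) * u" by simp
    also have "\<dots> \<le> (D + 4) * (D + 4) * u" using D u by (intro mult_right_mono) auto
    also have "\<dots> = ((D + 4) * t\<^sup>2)\<^sup>2" by (simp add: u_def power_mult_distrib power2_eq_square[of "D + 4"] power_mult[symmetric])
    finally show "2 * e \<le> ((D + 4) * t\<^sup>2)\<^sup>2" .
  qed (use D in auto)
  define e' where "e' = t\<^sup>2 * (4 + L\<^sup>2 * (D + 4)) / 2"
  have e': "(1 + 2 * u) - Re (\<Sum>f\<in>I. b f * rho k f 1 * (l f)\<^sup>2) + L\<^sup>2 * sqrt (2 * e) \<le> 2 * e'"
  proof -
    \<comment> \<open>Uses l^2 = U_2 + 1: the second moment of l is the coefficient at p^2, which is
      small, plus the coefficient at 1.\<close>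
    have "(\<Sum>f\<in>I. b f * rho k f 1 * (l f)\<^sup>2) = rho k P (p ^ 2) + rho k P 1"
      unfolding rPm[of 2] rP[of 1] sum.distrib[symmetric]
      by (intro sum.cong) (auto simp: numeral_2_eq_2 algebra_simps)
    moreover have "Re (rho k P (p ^ 2)) \<ge> - u"
      using \<rho>(2) abs_Re_le_cmod[of "rho k P (p\<^sup>2)"] by (simp add: u_def)
    ultimately have "(1 + 2 * u) - Re (\<Sum>f\<in>I. b f * rho k f 1 * (l f)\<^sup>2) \<le> 4 * u" using r1 by simp
    also have "\<dots> \<le> 4 * t\<^sup>2" using u by simp
    finally have "(1 + 2 * u) - Re (\<Sum>f\<in>I. b f * rho k f 1 * (l f)\<^sup>2) + L\<^sup>2 * sqrt (2 * e) \<le> 4 * t\<^sup>2 + L\<^sup>2 * ((D + 4) * t\<^sup>2)"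
      using se by (intro add_mono mult_left_mono) auto
    thus ?thesis by (simp add: e'_def algebra_simps)
  qed
  have se': "sqrt (2 * e') \<le> K * t"
  proof (rule real_le_lsqrt)
    have "4 + L\<^sup>2 * (D + 4) \<le> K\<^sup>2"
    proof -
      have "K\<^sup>2 = (D + 4)\<^sup>2 + 2 * ((D + 4) * L\<^sup>2) + (L\<^sup>2)\<^sup>2" unfolding K_def by (simp only: power2_sum mult.assoc add.assoc) (simp add: algebra_simps)
      moreover have "4\<^sup>2 \<le> (D + 4)\<^sup>2" using D by (intro power_mono) auto
      moreover have "0 \<le> (D + 4) * L\<^sup>2" using D by simp
      moreover have "0 \<le> (L\<^sup>2)\<^sup>2" by simp
      moreover have "L\<^sup>2 * (D + 4) = (D + 4) * L\<^sup>2" by (rule mult.commute)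
      moreover have "(4::real)\<^sup>2 = 16" by simp
      ultimately show ?thesis by linarith
    qed
    hence "t\<^sup>2 * (4 + L\<^sup>2 * (D + 4)) \<le> t\<^sup>2 * K\<^sup>2" by (intro mult_left_mono) auto
    thus "2 * e' \<le> (K * t)\<^sup>2" by (simp add: e'_def power_mult_distrib mult.commute)
  qed (use D t in \<open>auto simp: K_def\<close>)
  show ?thesis
  proof (rule that[OF I])
    fix J assume J: "finite J" "J \<subseteq> B" "I \<subseteq> J"
    have "(\<Sum>f\<in>J. harmonic_weight k f) \<le> W + (4 * u + \<epsilon>)" using mass[OF J(1,2)] lowW by linarith
    also have "4 * u + \<epsilon> \<le> (D + 4) * u" using e0 by (simp add: e_def)
    also have "\<dots> \<le> (D + 4) * t" using D u by (intro mult_left_mono) auto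
    finally show "(\<Sum>f\<in>J. harmonic_weight k f) \<le> (\<Sum>f\<in>I. harmonic_weight k f) + (D + 4) * t" by (simp add: W_def)
  next
    show "(\<Sum>f\<in>I. harmonic_weight k f) \<le> 2" using W u by (simp add: W_def)
  next
    fix m
    have "(\<Sum>f\<in>I. c * (norm (rho k f 1))\<^sup>2 * cheb m (Re (l f))) \<le>
      Re (\<Sum>f\<in>I. b f * rho k f 1 * cheb m (l f)) + (L + 1) ^ m * sqrt (2 * e) + real m * (L + 1) ^ m * sqrt (2 * e')"
      by (rule weighted_chebyshev_estimate[OF c0 _ lf _ e0(1) eb V e']) (use L1 W u in \<open>auto simp: W_def harmonic_weight_def c_def\<close>)
    also have "\<dots> \<le> Re (\<Sum>f\<in>I. b f * rho k f 1 * cheb m (l f)) + (L + 1) ^ m * (K * t) + real m * (L + 1) ^ m * (K * t)"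
    proof (intro add_mono order_refl mult_left_mono se')
      have "(D + 4) * t\<^sup>2 \<le> (D + 4) * t" using t D power_decreasing[of 1 2 t] by (intro mult_left_mono) auto
      also have "\<dots> \<le> K * t" using t by (intro mult_right_mono) (auto simp: K_def)
      finally show "sqrt (2 * e) \<le> K * t" using se by linarith
    qed (use L1 in auto)
    also have "\<dots> = Re (rho k P (p ^ m)) + (L + 1) ^ m * (1 + real m) * K * t" unfolding rPm by (simp add: algebra_simps)
    finally show "(\<Sum>f\<in>I. harmonic_weight k f * cheb m (Re (hecke_eigenvalue k p f))) \<le>
        Re (rho k P (p ^ m)) + (real p + 2) ^ m * (1 + real m) * (D + 4 + (real p + 1)\<^sup>2) * t"
      by (simp add: harmonic_weight_def c_def l_def L_def K_def add.assoc)
  qed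
qed

section \<open>The discrepancy\<close>

text \<open>Bounded finite sums leave only finitely many weights above 1/(n + 1), so the support is
  an increasing union of finite sets; the remaining points have weight 0 and form a null
  set.\<close>

lemma emeasure_point_measure_le:
  fixes w :: "'a \<Rightarrow> real"
  assumes X: "X \<subseteq> A" and w: "\<And>a. a \<in> X \<Longrightarrow> w a \<ge> 0"
    and le: "\<And>F. finite F \<Longrightarrow> F \<subseteq> X \<Longrightarrow> sum w F \<le> C"
  shows "emeasure (point_measure A (\<lambda>a. ennreal (w a))) X \<le> ennreal C"
proof -
  define M where "M = point_measure A (\<lambda>a. ennreal (w a))"
  define Y where "Y = (\<lambda>n::nat. {a\<in>X. w a > 1 / real (Suc n)})"
  have Y: "finite (Y n)" for n
  proof (rule ccontr)
    assume "infinite (Y n)"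
    then obtain F where F: "F \<subseteq> Y n" "finite F" "card F = Suc (nat \<lceil>\<bar>C\<bar> * real (Suc n)\<rceil>)"
      using infinite_arbitrarily_large by blast
    have "real (card F) * (1 / real (Suc n)) \<le> sum w F"
      using F by (intro sum_bounded_below) (auto simp: Y_def)
    also have "\<dots> \<le> C" using F by (intro le) (auto simp: Y_def)
    finally have "real (card F) \<le> C * real (Suc n)" by (simp add: divide_le_eq)
    moreover have "\<bar>C\<bar> * real (Suc n) < real (card F)" using F(3) by linarith
    moreover have "C * real (Suc n) \<le> \<bar>C\<bar> * real (Suc n)" by (intro mult_right_mono) auto
    ultimately show False by linarith
  qed
  have subs: "S \<in> sets M" if "S \<subseteq> X" for S using that X by (auto simp: M_def sets_point_measure)
  have fin: "emeasure M F = ennreal (sum w F)" if "finite F" "F \<subseteq> X" for F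
  proof -
    have "emeasure M F = (\<Sum>a\<in>F. ennreal (w a))" unfolding M_def using that X by (intro emeasure_point_measure_finite2) auto
    also have "\<dots> = ennreal (sum w F)" using that w by (intro sum_ennreal) auto
    finally show ?thesis .
  qed
  have inc: "incseq Y"
  proof (rule incseq_SucI)
    fix n
    have "1 / real (Suc (Suc n)) \<le> 1 / real (Suc n)" by (intro divide_left_mono) auto
    thus "Y n \<subseteq> Y (Suc n)" unfolding Y_def by fastforce
  qed
  have null: "emeasure M {a\<in>X. w a = 0} = 0"
  proof -
    have e: "{a \<in> {a\<in>X. w a = 0}. 0 < ennreal (w a)} = {}" by auto
    have "emeasure M {a\<in>X. w a = 0} = (\<Sum>a\<in>{a \<in> {a\<in>X. w a = 0}. 0 < ennreal (w a)}. ennreal (w a))"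
      unfolding M_def by (rule emeasure_point_measure) (simp only: e finite.emptyI, use X in auto)
    thus ?thesis by (simp only: e sum.empty)
  qed
  have "X = (\<Union>n. Y n) \<union> {a\<in>X. w a = 0}"
  proof -
    have "\<exists>n. w a > 1 / real (Suc n)" if "a \<in> X" "w a \<noteq> 0" for a
      using reals_Archimedean[of "w a"] w[OF that(1)] that(2) by (auto simp: inverse_eq_divide)
    thus ?thesis by (auto simp: Y_def)
  qed
  hence "emeasure M X \<le> emeasure M (\<Union>n. Y n) + emeasure M {a\<in>X. w a = 0}"
    using emeasure_subadditive[of "\<Union>n. Y n" M "{a\<in>X. w a = 0}"] subs by (auto simp: Y_def)
  also have "\<dots> = (SUP n. emeasure M (Y n))"
    unfolding null using inc subs by (subst SUP_emeasure_incseq) (auto simp: Y_def)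
  also have "\<dots> \<le> ennreal C"
  proof (rule SUP_least)
    fix n
    have "emeasure M (Y n) = ennreal (sum w (Y n))" by (intro fin Y) (auto simp: Y_def)
    also have "\<dots> \<le> ennreal C" by (intro ennreal_leI le Y) (auto simp: Y_def)
    finally show "emeasure M (Y n) \<le> ennreal C" .
  qed
  finally show ?thesis unfolding M_def .
qed

lemma emeasure_nu:
  assumes "S \<in> sets borel"
  shows "emeasure (nu k p B) S =
    emeasure (point_measure B (\<lambda>f. ennreal (harmonic_weight k f))) {f\<in>B. Re (hecke_eigenvalue k p f) \<in> S}"
proof -
  have "emeasure (nu k p B) S = emeasure (point_measure B (\<lambda>f. ennreal (harmonic_weight k f)))
      ((\<lambda>f. Re (hecke_eigenvalue k p f)) -` S \<inter> space (point_measure B (\<lambda>f. ennreal (harmonic_weight k f))))"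
    unfolding nu_def harmonic_weight_def pet_const_def by (rule emeasure_distr) (auto simp: assms)
  also have "(\<lambda>f. Re (hecke_eigenvalue k p f)) -` S \<inter> space (point_measure B (\<lambda>f. ennreal (harmonic_weight k f))) =
      {f\<in>B. Re (hecke_eigenvalue k p f) \<in> S}" by (auto simp: space_point_measure)
  finally show ?thesis .
qed

lemma measure_nu_le:
  assumes k: "k \<ge> 2" and le: "\<And>J. finite J \<Longrightarrow> J \<subseteq> B \<Longrightarrow> sum (harmonic_weight k) J \<le> C" and C: "C \<ge> 0"
    and S: "S \<in> sets borel"
  shows "emeasure (nu k p B) S \<le> ennreal C" "measure (nu k p B) S \<le> C"
proof -
  show e: "emeasure (nu k p B) S \<le> ennreal C"
    unfolding emeasure_nu[OF S] by (rule emeasure_point_measure_le) (auto intro: le harmonic_weight_nonneg[OF k])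
  show "measure (nu k p B) S \<le> C" unfolding measure_def using e C by (intro enn2real_leI)
qed

text \<open>A finite set that misses at most \<epsilon> of the total mass misses at most \<epsilon>
  on every Borel set.\<close>

lemma measure_nu_approx:
  assumes k: "k \<ge> 2" and I: "finite I" "I \<subseteq> B" and \<epsilon>: "\<epsilon> \<ge> 0"
    and le: "\<And>J. finite J \<Longrightarrow> J \<subseteq> B \<Longrightarrow> I \<subseteq> J \<Longrightarrow> sum (harmonic_weight k) J \<le> sum (harmonic_weight k) I + \<epsilon>"
    and S: "S \<in> sets borel"
  shows "\<bar>measure (nu k p B) S - (\<Sum>f | f \<in> I \<and> Re (hecke_eigenvalue k p f) \<in> S. harmonic_weight k f)\<bar> \<le> \<epsilon>"
proof -
  define w where "w = harmonic_weight k"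
  have w0: "w f \<ge> 0" for f by (simp add: w_def harmonic_weight_nonneg[OF k])
  define X where "X = {f\<in>B. Re (hecke_eigenvalue k p f) \<in> S}"
  define IS where "IS = {f. f \<in> I \<and> Re (hecke_eigenvalue k p f) \<in> S}"
  have IS: "finite IS" "IS \<subseteq> X" "IS \<subseteq> I" using I by (auto simp: IS_def X_def)
  have sp: "sum w I = sum w IS + sum w (I - IS)" using I IS by (simp add: sum.subset_diff)
  have up: "sum w F \<le> sum w IS + \<epsilon>" if F: "finite F" "F \<subseteq> X" for F
  proof -
    have "sum w F + sum w (I - IS) = sum w (F \<union> (I - IS))"
      using F I by (intro sum.union_disjoint[symmetric]) (auto simp: IS_def X_def)
    also have "\<dots> \<le> sum w (F \<union> I)" using F I w0 by (intro sum_mono2) auto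
    also have "\<dots> \<le> sum w I + \<epsilon>" unfolding w_def using F I by (intro le) (auto simp: X_def)
    finally show ?thesis using sp by simp
  qed
  have nu: "emeasure (nu k p B) S = emeasure (point_measure B (\<lambda>f. ennreal (w f))) X"
    unfolding emeasure_nu[OF S] X_def w_def ..
  have s0: "sum w IS \<ge> 0" using w0 by (intro sum_nonneg) auto
  have "emeasure (nu k p B) S \<le> ennreal (sum w IS + \<epsilon>)"
    unfolding nu by (rule emeasure_point_measure_le) (use w0 up in \<open>auto simp: X_def\<close>)
  moreover have "ennreal (sum w IS) \<le> emeasure (nu k p B) S"
  proof -
    have "ennreal (sum w IS) = (\<Sum>f\<in>IS. ennreal (w f))" using w0 by (intro sum_ennreal[symmetric]) auto
    also have "\<dots> = emeasure (point_measure B (\<lambda>f. ennreal (w f))) IS"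
      using IS by (intro emeasure_point_measure_finite2[symmetric]) (auto simp: X_def)
    also have "\<dots> \<le> emeasure (nu k p B) S" unfolding nu
      by (rule emeasure_mono[OF IS(2)]) (auto simp: sets_point_measure X_def)
    finally show ?thesis .
  qed
  moreover from calculation(1) have "emeasure (nu k p B) S = ennreal (measure (nu k p B) S)"
    by (intro emeasure_eq_ennreal_measure) (auto simp: top_unique)
  ultimately have e: "ennreal (measure (nu k p B) S) \<le> ennreal (sum w IS + \<epsilon>)" "ennreal (sum w IS) \<le> ennreal (measure (nu k p B) S)"
    by simp_all
  have "measure (nu k p B) S \<le> sum w IS + \<epsilon>" by (rule ennreal_le_iff[THEN iffD1, OF _ e(1)]) (use s0 \<epsilon> in simp)
  moreover have "sum w IS \<le> measure (nu k p B) S" by (rule ennreal_le_iff[THEN iffD1, OF _ e(2)]) simp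
  ultimately show ?thesis by (simp add: w_def IS_def)
qed

lemma measure_semicircle:
  "0 \<le> \<theta> \<Longrightarrow> \<theta> \<le> pi \<Longrightarrow> measure semicircle {-2..2 * cos \<theta>} = semicircle_cdf \<theta>"
  using semicircle_half_open[of \<theta>] by (simp add: measure_def)

lemma measure_semicircle_le_1:
  assumes "S \<in> sets borel"
  shows "measure semicircle S \<le> 1"
proof -
  have g: "(\<lambda>x. ennreal (indicator {-2..2} x * (1 / pi * sqrt (1 - x\<^sup>2 / 4)))) \<in> borel_measurable lborel" by measurable
  have "emeasure semicircle S \<le> emeasure semicircle {-2..2 * cos 0}"
    unfolding semicircle_def using assms
    by (subst (1 2) emeasure_density[OF g]) (auto intro!: nn_integral_mono simp: indicator_def)
  also have "\<dots> = ennreal 1" by (subst semicircle_half_open) (auto simp: semicircle_cdf_def)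
  finally show ?thesis unfolding measure_def by (intro enn2real_leI) auto
qed

section \<open>Lower bounds for the discrepancy\<close>

text \<open>The real supremum bounds its elements only if the set is bounded above; a common bound
  for both measures ensures this.\<close>

lemma discrepancy_ge:
  assumes "\<And>a b. measure M1 {a..b} \<le> C" "\<And>a b. measure M2 {a..b} \<le> C" "a \<le> b"
  shows "\<bar>measure M1 {a..b} - measure M2 {a..b}\<bar> \<le> discrepancy M1 M2"
  unfolding discrepancy_def
proof (rule cSup_upper)
  show "bdd_above {\<bar>measure M1 {a..b} - measure M2 {a..b}\<bar> | a b. a \<le> b}"
  proof (rule bdd_aboveI[of _ C])
    fix x assume "x \<in> {\<bar>measure M1 {a..b} - measure M2 {a..b}\<bar> | a b. a \<le> b}"
    then obtain a b where x: "x = \<bar>measure M1 {a..b} - measure M2 {a..b}\<bar>" by blast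
    show "x \<le> C" unfolding x using assms(1,2)[of a b] measure_nonneg[of M1 "{a..b}"] measure_nonneg[of M2 "{a..b}"] by linarith
  qed
qed (use assms(3) in blast)

lemma eventually_pet_const_ge:
  assumes "X > 0"
  shows "eventually (\<lambda>r. A * X ^ r \<le> pet_const (Suc r)) sequentially"
proof -
  \<comment> \<open>Of the factor 8 \<pi>, 4 \<pi> is the denominator in \<open>pet_const\<close>
    and 2 absorbs the passage from (r - 1)! to r!, by r \<le> 2^r.\<close>
  define Y where "Y = 8 * pi * X"
  have "(\<lambda>r. Y ^ r / fact r) \<longlonglongrightarrow> 0"
    using summable_LIMSEQ_zero[OF summable_exp[of Y]] by (simp add: divide_inverse mult.commute)
  hence "(\<lambda>r. \<bar>A\<bar> * (Y ^ r / fact r)) \<longlonglongrightarrow> \<bar>A\<bar> * 0" by (intro tendsto_mult tendsto_const)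
  hence "eventually (\<lambda>r. \<bar>A\<bar> * (Y ^ r / fact r) < 1) sequentially" by (intro order_tendstoD) auto
  thus ?thesis using eventually_ge_at_top[of 1]
  proof eventually_elim
    case (elim r)
    then obtain s where s: "r = Suc s" by (cases r) auto
    have "real r \<le> 2 ^ r" using less_exp[of r] by (metis less_imp_le of_nat_le_iff of_nat_numeral of_nat_power)
    have "A * X ^ r * (4 * pi) ^ r * real r \<le> \<bar>A\<bar> * X ^ r * (4 * pi) ^ r * 2 ^ r"
      using assms \<open>real r \<le> 2 ^ r\<close> by (intro mult_mono) auto
    also have "\<dots> = \<bar>A\<bar> * Y ^ r"
    proof -
      have "X ^ r * (4 * pi) ^ r * 2 ^ r = Y ^ r" unfolding Y_def power_mult_distrib[symmetric] by (simp add: mult_ac)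
      thus ?thesis by (simp only: mult.assoc)
    qed
    also have "\<dots> \<le> fact r" using elim(1) by (simp add: divide_less_eq less_imp_le)
    also have "fact r = real r * fact s" by (simp add: s)
    finally have "(A * X ^ r * (4 * pi) ^ r) * real r \<le> fact s * real r" by (simp add: mult_ac)
    hence "A * X ^ r * (4 * pi) ^ r \<le> fact s" using elim(2) by simp
    moreover have "pet_const (Suc r) = fact s / (4 * pi) ^ r"
      using Gamma_fact[of s, where ?'a = real] by (simp add: pet_const_def s add.commute)
    ultimately show ?case by (simp add: pos_le_divide_eq)
  qed
qed

lemma discrepancy_level_N:
  assumes N: "N > 1" and B: "\<And>k. even k \<Longrightarrow> k > 0 \<Longrightarrow> newform_basis k N (B k)"
  obtains \<delta> r0 where "\<delta> > 0" "\<And>r p. odd r \<Longrightarrow> r \<ge> r0 \<Longrightarrow> discrepancy (nu (Suc r) p (B (Suc r))) semicircle \<ge> \<delta>"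
proof -
  have "N \<ge> 1" using N by simp
  from norm_bound_from_level_1[OF this] obtain C where C: "C \<ge> 1"
    "\<And>k f. f \<in> cusp_forms k 1 \<Longrightarrow> sq_int (pet_measure k 1) f \<Longrightarrow> sq_int (pet_measure k N) f"
    "\<And>k f. f \<in> cusp_forms k 1 \<Longrightarrow> sq_int (pet_measure k 1) f \<Longrightarrow> norm_sq (pet_measure k N) f \<le> C * norm_sq (pet_measure k 1) f"
    by blast
  \<comment> \<open>With \<eta> = 1 the level one norm is at most 2 c plus a constant, hence 3 c for
    large weight; C passes to level N.\<close>
  define A where "A = 3 * C"
  have A: "A \<ge> 1" using C(1) by (simp add: A_def)
  define Lc where "Lc = (1 + 1 / 1) * (lattice_const\<^sup>2 * 2)"
  have "eventually (\<lambda>r. (odd r \<longrightarrow> norm (rho (Suc r) (poincare (Suc r)) (Suc 0) - (if (0::nat) = 0 then 1 else 0)) \<le> (1/4) ^ r)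
      \<and> max Lc (1 + 16 * A) * 1 ^ r \<le> pet_const (Suc r) \<and> r \<ge> 7) sequentially"
    by (intro eventually_conj eventually_rho_poincare_near_delta eventually_pet_const_ge eventually_ge_at_top) auto
  then obtain r0 where r0: "\<And>r. r \<ge> r0 \<Longrightarrow> odd r \<Longrightarrow> norm (rho (Suc r) (poincare (Suc r)) 1 - 1) \<le> (1/4) ^ r"
    "\<And>r. r \<ge> r0 \<Longrightarrow> Lc \<le> pet_const (Suc r) \<and> 1 + 16 * A \<le> pet_const (Suc r) \<and> r \<ge> 7"
    unfolding eventually_sequentially by auto
  have "discrepancy (nu (Suc r) p (B (Suc r))) semicircle \<ge> 1 / (16 * A)" if r: "odd r" "r \<ge> r0" for r p
  proof -
    define k where "k = Suc r"
    have k: "k \<ge> 2" "even k" "k > 0" using r r0(2)[OF r(2)] by (auto simp: k_def)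
    define P where "P = poincare k"
    have r7: "r \<ge> 7" using r0(2)[OF r(2)] by simp
    have P: "P \<in> cusp_forms k 1" unfolding P_def k_def using r r7 by (intro poincare_cusp_form) auto
    have sP: "sq_int (pet_measure k 1) P" unfolding P_def k_def by (rule poincare_norm_bound(1)[OF r7 r(1), of 1]) simp
    have "norm_sq (pet_measure k 1) P \<le> (1 + 1) * pet_const k + Lc"
      unfolding P_def k_def Lc_def by (rule poincare_norm_bound(2)[OF r7 r(1), of 1]) simp
    also have "\<dots> \<le> 3 * pet_const k" using r0(2)[OF r(2)] by (simp add: k_def)
    finally have "C * norm_sq (pet_measure k 1) P \<le> C * (3 * pet_const k)" using C(1) by (intro mult_left_mono) auto
    hence nP: "norm_sq (pet_measure k N) P \<le> A * pet_const k" using C(3)[OF P sP] by (simp add: A_def mult_ac)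
    have \<rho>: "norm (rho k P 1 - 1) \<le> 1 / 4"
    proof -
      have "norm (rho k P 1 - 1) \<le> (1/4) ^ r" using r0(1)[OF r(2,1)] by (simp add: k_def P_def)
      also have "\<dots> \<le> (1/4) ^ 1" using r7 by (intro power_decreasing) auto
      finally show ?thesis by simp
    qed
    define \<delta> where "\<delta> = 1 / (16 * A)"
    have \<delta>: "\<delta> \<le> 1" "\<delta> > 0" using A by (auto simp: \<delta>_def divide_simps)
    have mass: "sum (harmonic_weight k) J \<le> 1 - \<delta>" if "finite J" "J \<subseteq> B k" for J
      unfolding \<delta>_def using r0(2)[OF r(2)] by (intro level_N_mass_bound[OF N B[OF k(2,3)] that k(1) P C(2)[OF P sP] nP A \<rho>]) (simp add: k_def)
    have m: "measure (nu k p (B k)) S \<le> 1 - \<delta>" if "S \<in> sets borel" for S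
      using \<delta> by (intro measure_nu_le(2)[OF k(1) mass _ that]) auto
    have "\<bar>measure (nu k p (B k)) {-2..2} - measure semicircle {-2..2}\<bar> \<le> discrepancy (nu k p (B k)) semicircle"
    proof (rule discrepancy_ge[where C = 1])
      show "measure (nu k p (B k)) {a..b} \<le> 1" for a b using m[of "{a..b}"] \<delta> by simp
      show "measure semicircle {a..b} \<le> 1" for a b by (rule measure_semicircle_le_1) simp
    qed simp
    moreover have "measure semicircle {-2..2} = 1" using measure_semicircle[of 0] by (simp add: semicircle_cdf_def)
    moreover have "measure (nu k p (B k)) {-2..2} \<le> 1 - \<delta>" by (rule m) simp
    ultimately show ?thesis by (simp add: \<delta>_def k_def)
  qed
  thus ?thesis using A by (intro that[of "1 / (16 * A)" r0]) auto
qed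

text \<open>The terms are, in order, the main Bessel term, the tail over moduli c \<ge> 2, the
  transfer from complex eigenvalues, and the mass missed by the finite set times the factor from
  integration by parts.\<close>

lemma transition_error_small:
  fixes a b K :: real
  assumes a: "a > 0"
  shows "eventually (\<lambda>r::nat. a / 2 * (1 / real (Suc r) powr (1/3)) \<le>
    a * real r powr (-1/3) - b * (3/4) ^ r - real r ^ 4 * (1 + 2 * real r) * K * (1/2) ^ r
      - 80 * (ln (real (Suc r)))\<^sup>2 * (6 * (1/2) ^ r)) sequentially"
proof -
  \<comment> \<open>Each of the three errors may take a/8, so at least a/2 of the main term
    survives.\<close>
  have 1: "eventually (\<lambda>r::nat. \<bar>b\<bar> * (3/4) ^ r \<le> a / 8 * real r powr (-1/3)) sequentially" using a by real_asymp
  have 2: "eventually (\<lambda>r::nat. real r ^ 4 * (1 + 2 * real r) * \<bar>K\<bar> * (1/2) ^ r \<le> a / 8 * real r powr (-1/3)) sequentially" using a by real_asymp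
  have 3: "eventually (\<lambda>r::nat. 80 * (ln (real r + 1))\<^sup>2 * (6 * (1/2) ^ r) \<le> a / 8 * real r powr (-1/3)) sequentially" using a by real_asymp
  show ?thesis using 1 2 3 eventually_ge_at_top[of 1]
  proof eventually_elim
    case (elim r)
    have b: "b * (3/4) ^ r \<le> \<bar>b\<bar> * (3/4) ^ r" by (intro mult_right_mono) auto
    have K: "real r ^ 4 * (1 + 2 * real r) * K * (1/2) ^ r \<le> real r ^ 4 * (1 + 2 * real r) * \<bar>K\<bar> * (1/2) ^ r"
      by (intro mult_right_mono mult_left_mono) auto
    have l: "80 * (ln (real (Suc r)))\<^sup>2 * (6 * (1/2) ^ r) \<le> a / 8 * real r powr (-1/3)" using elim(3) by (simp add: add.commute)
    have "1 / real (Suc r) powr (1/3) = real (Suc r) powr (-1/3)" by (simp add: powr_minus_divide)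
    also have "\<dots> \<le> real r powr (-1/3)" using elim(4) by (intro powr_mono2') auto
    finally have "a / 2 * (1 / real (Suc r) powr (1/3)) \<le> a / 2 * real r powr (-1/3)" using a by (intro mult_left_mono) auto
    moreover have "0 \<le> a * real r powr (-1/3)" using a by simp
    ultimately show ?case using b K l elim(1,2) by linarith
  qed
qed

lemma discrepancy_level_1:
  assumes p: "prime p" and B: "\<And>k. even k \<Longrightarrow> k > 0 \<Longrightarrow> newform_basis k 1 (B k)"
  obtains c j0 where "c > 0" "\<And>j. j \<ge> j0 \<Longrightarrow> \<exists>r. odd r \<and> r \<ge> 2 ^ j \<and>
    discrepancy (nu (Suc r) p (B (Suc r))) semicircle \<ge> c * (1 / (real (Suc r) powr (1 / 3) * (ln (real (Suc r)))\<^sup>2))"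
proof -
  define a where "a = 2 * pi * exp (-42) * 40 powr (-1/6)"
  have a: "a > 0" by (simp add: a_def)
  define b where "b = 2 * pi * kloosterman_tail_const"
  define K where "K = 2 + 4 + (real p + 1)\<^sup>2"
  have K: "K \<ge> 0" by (simp add: K_def)
  define Lc where "Lc = lattice_const\<^sup>2 * 2"
  have p2: "p \<ge> 2" using p by (rule prime_ge_2_nat)
  have p0: "real p > 0" using p2 by simp
  have "eventually (\<lambda>r. (odd r \<longrightarrow> norm (rho (Suc r) (poincare (Suc r)) (Suc 0) - (if (0::nat) = 0 then 1 else 0)) \<le> (1/16) ^ r)
      \<and> (odd r \<longrightarrow> norm (rho (Suc r) (poincare (Suc r)) (Suc (p\<^sup>2 - 1)) - (if p\<^sup>2 - 1 = 0 then 1 else 0)) \<le> (1/16) ^ r)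
      \<and> 1 * (16 * real p) ^ r \<le> pet_const (Suc r)
      \<and> 2 * Lc * 256 ^ r \<le> pet_const (Suc r)
      \<and> a / 2 * (1 / real (Suc r) powr (1/3)) \<le> a * real r powr (-1/3) - b * (3/4) ^ r - real r ^ 4 * (1 + 2 * real r) * K * (1/2) ^ r
      - 80 * (ln (real (Suc r)))\<^sup>2 * (6 * (1/2) ^ r)
      \<and> r \<ge> 320) sequentially"
    by (intro eventually_conj eventually_rho_poincare_near_delta eventually_pet_const_ge transition_error_small eventually_ge_at_top)
       (use p0 a in auto)
  then obtain r0 where r0: "\<And>r. r \<ge> r0 \<Longrightarrow>
      (odd r \<longrightarrow> norm (rho (Suc r) (poincare (Suc r)) (Suc 0) - (if (0::nat) = 0 then 1 else 0)) \<le> (1/16) ^ r)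
      \<and> (odd r \<longrightarrow> norm (rho (Suc r) (poincare (Suc r)) (Suc (p\<^sup>2 - 1)) - (if p\<^sup>2 - 1 = 0 then 1 else 0)) \<le> (1/16) ^ r)
      \<and> 1 * (16 * real p) ^ r \<le> pet_const (Suc r)
      \<and> 2 * Lc * 256 ^ r \<le> pet_const (Suc r)
      \<and> a / 2 * (1 / real (Suc r) powr (1/3)) \<le> a * real r powr (-1/3) - b * (3/4) ^ r - real r ^ 4 * (1 + 2 * real r) * K * (1/2) ^ r
      - 80 * (ln (real (Suc r)))\<^sup>2 * (6 * (1/2) ^ r)
      \<and> r \<ge> 320"
    unfolding eventually_sequentially by blast
  define j0 where "j0 = max 7 r0"
  have "\<exists>r. odd r \<and> r \<ge> 2 ^ j \<and>
    discrepancy (nu (Suc r) p (B (Suc r))) semicircle \<ge> a / 160 * (1 / (real (Suc r) powr (1 / 3) * (ln (real (Suc r)))\<^sup>2))"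
    if j: "j \<ge> j0" for j
  proof -
    have j7: "j \<ge> 7" "j \<ge> r0" "j \<ge> 1" using j by (auto simp: j0_def)
    define q where "q = p ^ j"
    have q2j: "2 ^ j \<le> q" unfolding q_def using p2 by (rule power_mono) simp
    have "(2::nat) ^ 7 \<le> 2 ^ j" using j7 by (intro power_increasing) auto
    hence q100: "q \<ge> 100" using q2j by simp
    obtain r x where r: "r mod 4 = 1" "r \<ge> 320" "x = 4 * pi * real q" "x < real r"
      "5 * (real r)\<^sup>2 \<le> 4 * sqrt ((real r)\<^sup>2 - x\<^sup>2) ^ 3" "sqrt ((real r)\<^sup>2 - x\<^sup>2) ^ 3 \<le> 40 * (real r)\<^sup>2"
      by (rule transition_weight_exists[OF q100])
    have "1 * real q \<le> 4 * pi * real q" using pi_gt3 by (intro mult_right_mono) auto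
    hence qr: "real q \<le> real r" using r(3,4) by simp
    have jr: "j < r"
    proof -
      have "j < 2 ^ j" by (rule less_exp)
      thus ?thesis using q2j qr unfolding of_nat_le_iff by linarith
    qed
    have odd: "odd r" using r(1) by presburger
    have rr0: "r \<ge> r0" using jr j7 by simp
    note R = r0[OF rr0]
    define k where "k = Suc r"
    have k: "k \<ge> 2" "even k" "k > 0" using odd r(2) by (auto simp: k_def)
    note Bk = B[OF k(2,3)]
    define P where "P = poincare k"
    \<comment> \<open>So t^4 = 16^(-r), which explains the 16 in the eventual estimates. Their 256
      is t^(-8): one t^(-4) from 1/\<eta> in the norm bound with \<eta> = t^4, another from the
      error t^4 to be reached.\<close>
    define t where "t = (1/2 :: real) ^ r"
    have t: "0 < t" "t \<le> 1 / 4"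
    proof -
      have "t \<le> (1/2) ^ 2" unfolding t_def using r(2) by (intro power_decreasing) auto
      thus "t \<le> 1 / 4" by (simp add: power2_eq_square)
    qed (simp add: t_def)
    have t4: "t ^ 4 = (1/16) ^ r"
      unfolding t_def power_mult[symmetric] mult.commute[of r] unfolding power_mult by (simp add: power_divide)
    have r7: "r \<ge> 7" "r \<ge> 3" using r(2) by simp_all
    have P: "P \<in> cusp_forms k 1" unfolding P_def k_def using odd r7 by (intro poincare_cusp_form) auto
    have t4p: "t ^ 4 > 0" using t by simp
    have sP: "sq_int (pet_measure k 1) P" unfolding P_def k_def by (rule poincare_norm_bound(1)[OF r7(1) odd t4p])
    have cp: "pet_const k > 0" by (rule pet_const_pos[OF k(1)])
    have Lc0: "Lc \<ge> 0" by (simp add: Lc_def)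
    have nP: "norm_sq (pet_measure k 1) P \<le> (1 + 2 * t ^ 4) * pet_const k"
    proof -
      have "norm_sq (pet_measure k 1) P \<le> (1 + t ^ 4) * pet_const k + (1 + 1 / t ^ 4) * Lc"
        unfolding P_def k_def Lc_def by (rule poincare_norm_bound(2)[OF r7(1) odd t4p])
      also have "(1 + 1 / t ^ 4) * Lc \<le> t ^ 4 * pet_const k"
      proof -
        have "t ^ 4 \<le> 1" using t by (intro power_le_one) auto
        hence "(t ^ 4 + 1) * Lc \<le> 2 * Lc" using Lc0 by (intro mult_right_mono) auto
        also have "\<dots> = (2 * Lc * 256 ^ r) * (t ^ 4 * t ^ 4)" unfolding t4 by (simp add: power_mult_distrib[symmetric])
        also have "\<dots> \<le> pet_const k * (t ^ 4 * t ^ 4)" using R by (intro mult_right_mono) (auto simp: k_def)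
        finally have "(t ^ 4 + 1) * Lc / t ^ 4 \<le> pet_const k * (t ^ 4 * t ^ 4) / t ^ 4" using t4p by (intro divide_right_mono) auto
        also have "\<dots> = t ^ 4 * pet_const k"
        proof -
          have "x * (y * y) / y = y * x" if "y > 0" for x y :: real using that by simp
          thus ?thesis using t4p by blast
        qed
        also have "(t ^ 4 + 1) * Lc / t ^ 4 = (1 + 1 / t ^ 4) * Lc" using t(1) by (simp add: add_divide_distrib distrib_right)
        finally show ?thesis .
      qed
      finally show ?thesis by (simp add: algebra_simps)
    qed
    have pp: "Suc (p\<^sup>2 - 1) = p\<^sup>2" "p\<^sup>2 - 1 \<noteq> 0"
    proof -
      have "2\<^sup>2 \<le> p\<^sup>2" using p2 by (intro power_mono) auto
      thus "Suc (p\<^sup>2 - 1) = p\<^sup>2" "p\<^sup>2 - 1 \<noteq> 0" by simp_all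
    qed
    have \<rho>: "norm (rho k P 1 - 1) \<le> t ^ 4" "norm (rho k P (p\<^sup>2)) \<le> t ^ 4"
    proof -
      have "norm (rho k P (Suc 0) - (if (0::nat) = 0 then 1 else 0)) \<le> t ^ 4"
        "norm (rho k P (Suc (p\<^sup>2 - 1)) - (if p\<^sup>2 - 1 = 0 then 1 else 0)) \<le> t ^ 4"
        unfolding t4 k_def P_def using R odd by blast+
      thus "norm (rho k P 1 - 1) \<le> t ^ 4" "norm (rho k P (p\<^sup>2)) \<le> t ^ 4"
        unfolding pp(1) if_not_P[OF pp(2)] by simp_all
    qed
    have cb: "real p ^ (k - 1) \<le> t ^ 4 * pet_const k"
    proof -
      have "real p ^ (k - 1) = t ^ 4 * (16 * real p) ^ r" unfolding t4 power_mult_distrib[symmetric] by (simp add: k_def)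
      also have "\<dots> \<le> t ^ 4 * pet_const k" using R t4p by (intro mult_left_mono) (auto simp: k_def)
      finally show ?thesis .
    qed
    obtain I where I: "finite I" "I \<subseteq> B k"
      "\<And>J. finite J \<Longrightarrow> J \<subseteq> B k \<Longrightarrow> I \<subseteq> J \<Longrightarrow> (\<Sum>f\<in>J. harmonic_weight k f) \<le> (\<Sum>f\<in>I. harmonic_weight k f) + (2 + 4) * t"
      "(\<Sum>f\<in>I. harmonic_weight k f) \<le> 2"
      "\<And>m. (\<Sum>f\<in>I. harmonic_weight k f * cheb m (Re (hecke_eigenvalue k p f))) \<le>
        Re (rho k P (p ^ m)) + (real p + 2) ^ m * (1 + real m) * (2 + 4 + (real p + 1)\<^sup>2) * t"
      using level_1_estimate[OF Bk k(1) p P sP nP t _ order_refl \<rho> cb] t4p by auto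
    define d where "d = discrepancy (nu k p (B k)) semicircle"
    have mass: "sum (harmonic_weight k) J \<le> 4" if "finite J" "J \<subseteq> B k" for J
    proof -
      have "sum (harmonic_weight k) J \<le> sum (harmonic_weight k) (J \<union> I)"
        using that I harmonic_weight_nonneg[OF k(1)] by (intro sum_mono2) auto
      also have "\<dots> \<le> 2 + 6 * t" using I(3)[of "J \<union> I"] I(1,2,4) that by simp
      finally show ?thesis using t by simp
    qed
    have near: "\<bar>(\<Sum>f | f \<in> I \<and> -2 \<le> Re (hecke_eigenvalue k p f) \<and> Re (hecke_eigenvalue k p f) \<le> 2 * cos \<theta>. harmonic_weight k f) - semicircle_cdf \<theta>\<bar> \<le> d + 6 * t"
      if th: "0 \<le> \<theta>" "\<theta> \<le> pi" for \<theta>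
    proof -
      have "\<bar>measure (nu k p (B k)) {-2..2 * cos \<theta>} - measure semicircle {-2..2 * cos \<theta>}\<bar> \<le> d"
        unfolding d_def
      proof (rule discrepancy_ge[where C = 4])
        show "measure (nu k p (B k)) {a..b} \<le> 4" for a b by (rule measure_nu_le(2)[OF k(1) mass]) auto
        show "measure semicircle {a..b} \<le> 4" for a b using measure_semicircle_le_1[of "{a..b}"] by simp
        show "-2 \<le> 2 * cos \<theta>" using cos_ge_minus_one[of \<theta>] by simp
      qed
      moreover have "\<bar>measure (nu k p (B k)) {-2..2 * cos \<theta>} -
          (\<Sum>f | f \<in> I \<and> Re (hecke_eigenvalue k p f) \<in> {-2..2 * cos \<theta>}. harmonic_weight k f)\<bar> \<le> 6 * t"
        using I(3) t by (intro measure_nu_approx[OF k(1) I(1,2)]) auto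
      ultimately show ?thesis unfolding measure_semicircle[OF th] by simp
    qed
    define m where "m = 2 * j"
    have pm: "p ^ m = q\<^sup>2" by (simp add: m_def q_def power_mult[symmetric] mult.commute)
    have "- (real (2 * j + 1) + pi * (2 * real j * real (Suc j))) * (d + 6 * t) \<le>
        (\<Sum>f\<in>I. harmonic_weight k f * cheb (2 * j) (Re (hecke_eigenvalue k p f)))"
      by (rule cheb_sum_lower_bound[OF I(1) harmonic_weight_nonneg[OF k(1)] j7(3) near])
    also have "\<dots> \<le> Re (rho k P (q\<^sup>2)) + (real p + 2) ^ m * (1 + real m) * K * t"
      using I(5)[of m] unfolding pm K_def[symmetric] unfolding m_def .
    also have "\<dots> \<le> (- a * real r powr (-1/3) + b * (3 / 4) ^ r) + real r ^ 4 * (1 + 2 * real r) * K * (1/2) ^ r"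
    proof (intro add_mono)
      show "Re (rho k P (q\<^sup>2)) \<le> - a * real r powr (-1/3) + b * (3 / 4) ^ r"
        unfolding a_def b_def P_def k_def by (rule Re_rho_poincare_transition[OF r(1,2) _ r(3-6)]) (use q100 in simp)
      \<comment> \<open>Since p + 2 \<le> p^2, the power is at most p^(4 j) = q^4, which is
        polynomial in r.\<close>
      have "(real p + 2) ^ m \<le> (real p ^ 2) ^ m"
      proof (intro power_mono)
        have "2 * real p \<le> real p * real p" using p2 by (intro mult_right_mono) auto
        moreover have "2 \<le> real p" using p2 by simp
        ultimately show "real p + 2 \<le> real p ^ 2" unfolding power2_eq_square by linarith
      qed simp
      also have "(real p ^ 2) ^ m = real q ^ 4" by (simp add: q_def m_def power_mult[symmetric] mult.commute)
      also have "\<dots> \<le> real r ^ 4" using qr by (intro power_mono) auto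
      finally have 1: "(real p + 2) ^ m \<le> real r ^ 4" .
      have 2: "1 + real m \<le> 1 + 2 * real r" using jr by (simp add: m_def)
      show "(real p + 2) ^ m * (1 + real m) * K * t \<le> real r ^ 4 * (1 + 2 * real r) * K * (1/2) ^ r"
        unfolding t_def using 1 2 K by (intro mult_mono) auto
    qed
    finally have main: "a * real r powr (-1/3) - b * (3/4) ^ r - real r ^ 4 * (1 + 2 * real r) * K * (1/2) ^ r \<le>
        (real (2 * j + 1) + pi * (2 * real j * real (Suc j))) * (d + 6 * t)" by (simp add: algebra_simps)
    have d0: "d + 6 * t \<ge> 0" using near[of 0] by simp
    define l where "l = ln (real k)"
    have l0: "l > 0" using k by (simp add: l_def)
    \<comment> \<open>The source of the logarithms: 2^j \<le> k gives j = O(log k).\<close>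
    have jl: "real j \<le> 2 * l"
    proof -
      have "real j * ln 2 = ln (2 ^ j)" by (simp add: ln_realpow)
      also have "\<dots> \<le> l" unfolding l_def
      proof (subst ln_le_cancel_iff)
        have "(2::real) ^ j \<le> real q" using q2j by simp
        also have "\<dots> \<le> real k" using qr by (simp add: k_def)
        finally show "(2::real) ^ j \<le> real k" .
      qed (use k in auto)
      finally have "real j * ln 2 \<le> l" .
      moreover have "1 / 2 \<le> ln (2::real)" using ln_le_minus_one[of "1/2"] by (simp add: ln_div)
      hence "real j * (1/2) \<le> real j * ln 2" by (intro mult_left_mono) auto
      ultimately show ?thesis by simp
    qed
    \<comment> \<open>With \<pi> < 4 the factor is at most 8 j^2 + 10 j + 1 \<le> 20 j^2, and j
      \<le> 2 l turns 20 into 80.\<close>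
    have fac: "real (2 * j + 1) + pi * (2 * real j * real (Suc j)) \<le> 80 * l\<^sup>2"
    proof -
      have j1: "real j \<ge> 1" using j7 by simp
      have jj: "real j * 1 \<le> real j * real j" using j1 by (intro mult_left_mono) auto
      have "pi * (2 * real j * real (Suc j)) \<le> 4 * (2 * real j * real (Suc j))"
        using pi_less_4 by (intro mult_right_mono) auto
      also have "\<dots> = 8 * (real j * real j) + 8 * real j" by (simp add: algebra_simps)
      finally have "pi * (2 * real j * real (Suc j)) \<le> 8 * (real j * real j) + 8 * real j" .
      moreover have "real (2 * j + 1) = 2 * real j + 1" by simp
      ultimately have "real (2 * j + 1) + pi * (2 * real j * real (Suc j)) \<le> 20 * (real j * real j)" using jj j1 by linarith
      also have "\<dots> \<le> 20 * ((2 * l) * (2 * l))" using jl l0 by (intro mult_left_mono mult_mono) auto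
      finally show ?thesis by (simp add: power2_eq_square)
    qed
    have "a / 2 * (1 / real k powr (1/3)) + 80 * l\<^sup>2 * (6 * t) \<le> (real (2 * j + 1) + pi * (2 * real j * real (Suc j))) * (d + 6 * t)"
      using R main by (simp add: l_def k_def t_def)
    also have "\<dots> \<le> 80 * l\<^sup>2 * (d + 6 * t)" using fac d0 by (intro mult_right_mono)
    finally have "a / 2 * (1 / real k powr (1/3)) \<le> 80 * l\<^sup>2 * d" by (simp add: algebra_simps)
    hence "a / 2 * (1 / real k powr (1/3)) / (80 * l\<^sup>2) \<le> d" using l0 by (subst pos_divide_le_eq) (simp_all only: mult.commute[of d] zero_less_power mult_pos_pos zero_less_numeral)
    moreover have "a / 2 * (1 / real k powr (1/3)) / (80 * l\<^sup>2) = a / 160 * (1 / (real k powr (1/3) * l\<^sup>2))" by simp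
    ultimately have "a / 160 * (1 / (real k powr (1/3) * l\<^sup>2)) \<le> d" by simp
    moreover have "2 ^ j \<le> r"
    proof -
      have "q \<le> r" using qr by simp
      with q2j show ?thesis by (rule order_trans)
    qed
    ultimately show ?thesis using odd unfolding d_def l_def k_def by blast
  qed
  thus ?thesis using a by (intro that[of "a / 160" j0]) auto
qed

theorem theorem1p6:
  fixes N p :: nat and B :: "nat \<Rightarrow> (complex \<Rightarrow> complex) set"
  assumes "N \<ge> 1" and "squarefree N" and "prime p" and "\<not> p dvd N"
    and "\<And>k. even k \<Longrightarrow> k > 0 \<Longrightarrow> newform_basis k N (B k)"
  shows "\<exists>K :: nat \<Rightarrow> nat. (\<forall>n. even (K n) \<and> K n > 0) \<and> filterlim K at_top sequentially \<and>
           (\<exists>c>0. \<forall>n. discrepancy (nu (K n) p (B (K n))) semicircle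
              \<ge> c * (1 / (real (K n) powr (1 / 3) * (ln (real (K n)))\<^sup>2)))"
proof (cases "N = 1")
  case True
  obtain c j0 where c: "c > 0" and c2: "\<And>j. j \<ge> j0 \<Longrightarrow> \<exists>r. odd r \<and> r \<ge> 2 ^ j \<and>
    discrepancy (nu (Suc r) p (B (Suc r))) semicircle \<ge> c * (1 / (real (Suc r) powr (1 / 3) * (ln (real (Suc r)))\<^sup>2))"
    using discrepancy_level_1[OF assms(3), of B] assms(5) True by blast
  \<comment> \<open>The exponent n + j0 starts the sequence where the estimate holds and forces the
    weights to infinity.\<close>
  have "\<forall>n. \<exists>r. odd r \<and> r \<ge> 2 ^ (n + j0) \<and>
    discrepancy (nu (Suc r) p (B (Suc r))) semicircle \<ge> c * (1 / (real (Suc r) powr (1 / 3) * (ln (real (Suc r)))\<^sup>2))"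
    using c2 by simp
  then obtain R where R: "\<And>n. odd (R n) \<and> R n \<ge> 2 ^ (n + j0) \<and>
    discrepancy (nu (Suc (R n)) p (B (Suc (R n)))) semicircle \<ge> c * (1 / (real (Suc (R n)) powr (1 / 3) * (ln (real (Suc (R n))))\<^sup>2))"
    by metis
  have "n \<le> Suc (R n)" for n
  proof -
    have "n + j0 < 2 ^ (n + j0)" by (rule less_exp)
    thus ?thesis using R[of n] by linarith
  qed
  hence "filterlim (\<lambda>n. Suc (R n)) at_top sequentially"
    by (intro filterlim_at_top_mono[OF filterlim_ident]) (auto intro: always_eventually)
  thus ?thesis using R c by (intro exI[of _ "\<lambda>n. Suc (R n)"] conjI exI[of _ c]) auto
next
  case False
  hence N: "N > 1" using assms(1) by simp
  obtain \<delta> r0 where \<delta>: "\<delta> > 0" and \<delta>2: "\<And>r p. odd r \<Longrightarrow> r \<ge> r0 \<Longrightarrow> discrepancy (nu (Suc r) p (B (Suc r))) semicircle \<ge> \<delta>"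
    using discrepancy_level_N[OF N, of B] assms(5) by blast
  define R where "R = (\<lambda>n. 2 * (n + r0 + 1) + 1)"
  have lim: "filterlim (\<lambda>n. Suc (R n)) at_top sequentially"
    by (intro filterlim_at_top_mono[OF filterlim_ident]) (auto intro: always_eventually simp: R_def)
  have ge: "\<delta> * (1 / (real (Suc (R n)) powr (1 / 3) * (ln (real (Suc (R n))))\<^sup>2)) \<le>
      discrepancy (nu (Suc (R n)) p (B (Suc (R n)))) semicircle" for n
  proof -
    define x where "x = real (Suc (R n))"
    \<comment> \<open>From 3 > e one gets ln x \<ge> 1, so the rate in the claim is at most 1 and a
      constant lower bound suffices.\<close>
    have x: "x \<ge> 3" by (simp add: x_def R_def)
    have "1 \<le> ln x" using x e_less_272 by (subst ln_ge_iff) auto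
    hence "1 \<le> (ln x)\<^sup>2" by (rule one_le_power)
    moreover have "1 \<le> x powr (1/3)" using x by (intro ge_one_powr_ge_zero) auto
    ultimately have "1 * 1 \<le> x powr (1/3) * (ln x)\<^sup>2" by (intro mult_mono) auto
    hence "1 / (x powr (1/3) * (ln x)\<^sup>2) \<le> 1" by (simp add: divide_le_eq)
    hence "\<delta> * (1 / (x powr (1/3) * (ln x)\<^sup>2)) \<le> \<delta> * 1" using \<delta> by (intro mult_left_mono) auto
    also have "\<dots> \<le> discrepancy (nu (Suc (R n)) p (B (Suc (R n)))) semicircle"
      using \<delta>2[of "R n" p] by (simp add: R_def)
    finally show ?thesis by (simp add: x_def)
  qed
  show ?thesis
    using lim ge \<delta> by (intro exI[of _ "\<lambda>n. Suc (R n)"] conjI exI[of _ \<delta>]) (auto simp: R_def)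
qed

end
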